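(* Let $h\colon Y\to Z$ be a morphism of schemes having the same underlying topological space, and let $\mathcal{F}$ be a coherent sheaf on $Y$. The space of isomorphism classes of infinitesimal extensions of $Y$ by $\mathcal{F}$ that are also extensions of $\mathcal{O}_Z$-algebras and are split as extensions of $\mathcal{O}_Z$-modules is in one to one correspondence with the subspace $H^2_S(\mathcal{O}_Y,\mathcal{F})$ of $H^2(\mathcal{O}_Y,\mathcal{F})$ consisting of classes of symmetric maps $f$.
   Context: An infinitesimal extension of $Y$ by a coherent $\mathcal{O}_Y$-module $\mathcal{F}$ is a scheme $X$ with the same underlying topological space as $Y$, together with a surjection of sheaves of rings $\mathcal{O}_X\to\mathcal{O}_Y$ whose kernel is a square-zero ideal identified, as an $\mathcal{O}_Y$-module, with $\mathcal{F}$. It is an extension of $\mathcal{O}_Z$-algebras if $\mathcal{O}_X$ is an $\mathcal{O}_Z$-algebra and $\mathcal{O}_X\to\mathcal{O}_Y$ is a homomorphism of $\mathcal{O}_Z$-algebras. Isomorphisms of such extensions are isomorphisms of $\mathcal{O}_Z$-algebras inducing the identity on $\mathcal{F}$ and on $\mathcal{O}_Y$. The underlying map of $h$ is the identity on the common topological space, and $\mathrm{Hom}_Z$ denotes $\mathcal{O}_Z$-linear homomorphisms of sheaves on it. Consider the complex (tensor products over $\mathcal{O}_Z$) $$\mathrm{Hom}_Z(\mathcal{O}_Y,\mathcal{F})\overset{\delta^0}{\to}\mathrm{Hom}_Z(\mathcal{O}_Y^{\otimes 2},\mathcal{F})\overset{\delta^1}{\to}\mathrm{Hom}_Z(\mathcal{O}_Y^{\otimes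 3},\mathcal{F})$$ where, for sections over any open affine $U\subset Y$, $$\delta^0(g)(r_0,r_1)=r_0g(r_1)-g(r_0r_1)+r_1g(r_0),$$ $$\delta^1(f)(r_0,r_1,r_2)=r_0f(r_1,r_2)-f(r_0r_1,r_2)+f(r_0,r_1r_2)-f(r_0,r_1)r_2.$$ Put $H^2(\mathcal{O}_Y,\mathcal{F})=\ker\delta^1/\mathrm{im}\,\delta^0$. A map $f\in\mathrm{Hom}_Z(\mathcal{O}_Y^{\otimes2},\mathcal{F})$ is symmetric if $f(r_0,r_1)=f(r_1,r_0)$. A symmetric $f\in\ker\delta^1$ defines the extension with $\mathcal{O}_X=\mathcal{O}_Y\oplus\mathcal{F}$ as $\mathcal{O}_Z$-module and product $(x,m)(x',m')=(xx',xm'+x'm+f(x,x'))$. *)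

theory Defs
  imports
    "HOL-Analysis.Abstract_Topology"
    "HOL-Algebra.Algebra"
    "HOL-Algebra.Free_Abelian_Groups"
begin

section \<open>Sheaves of rings and of modules\<close>

text \<open>
  All sections of a presheaf live in one HOL type; \<open>carrier (sect F U)\<close> is the set of sections
  over \<open>U\<close>. Values at sets that are not open, and of maps outside the carriers, are irrelevant.
\<close>

record ('p, 's, 'x) presheaf =
  sect :: "'p set \<Rightarrow> 's"
  res :: "'p set \<Rightarrow> 'p set \<Rightarrow> 'x \<Rightarrow> 'x"

type_synonym ('p, 'a) ring_presheaf = "('p, 'a ring, 'a) presheaf"
type_synonym ('p, 'a, 'm) mod_presheaf = "('p, ('a, 'm) module, 'm) presheaf"

definition is_presheaf ::
  "'p topology \<Rightarrow> ('p, ('x, 'e) partial_object_scheme, 'x) presheaf \<Rightarrow> bool" where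
  "is_presheaf T F \<longleftrightarrow>
    (\<forall>U. openin T U \<longrightarrow> (\<forall>x\<in>carrier (sect F U). res F U U x = x)) \<and>
    (\<forall>U V. openin T U \<and> openin T V \<and> V \<subseteq> U \<longrightarrow>
      res F U V \<in> carrier (sect F U) \<rightarrow> carrier (sect F V)) \<and>
    (\<forall>U V W. openin T U \<and> openin T V \<and> openin T W \<and> W \<subseteq> V \<and> V \<subseteq> U \<longrightarrow>
      (\<forall>x\<in>carrier (sect F U). res F V W (res F U V x) = res F U W x))"

definition is_sheaf ::
  "'p topology \<Rightarrow> ('p, ('x, 'e) partial_object_scheme, 'x) presheaf \<Rightarrow> bool" where
  "is_sheaf T F \<longleftrightarrow> is_presheaf T F \<and>
    (\<forall>\<U> s. (\<forall>U\<in>\<U>. openin T U) \<and> (\<forall>U\<in>\<U>. s U \<in> carrier (sect F U)) \<and>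
      (\<forall>U\<in>\<U>. \<forall>V\<in>\<U>. res F U (U \<inter> V) (s U) = res F V (U \<inter> V) (s V)) \<longrightarrow>
      (\<exists>!x. x \<in> carrier (sect F (\<Union>\<U>)) \<and> (\<forall>U\<in>\<U>. res F (\<Union>\<U>) U x = s U)))"

definition ring_sheaf :: "'p topology \<Rightarrow> ('p, 'a) ring_presheaf \<Rightarrow> bool" where
  "ring_sheaf T A \<longleftrightarrow> is_sheaf T A \<and>
    (\<forall>U. openin T U \<longrightarrow> cring (sect A U)) \<and>
    (\<forall>U V. openin T U \<and> openin T V \<and> V \<subseteq> U \<longrightarrow> res A U V \<in> ring_hom (sect A U) (sect A V))"

definition mod_sheaf ::
  "'p topology \<Rightarrow> ('p, 'a) ring_presheaf \<Rightarrow> ('p, 'a, 'm) mod_presheaf \<Rightarrow> bool" where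
  "mod_sheaf T A F \<longleftrightarrow> is_sheaf T F \<and>
    (\<forall>U. openin T U \<longrightarrow> Module.module (sect A U) (sect F U)) \<and>
    (\<forall>U V. openin T U \<and> openin T V \<and> V \<subseteq> U \<longrightarrow>
      (\<forall>x\<in>carrier (sect F U). \<forall>y\<in>carrier (sect F U).
        res F U V (x \<oplus>\<^bsub>sect F U\<^esub> y) = res F U V x \<oplus>\<^bsub>sect F V\<^esub> res F U V y) \<and>
      (\<forall>a\<in>carrier (sect A U). \<forall>x\<in>carrier (sect F U).
        res F U V (a \<odot>\<^bsub>sect F U\<^esub> x) = res A U V a \<odot>\<^bsub>sect F V\<^esub> res F U V x))"

definition commutes_with_res ::
  "'p topology \<Rightarrow> ('p, ('x, 'd) partial_object_scheme, 'x) presheaf \<Rightarrow>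
   ('p, ('y, 'e) partial_object_scheme, 'y) presheaf \<Rightarrow> ('p set \<Rightarrow> 'x \<Rightarrow> 'y) \<Rightarrow> bool" where
  "commutes_with_res T F G \<phi> \<longleftrightarrow>
    (\<forall>U V. openin T U \<and> openin T V \<and> V \<subseteq> U \<longrightarrow>
      (\<forall>x\<in>carrier (sect F U). \<phi> V (res F U V x) = res G U V (\<phi> U x)))"

definition ring_sheaf_hom ::
  "'p topology \<Rightarrow> ('p, 'a) ring_presheaf \<Rightarrow> ('p, 'b) ring_presheaf \<Rightarrow>
   ('p set \<Rightarrow> 'a \<Rightarrow> 'b) \<Rightarrow> bool" where
  "ring_sheaf_hom T A B \<phi> \<longleftrightarrow>
    (\<forall>U. openin T U \<longrightarrow> \<phi> U \<in> ring_hom (sect A U) (sect B U)) \<and> commutes_with_res T A B \<phi>"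

definition ring_sheaf_iso ::
  "'p topology \<Rightarrow> ('p, 'a) ring_presheaf \<Rightarrow> ('p, 'b) ring_presheaf \<Rightarrow>
   ('p set \<Rightarrow> 'a \<Rightarrow> 'b) \<Rightarrow> bool" where
  "ring_sheaf_iso T A B \<phi> \<longleftrightarrow> ring_sheaf_hom T A B \<phi> \<and>
    (\<forall>U. openin T U \<longrightarrow> bij_betw (\<phi> U) (carrier (sect A U)) (carrier (sect B U)))"

definition mod_sheaf_hom ::
  "'p topology \<Rightarrow> ('p, 'a) ring_presheaf \<Rightarrow> ('p, 'a, 'm) mod_presheaf \<Rightarrow>
   ('p, 'a, 'n) mod_presheaf \<Rightarrow> ('p set \<Rightarrow> 'm \<Rightarrow> 'n) \<Rightarrow> bool" where
  "mod_sheaf_hom T A F G \<phi> \<longleftrightarrow>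
    (\<forall>U. openin T U \<longrightarrow>
      \<phi> U \<in> carrier (sect F U) \<rightarrow> carrier (sect G U) \<and>
      (\<forall>x\<in>carrier (sect F U). \<forall>y\<in>carrier (sect F U).
        \<phi> U (x \<oplus>\<^bsub>sect F U\<^esub> y) = \<phi> U x \<oplus>\<^bsub>sect G U\<^esub> \<phi> U y) \<and>
      (\<forall>a\<in>carrier (sect A U). \<forall>x\<in>carrier (sect F U).
        \<phi> U (a \<odot>\<^bsub>sect F U\<^esub> x) = a \<odot>\<^bsub>sect G U\<^esub> \<phi> U x)) \<and>
    commutes_with_res T F G \<phi>"

definition regular_module :: "'a ring \<Rightarrow> ('a, 'a) module" where
  "regular_module R = \<lparr>carrier = carrier R, monoid.mult = monoid.mult R, one = one R,
    ring.zero = ring.zero R, ring.add = ring.add R, smult = monoid.mult R\<rparr>"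

definition regular_sheaf :: "('p, 'a) ring_presheaf \<Rightarrow> ('p, 'a, 'a) mod_presheaf" where
  "regular_sheaf A = \<lparr>sect = (\<lambda>U. regular_module (sect A U)), res = res A\<rparr>"

definition restrict_scalars ::
  "('p set \<Rightarrow> 'c \<Rightarrow> 'a) \<Rightarrow> ('p, 'a, 'm) mod_presheaf \<Rightarrow> ('p, 'c, 'm) mod_presheaf" where
  "restrict_scalars h F = \<lparr>sect = (\<lambda>U. \<lparr>
      carrier = carrier (sect F U), monoid.mult = monoid.mult (sect F U),
      one = one (sect F U), ring.zero = ring.zero (sect F U), ring.add = ring.add (sect F U),
      smult = (\<lambda>c x. h U c \<odot>\<^bsub>sect F U\<^esub> x)\<rparr>), res = res F\<rparr>"


section \<open>Stalks\<close>

definition germ ::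
  "'p topology \<Rightarrow> ('p, ('x, 'e) partial_object_scheme, 'x) presheaf \<Rightarrow> 'p \<Rightarrow> 'p set \<Rightarrow> 'x \<Rightarrow>
   ('p set \<times> 'x) set" where
  "germ T F p U x = {(V, y). openin T V \<and> p \<in> V \<and> y \<in> carrier (sect F V) \<and>
    (\<exists>W. openin T W \<and> p \<in> W \<and> W \<subseteq> U \<inter> V \<and> res F U W x = res F V W y)}"

definition germs ::
  "'p topology \<Rightarrow> ('p, ('x, 'e) partial_object_scheme, 'x) presheaf \<Rightarrow> 'p \<Rightarrow>
   ('p set \<times> 'x) set set" where
  "germs T F p = {germ T F p U x | U x. openin T U \<and> p \<in> U \<and> x \<in> carrier (sect F U)}"

definition stalk_ring ::
  "'p topology \<Rightarrow> ('p, 'a) ring_presheaf \<Rightarrow> 'p \<Rightarrow> ('p set \<times> 'a) set ring" where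
  "stalk_ring T A p = \<lparr>
    carrier = germs T A p,
    monoid.mult = (\<lambda>s t. \<Union>(U, x)\<in>s. \<Union>(V, y)\<in>t.
      germ T A p (U \<inter> V) (res A U (U \<inter> V) x \<otimes>\<^bsub>sect A (U \<inter> V)\<^esub> res A V (U \<inter> V) y)),
    one = germ T A p (topspace T) \<one>\<^bsub>sect A (topspace T)\<^esub>,
    ring.zero = germ T A p (topspace T) \<zero>\<^bsub>sect A (topspace T)\<^esub>,
    ring.add = (\<lambda>s t. \<Union>(U, x)\<in>s. \<Union>(V, y)\<in>t.
      germ T A p (U \<inter> V) (res A U (U \<inter> V) x \<oplus>\<^bsub>sect A (U \<inter> V)\<^esub> res A V (U \<inter> V) y))\<rparr>"

definition stalk_map ::
  "'p topology \<Rightarrow> ('p, 'b) ring_presheaf \<Rightarrow> ('p set \<Rightarrow> 'a \<Rightarrow> 'b) \<Rightarrow> 'p \<Rightarrow>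
   ('p set \<times> 'a) set \<Rightarrow> ('p set \<times> 'b) set" where
  "stalk_map T B \<phi> p s = (\<Union>(U, x)\<in>s. germ T B p U (\<phi> U x))"

text \<open>Intended for local rings, which have exactly one maximal ideal.\<close>

definition local_hom :: "'a ring \<Rightarrow> 'b ring \<Rightarrow> ('a \<Rightarrow> 'b) \<Rightarrow> bool" where
  "local_hom A B f \<longleftrightarrow> f \<in> ring_hom A B \<and>
    (\<forall>m n. maximalideal m A \<and> maximalideal n B \<longrightarrow> {x \<in> carrier A. f x \<in> n} = m)"

text \<open>
  A morphism of schemes from \<open>(T, B)\<close> to \<open>(T, A)\<close> whose underlying continuous map is the
  identity is a local homomorphism of sheaves of rings from \<open>A\<close> to \<open>B\<close>.
\<close>

definition scheme_morphism_over_id ::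
  "'p topology \<Rightarrow> ('p, 'a) ring_presheaf \<Rightarrow> ('p, 'b) ring_presheaf \<Rightarrow>
   ('p set \<Rightarrow> 'a \<Rightarrow> 'b) \<Rightarrow> bool" where
  "scheme_morphism_over_id T A B h \<longleftrightarrow> ring_sheaf_hom T A B h \<and>
    (\<forall>p\<in>topspace T. local_hom (stalk_ring T A p) (stalk_ring T B p) (stalk_map T B h p))"


section \<open>Localization and the spectrum\<close>

text \<open>The fraction \<open>m/s\<close> in the localization of the module \<open>M\<close> at the multiplicative set \<open>S\<close>.\<close>

definition fraction :: "('a, 'm) module \<Rightarrow> 'a set \<Rightarrow> 'm \<Rightarrow> 'a \<Rightarrow> ('m \<times> 'a) set" where
  "fraction M S m s = {(n, t). n \<in> carrier M \<and> t \<in> S \<and>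
    (\<exists>u\<in>S. u \<odot>\<^bsub>M\<^esub> (t \<odot>\<^bsub>M\<^esub> m) = u \<odot>\<^bsub>M\<^esub> (s \<odot>\<^bsub>M\<^esub> n))}"

definition loc_ring :: "'a ring \<Rightarrow> 'a set \<Rightarrow> ('a \<times> 'a) set ring" where
  "loc_ring R S = (let fr = fraction (regular_module R) S in \<lparr>
    carrier = {fr a s | a s. a \<in> carrier R \<and> s \<in> S},
    monoid.mult = (\<lambda>x y. \<Union>(a, s)\<in>x. \<Union>(b, t)\<in>y. fr (a \<otimes>\<^bsub>R\<^esub> b) (s \<otimes>\<^bsub>R\<^esub> t)),
    one = fr \<one>\<^bsub>R\<^esub> \<one>\<^bsub>R\<^esub>,
    ring.zero = fr \<zero>\<^bsub>R\<^esub> \<one>\<^bsub>R\<^esub>,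
    ring.add = (\<lambda>x y. \<Union>(a, s)\<in>x. \<Union>(b, t)\<in>y.
      fr (t \<otimes>\<^bsub>R\<^esub> a \<oplus>\<^bsub>R\<^esub> s \<otimes>\<^bsub>R\<^esub> b) (s \<otimes>\<^bsub>R\<^esub> t))\<rparr>)"

text \<open>
  The module records of HOL-Algebra carry the unused ring fields \<open>mult\<close> and \<open>one\<close>.
  The scalars of \<open>loc_module R S M\<close> are the elements of \<open>loc_ring R S\<close>.
\<close>

definition loc_module ::
  "'a ring \<Rightarrow> 'a set \<Rightarrow> ('a, 'm) module \<Rightarrow> (('a \<times> 'a) set, ('m \<times> 'a) set) module" where
  "loc_module R S M = \<lparr>
    carrier = {fraction M S m s | m s. m \<in> carrier M \<and> s \<in> S},
    monoid.mult = undefined,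
    one = undefined,
    ring.zero = fraction M S \<zero>\<^bsub>M\<^esub> \<one>\<^bsub>R\<^esub>,
    ring.add = (\<lambda>x y. \<Union>(m, s)\<in>x. \<Union>(n, t)\<in>y.
      fraction M S (t \<odot>\<^bsub>M\<^esub> m \<oplus>\<^bsub>M\<^esub> s \<odot>\<^bsub>M\<^esub> n) (s \<otimes>\<^bsub>R\<^esub> t)),
    smult = (\<lambda>x y. \<Union>(a, s)\<in>x. \<Union>(n, t)\<in>y. fraction M S (a \<odot>\<^bsub>M\<^esub> n) (s \<otimes>\<^bsub>R\<^esub> t))\<rparr>"

definition Spec :: "'a ring \<Rightarrow> 'a set set" where
  "Spec R = {P. primeideal P R}"

definition zariski :: "'a ring \<Rightarrow> 'a set topology" where
  "zariski R = topology (\<lambda>U. \<exists>S. S \<subseteq> carrier R \<and> U = {P \<in> Spec R. \<not> S \<subseteq> P})"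

lemma openin_zariski:
  "openin (zariski R) U \<longleftrightarrow> (\<exists>S. S \<subseteq> carrier R \<and> U = {P \<in> Spec R. \<not> S \<subseteq> P})"
proof -
  let ?op = "\<lambda>U. \<exists>S. S \<subseteq> carrier R \<and> U = {P \<in> Spec R. \<not> S \<subseteq> P}"
  have int: "?op (U \<inter> V)" if U: "?op U" and V: "?op V" for U V
  proof -
    obtain A B where A: "A \<subseteq> carrier R" "U = {P \<in> Spec R. \<not> A \<subseteq> P}"
      and B: "B \<subseteq> carrier R" "V = {P \<in> Spec R. \<not> B \<subseteq> P}"
      using U V by blast
    let ?C = "{a \<otimes>\<^bsub>R\<^esub> b | a b. a \<in> A \<and> b \<in> B}"
    have "(\<not> ?C \<subseteq> P) = (\<not> A \<subseteq> P \<and> \<not> B \<subseteq> P)" and "?C \<subseteq> carrier R" if "P \<in> Spec R" for P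
    proof -
      interpret primeideal P R using that by (simp add: Spec_def)
      show "?C \<subseteq> carrier R" using A(1) B(1) by auto
      show "(\<not> ?C \<subseteq> P) = (\<not> A \<subseteq> P \<and> \<not> B \<subseteq> P)"
      proof
        assume "\<not> ?C \<subseteq> P"
        then obtain a b where ab: "a \<in> A" "b \<in> B" "a \<otimes>\<^bsub>R\<^esub> b \<notin> P" by blast
        have "a \<in> carrier R" "b \<in> carrier R" using ab A(1) B(1) by auto
        then have "a \<notin> P" "b \<notin> P" using ab(3) I_l_closed I_r_closed by auto
        then show "\<not> A \<subseteq> P \<and> \<not> B \<subseteq> P" using ab by blast
      next
        assume "\<not> A \<subseteq> P \<and> \<not> B \<subseteq> P"
        then obtain a b where ab: "a \<in> A" "b \<in> B" "a \<notin> P" "b \<notin> P" by blast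
        then have "a \<otimes>\<^bsub>R\<^esub> b \<notin> P" using I_prime[of a b] A(1) B(1) by blast
        then show "\<not> ?C \<subseteq> P" using ab by blast
      qed
    qed note * = this
    show ?thesis
    proof (cases "Spec R = {}")
      case True
      then show ?thesis using A(2) by (intro exI[of _ "{}"]) auto
    next
      case False
      then have "?C \<subseteq> carrier R" using *(2) by blast
      moreover have "U \<inter> V = {P \<in> Spec R. \<not> ?C \<subseteq> P}"
        unfolding A(2) B(2) using *(1) by blast
      ultimately show ?thesis by blast
    qed
  qed
  have un: "?op (\<Union>K)" if K: "\<And>U. U \<in> K \<Longrightarrow> ?op U" for K
  proof -
    obtain A where A: "\<And>U. U \<in> K \<Longrightarrow> A U \<subseteq> carrier R \<and> U = {P \<in> Spec R. \<not> A U \<subseteq> P}"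
      using K by metis
    have mem: "P \<in> U \<longleftrightarrow> P \<in> Spec R \<and> \<not> A U \<subseteq> P" if "U \<in> K" for U P
      using A[OF that] by blast
    have "P \<in> \<Union>K \<longleftrightarrow> P \<in> {P \<in> Spec R. \<not> \<Union>(A ` K) \<subseteq> P}" for P
      by (auto simp: mem UN_subset_iff)
    then have "\<Union>K = {P \<in> Spec R. \<not> \<Union>(A ` K) \<subseteq> P}" by (rule Set.set_eqI)
    moreover have "\<Union>(A ` K) \<subseteq> carrier R" using A by (simp add: UN_subset_iff)
    ultimately show ?thesis by (intro exI[of _ "\<Union>(A ` K)"] conjI)
  qed
  have "istopology ?op"
    unfolding istopology_def by (intro conjI allI impI int un) simp_all
  then show ?thesis by (simp add: zariski_def topology_inverse')
qed

text \<open>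
  Functions on \<open>U\<close> with value in the localization \<open>M\<^sub>P\<close> at each prime \<open>P\<close> that are
  locally given by a single fraction.
\<close>

definition local_fractions ::
  "'a ring \<Rightarrow> ('a, 'm) module \<Rightarrow> 'a set set \<Rightarrow> ('a set \<Rightarrow> ('m \<times> 'a) set) set" where
  "local_fractions R M U =
    {s \<in> (\<Pi>\<^sub>E P\<in>U. {fraction M (carrier R - P) m f | m f. m \<in> carrier M \<and> f \<in> carrier R - P}).
      \<forall>P\<in>U. \<exists>V m f. openin (zariski R) V \<and> P \<in> V \<and> V \<subseteq> U \<and> m \<in> carrier M \<and> f \<in> carrier R \<and>
        (\<forall>Q\<in>V. f \<notin> Q \<and> s Q = fraction M (carrier R - Q) m f)}"

definition spec_sheaf ::
  "'a ring \<Rightarrow> ('a set, 'a set \<Rightarrow> ('a \<times> 'a) set) ring_presheaf" where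
  "spec_sheaf R = \<lparr>
    sect = (\<lambda>U. \<lparr>
      carrier = local_fractions R (regular_module R) U,
      monoid.mult = (\<lambda>s t. \<lambda>P\<in>U. s P \<otimes>\<^bsub>loc_ring R (carrier R - P)\<^esub> t P),
      one = (\<lambda>P\<in>U. \<one>\<^bsub>loc_ring R (carrier R - P)\<^esub>),
      ring.zero = (\<lambda>P\<in>U. \<zero>\<^bsub>loc_ring R (carrier R - P)\<^esub>),
      ring.add = (\<lambda>s t. \<lambda>P\<in>U. s P \<oplus>\<^bsub>loc_ring R (carrier R - P)\<^esub> t P)\<rparr>),
    res = (\<lambda>U V s. restrict s V)\<rparr>"

text \<open>The sheaf of modules on the spectrum of \<open>R\<close> associated with the \<open>R\<close>-module \<open>M\<close>.\<close>

definition tilde ::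
  "'a ring \<Rightarrow> ('a, 'm) module \<Rightarrow>
   ('a set, 'a set \<Rightarrow> ('a \<times> 'a) set, 'a set \<Rightarrow> ('m \<times> 'a) set) mod_presheaf" where
  "tilde R M = \<lparr>
    sect = (\<lambda>U. \<lparr>
      carrier = local_fractions R M U,
      monoid.mult = undefined,
      one = undefined,
      ring.zero = (\<lambda>P\<in>U. \<zero>\<^bsub>loc_module R (carrier R - P) M\<^esub>),
      ring.add = (\<lambda>s t. \<lambda>P\<in>U. s P \<oplus>\<^bsub>loc_module R (carrier R - P) M\<^esub> t P),
      smult = (\<lambda>r s. \<lambda>P\<in>U. r P \<odot>\<^bsub>loc_module R (carrier R - P) M\<^esub> s P)\<rparr>),
    res = (\<lambda>U V s. restrict s V)\<rparr>"


section \<open>Schemes and coherent sheaves\<close>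

text \<open>The direct image under \<open>\<phi>\<close>, defined on the open set \<open>U\<close>, of the restriction of \<open>F\<close> to \<open>U\<close>.\<close>

definition direct_image ::
  "'p set \<Rightarrow> ('p \<Rightarrow> 'q) \<Rightarrow> ('p, 's, 'x) presheaf \<Rightarrow> ('q, 's, 'x) presheaf" where
  "direct_image U \<phi> F = \<lparr>
    sect = (\<lambda>V. sect F {p \<in> U. \<phi> p \<in> V}),
    res = (\<lambda>V W. res F {p \<in> U. \<phi> p \<in> V} {p \<in> U. \<phi> p \<in> W})\<rparr>"

definition affine_chart ::
  "'p topology \<Rightarrow> ('p, 'a) ring_presheaf \<Rightarrow> 'p set \<Rightarrow> 'r ring \<Rightarrow> ('p \<Rightarrow> 'r set) \<Rightarrow>
   ('r set set \<Rightarrow> ('r set \<Rightarrow> ('r \<times> 'r) set) \<Rightarrow> 'a) \<Rightarrow> bool" where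
  "affine_chart T A U R \<phi> \<psi> \<longleftrightarrow> openin T U \<and> cring R \<and>
    homeomorphic_map (subtopology T U) (zariski R) \<phi> \<and>
    ring_sheaf_iso (zariski R) (spec_sheaf R) (direct_image U \<phi> A) \<psi>"

text \<open>
  A ring whose spectrum is isomorphic to \<open>(U, A|U)\<close> is isomorphic to the ring of sections of \<open>A\<close>
  over \<open>U\<close>, so it is no restriction that \<open>R\<close> ranges over rings on the type of sections of \<open>A\<close>.
  The same applies to the module \<open>M\<close> in the definition of coherent sheaves. A ringed space that
  is locally isomorphic, as a ringed space, to spectra is automatically locally ringed.
\<close>

definition scheme :: "'p topology \<Rightarrow> ('p, 'a) ring_presheaf \<Rightarrow> bool" where
  "scheme T A \<longleftrightarrow> ring_sheaf T A \<and>
    (\<forall>p\<in>topspace T. \<exists>U (R :: 'a ring) \<phi> \<psi>. p \<in> U \<and> affine_chart T A U R \<phi> \<psi>)"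

definition finitely_generated :: "'a ring \<Rightarrow> ('a, 'm) module \<Rightarrow> bool" where
  "finitely_generated R M \<longleftrightarrow>
    (\<exists>S. finite S \<and> S \<subseteq> carrier M \<and> (\<forall>N. submodule N R M \<and> S \<subseteq> N \<longrightarrow> N = carrier M))"

text \<open>
  Coherence in the sense of Hartshorne: locally the sheaf associated with a finitely generated
  module. Over schemes that are not locally Noetherian this is weaker than requiring finite type
  and all kernels from free modules of finite rank to be of finite type.
\<close>

definition coherent ::
  "'p topology \<Rightarrow> ('p, 'a) ring_presheaf \<Rightarrow> ('p, 'a, 'm) mod_presheaf \<Rightarrow> bool" where
  "coherent T A F \<longleftrightarrow> mod_sheaf T A F \<and>
    (\<forall>p\<in>topspace T. \<exists>U (R :: 'a ring) \<phi> \<psi> (M :: ('a, 'm) module) \<theta>.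
      p \<in> U \<and> affine_chart T A U R \<phi> \<psi> \<and> Module.module R M \<and> finitely_generated R M \<and>
      (\<forall>V. openin (zariski R) V \<longrightarrow>
        bij_betw (\<theta> V) (carrier (sect (tilde R M) V)) (carrier (sect (direct_image U \<phi> F) V))) \<and>
      mod_sheaf_hom (zariski R) (spec_sheaf R) (tilde R M)
        (restrict_scalars \<psi> (direct_image U \<phi> F)) \<theta>)"


section \<open>Tensor powers of a sheaf of modules\<close>

definition tuples :: "('a, 'm) module \<Rightarrow> nat \<Rightarrow> 'm list set" where
  "tuples M n = {xs. length xs = n \<and> set xs \<subseteq> carrier M}"

definition tensor_relations ::
  "'a ring \<Rightarrow> ('a, 'm) module \<Rightarrow> nat \<Rightarrow> ('m list \<Rightarrow>\<^sub>0 int) set" where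
  "tensor_relations R M n =
    {frag_of (xs[i := x \<oplus>\<^bsub>M\<^esub> y]) - frag_of (xs[i := x]) - frag_of (xs[i := y]) | xs i x y.
      xs \<in> tuples M n \<and> i < n \<and> x \<in> carrier M \<and> y \<in> carrier M} \<union>
    {frag_of (xs[i := a \<odot>\<^bsub>M\<^esub> xs ! i]) - frag_of (xs[j := a \<odot>\<^bsub>M\<^esub> xs ! j]) | xs i j a.
      xs \<in> tuples M n \<and> i < n \<and> j < n \<and> a \<in> carrier R}"

definition tensor_null ::
  "'a ring \<Rightarrow> ('a, 'm) module \<Rightarrow> nat \<Rightarrow> ('m list \<Rightarrow>\<^sub>0 int) set" where
  "tensor_null R M n = generate (free_Abelian_group (tuples M n)) (tensor_relations R M n)"

definition tensor_class ::
  "'a ring \<Rightarrow> ('a, 'm) module \<Rightarrow> nat \<Rightarrow> ('m list \<Rightarrow>\<^sub>0 int) \<Rightarrow> ('m list \<Rightarrow>\<^sub>0 int) set" where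
  "tensor_class R M n c = tensor_null R M n #>\<^bsub>free_Abelian_group (tuples M n)\<^esub> c"

text \<open>
  The \<open>n\<close>-fold tensor power of \<open>M\<close> over \<open>R\<close>, for \<open>n \<ge> 1\<close>. By the second kind of relations,
  scalars may be taken to act on the first factor.
\<close>

definition tensor_power ::
  "'a ring \<Rightarrow> ('a, 'm) module \<Rightarrow> nat \<Rightarrow> ('a, ('m list \<Rightarrow>\<^sub>0 int) set) module" where
  "tensor_power R M n = \<lparr>
    carrier = carrier (free_Abelian_group (tuples M n) Mod tensor_null R M n),
    monoid.mult = undefined,
    one = undefined,
    ring.zero = tensor_null R M n,
    ring.add = monoid.mult (free_Abelian_group (tuples M n) Mod tensor_null R M n),
    smult = (\<lambda>a C. \<Union>c\<in>C. tensor_class R M n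
      (frag_extend (\<lambda>xs. frag_of (xs[0 := a \<odot>\<^bsub>M\<^esub> xs ! 0])) c))\<rparr>"

definition tensor_presheaf ::
  "('p, 'a) ring_presheaf \<Rightarrow> ('p, 'a, 'm) mod_presheaf \<Rightarrow> nat \<Rightarrow>
   ('p, 'a, ('m list \<Rightarrow>\<^sub>0 int) set) mod_presheaf" where
  "tensor_presheaf A G n = \<lparr>
    sect = (\<lambda>U. tensor_power (sect A U) (sect G U) n),
    res = (\<lambda>U V C. \<Union>c\<in>C. tensor_class (sect A V) (sect G V) n
      (frag_extend (\<lambda>xs. frag_of (map (res G U V) xs)) c))\<rparr>"

definition sheafification ::
  "'p topology \<Rightarrow> ('p, 'a) ring_presheaf \<Rightarrow> ('p, 'a, 'm) mod_presheaf \<Rightarrow>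
   ('p, 'a, 'p \<Rightarrow> ('p set \<times> 'm) set) mod_presheaf" where
  "sheafification T A P = \<lparr>
    sect = (\<lambda>U. \<lparr>
      carrier = {s \<in> (\<Pi>\<^sub>E p\<in>U. germs T P p). \<forall>p\<in>U. \<exists>V x. openin T V \<and> p \<in> V \<and> V \<subseteq> U \<and>
        x \<in> carrier (sect P V) \<and> (\<forall>q\<in>V. s q = germ T P q V x)},
      monoid.mult = undefined,
      one = undefined,
      ring.zero = (\<lambda>p\<in>U. germ T P p U \<zero>\<^bsub>sect P U\<^esub>),
      ring.add = (\<lambda>s t. \<lambda>p\<in>U. \<Union>(V, x)\<in>s p. \<Union>(W, y)\<in>t p.
        germ T P p (V \<inter> W) (res P V (V \<inter> W) x \<oplus>\<^bsub>sect P (V \<inter> W)\<^esub> res P W (V \<inter> W) y)),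
      smult = (\<lambda>a s. \<lambda>p\<in>U. \<Union>(V, x)\<in>s p.
        germ T P p (U \<inter> V) (res A U (U \<inter> V) a \<odot>\<^bsub>sect P (U \<inter> V)\<^esub> res P V (U \<inter> V) x))\<rparr>),
    res = (\<lambda>U V s. restrict s V)\<rparr>"

definition tensor_sheaf ::
  "'p topology \<Rightarrow> ('p, 'a) ring_presheaf \<Rightarrow> ('p, 'a, 'm) mod_presheaf \<Rightarrow> nat \<Rightarrow>
   ('p, 'a, 'p \<Rightarrow> ('p set \<times> ('m list \<Rightarrow>\<^sub>0 int) set) set) mod_presheaf" where
  "tensor_sheaf T A G n = sheafification T A (tensor_presheaf A G n)"

text \<open>The section \<open>x\<^sub>1 \<otimes> \<dots> \<otimes> x\<^sub>n\<close> of the tensor power over \<open>U\<close>, for \<open>xs = [x\<^sub>1, \<dots>, x\<^sub>n]\<close>.\<close>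

definition pure_tensor ::
  "'p topology \<Rightarrow> ('p, 'a) ring_presheaf \<Rightarrow> ('p, 'a, 'm) mod_presheaf \<Rightarrow> 'p set \<Rightarrow> 'm list \<Rightarrow>
   'p \<Rightarrow> ('p set \<times> ('m list \<Rightarrow>\<^sub>0 int) set) set" where
  "pure_tensor T A G U xs = (\<lambda>p\<in>U. germ T (tensor_presheaf A G (length xs)) p U
    (tensor_class (sect A U) (sect G U) (length xs) (frag_of xs)))"


section \<open>The Hochschild complex\<close>

text \<open>
  Homomorphisms are normalized outside the open sets and the carriers, so that equality of
  elements of \<open>hom_module\<close> is equality of sheaf homomorphisms.
\<close>

definition normalize_family ::
  "'p topology \<Rightarrow> ('p, ('x, 'e) partial_object_scheme, 'x) presheaf \<Rightarrow>
   ('p set \<Rightarrow> 'x \<Rightarrow> 'y) \<Rightarrow> 'p set \<Rightarrow> 'x \<Rightarrow> 'y" where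
  "normalize_family T G f =
    (\<lambda>U. if openin T U then restrict (f U) (carrier (sect G U)) else (\<lambda>_. undefined))"

text \<open>Global homomorphisms, as a module over the global sections of \<open>A\<close>.\<close>

definition hom_module ::
  "'p topology \<Rightarrow> ('p, 'a) ring_presheaf \<Rightarrow> ('p, 'a, 'm) mod_presheaf \<Rightarrow>
   ('p, 'a, 'n) mod_presheaf \<Rightarrow> ('a, 'p set \<Rightarrow> 'm \<Rightarrow> 'n) module" where
  "hom_module T A G F = \<lparr>
    carrier = {f. mod_sheaf_hom T A G F f \<and> normalize_family T G f = f},
    monoid.mult = undefined,
    one = undefined,
    ring.zero = normalize_family T G (\<lambda>U _. \<zero>\<^bsub>sect F U\<^esub>),
    ring.add = (\<lambda>f g. normalize_family T G (\<lambda>U x. f U x \<oplus>\<^bsub>sect F U\<^esub> g U x)),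
    smult = (\<lambda>a f. normalize_family T G (\<lambda>U x. res A (topspace T) U a \<odot>\<^bsub>sect F U\<^esub> f U x))\<rparr>"

definition quotient_module ::
  "('a, 'm) module \<Rightarrow> 'm set \<Rightarrow> ('a, 'm set) module" where
  "quotient_module M N = \<lparr>
    carrier = a_rcosets\<^bsub>M\<^esub> N,
    monoid.mult = undefined,
    one = undefined,
    ring.zero = N,
    ring.add = (\<lambda>C D. C <+>\<^bsub>M\<^esub> D),
    smult = (\<lambda>a C. \<Union>x\<in>C. N +>\<^bsub>M\<^esub> (a \<odot>\<^bsub>M\<^esub> x))\<rparr>"

text \<open>
  In the rest of the theory \<open>OZ\<close> and \<open>OY\<close> are the structure sheaves of two schemes on the
  space \<open>T\<close>, \<open>h\<close> is a homomorphism from \<open>OZ\<close> to \<open>OY\<close>, and \<open>F\<close> is an \<open>OY\<close>-module.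
\<close>

definition algebra_as_module ::
  "('p set \<Rightarrow> 'c \<Rightarrow> 'a) \<Rightarrow> ('p, 'a) ring_presheaf \<Rightarrow> ('p, 'c, 'a) mod_presheaf" where
  "algebra_as_module h A = restrict_scalars h (regular_sheaf A)"

abbreviation tens where
  "tens T OZ OY h \<equiv> pure_tensor T OZ (algebra_as_module h OY)"

definition cochains1 where
  "cochains1 T OZ OY h F =
    hom_module T OZ (algebra_as_module h OY) (restrict_scalars h F)"

definition cochains where
  "cochains T OZ OY h F n =
    hom_module T OZ (tensor_sheaf T OZ (algebra_as_module h OY) n) (restrict_scalars h F)"

text \<open>
  A homomorphism from a tensor power is determined by its values on pure tensors; both
  coboundaries are the homomorphisms with the prescribed values there. The formulas hold over
  all open sets, and those over any basis of open sets (such as the affine ones) determine them.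
\<close>

definition \<delta>\<^sub>0 ::
  "'p topology \<Rightarrow> ('p, 'c) ring_presheaf \<Rightarrow> ('p, 'a) ring_presheaf \<Rightarrow> ('p set \<Rightarrow> 'c \<Rightarrow> 'a) \<Rightarrow>
   ('p, 'a, 'm) mod_presheaf \<Rightarrow> ('p set \<Rightarrow> 'a \<Rightarrow> 'm) \<Rightarrow>
   'p set \<Rightarrow> ('p \<Rightarrow> ('p set \<times> ('a list \<Rightarrow>\<^sub>0 int) set) set) \<Rightarrow> 'm" where
  "\<delta>\<^sub>0 T OZ OY h F g = (THE f. f \<in> carrier (cochains T OZ OY h F 2) \<and>
    (\<forall>U. openin T U \<longrightarrow> (\<forall>r\<^sub>0\<in>carrier (sect OY U). \<forall>r\<^sub>1\<in>carrier (sect OY U).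
      f U (tens T OZ OY h U [r\<^sub>0, r\<^sub>1]) =
        r\<^sub>0 \<odot>\<^bsub>sect F U\<^esub> g U r\<^sub>1 \<ominus>\<^bsub>sect F U\<^esub> g U (r\<^sub>0 \<otimes>\<^bsub>sect OY U\<^esub> r\<^sub>1)
          \<oplus>\<^bsub>sect F U\<^esub> r\<^sub>1 \<odot>\<^bsub>sect F U\<^esub> g U r\<^sub>0)))"

definition \<delta>\<^sub>1 ::
  "'p topology \<Rightarrow> ('p, 'c) ring_presheaf \<Rightarrow> ('p, 'a) ring_presheaf \<Rightarrow> ('p set \<Rightarrow> 'c \<Rightarrow> 'a) \<Rightarrow>
   ('p, 'a, 'm) mod_presheaf \<Rightarrow>
   ('p set \<Rightarrow> ('p \<Rightarrow> ('p set \<times> ('a list \<Rightarrow>\<^sub>0 int) set) set) \<Rightarrow> 'm) \<Rightarrow>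
   'p set \<Rightarrow> ('p \<Rightarrow> ('p set \<times> ('a list \<Rightarrow>\<^sub>0 int) set) set) \<Rightarrow> 'm" where
  "\<delta>\<^sub>1 T OZ OY h F f = (THE k. k \<in> carrier (cochains T OZ OY h F 3) \<and>
    (\<forall>U. openin T U \<longrightarrow> (\<forall>r\<^sub>0\<in>carrier (sect OY U). \<forall>r\<^sub>1\<in>carrier (sect OY U).
      \<forall>r\<^sub>2\<in>carrier (sect OY U).
      k U (tens T OZ OY h U [r\<^sub>0, r\<^sub>1, r\<^sub>2]) =
        r\<^sub>0 \<odot>\<^bsub>sect F U\<^esub> f U (tens T OZ OY h U [r\<^sub>1, r\<^sub>2])
          \<ominus>\<^bsub>sect F U\<^esub> f U (tens T OZ OY h U [r\<^sub>0 \<otimes>\<^bsub>sect OY U\<^esub> r\<^sub>1, r\<^sub>2])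
          \<oplus>\<^bsub>sect F U\<^esub> f U (tens T OZ OY h U [r\<^sub>0, r\<^sub>1 \<otimes>\<^bsub>sect OY U\<^esub> r\<^sub>2])
          \<ominus>\<^bsub>sect F U\<^esub> r\<^sub>2 \<odot>\<^bsub>sect F U\<^esub> f U (tens T OZ OY h U [r\<^sub>0, r\<^sub>1]))))"

definition cocycles where
  "cocycles T OZ OY h F =
    a_kernel (cochains T OZ OY h F 2) (cochains T OZ OY h F 3) (\<delta>\<^sub>1 T OZ OY h F)"

definition coboundaries where
  "coboundaries T OZ OY h F = \<delta>\<^sub>0 T OZ OY h F ` carrier (cochains1 T OZ OY h F)"

definition H2 where
  "H2 T OZ OY h F =
    quotient_module ((cochains T OZ OY h F 2)\<lparr>carrier := cocycles T OZ OY h F\<rparr>)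
      (coboundaries T OZ OY h F)"

definition H2_class where
  "H2_class T OZ OY h F f = coboundaries T OZ OY h F +>\<^bsub>cochains T OZ OY h F 2\<^esub> f"

definition symmetric_map where
  "symmetric_map T OZ OY h f \<longleftrightarrow>
    (\<forall>U. openin T U \<longrightarrow> (\<forall>r\<^sub>0\<in>carrier (sect OY U). \<forall>r\<^sub>1\<in>carrier (sect OY U).
      f U (tens T OZ OY h U [r\<^sub>0, r\<^sub>1]) = f U (tens T OZ OY h U [r\<^sub>1, r\<^sub>0])))"

definition symmetric_cocycles where
  "symmetric_cocycles T OZ OY h F = {f \<in> cocycles T OZ OY h F. symmetric_map T OZ OY h f}"

definition H2_S where
  "H2_S T OZ OY h F = H2_class T OZ OY h F ` symmetric_cocycles T OZ OY h F"


section \<open>Infinitesimal extensions\<close>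

record ('p, 'c, 'a, 'm, 'x) extension =
  total :: "('p, 'x) ring_presheaf"
  proj :: "'p set \<Rightarrow> 'x \<Rightarrow> 'a"
  incl :: "'p set \<Rightarrow> 'm \<Rightarrow> 'x"
  scal :: "'p set \<Rightarrow> 'c \<Rightarrow> 'x"

definition locally_surjective ::
  "'p topology \<Rightarrow> ('p, 'a) ring_presheaf \<Rightarrow> ('p, 'b) ring_presheaf \<Rightarrow>
   ('p set \<Rightarrow> 'a \<Rightarrow> 'b) \<Rightarrow> bool" where
  "locally_surjective T A B \<phi> \<longleftrightarrow>
    (\<forall>U. openin T U \<longrightarrow> (\<forall>y\<in>carrier (sect B U). \<forall>p\<in>U. \<exists>V. openin T V \<and> p \<in> V \<and> V \<subseteq> U \<and>
      (\<exists>x\<in>carrier (sect A V). \<phi> V x = res B U V y)))"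

text \<open>
  The kernel of \<open>proj\<close> squares to zero, and a section of \<open>OY\<close> acts on it through local lifts
  to \<open>total\<close>. So \<open>incl\<close> is \<open>OY\<close>-linear onto the kernel iff it satisfies the last equation.
\<close>

definition infinitesimal_extension ::
  "'p topology \<Rightarrow> ('p, 'a) ring_presheaf \<Rightarrow> ('p, 'a, 'm) mod_presheaf \<Rightarrow>
   ('p, 'c, 'a, 'm, 'x) extension \<Rightarrow> bool" where
  "infinitesimal_extension T OY F E \<longleftrightarrow>
    scheme T (total E) \<and>
    ring_sheaf_hom T (total E) OY (proj E) \<and>
    locally_surjective T (total E) OY (proj E) \<and>
    commutes_with_res T F (total E) (incl E) \<and>
    (\<forall>U. openin T U \<longrightarrow>
      (\<forall>x \<in> a_kernel (sect (total E) U) (sect OY U) (proj E U).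
        \<forall>y \<in> a_kernel (sect (total E) U) (sect OY U) (proj E U).
          x \<otimes>\<^bsub>sect (total E) U\<^esub> y = \<zero>\<^bsub>sect (total E) U\<^esub>) \<and>
      bij_betw (incl E U) (carrier (sect F U))
        (a_kernel (sect (total E) U) (sect OY U) (proj E U)) \<and>
      (\<forall>m\<in>carrier (sect F U). \<forall>n\<in>carrier (sect F U).
        incl E U (m \<oplus>\<^bsub>sect F U\<^esub> n) = incl E U m \<oplus>\<^bsub>sect (total E) U\<^esub> incl E U n) \<and>
      (\<forall>x\<in>carrier (sect (total E) U). \<forall>m\<in>carrier (sect F U).
        incl E U (proj E U x \<odot>\<^bsub>sect F U\<^esub> m) = x \<otimes>\<^bsub>sect (total E) U\<^esub> incl E U m))"

definition algebra_extension ::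
  "'p topology \<Rightarrow> ('p, 'c) ring_presheaf \<Rightarrow> ('p set \<Rightarrow> 'c \<Rightarrow> 'a) \<Rightarrow>
   ('p, 'c, 'a, 'm, 'x) extension \<Rightarrow> bool" where
  "algebra_extension T OZ h E \<longleftrightarrow> ring_sheaf_hom T OZ (total E) (scal E) \<and>
    (\<forall>U. openin T U \<longrightarrow> (\<forall>z\<in>carrier (sect OZ U). proj E U (scal E U z) = h U z))"

definition module_split ::
  "'p topology \<Rightarrow> ('p, 'c) ring_presheaf \<Rightarrow> ('p, 'a) ring_presheaf \<Rightarrow> ('p set \<Rightarrow> 'c \<Rightarrow> 'a) \<Rightarrow>
   ('p, 'c, 'a, 'm, 'x) extension \<Rightarrow> bool" where
  "module_split T OZ OY h E \<longleftrightarrow>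
    (\<exists>\<sigma>. mod_sheaf_hom T OZ (algebra_as_module h OY) (algebra_as_module (scal E) (total E)) \<sigma> \<and>
      (\<forall>U. openin T U \<longrightarrow> (\<forall>y\<in>carrier (sect OY U). proj E U (\<sigma> U y) = y)))"

definition split_extension ::
  "'p topology \<Rightarrow> ('p, 'c) ring_presheaf \<Rightarrow> ('p, 'a) ring_presheaf \<Rightarrow> ('p set \<Rightarrow> 'c \<Rightarrow> 'a) \<Rightarrow>
   ('p, 'a, 'm) mod_presheaf \<Rightarrow> ('p, 'c, 'a, 'm, 'x) extension \<Rightarrow> bool" where
  "split_extension T OZ OY h F E \<longleftrightarrow> infinitesimal_extension T OY F E \<and>
    algebra_extension T OZ h E \<and> module_split T OZ OY h E"

definition isomorphic_extensions ::
  "'p topology \<Rightarrow> ('p, 'c) ring_presheaf \<Rightarrow> ('p, 'a, 'm) mod_presheaf \<Rightarrow>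
   ('p, 'c, 'a, 'm, 'x) extension \<Rightarrow> ('p, 'c, 'a, 'm, 'y) extension \<Rightarrow> bool" where
  "isomorphic_extensions T OZ F E E' \<longleftrightarrow>
    (\<exists>\<phi>. ring_sheaf_iso T (total E) (total E') \<phi> \<and>
      (\<forall>U. openin T U \<longrightarrow>
        (\<forall>z\<in>carrier (sect OZ U). \<phi> U (scal E U z) = scal E' U z) \<and>
        (\<forall>m\<in>carrier (sect F U). \<phi> U (incl E U m) = incl E' U m) \<and>
        (\<forall>x\<in>carrier (sect (total E) U). proj E' U (\<phi> U x) = proj E U x)))"

definition iso_relation where
  "iso_relation T OZ OY h F = {(E, E'). split_extension T OZ OY h F E \<and>
    split_extension T OZ OY h F E' \<and> isomorphic_extensions T OZ F E E'}"

definition extension_classes where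
  "extension_classes T OZ OY h F =
    {E. split_extension T OZ OY h F E} // iso_relation T OZ OY h F"

text \<open>
  The extension defined by a symmetric cocycle \<open>f\<close>. The cocycle condition gives
  \<open>f(1, r) = r f(1, 1)\<close>, so the unit of the displayed product is \<open>(1, -f(1, 1))\<close>. The structure
  map from \<open>OZ\<close> sends \<open>z\<close> to \<open>z\<close> times this unit, formed in the module \<open>OY \<oplus> F\<close>.
\<close>

definition cocycle_extension ::
  "'p topology \<Rightarrow> ('p, 'c) ring_presheaf \<Rightarrow> ('p, 'a) ring_presheaf \<Rightarrow> ('p set \<Rightarrow> 'c \<Rightarrow> 'a) \<Rightarrow>
   ('p, 'a, 'm) mod_presheaf \<Rightarrow>
   ('p set \<Rightarrow> ('p \<Rightarrow> ('p set \<times> ('a list \<Rightarrow>\<^sub>0 int) set) set) \<Rightarrow> 'm) \<Rightarrow>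
   ('p, 'c, 'a, 'm, 'a \<times> 'm) extension" where
  "cocycle_extension T OZ OY h F f =
   (let e = (\<lambda>U. \<ominus>\<^bsub>sect F U\<^esub> f U (tens T OZ OY h U [\<one>\<^bsub>sect OY U\<^esub>, \<one>\<^bsub>sect OY U\<^esub>])) in \<lparr>
    total = \<lparr>
      sect = (\<lambda>U. \<lparr>
        carrier = carrier (sect OY U) \<times> carrier (sect F U),
        monoid.mult = (\<lambda>(x, m) (x', m'). (x \<otimes>\<^bsub>sect OY U\<^esub> x',
          x \<odot>\<^bsub>sect F U\<^esub> m' \<oplus>\<^bsub>sect F U\<^esub> x' \<odot>\<^bsub>sect F U\<^esub> m
            \<oplus>\<^bsub>sect F U\<^esub> f U (tens T OZ OY h U [x, x']))),
        one = (\<one>\<^bsub>sect OY U\<^esub>, e U),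
        ring.zero = (\<zero>\<^bsub>sect OY U\<^esub>, \<zero>\<^bsub>sect F U\<^esub>),
        ring.add = (\<lambda>(x, m) (x', m'). (x \<oplus>\<^bsub>sect OY U\<^esub> x', m \<oplus>\<^bsub>sect F U\<^esub> m'))\<rparr>),
      res = (\<lambda>U V (x, m). (res OY U V x, res F U V m))\<rparr>,
    proj = (\<lambda>U. fst),
    incl = (\<lambda>U m. (\<zero>\<^bsub>sect OY U\<^esub>, m)),
    scal = (\<lambda>U z. (h U z, h U z \<odot>\<^bsub>sect F U\<^esub> e U))\<rparr>)"

end

theory Submission
  imports Defs
begin

text \<open>
  A splitting \<open>\<sigma>\<close> of an extension as \<open>OZ\<close>-modules identifies \<open>OX\<close> with \<open>OY \<oplus> F\<close>, and the failure of \<open>\<sigma>\<close>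
  to be multiplicative is a bilinear map \<open>f\<close> with \<open>\<sigma> x \<sigma> y = \<sigma> (x y) + f(x, y)\<close>. Commutativity of \<open>OX\<close>
  makes \<open>f\<close> symmetric and associativity makes it a cocycle. An isomorphism between the extensions given
  by \<open>f\<close> and \<open>f'\<close> has the form \<open>(x, m) \<mapsto> (x, m + k x)\<close>, and it is multiplicative exactly when
  \<open>f - f' = \<delta>\<^sub>0 k\<close>. Maps out of the sheaf \<open>OY \<otimes> OY\<close> are compared with families of bilinear maps through
  the universal properties of tensor powers and of sheafification.

  The remaining point is that \<open>OY \<oplus> F\<close> with the product twisted by a symmetric cocycle is a scheme. Over
  an affine open set on which \<open>F\<close> is the sheaf of a module, its sections form a square-zero extension of
  the ring of sections of \<open>OY\<close>, which has the same prime ideals and the same units modulo the kernel.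
  A sheaf of rings is affine on an open set as soon as the open set is the spectrum of a ring whose
  basic open sets are the loci of invertibility, and the stalks are the localisations of that ring; these
  conditions pass from \<open>OY\<close> and \<open>F\<close> to the extension.
\<close>

text \<open>Two points shape the argument. Cocycles are not normalised: a splitting of modules need
  not send 1 to 1, so f(1, 1) may be nonzero, the unit of the twisted product is (1, -f(1, 1)), and
  \<open>OZ\<close> maps to multiples of it. The identity f(1, x) = x f(1, 1), a case of the cocycle
  condition, makes the resulting action of \<open>OZ\<close> componentwise again. The other point is
  the choice of chart rings. A chart of \<open>OY\<close> comes with a ring \<open>R\<close> on the
  type of sections of \<open>OY\<close>, while a chart of the extension must use a ring of pairs.
  The ring of sections over the open set serves in both cases. Replacing \<open>R\<close> by it
  requires that the sections over a whole spectrum of the sheaf of a module \<open>M\<close> are the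
  elements of \<open>M\<close>. This is derived from the conditions on stalks by quasi-compactness
  phrased with ideals: the elements r for which a claim holds over the basic open set of r, or after
  multiplication by r, form an ideal contained in no prime, hence the unit ideal.\<close>

abbreviation "Sec F U \<equiv> carrier (sect F U)"

section \<open>Sheaves of rings and of modules\<close>

locale presheaf_on =
  fixes T :: "'p topology" and F :: "('p, ('x, 'e) partial_object_scheme, 'x) presheaf"
  assumes presheaf: "is_presheaf T F"
begin

lemma res_closed [simp, intro]:
  "\<lbrakk>openin T U; openin T V; V \<subseteq> U; x \<in> Sec F U\<rbrakk> \<Longrightarrow> res F U V x \<in> Sec F V"
  using presheaf by (simp add: is_presheaf_def Pi_iff)

lemma res_id [simp]: "\<lbrakk>openin T U; x \<in> Sec F U\<rbrakk> \<Longrightarrow> res F U U x = x"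
  using presheaf by (simp add: is_presheaf_def Pi_iff)

lemma res_res [simp]:
  "\<lbrakk>openin T U; openin T V; openin T W; W \<subseteq> V; V \<subseteq> U; x \<in> Sec F U\<rbrakk>
    \<Longrightarrow> res F V W (res F U V x) = res F U W x"
  using presheaf by (simp add: is_presheaf_def Pi_iff)

lemma res_eq_mono:
  assumes "openin T U" "openin T U'" "openin T V" "openin T W" "W \<subseteq> V" "V \<subseteq> U" "V \<subseteq> U'"
    "x \<in> Sec F U" "y \<in> Sec F U'" "res F U V x = res F U' V y"
  shows "res F U W x = res F U' W y"
  by (metis res_res assms)

end

locale sheaf_on = presheaf_on T F
  for T :: "'p topology" and F :: "('p, ('x, 'e) partial_object_scheme, 'x) presheaf" +
  assumes sheaf: "is_sheaf T F"
begin

lemma ex1_glue: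
  assumes "\<And>U. U \<in> \<U> \<Longrightarrow> openin T U" "\<And>U. U \<in> \<U> \<Longrightarrow> s U \<in> Sec F U"
    "\<And>U V. U \<in> \<U> \<Longrightarrow> V \<in> \<U> \<Longrightarrow> res F U (U \<inter> V) (s U) = res F V (U \<inter> V) (s V)"
  shows "\<exists>!x. x \<in> Sec F (\<Union>\<U>) \<and> (\<forall>U\<in>\<U>. res F (\<Union>\<U>) U x = s U)"
proof -
  have "\<forall>\<U> s. (\<forall>U\<in>\<U>. openin T U) \<and> (\<forall>U\<in>\<U>. s U \<in> Sec F U) \<and>
      (\<forall>U\<in>\<U>. \<forall>V\<in>\<U>. res F U (U \<inter> V) (s U) = res F V (U \<inter> V) (s V)) \<longrightarrow>
      (\<exists>!x. x \<in> Sec F (\<Union>\<U>) \<and> (\<forall>U\<in>\<U>. res F (\<Union>\<U>) U x = s U))"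
    by (rule sheaf[unfolded is_sheaf_def, THEN conjunct2])
  from this[rule_format, of \<U> s] show ?thesis using assms by blast
qed

lemma local_eq:
  assumes U: "openin T U" and x: "x \<in> Sec F U" and y: "y \<in> Sec F U"
    and loc: "\<And>p. p \<in> U \<Longrightarrow> \<exists>W. openin T W \<and> p \<in> W \<and> W \<subseteq> U \<and> res F U W x = res F U W y"
  shows "x = y"
proof -
  \<comment> \<open>The cover consists of all open sets on which the two sections agree, so no
    neighbourhoods have to be chosen.\<close>
  define \<U> where "\<U> = {W. openin T W \<and> W \<subseteq> U \<and> res F U W x = res F U W y}"
  have un: "\<Union>\<U> = U"
  proof
    show "U \<subseteq> \<Union>\<U>"
    proof
      fix p assume "p \<in> U"
      from loc[OF this] show "p \<in> \<Union>\<U>" unfolding \<U>_def by blast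
    qed
  qed (auto simp: \<U>_def)
  have "\<exists>!z. z \<in> Sec F (\<Union>\<U>) \<and> (\<forall>W\<in>\<U>. res F (\<Union>\<U>) W z = res F U W x)"
  proof (rule ex1_glue)
    fix V W assume VW: "V \<in> \<U>" "W \<in> \<U>"
    then have "openin T V" "openin T W" "V \<subseteq> U" "W \<subseteq> U" by (auto simp: \<U>_def)
    then show "res F V (V \<inter> W) (res F U V x) = res F W (V \<inter> W) (res F U W x)"
      using U x by (simp add: openin_Int)
  next
    fix V assume "V \<in> \<U>"
    then have V: "openin T V" "V \<subseteq> U" by (simp_all add: \<U>_def)
    then show "openin T V" "res F U V x \<in> Sec F V" using U x by blast+
  qed
  moreover have "\<forall>W\<in>\<U>. res F U W y = res F U W x" by (simp add: \<U>_def)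
  ultimately show ?thesis unfolding un using x y by (metis (no_types, lifting))
qed

text \<open>The local sections are described by a predicate \<open>Q\<close> instead of an indexed
  family, which suits constructions that only characterise them. Compatibility over a single set
  shows that \<open>Q\<close> determines the section there, so the choice of \<open>s W\<close> is
  harmless.\<close>

lemma glue:
  assumes U: "openin T U"
    and ex: "\<And>p. p \<in> U \<Longrightarrow> \<exists>W y. openin T W \<and> p \<in> W \<and> W \<subseteq> U \<and> y \<in> Sec F W \<and> Q W y"
    and compat: "\<And>V x W y. \<lbrakk>openin T V; V \<subseteq> U; x \<in> Sec F V; Q V x;
      openin T W; W \<subseteq> U; y \<in> Sec F W; Q W y\<rbrakk>
      \<Longrightarrow> res F V (V \<inter> W) x = res F W (V \<inter> W) y"
  shows "\<exists>x\<in>Sec F U. \<forall>W y. openin T W \<and> W \<subseteq> U \<and> y \<in> Sec F W \<and> Q W y \<longrightarrow>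
    res F U W x = y"
proof -
  define \<U> where "\<U> = {W. openin T W \<and> W \<subseteq> U \<and> (\<exists>y\<in>Sec F W. Q W y)}"
  define s where "s W = (SOME y. y \<in> Sec F W \<and> Q W y)" for W
  have s: "s W \<in> Sec F W \<and> Q W (s W)" if "W \<in> \<U>" for W
    unfolding s_def by (rule someI_ex) (use that in \<open>auto simp: \<U>_def\<close>)
  have un: "\<Union>\<U> = U"
  proof
    show "U \<subseteq> \<Union>\<U>"
    proof
      fix p assume "p \<in> U"
      from ex[OF this] show "p \<in> \<Union>\<U>" unfolding \<U>_def by blast
    qed
  qed (auto simp: \<U>_def)
  have "\<exists>!z. z \<in> Sec F (\<Union>\<U>) \<and> (\<forall>W\<in>\<U>. res F (\<Union>\<U>) W z = s W)"
  proof (rule ex1_glue)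
    fix V W assume VW: "V \<in> \<U>" "W \<in> \<U>"
    then have "openin T V" "openin T W" "V \<subseteq> U" "W \<subseteq> U" by (simp_all add: \<U>_def)
    then show "res F V (V \<inter> W) (s V) = res F W (V \<inter> W) (s W)"
      using s[OF VW(1)] s[OF VW(2)] compat[of V "s V" W "s W"] by simp
  next
    fix V assume V: "V \<in> \<U>"
    then show "openin T V" by (simp add: \<U>_def)
    show "s V \<in> Sec F V" using s[OF V] by simp
  qed
  then obtain z where z: "z \<in> Sec F U" "\<And>W. W \<in> \<U> \<Longrightarrow> res F U W z = s W"
    unfolding un by blast
  have "res F U W z = y" if W: "openin T W" "W \<subseteq> U" "y \<in> Sec F W" "Q W y" for W y
  proof -
    have "W \<in> \<U>" using W by (auto simp: \<U>_def)
    then have "res F U W z = s W" "s W \<in> Sec F W" "Q W (s W)" using z s by auto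
    moreover have "res F W (W \<inter> W) (s W) = res F W (W \<inter> W) y"
      using compat[OF W(1,2) calculation(2,3) W(1,2,3,4)] .
    ultimately show ?thesis using W by simp
  qed
  with z(1) show ?thesis by (intro bexI[of _ z]) simp_all
qed

end

lemma sheaf_onI: "is_sheaf T F \<Longrightarrow> sheaf_on T F"
  unfolding sheaf_on_def presheaf_on_def sheaf_on_axioms_def
  by (rule conjI, unfold is_sheaf_def, erule conjunct1, assumption)

locale ring_sheaf_on = sheaf_on T A for T :: "'p topology" and A :: "('p, 'a) ring_presheaf" +
  assumes ring_sheaf: "ring_sheaf T A"
begin

lemma cring_sect: "openin T U \<Longrightarrow> cring (sect A U)"
  using ring_sheaf by (simp add: ring_sheaf_def)

lemma res_ring_hom: "\<lbrakk>openin T U; openin T V; V \<subseteq> U\<rbrakk> \<Longrightarrow> res A U V \<in> ring_hom (sect A U) (sect A V)"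
  using ring_sheaf by (simp add: ring_sheaf_def)

lemma res_mult [simp]:
  "\<lbrakk>openin T U; openin T V; V \<subseteq> U; x \<in> Sec A U; y \<in> Sec A U\<rbrakk>
    \<Longrightarrow> res A U V (x \<otimes>\<^bsub>sect A U\<^esub> y) = res A U V x \<otimes>\<^bsub>sect A V\<^esub> res A U V y"
  by (rule ring_hom_mult[OF res_ring_hom])

lemma res_add [simp]:
  "\<lbrakk>openin T U; openin T V; V \<subseteq> U; x \<in> Sec A U; y \<in> Sec A U\<rbrakk>
    \<Longrightarrow> res A U V (x \<oplus>\<^bsub>sect A U\<^esub> y) = res A U V x \<oplus>\<^bsub>sect A V\<^esub> res A U V y"
  by (rule ring_hom_add[OF res_ring_hom])

lemma res_one [simp]:
  "\<lbrakk>openin T U; openin T V; V \<subseteq> U\<rbrakk> \<Longrightarrow> res A U V \<one>\<^bsub>sect A U\<^esub> = \<one>\<^bsub>sect A V\<^esub>"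
  by (rule ring_hom_one[OF res_ring_hom])

lemma res_zero [simp]:
  "\<lbrakk>openin T U; openin T V; V \<subseteq> U\<rbrakk> \<Longrightarrow> res A U V \<zero>\<^bsub>sect A U\<^esub> = \<zero>\<^bsub>sect A V\<^esub>"
  by (rule ring_hom_zero[OF res_ring_hom cring.axioms(1) cring.axioms(1)]) (auto intro: cring_sect)

lemma sect_simps [simp, intro]:
  assumes "openin T U"
  shows "\<one>\<^bsub>sect A U\<^esub> \<in> Sec A U" "\<zero>\<^bsub>sect A U\<^esub> \<in> Sec A U"
    "\<lbrakk>x \<in> Sec A U; y \<in> Sec A U\<rbrakk> \<Longrightarrow> x \<otimes>\<^bsub>sect A U\<^esub> y \<in> Sec A U"
    "\<lbrakk>x \<in> Sec A U; y \<in> Sec A U\<rbrakk> \<Longrightarrow> x \<oplus>\<^bsub>sect A U\<^esub> y \<in> Sec A U"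
proof -
  interpret cring "sect A U" by (rule cring_sect[OF assms])
  show "\<one>\<^bsub>sect A U\<^esub> \<in> Sec A U" "\<zero>\<^bsub>sect A U\<^esub> \<in> Sec A U"
    "\<lbrakk>x \<in> Sec A U; y \<in> Sec A U\<rbrakk> \<Longrightarrow> x \<otimes>\<^bsub>sect A U\<^esub> y \<in> Sec A U"
    "\<lbrakk>x \<in> Sec A U; y \<in> Sec A U\<rbrakk> \<Longrightarrow> x \<oplus>\<^bsub>sect A U\<^esub> y \<in> Sec A U"
    by auto
qed

end

lemma ring_sheaf_onI: "ring_sheaf T A \<Longrightarrow> ring_sheaf_on T A"
  by (simp add: ring_sheaf_on_def ring_sheaf_on_axioms_def sheaf_onI ring_sheaf_def)

locale module_sheaf_on = ring_sheaf_on T A + F: sheaf_on T F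
  for T :: "'p topology" and A :: "('p, 'a) ring_presheaf" and F :: "('p, 'a, 'm) mod_presheaf" +
  assumes mod_sheaf: "mod_sheaf T A F"
begin

lemma module_sect: "openin T U \<Longrightarrow> Module.module (sect A U) (sect F U)"
  using mod_sheaf by (simp add: mod_sheaf_def)

lemma F_res_add [simp]:
  "\<lbrakk>openin T U; openin T V; V \<subseteq> U; x \<in> Sec F U; y \<in> Sec F U\<rbrakk>
    \<Longrightarrow> res F U V (x \<oplus>\<^bsub>sect F U\<^esub> y) = res F U V x \<oplus>\<^bsub>sect F V\<^esub> res F U V y"
  using mod_sheaf by (simp add: mod_sheaf_def)

lemma F_res_smult [simp]:
  "\<lbrakk>openin T U; openin T V; V \<subseteq> U; a \<in> Sec A U; x \<in> Sec F U\<rbrakk>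
    \<Longrightarrow> res F U V (a \<odot>\<^bsub>sect F U\<^esub> x) = res A U V a \<odot>\<^bsub>sect F V\<^esub> res F U V x"
  using mod_sheaf by (simp add: mod_sheaf_def)

lemma F_sect_simps [simp, intro]:
  assumes "openin T U"
  shows "\<zero>\<^bsub>sect F U\<^esub> \<in> Sec F U"
    "\<lbrakk>a \<in> Sec A U; y \<in> Sec F U\<rbrakk> \<Longrightarrow> a \<odot>\<^bsub>sect F U\<^esub> y \<in> Sec F U"
    "\<lbrakk>x \<in> Sec F U; y \<in> Sec F U\<rbrakk> \<Longrightarrow> x \<oplus>\<^bsub>sect F U\<^esub> y \<in> Sec F U"
    "x \<in> Sec F U \<Longrightarrow> \<ominus>\<^bsub>sect F U\<^esub> x \<in> Sec F U"
proof -
  interpret module "sect A U" "sect F U" by (rule module_sect[OF assms])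
  show "\<zero>\<^bsub>sect F U\<^esub> \<in> Sec F U"
    "\<lbrakk>a \<in> Sec A U; y \<in> Sec F U\<rbrakk> \<Longrightarrow> a \<odot>\<^bsub>sect F U\<^esub> y \<in> Sec F U"
    "\<lbrakk>x \<in> Sec F U; y \<in> Sec F U\<rbrakk> \<Longrightarrow> x \<oplus>\<^bsub>sect F U\<^esub> y \<in> Sec F U"
    "x \<in> Sec F U \<Longrightarrow> \<ominus>\<^bsub>sect F U\<^esub> x \<in> Sec F U"
    by auto
qed

lemma F_res_group_hom:
  assumes "openin T U" "openin T V" "V \<subseteq> U"
  shows "abelian_group_hom (sect F U) (sect F V) (res F U V)"
proof -
  interpret U: module "sect A U" "sect F U" by (rule module_sect) fact
  interpret V: module "sect A V" "sect F V" by (rule module_sect) fact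
  show ?thesis
    by (intro abelian_group_homI U.M.abelian_group_axioms V.M.abelian_group_axioms
        group_hom.intro U.M.a_group V.M.a_group group_hom_axioms.intro homI)
      (use assms in auto)
qed

lemma F_res_zero [simp]:
  "\<lbrakk>openin T U; openin T V; V \<subseteq> U\<rbrakk> \<Longrightarrow> res F U V \<zero>\<^bsub>sect F U\<^esub> = \<zero>\<^bsub>sect F V\<^esub>"
  by (rule abelian_group_hom.hom_zero[OF F_res_group_hom])

lemma F_res_minus [simp]:
  "\<lbrakk>openin T U; openin T V; V \<subseteq> U; x \<in> Sec F U\<rbrakk>
    \<Longrightarrow> res F U V (\<ominus>\<^bsub>sect F U\<^esub> x) = \<ominus>\<^bsub>sect F V\<^esub> res F U V x"
  by (rule abelian_group_hom.hom_a_inv[OF F_res_group_hom])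

end

lemma module_sheaf_onI: "\<lbrakk>ring_sheaf T A; mod_sheaf T A F\<rbrakk> \<Longrightarrow> module_sheaf_on T A F"
  by (simp add: module_sheaf_on_def module_sheaf_on_axioms_def ring_sheaf_onI sheaf_onI mod_sheaf_def)

lemma regular_module_module: "cring R \<Longrightarrow> Module.module R (regular_module R)"
proof -
  assume "cring R"
  then interpret cring R .
  show ?thesis
  proof (rule moduleI)
    show "abelian_group (regular_module R)"
    proof (rule abelian_groupI)
      fix x assume "x \<in> carrier (regular_module R)"
      then show "\<exists>y\<in>carrier (regular_module R). y \<oplus>\<^bsub>regular_module R\<^esub> x = \<zero>\<^bsub>regular_module R\<^esub>"
        by (intro bexI[of _ "\<ominus>\<^bsub>R\<^esub> x"]) (auto simp: regular_module_def l_neg)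
    qed (simp_all add: regular_module_def a_ac)
  qed (simp_all add: regular_module_def l_distr r_distr m_assoc is_cring)
qed

text \<open>An ideal maximal among those containing \<open>I\<close> and missing every power of
  \<open>f\<close> is prime, and Zorn's lemma supplies one. With \<open>f = \<one>\<close> this
  gives a prime over a proper ideal; the general case gives points of a basic open set.\<close>

lemma (in cring) prime_avoiding_powers:
  assumes I: "ideal I R" and f: "f \<in> carrier R" and pow: "\<And>n::nat. f [^] n \<notin> I"
  obtains P where "primeideal P R" "I \<subseteq> P" "f \<notin> P"
proof -
  define S where "S = {J. ideal J R \<and> I \<subseteq> J \<and> (\<forall>n::nat. f [^] n \<notin> J)}"
  have "\<exists>P\<in>S. \<forall>J\<in>S. P \<subseteq> J \<longrightarrow> J = P"
  proof (rule subset_Zorn_nonempty)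
    have "I \<in> S" using I pow by (simp add: S_def)
    then show "S \<noteq> {}" by blast
    fix C assume "C \<noteq> {}" and C: "subset.chain S C"
    then have CS: "C \<subseteq> S" by (simp add: subset.chain_def)
    have "ideal (\<Union>C) R"
    proof -
      have "subset.chain {I. ideal I R} C" using C unfolding S_def subset.chain_def by blast
      then show ?thesis using chain_Union_is_ideal[of C] \<open>C \<noteq> {}\<close> by simp
    qed
    moreover obtain J where "J \<in> C" using \<open>C \<noteq> {}\<close> by blast
    moreover have "I \<subseteq> J'" "f [^] n \<notin> J'" if "J' \<in> C" for J' and n :: nat
      using that CS unfolding S_def by auto
    ultimately show "\<Union>C \<in> S" unfolding S_def by (auto simp del: UnionE)
  qed
  then obtain P where PS: "P \<in> S" and maxS: "\<And>J. J \<in> S \<Longrightarrow> P \<subseteq> J \<Longrightarrow> J = P" by metis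
  then have P: "ideal P R" "I \<subseteq> P" "\<And>n::nat. f [^] n \<notin> P" by (simp_all add: S_def)
  interpret P: ideal P R by (rule P(1))
  \<comment> \<open>By maximality, adjoining an element outside \<open>P\<close> brings in a power
    of \<open>f\<close>.\<close>
  have ext: "\<exists>n::nat. \<exists>p\<in>P. \<exists>r\<in>carrier R. f [^] n = p \<oplus> r \<otimes> a" if a: "a \<in> carrier R" "a \<notin> P" for a
  proof -
    have J: "ideal (P <+> PIdl a) R" by (rule add_ideals[OF P(1) cgenideal_ideal[OF a(1)]])
    have sub: "P \<subseteq> P <+> PIdl a" and mem: "a \<in> P <+> PIdl a"
    proof -
      have zero: "\<zero> \<in> PIdl a" using a by (auto simp: cgenideal_def intro!: exI[of _ \<zero>])
      show "P \<subseteq> P <+> PIdl a"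
      proof
        fix x assume x: "x \<in> P"
        then have "x = x \<oplus> \<zero>" using P.Icarr by simp
        then show "x \<in> P <+> PIdl a" unfolding set_add_def' using x zero by blast
      qed
      have "a = \<zero> \<oplus> a" using a by simp
      then show "a \<in> P <+> PIdl a"
        unfolding set_add_def' using P.zero_closed cgenideal_self[OF a(1)] by blast
    qed
    have "\<exists>n::nat. f [^] n \<in> P <+> PIdl a"
    proof (rule ccontr)
      assume "\<not> ?thesis"
      then have "P <+> PIdl a \<in> S" using J P(2) sub by (simp add: S_def subset_trans[OF P(2)])
      then show False using maxS[OF _ sub] mem a(2) by metis
    qed
    then show ?thesis unfolding set_add_def' cgenideal_def by blast
  qed
  have "primeideal P R"
  proof (rule primeidealI[OF P(1) is_cring])
    show "carrier R \<noteq> P" using P(3)[of 0] by auto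
    fix a b assume ab: "a \<in> carrier R" "b \<in> carrier R" "a \<otimes> b \<in> P"
    show "a \<in> P \<or> b \<in> P"
    proof (rule ccontr)
      assume "\<not> ?thesis"
      then obtain n m :: nat and p q r s where
        n: "p \<in> P" "r \<in> carrier R" "f [^] n = p \<oplus> r \<otimes> a" and
        m: "q \<in> P" "s \<in> carrier R" "f [^] m = q \<oplus> s \<otimes> b"
        using ext[OF ab(1)] ext[OF ab(2)] by blast
      have c: "p \<in> carrier R" "q \<in> carrier R" using n m P.Icarr by auto
      \<comment> \<open>If both factors were outside \<open>P\<close>, the product of the two
        expressions would put \<open>f [^] (n + m)\<close> into \<open>P\<close>, because every term
        has a factor in \<open>P\<close> or the factor \<open>a \<otimes> b\<close>.\<close>
      have "f [^] (n + m) = (p \<oplus> r \<otimes> a) \<otimes> (q \<oplus> s \<otimes> b)"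
        using nat_pow_mult[OF f, of n m] n m by simp
      also have "\<dots> = p \<otimes> (q \<oplus> s \<otimes> b) \<oplus> ((r \<otimes> a) \<otimes> q \<oplus> (r \<otimes> a) \<otimes> (s \<otimes> b))"
        using n m ab c by (simp add: l_distr r_distr a_ac)
      also have "(r \<otimes> a) \<otimes> (s \<otimes> b) = (r \<otimes> s) \<otimes> (a \<otimes> b)"
        using n m ab by (simp add: m_ac)
      also have "p \<otimes> (q \<oplus> s \<otimes> b) \<oplus> ((r \<otimes> a) \<otimes> q \<oplus> (r \<otimes> s) \<otimes> (a \<otimes> b)) \<in> P"
        using n m ab c by (simp add: P.a_closed P.I_r_closed P.I_l_closed)
      finally show False using P(3) by blast
    qed
  qed
  moreover have "f \<notin> P" using P(3)[of 1] f by simp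
  ultimately show ?thesis using P(2) that by blast
qed

text \<open>Negatives come from multiplication by \<open>\<ominus> \<one>\<close>, so closure under
  sums and under multiples is all that has to be checked, besides containing zero.\<close>

lemma (in cring) cring_idealI:
  assumes "I \<subseteq> carrier R" "\<zero> \<in> I" "\<And>x y. \<lbrakk>x \<in> I; y \<in> I\<rbrakk> \<Longrightarrow> x \<oplus> y \<in> I"
    and mult: "\<And>r x. \<lbrakk>r \<in> carrier R; x \<in> I\<rbrakk> \<Longrightarrow> r \<otimes> x \<in> I"
  shows "ideal I R"
proof (rule idealI)
  show "ring R" by (rule ring_axioms)
  show "subgroup I (add_monoid R)"
  proof (rule subgroup.intro)
    fix x assume x: "x \<in> I"
    then have "\<ominus> x = (\<ominus> \<one>) \<otimes> x" using assms(1) by (simp add: l_minus subset_iff)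
    then show "inv\<^bsub>add_monoid R\<^esub> x \<in> I" using mult[of "\<ominus> \<one>" x] x by (simp add: a_inv_def)
  qed (use assms in auto)
  fix a x assume "a \<in> I" "x \<in> carrier R"
  then show "x \<otimes> a \<in> I" "a \<otimes> x \<in> I"
    using mult[of x a] assms(1) m_comm[of x a] by (auto simp: subset_iff)
qed

section \<open>Affine open sets described by their units\<close>

text \<open>Says that the germ of \<open>g\<close> at \<open>p\<close> is invertible. Spelling this
  with an inverse over a neighbourhood keeps rings of germs out of the argument.\<close>

definition unit_at ::
  "'p topology \<Rightarrow> ('p, 'a) ring_presheaf \<Rightarrow> 'p set \<Rightarrow> 'a \<Rightarrow> 'p \<Rightarrow> bool" where
  "unit_at T A U g p \<longleftrightarrow> (\<exists>W. openin T W \<and> p \<in> W \<and> W \<subseteq> U \<and>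
    (\<exists>b\<in>Sec A W. b \<otimes>\<^bsub>sect A W\<^esub> res A U W g = \<one>\<^bsub>sect A W\<^esub>))"

text \<open>The inverse of \<open>g\<close> exists only over some neighbourhood of \<open>p\<close>,
  so the cancellation is obtained after shrinking \<open>W\<close>.\<close>

lemma (in module_sheaf_on) unit_at_cancel:
  assumes U: "openin T U" and V: "openin T V" "V \<subseteq> U" and g: "g \<in> Sec A U"
    and p: "unit_at T A U g p" and W: "openin T W" "p \<in> W" "W \<subseteq> V"
    and x: "x \<in> Sec F V" and y: "y \<in> Sec F V"
    and eq: "res A U W g \<odot>\<^bsub>sect F W\<^esub> res F V W x = res A U W g \<odot>\<^bsub>sect F W\<^esub> res F V W y"
  obtains W' where "openin T W'" "p \<in> W'" "W' \<subseteq> W" "res F V W' x = res F V W' y"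
proof -
  obtain W0 b where W0: "openin T W0" "p \<in> W0" "W0 \<subseteq> U" "b \<in> Sec A W0"
    "b \<otimes>\<^bsub>sect A W0\<^esub> res A U W0 g = \<one>\<^bsub>sect A W0\<^esub>" using p unfolding unit_at_def by blast
  define W' where "W' = W \<inter> W0"
  have W': "openin T W'" "p \<in> W'" "W' \<subseteq> W" "W' \<subseteq> W0" "W' \<subseteq> U" "W' \<subseteq> V" "W \<subseteq> U"
    using W W0 V by (auto simp: W'_def)
  interpret module "sect A W'" "sect F W'" by (rule module_sect) fact
  have b: "res A W0 W' b \<otimes>\<^bsub>sect A W'\<^esub> res A U W' g = \<one>\<^bsub>sect A W'\<^esub>"
    using arg_cong[OF W0(5), of "res A W0 W'"] W0(1-4) W' U g by simp
  have eq': "res A U W' g \<odot>\<^bsub>sect F W'\<^esub> res F V W' x = res A U W' g \<odot>\<^bsub>sect F W'\<^esub> res F V W' y"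
    using arg_cong[OF eq, of "res F W W'"] W W' U V g x y by simp
  have "res F V W' z = res A W0 W' b \<odot>\<^bsub>sect F W'\<^esub> (res A U W' g \<odot>\<^bsub>sect F W'\<^esub> res F V W' z)"
    if "z \<in> Sec F V" for z
    using that W0 W' U V g smult_assoc1[of "res A W0 W' b" "res A U W' g" "res F V W' z"] b by simp
  then have "res F V W' x = res F V W' y" using x y eq' by metis
  then show ?thesis using that W' by blast
qed

text \<open>Cancellation at each point gives local equality, and the sheaf property makes it
  equality over all of \<open>V\<close>.\<close>

lemma (in module_sheaf_on) units_cancel:
  assumes U: "openin T U" and V: "openin T V" "V \<subseteq> U" and g: "g \<in> Sec A U"
    and units: "\<And>p. p \<in> V \<Longrightarrow> unit_at T A U g p"
    and x: "x \<in> Sec F V" and y: "y \<in> Sec F V"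
    and eq: "res A U V g \<odot>\<^bsub>sect F V\<^esub> x = res A U V g \<odot>\<^bsub>sect F V\<^esub> y"
  shows "x = y"
proof (rule F.local_eq[OF V(1) x y])
  fix p assume p: "p \<in> V"
  have "res A U V g \<odot>\<^bsub>sect F V\<^esub> res F V V x = res A U V g \<odot>\<^bsub>sect F V\<^esub> res F V V y"
    using eq x y V by simp
  from unit_at_cancel[OF U V g units[OF p] V(1) p subset_refl x y this]
  show "\<exists>W. openin T W \<and> p \<in> W \<and> W \<subseteq> V \<and> res F V W x = res F V W y" by metis
qed

text \<open>
  \<open>U\<close> is the spectrum of \<open>R\<close> via \<open>\<phi>\<close>. The topology is tied to the ring by \<open>unit_iff\<close>: the basic open
  set of \<open>r\<close> is the set of points near which the section \<open>\<rho> r\<close> is invertible. No comparison of sheaves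
  is part of the data, which is what makes the condition easy to check for an extension.
\<close>

locale affine_presentation = ring_sheaf_on T A + R: cring R
  for T :: "'p topology" and A :: "('p, 'a) ring_presheaf" and U :: "'p set"
    and R :: "'r ring" (structure) and \<phi> :: "'p \<Rightarrow> 'r set" and \<rho> :: "'r \<Rightarrow> 'a" +
  assumes open_U: "openin T U"
    and bij: "bij_betw \<phi> U (Spec R)"
    and open_D: "r \<in> carrier R \<Longrightarrow> openin T {q \<in> U. r \<notin> \<phi> q}"
    and basis: "\<lbrakk>openin T V; V \<subseteq> U; p \<in> V\<rbrakk>
      \<Longrightarrow> \<exists>r\<in>carrier R. r \<notin> \<phi> p \<and> {q \<in> U. r \<notin> \<phi> q} \<subseteq> V"
    and hom: "\<rho> \<in> ring_hom R (sect A U)"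
    and unit_iff: "\<lbrakk>r \<in> carrier R; p \<in> U\<rbrakk> \<Longrightarrow> unit_at T A U (\<rho> r) p \<longleftrightarrow> r \<notin> \<phi> p"
begin

abbreviation D :: "'r \<Rightarrow> 'p set" where "D r \<equiv> {q \<in> U. r \<notin> \<phi> q}"

lemma prime: "p \<in> U \<Longrightarrow> primeideal (\<phi> p) R"
  using bij_betwE[OF bij] by (auto simp: Spec_def)

lemma D_one: "D \<one> = U"
proof -
  have "\<one> \<notin> \<phi> p" if "p \<in> U" for p
  proof -
    interpret primeideal "\<phi> p" R by (rule prime[OF that])
    show ?thesis using I_notcarr one_imp_carrier by blast
  qed
  then show ?thesis by blast
qed

lemma not_mem_mult:
  "\<lbrakk>p \<in> U; r \<in> carrier R; s \<in> carrier R\<rbrakk> \<Longrightarrow> r \<otimes> s \<notin> \<phi> p \<longleftrightarrow> r \<notin> \<phi> p \<and> s \<notin> \<phi> p"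
proof -
  assume p: "p \<in> U" "r \<in> carrier R" "s \<in> carrier R"
  interpret primeideal "\<phi> p" R by (rule prime) fact
  show ?thesis using I_prime[of r s] p I_l_closed[of s r] I_r_closed[of r s] by blast
qed

lemma D_mult: "\<lbrakk>r \<in> carrier R; s \<in> carrier R\<rbrakk> \<Longrightarrow> D (r \<otimes> s) = D r \<inter> D s"
  using not_mem_mult by blast

lemma D_add: "\<lbrakk>r \<in> carrier R; s \<in> carrier R\<rbrakk> \<Longrightarrow> D (r \<oplus> s) \<subseteq> D r \<union> D s"
proof
  fix p assume p: "p \<in> D (r \<oplus> s)"
  then interpret primeideal "\<phi> p" R by (intro prime) simp
  show "p \<in> D r \<union> D s" using p a_closed[of r s] by blast
qed

lemma not_mem_pow: "\<lbrakk>p \<in> U; r \<in> carrier R; r \<notin> \<phi> p\<rbrakk> \<Longrightarrow> r [^] (n::nat) \<notin> \<phi> p"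
proof (induction n)
  case 0
  then show ?case using D_one by auto
next
  case (Suc n)
  then show ?case using not_mem_mult[of p "r [^] n" r] by simp
qed

text \<open>Quasi-compactness of the spectrum in ideal form: a proper ideal lies in a prime, every
  prime is \<open>\<phi> p\<close> for some point \<open>p\<close>, and each \<open>\<phi> p\<close>
  misses an element of \<open>J\<close>. It drives both local-to-global arguments on sections over
  \<open>U\<close>.\<close>

lemma ideal_eq_carrier:
  assumes J: "ideal J R" and ex: "\<And>p. p \<in> U \<Longrightarrow> \<exists>k\<in>J. k \<notin> \<phi> p"
  shows "\<one> \<in> J"
proof (rule ccontr)
  assume "\<one> \<notin> J"
  then obtain P where P: "primeideal P R" "J \<subseteq> P"
    using R.prime_avoiding_powers[OF J R.one_closed] R.nat_pow_one by metis
  then obtain p where "p \<in> U" "P = \<phi> p"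
    using bij unfolding Spec_def bij_betw_def by blast
  then show False using ex P(2) by blast
qed

lemma rho_closed [simp]: "r \<in> carrier R \<Longrightarrow> \<rho> r \<in> Sec A U"
  using hom by (rule ring_hom_closed)

lemma rho_mult [simp]:
  "\<lbrakk>r \<in> carrier R; s \<in> carrier R\<rbrakk> \<Longrightarrow> \<rho> (r \<otimes> s) = \<rho> r \<otimes>\<^bsub>sect A U\<^esub> \<rho> s"
  using hom by (rule ring_hom_mult)

lemma rho_add [simp]:
  "\<lbrakk>r \<in> carrier R; s \<in> carrier R\<rbrakk> \<Longrightarrow> \<rho> (r \<oplus> s) = \<rho> r \<oplus>\<^bsub>sect A U\<^esub> \<rho> s"
  using hom by (rule ring_hom_add)

lemma rho_one [simp]: "\<rho> \<one> = \<one>\<^bsub>sect A U\<^esub>"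
  using hom by (rule ring_hom_one)

lemma rho_zero [simp]: "\<rho> \<zero> = \<zero>\<^bsub>sect A U\<^esub>"
  using ring_hom_zero[OF hom R.ring_axioms cring.axioms(1)[OF cring_sect[OF open_U]]] .

end

text \<open>
  The last two conditions say that the stalk of \<open>F\<close> at \<open>p\<close> is the localisation of \<open>M\<close> at \<open>\<phi> p\<close>.
\<close>

locale module_presentation = affine_presentation T A U R \<phi> \<rho> + module_sheaf_on T A F + M: module R M
  for T :: "'p topology" and A :: "('p, 'a) ring_presheaf" and U :: "'p set"
    and R :: "'r ring" (structure) and \<phi> :: "'p \<Rightarrow> 'r set" and \<rho> :: "'r \<Rightarrow> 'a"
    and F :: "('p, 'a, 'm) mod_presheaf" and M :: "('r, 'n) module" and \<tau> :: "'n \<Rightarrow> 'm" +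
  assumes tau_closed [simp]: "m \<in> carrier M \<Longrightarrow> \<tau> m \<in> Sec F U"
    and tau_add [simp]: "\<lbrakk>m \<in> carrier M; n \<in> carrier M\<rbrakk> \<Longrightarrow> \<tau> (m \<oplus>\<^bsub>M\<^esub> n) = \<tau> m \<oplus>\<^bsub>sect F U\<^esub> \<tau> n"
    and tau_smult [simp]: "\<lbrakk>r \<in> carrier R; m \<in> carrier M\<rbrakk> \<Longrightarrow> \<tau> (r \<odot>\<^bsub>M\<^esub> m) = \<rho> r \<odot>\<^bsub>sect F U\<^esub> \<tau> m"
    and fractions: "\<lbrakk>openin T V; V \<subseteq> U; y \<in> Sec F V; p \<in> V\<rbrakk>
      \<Longrightarrow> \<exists>W m f. openin T W \<and> p \<in> W \<and> W \<subseteq> V \<and> m \<in> carrier M \<and> f \<in> carrier R \<and> f \<notin> \<phi> p \<and>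
        res A U W (\<rho> f) \<odot>\<^bsub>sect F W\<^esub> res F V W y = res F U W (\<tau> m)"
    and torsion: "\<lbrakk>m \<in> carrier M; openin T W; p \<in> W; W \<subseteq> U; res F U W (\<tau> m) = \<zero>\<^bsub>sect F W\<^esub>\<rbrakk>
      \<Longrightarrow> \<exists>u\<in>carrier R. u \<notin> \<phi> p \<and> u \<odot>\<^bsub>M\<^esub> m = \<zero>\<^bsub>M\<^esub>"
begin

section \<open>Sections of \<open>F\<close> over \<open>U\<close> as elements of
  \<open>M\<close>\<close>

sublocale FU: module "sect A U" "sect F U"
  by (rule module_sect[OF open_U])

lemma tau_zero [simp]: "\<tau> \<zero>\<^bsub>M\<^esub> = \<zero>\<^bsub>sect F U\<^esub>"
proof -
  have "\<tau> \<zero>\<^bsub>M\<^esub> \<oplus>\<^bsub>sect F U\<^esub> \<tau> \<zero>\<^bsub>M\<^esub> = \<tau> \<zero>\<^bsub>M\<^esub> \<oplus>\<^bsub>sect F U\<^esub> \<zero>\<^bsub>sect F U\<^esub>"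
    using tau_add[of "\<zero>\<^bsub>M\<^esub>" "\<zero>\<^bsub>M\<^esub>"] by simp
  then show ?thesis using FU.M.add.l_cancel by (metis FU.M.zero_closed M.M.zero_closed tau_closed)
qed

text \<open>If no power of \<open>f\<close> annihilated \<open>m\<close>, some prime over the
  annihilator would avoid \<open>f\<close>. It is a point of \<open>D f\<close>, near which
  \<open>m\<close> vanishes, and \<open>torsion\<close> then yields an annihilating element outside
  that prime.\<close>

lemma power_torsion:
  assumes m: "m \<in> carrier M" and f: "f \<in> carrier R" and z: "res F U (D f) (\<tau> m) = \<zero>\<^bsub>sect F (D f)\<^esub>"
  shows "\<exists>N::nat. (f [^] N) \<odot>\<^bsub>M\<^esub> m = \<zero>\<^bsub>M\<^esub>"
proof (rule ccontr)
  assume non: "\<not> ?thesis"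
  define I where "I = {r \<in> carrier R. r \<odot>\<^bsub>M\<^esub> m = \<zero>\<^bsub>M\<^esub>}"
  have I: "ideal I R"
    by (rule R.cring_idealI) (auto simp: I_def m M.smult_l_distr M.smult_assoc1)
  have "\<And>n::nat. f [^] n \<notin> I" using non by (simp add: I_def)
  then obtain P where P: "primeideal P R" "I \<subseteq> P" "f \<notin> P"
    using R.prime_avoiding_powers[OF I f] by blast
  then obtain p where p: "p \<in> U" "P = \<phi> p"
    using bij unfolding Spec_def bij_betw_def by blast
  obtain u where "u \<in> carrier R" "u \<notin> \<phi> p" "u \<odot>\<^bsub>M\<^esub> m = \<zero>\<^bsub>M\<^esub>"
    using torsion[OF m open_D[OF f] _ _ z, of p] p P(3) by blast
  then show False using P(2) p by (auto simp: I_def)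
qed

text \<open>Brings a local expression of \<open>y\<close> as a fraction into a form where the
  denominator \<open>k\<close> also defines the open set. The given denominator \<open>f\<close> and
  its numerator are both multiplied by some \<open>g\<close> with \<open>D g\<close> inside the
  neighbourhood.\<close>

lemma local_fraction:
  assumes y: "y \<in> Sec F U" and p: "p \<in> U"
  obtains k m where "k \<in> carrier R" "k \<notin> \<phi> p" "m \<in> carrier M"
    "res F U (D k) (\<rho> k \<odot>\<^bsub>sect F U\<^esub> y) = res F U (D k) (\<tau> m)"
proof -
  obtain W m f where W: "openin T W" "p \<in> W" "W \<subseteq> U" and m: "m \<in> carrier M"
    and f: "f \<in> carrier R" "f \<notin> \<phi> p"
    and eq: "res A U W (\<rho> f) \<odot>\<^bsub>sect F W\<^esub> res F U W y = res F U W (\<tau> m)"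
    using fractions[OF open_U subset_refl y p] by blast
  obtain g where g: "g \<in> carrier R" "g \<notin> \<phi> p" "D g \<subseteq> W"
    using basis[OF W(1,3,2)] by blast
  define k where "k = g \<otimes> f"
  have k: "k \<in> carrier R" "k \<notin> \<phi> p" "D k \<subseteq> W"
    using g f D_mult[OF g(1) f(1)] not_mem_mult[OF p g(1) f(1)] by (auto simp: k_def)
  have Dk: "openin T (D k)" "D k \<subseteq> U" using open_D[OF k(1)] by auto
  have eqW: "res F U W (\<rho> f \<odot>\<^bsub>sect F U\<^esub> y) = res F U W (\<tau> m)"
    using eq open_U W f y by simp
  have "res F U (D k) (\<rho> f \<odot>\<^bsub>sect F U\<^esub> y) = res F U (D k) (\<tau> m)"
    by (rule F.res_eq_mono[OF open_U open_U W(1) Dk(1) k(3) W(3) W(3) _ _ eqW])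
      (use f y m open_U in auto)
  then have "res F U (D k) (\<rho> g \<odot>\<^bsub>sect F U\<^esub> (\<rho> f \<odot>\<^bsub>sect F U\<^esub> y)) = res F U (D k) (\<rho> g \<odot>\<^bsub>sect F U\<^esub> \<tau> m)"
    using Dk open_U f g y m by simp
  then have "res F U (D k) (\<rho> k \<odot>\<^bsub>sect F U\<^esub> y) = res F U (D k) (\<tau> (g \<odot>\<^bsub>M\<^esub> m))"
    using f g y m by (simp add: k_def FU.smult_assoc1)
  then show ?thesis using that k g m by blast
qed

text \<open>The analogue of \<open>power_torsion\<close> for an arbitrary section, which is not yet
  known to come from \<open>M\<close>. An exponent is found over suitable basic open sets
  \<open>D r\<close>, and the elements \<open>r\<close> that admit one form an ideal.\<close>

lemma power_kills_section:
  assumes t: "t \<in> Sec F U" and f: "f \<in> carrier R"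
    and z: "res F U (D f) t = \<zero>\<^bsub>sect F (D f)\<^esub>"
  shows "\<exists>N::nat. \<rho> (f [^] N) \<odot>\<^bsub>sect F U\<^esub> t = \<zero>\<^bsub>sect F U\<^esub>"
proof -
  define Z where "Z r N \<longleftrightarrow> res F U (D r) (\<rho> (f [^] (N::nat)) \<odot>\<^bsub>sect F U\<^esub> t) = \<zero>\<^bsub>sect F (D r)\<^esub>" for r N
  define J where "J = {r \<in> carrier R. \<exists>N. Z r N}"
  have mono: "Z r N'" if "Z r N" "N \<le> N'" "r \<in> carrier R" for r N N'
  proof -
    interpret Dr: module "sect A (D r)" "sect F (D r)" by (rule module_sect[OF open_D[OF that(3)]])
    have "f [^] N' = f [^] (N' - N) \<otimes> f [^] N" using that f by (simp add: R.nat_pow_mult)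
    then have "\<rho> (f [^] N') \<odot>\<^bsub>sect F U\<^esub> t = \<rho> (f [^] (N' - N)) \<odot>\<^bsub>sect F U\<^esub> (\<rho> (f [^] N) \<odot>\<^bsub>sect F U\<^esub> t)"
      using f t by (simp add: FU.smult_assoc1)
    moreover have "D r \<subseteq> U" by blast
    ultimately show ?thesis
      using that f t open_U open_D[OF that(3)] unfolding Z_def
      by (simp del: F_res_smult add: F_res_smult[where a = "\<rho> (f [^] (N' - N))"])
  qed
  have shrink: "Z s N" if "Z r N" "r \<in> carrier R" "s \<in> carrier R" "D s \<subseteq> D r" for r s N
  proof -
    have "D r \<subseteq> U" by blast
    have "res F U (D s) (\<rho> (f [^] N) \<odot>\<^bsub>sect F U\<^esub> t)
        = res F (D r) (D s) (res F U (D r) (\<rho> (f [^] N) \<odot>\<^bsub>sect F U\<^esub> t))"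
      using F.res_res[OF open_U open_D[OF that(2)] open_D[OF that(3)] that(4) \<open>D r \<subseteq> U\<close>,
          of "\<rho> (f [^] N) \<odot>\<^bsub>sect F U\<^esub> t"] f t open_U by simp
    also have "\<dots> = \<zero>\<^bsub>sect F (D s)\<^esub>"
      using that F_res_zero[OF open_D[OF that(2)] open_D[OF that(3)] that(4)] unfolding Z_def by simp
    finally show ?thesis unfolding Z_def .
  qed
  have "ideal J R"
  proof (rule R.cring_idealI)
    show "J \<subseteq> carrier R" by (auto simp: J_def)
    show "r \<otimes> x \<in> J" if "r \<in> carrier R" "x \<in> J" for r x
      using that shrink[of x _ "r \<otimes> x"] D_mult[of r x] by (auto simp: J_def)
    \<comment> \<open>The basic open set of \<open>\<zero>\<close> is empty, and any two sections
      over the empty set agree because there is no point at which to compare them.\<close>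
    have D0: "D \<zero> = {}"
    proof -
      have "\<zero> \<in> \<phi> p" if "p \<in> U" for p
        using prime[OF that] by (simp add: additive_subgroup.zero_closed ideal.axioms(1) primeideal.axioms(1))
      then show ?thesis by blast
    qed
    have sub: "x = \<zero>\<^bsub>sect F {}\<^esub>" if "x \<in> Sec F {}" for x
      by (rule F.local_eq[of "{}"]) (use that in auto)
    have "Z \<zero> 0" unfolding Z_def D0 by (rule sub) (use t open_U in auto)
    then show "\<zero> \<in> J" by (auto simp: J_def)
    fix r s assume rs: "r \<in> J" "s \<in> J"
    then obtain N N' where N: "r \<in> carrier R" "s \<in> carrier R" "Z r N" "Z s N'" by (auto simp: J_def)
    \<comment> \<open>A common exponent serves over \<open>D r\<close> and over \<open>D s\<close>,
      which together contain \<open>D (r \<oplus> s)\<close>.\<close>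
    define K where "K = max N N'"
    have K: "Z r K" "Z s K" using mono N by (auto simp: K_def)
    have o: "openin T (D r)" "openin T (D s)" "openin T (D (r \<oplus> s))" using N open_D by auto
    have "Z (r \<oplus> s) K" unfolding Z_def
    proof (rule F.local_eq[OF o(3)])
      fix p assume p: "p \<in> D (r \<oplus> s)"
      then obtain q where q: "q \<in> {r, s}" "p \<in> D q" using D_add[OF N(1,2)] by blast
      then have q': "q \<in> carrier R" "Z q K" using N K by auto
      define W where "W = D q \<inter> D (r \<oplus> s)"
      have W: "openin T W" "W \<subseteq> D q" "W \<subseteq> D (r \<oplus> s)" "p \<in> W" "W \<subseteq> U" "D q \<subseteq> U" "D (r \<oplus> s) \<subseteq> U"
        using open_D[OF q'(1)] o p q by (auto simp: W_def)
      have "res F U W (\<rho> (f [^] K) \<odot>\<^bsub>sect F U\<^esub> t) = res F (D q) W (res F U (D q) (\<rho> (f [^] K) \<odot>\<^bsub>sect F U\<^esub> t))"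
        using F.res_res[OF open_U open_D[OF q'(1)] W(1,2,6), of "\<rho> (f [^] K) \<odot>\<^bsub>sect F U\<^esub> t"] f t open_U
        by simp
      also have "\<dots> = \<zero>\<^bsub>sect F W\<^esub>"
        using q'(2) F_res_zero[OF open_D[OF q'(1)] W(1,2)] unfolding Z_def by simp
      finally have *: "res F U W (\<rho> (f [^] K) \<odot>\<^bsub>sect F U\<^esub> t) = \<zero>\<^bsub>sect F W\<^esub>" .
      have "res F (D (r \<oplus> s)) W (res F U (D (r \<oplus> s)) (\<rho> (f [^] K) \<odot>\<^bsub>sect F U\<^esub> t)) = \<zero>\<^bsub>sect F W\<^esub>"
        using F.res_res[OF open_U o(3) W(1,3,7), of "\<rho> (f [^] K) \<odot>\<^bsub>sect F U\<^esub> t"] f t open_U * by simp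
      moreover have "res F (D (r \<oplus> s)) W \<zero>\<^bsub>sect F (D (r \<oplus> s))\<^esub> = \<zero>\<^bsub>sect F W\<^esub>"
        by (rule F_res_zero[OF o(3) W(1,3)])
      ultimately show "\<exists>W. openin T W \<and> p \<in> W \<and> W \<subseteq> D (r \<oplus> s) \<and>
          res F (D (r \<oplus> s)) W (res F U (D (r \<oplus> s)) (\<rho> (f [^] K) \<odot>\<^bsub>sect F U\<^esub> t))
          = res F (D (r \<oplus> s)) W \<zero>\<^bsub>sect F (D (r \<oplus> s))\<^esub>"
        using W by (intro exI[of _ W]) simp
    qed (use F.res_closed[OF open_U o(3), of "\<rho> (f [^] K) \<odot>\<^bsub>sect F U\<^esub> t"] f t open_U o in auto)
    then show "r \<oplus> s \<in> J" using N by (auto simp: J_def)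
  qed
  moreover have "\<exists>k\<in>J. k \<notin> \<phi> p" if p: "p \<in> U" for p
  proof -
    obtain k m where k: "k \<in> carrier R" "k \<notin> \<phi> p" and m: "m \<in> carrier M"
      and eq: "res F U (D k) (\<rho> k \<odot>\<^bsub>sect F U\<^esub> t) = res F U (D k) (\<tau> m)"
      by (rule local_fraction[OF t p])
    have Dk: "openin T (D k)" "D k \<subseteq> U" using open_D k by auto
    \<comment> \<open>On \<open>D k\<close> the section is the fraction \<open>m/k\<close>. Hence
      \<open>m\<close> vanishes on \<open>D (f \<otimes> k)\<close>, and some power of
      \<open>f \<otimes> k\<close> annihilates it.\<close>
    have fk: "f \<otimes> k \<in> carrier R" "D (f \<otimes> k) = D f \<inter> D k" using D_mult f k by auto
    have Dfk: "openin T (D (f \<otimes> k))" "D (f \<otimes> k) \<subseteq> U" "D (f \<otimes> k) \<subseteq> D f" "D (f \<otimes> k) \<subseteq> D k"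
      using open_D[OF fk(1)] fk by auto
    have Df: "openin T (D f)" "D f \<subseteq> U" using open_D f by auto
    have "res F U (D (f \<otimes> k)) (\<tau> m) = res F U (D (f \<otimes> k)) (\<rho> k \<odot>\<^bsub>sect F U\<^esub> t)"
      by (rule F.res_eq_mono[OF open_U open_U Dk(1) Dfk(1,4) Dk(2) Dk(2) _ _ eq[symmetric]])
        (use m k t open_U in auto)
    also have "\<dots> = res A U (D (f \<otimes> k)) (\<rho> k) \<odot>\<^bsub>sect F (D (f \<otimes> k))\<^esub> res F U (D (f \<otimes> k)) t"
      using k t open_U Dfk by simp
    also have "res F U (D (f \<otimes> k)) t = res F (D f) (D (f \<otimes> k)) (res F U (D f) t)"
      using F.res_res[OF open_U Df(1) Dfk(1,3) Df(2) t] by simp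
    also have "\<dots> = \<zero>\<^bsub>sect F (D (f \<otimes> k))\<^esub>" unfolding z by (rule F_res_zero[OF Df(1) Dfk(1,3)])
    also have "res A U (D (f \<otimes> k)) (\<rho> k) \<odot>\<^bsub>sect F (D (f \<otimes> k))\<^esub> \<zero>\<^bsub>sect F (D (f \<otimes> k))\<^esub> = \<zero>\<^bsub>sect F (D (f \<otimes> k))\<^esub>"
      by (rule module.smult_r_null[OF module_sect[OF Dfk(1)] res_closed[OF open_U Dfk(1,2) rho_closed[OF k(1)]]])
    finally obtain N :: nat where N: "((f \<otimes> k) [^] N) \<odot>\<^bsub>M\<^esub> m = \<zero>\<^bsub>M\<^esub>"
      using power_torsion[OF m fk(1)] by blast
    have "\<rho> (f [^] N) \<odot>\<^bsub>sect F U\<^esub> (\<rho> (k [^] N) \<odot>\<^bsub>sect F U\<^esub> \<tau> m) = \<tau> (((f \<otimes> k) [^] N) \<odot>\<^bsub>M\<^esub> m)"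
      using f k m by (simp add: R.nat_pow_distrib FU.smult_assoc1)
    then have zero: "\<rho> (f [^] N) \<odot>\<^bsub>sect F U\<^esub> (\<rho> (k [^] N) \<odot>\<^bsub>sect F U\<^esub> \<tau> m) = \<zero>\<^bsub>sect F U\<^esub>"
      using N by simp
    define V where "V = D k"
    have V: "openin T V" "V \<subseteq> U" using Dk by (simp_all add: V_def)
    interpret V: module "sect A V" "sect F V" by (rule module_sect[OF V(1)])
    have c: "\<rho> (f [^] N) \<in> Sec A U" "\<rho> (k [^] N) \<in> Sec A U" "\<rho> k \<in> Sec A U"
      "\<tau> m \<in> Sec F U" using f k m by auto
    have eqV: "res F U V (\<tau> m) = res A U V (\<rho> k) \<odot>\<^bsub>sect F V\<^esub> res F U V t"
      using eq open_U V c t by (simp add: V_def)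
    have "\<zero>\<^bsub>sect F V\<^esub> = res F U V (\<rho> (f [^] N) \<odot>\<^bsub>sect F U\<^esub> (\<rho> (k [^] N) \<odot>\<^bsub>sect F U\<^esub> \<tau> m))"
      using zero open_U V by simp
    also have "\<dots> = res A U V (\<rho> (f [^] N)) \<odot>\<^bsub>sect F V\<^esub> (res A U V (\<rho> (k [^] N)) \<odot>\<^bsub>sect F V\<^esub> (res A U V (\<rho> k) \<odot>\<^bsub>sect F V\<^esub> res F U V t))"
      using eqV open_U V c t by simp
    also have "\<dots> = res A U V (\<rho> (k [^] Suc N)) \<odot>\<^bsub>sect F V\<^esub> res F U V (\<rho> (f [^] N) \<odot>\<^bsub>sect F U\<^esub> t)"
      using open_U V c t f k
      by (simp add: V.smult_assoc1[symmetric] V.R.m_ac)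
    \<comment> \<open>\<open>k\<close> is a unit on \<open>D k\<close> and can be cancelled there.
      The exponent is \<open>Suc N\<close> because \<open>\<tau> m\<close> is
      \<open>\<rho> k\<close> times \<open>t\<close> on \<open>D k\<close>, which adds one factor
      \<open>k\<close> to the \<open>N\<close> already present.\<close>
    finally have *: "res A U V (\<rho> (k [^] Suc N)) \<odot>\<^bsub>sect F V\<^esub> res F U V (\<rho> (f [^] N) \<odot>\<^bsub>sect F U\<^esub> t)
        = res A U V (\<rho> (k [^] Suc N)) \<odot>\<^bsub>sect F V\<^esub> \<zero>\<^bsub>sect F V\<^esub>"
      using V.smult_r_null[of "res A U V (\<rho> (k [^] Suc N))"] open_U V k by simp
    have "res F U V (\<rho> (f [^] N) \<odot>\<^bsub>sect F U\<^esub> t) = \<zero>\<^bsub>sect F V\<^esub>"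
    proof (rule units_cancel[OF open_U V _ _ _ _ *])
      show "\<rho> (k [^] Suc N) \<in> Sec A U" using k by auto
      show "unit_at T A U (\<rho> (k [^] Suc N)) q" if "q \<in> V" for q
        using that unit_iff[of "k [^] Suc N" q] not_mem_pow[of q k "Suc N"] k by (auto simp: V_def)
    qed (use open_U V c t in auto)
    then have "k \<in> J" using k unfolding J_def Z_def V_def by blast
    then show ?thesis using k by blast
  qed
  ultimately have "\<one> \<in> J" by (rule ideal_eq_carrier)
  then obtain N where "Z \<one> N" by (auto simp: J_def)
  then have "res F U U (\<rho> (f [^] N) \<odot>\<^bsub>sect F U\<^esub> t) = \<zero>\<^bsub>sect F U\<^esub>" unfolding Z_def D_one .
  then show ?thesis using f t open_U by auto
qed

text \<open>Global sections of the sheaf of a module come from the module. The elements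
  \<open>r\<close> for which \<open>r\<close> times \<open>y\<close> comes from \<open>M\<close>
  form an ideal, and a local fraction \<open>m/k\<close> puts a power of \<open>k\<close> into
  it.\<close>

theorem tau_surj:
  assumes y: "y \<in> Sec F U"
  shows "\<exists>m\<in>carrier M. \<tau> m = y"
proof -
  define J where "J = {r \<in> carrier R. \<exists>m\<in>carrier M. \<rho> r \<odot>\<^bsub>sect F U\<^esub> y = \<tau> m}"
  have "ideal J R"
  proof (rule R.cring_idealI)
    show "\<zero> \<in> J" using y by (auto simp: J_def intro!: bexI[of _ "\<zero>\<^bsub>M\<^esub>"])
    fix r s assume "r \<in> J" "s \<in> J"
    then obtain m n where "r \<in> carrier R" "m \<in> carrier M" "\<rho> r \<odot>\<^bsub>sect F U\<^esub> y = \<tau> m"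
      "s \<in> carrier R" "n \<in> carrier M" "\<rho> s \<odot>\<^bsub>sect F U\<^esub> y = \<tau> n" by (auto simp: J_def)
    then show "r \<oplus> s \<in> J"
      using y by (auto simp: J_def FU.smult_l_distr intro!: bexI[of _ "m \<oplus>\<^bsub>M\<^esub> n"])
  next
    fix r s assume "r \<in> carrier R" "s \<in> J"
    then obtain n where "r \<in> carrier R"
      "s \<in> carrier R" "n \<in> carrier M" "\<rho> s \<odot>\<^bsub>sect F U\<^esub> y = \<tau> n" by (auto simp: J_def)
    then show "r \<otimes> s \<in> J"
      using y by (auto simp: J_def FU.smult_assoc1 intro!: bexI[of _ "r \<odot>\<^bsub>M\<^esub> n"])
  qed (auto simp: J_def)
  moreover have "\<exists>k\<in>J. k \<notin> \<phi> p" if p: "p \<in> U" for p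
  proof -
    obtain k m where k: "k \<in> carrier R" "k \<notin> \<phi> p" and m: "m \<in> carrier M"
      and eq: "res F U (D k) (\<rho> k \<odot>\<^bsub>sect F U\<^esub> y) = res F U (D k) (\<tau> m)"
      by (rule local_fraction[OF y p])
    \<comment> \<open>The difference of \<open>k\<close> times \<open>y\<close> and
      \<open>\<tau> m\<close> is known to vanish on \<open>D k\<close>. A power of \<open>k\<close>
      makes it vanish over \<open>U\<close>, at the price of replacing \<open>k\<close> by
      \<open>k [^] Suc N\<close>.\<close>
    define t where "t = \<rho> k \<odot>\<^bsub>sect F U\<^esub> y \<oplus>\<^bsub>sect F U\<^esub> \<ominus>\<^bsub>sect F U\<^esub> \<tau> m"
    have t: "t \<in> Sec F U" using k y m by (simp add: t_def)
    define V where "V = D k"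
    have V: "openin T V" "V \<subseteq> U" using open_D k by (auto simp: V_def)
    interpret V: module "sect A V" "sect F V" by (rule module_sect[OF V(1)])
    have c: "\<rho> k \<odot>\<^bsub>sect F U\<^esub> y \<in> Sec F U" "\<tau> m \<in> Sec F U"
      "\<ominus>\<^bsub>sect F U\<^esub> \<tau> m \<in> Sec F U"
      using k y m by auto
    have "res F U V t = \<zero>\<^bsub>sect F V\<^esub>"
      unfolding t_def F_res_add[OF open_U V c(1,3)] F_res_minus[OF open_U V c(2)] eq[folded V_def]
      using c open_U V by (simp add: V.M.r_neg)
    then obtain N :: nat where N: "\<rho> (k [^] N) \<odot>\<^bsub>sect F U\<^esub> t = \<zero>\<^bsub>sect F U\<^esub>"
      using power_kills_section[OF t k(1)] by (auto simp: V_def)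
    have "\<rho> (k [^] N) \<odot>\<^bsub>sect F U\<^esub> (\<rho> k \<odot>\<^bsub>sect F U\<^esub> y)
        \<oplus>\<^bsub>sect F U\<^esub> \<ominus>\<^bsub>sect F U\<^esub> (\<rho> (k [^] N) \<odot>\<^bsub>sect F U\<^esub> \<tau> m) = \<zero>\<^bsub>sect F U\<^esub>"
      using N c k m unfolding t_def by (simp add: FU.smult_r_distr FU.smult_r_minus)
    then have "\<rho> (k [^] N) \<odot>\<^bsub>sect F U\<^esub> (\<rho> k \<odot>\<^bsub>sect F U\<^esub> y) = \<rho> (k [^] N) \<odot>\<^bsub>sect F U\<^esub> \<tau> m"
      using FU.M.minus_equality[of "\<rho> (k [^] N) \<odot>\<^bsub>sect F U\<^esub> (\<rho> k \<odot>\<^bsub>sect F U\<^esub> y)"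
          "\<ominus>\<^bsub>sect F U\<^esub> (\<rho> (k [^] N) \<odot>\<^bsub>sect F U\<^esub> \<tau> m)"] k c m y by simp
    then have "\<rho> (k [^] Suc N) \<odot>\<^bsub>sect F U\<^esub> y = \<tau> ((k [^] N) \<odot>\<^bsub>M\<^esub> m)"
      using k y m by (simp add: FU.smult_assoc1)
    then have "k [^] Suc N \<in> J" using k m unfolding J_def by blast
    then show ?thesis using not_mem_pow[OF p k] by blast
  qed
  ultimately have "\<one> \<in> J" by (rule ideal_eq_carrier)
  then show ?thesis using y by (auto simp: J_def)
qed

end

section \<open>From presentations to affine charts\<close>

text \<open>Sums and products of fractions and of germs are encoded as unions over all pairs of
  representatives. Such a union is the intended value once every pair yields the same set.\<close>

lemma UN_pair_const:
  assumes "a \<in> A" "b \<in> B" and const: "\<And>x t y u. \<lbrakk>(x, t) \<in> A; (y, u) \<in> B\<rbrakk> \<Longrightarrow> f x t y u = c"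
  shows "(\<Union>(x, t)\<in>A. \<Union>(y, u)\<in>B. f x t y u) = c"
proof -
  have "(\<Union>(x, t)\<in>A. \<Union>(y, u)\<in>B. f x t y u) = (\<Union>(x, t)\<in>A. \<Union>(y, u)\<in>B. c)"
  proof (rule SUP_cong[OF refl])
    fix xt assume "xt \<in> A"
    then show "(case xt of (x, t) \<Rightarrow> \<Union>(y, u)\<in>B. f x t y u) = (case xt of (x, t) \<Rightarrow> \<Union>(y, u)\<in>B. c)"
      using const by (cases xt) (auto intro!: SUP_cong)
  qed
  moreover have "A \<noteq> {}" "B \<noteq> {}" using assms by auto
  ultimately show ?thesis by (simp add: case_prod_unfold)
qed

lemma regular_module_simps [simp]:
  "carrier (regular_module R) = carrier R" "smult (regular_module R) = monoid.mult R"
  "ring.add (regular_module R) = ring.add R" "ring.zero (regular_module R) = ring.zero R"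
  by (simp_all add: regular_module_def)

lemma regular_sheaf_simps [simp]:
  "sect (regular_sheaf A) U = regular_module (sect A U)" "res (regular_sheaf A) = res A"
  by (simp_all add: regular_sheaf_def)

text \<open>The sheaf axioms see only carriers and restrictions, so regarding a ring as a module or
  changing the scalars preserves them.\<close>

lemma is_sheaf_cong:
  assumes "\<And>U. Sec F U = Sec G U" "res F = res G"
  shows "is_sheaf T F \<longleftrightarrow> is_sheaf T G"
  unfolding is_sheaf_def is_presheaf_def assms ..

lemma (in ring_sheaf_on) regular_mod_sheaf: "mod_sheaf T A (regular_sheaf A)"
proof -
  have "is_sheaf T (regular_sheaf A)"
    using sheaf is_sheaf_cong[of "regular_sheaf A" A T] by simp
  then show ?thesis unfolding mod_sheaf_def by (simp add: cring_sect regular_module_module)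
qed

lemma (in ring_sheaf_on) regular_module_sheaf_on: "module_sheaf_on T A (regular_sheaf A)"
  by (rule module_sheaf_onI[OF ring_sheaf regular_mod_sheaf])

text \<open>The point \<open>p\<close> viewed as an ideal of the ring of sections, prime when
  \<open>U\<close> is affine. It replaces the map \<open>\<phi>\<close> of a chart by one that
  depends on the sheaf alone.\<close>

definition nonunits :: "'p topology \<Rightarrow> ('p, 'a) ring_presheaf \<Rightarrow> 'p set \<Rightarrow> 'p \<Rightarrow> 'a set" where
  "nonunits T A U p = {g \<in> Sec A U. \<not> unit_at T A U g p}"

text \<open>A chart maps the structure sheaf of the spectrum to the given sheaf, whereas evaluating
  sections at primes goes the opposite way. This turns the latter comparison into the
  former.\<close>

lemma ring_sheaf_iso_inverse:
  assumes iso: "ring_sheaf_iso T A B f" and A: "is_presheaf T A"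
    and ring: "\<And>U. openin T U \<Longrightarrow> ring (sect A U)"
  shows "ring_sheaf_iso T B A (\<lambda>U. inv_into (Sec A U) (f U))"
proof -
  let ?g = "\<lambda>U. inv_into (Sec A U) (f U)"
  interpret presheaf_on T A by (rule presheaf_on.intro[OF A])
  have f: "f U \<in> ring_hom (sect A U) (sect B U)"
    "bij_betw (f U) (Sec A U) (Sec B U)" if "openin T U" for U
    using iso that by (simp_all add: ring_sheaf_iso_def ring_sheaf_hom_def)
  have nat: "f V (res A U V x) = res B U V (f U x)"
    if "openin T U" "openin T V" "V \<subseteq> U" "x \<in> Sec A U" for U V x
    using iso that by (simp add: ring_sheaf_iso_def ring_sheaf_hom_def commutes_with_res_def)
  have gc: "?g U y \<in> Sec A U" and fg: "f U (?g U y) = y"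
    if "openin T U" "y \<in> Sec B U" for U y
    using f(2)[OF that(1)] that(2) inv_into_into[of y "f U" "Sec A U"]
      f_inv_into_f[of y "f U" "Sec A U"] by (simp_all add: bij_betw_def)
  have eqI: "?g U y = x" if "openin T U" "x \<in> Sec A U" "f U x = y" for U x y
    using f(2)[OF that(1)] that inv_into_f_f[of "f U" "Sec A U" x] by (simp add: bij_betw_def)
  have "?g U \<in> ring_hom (sect B U) (sect A U)" if U: "openin T U" for U
  proof -
    interpret ring "sect A U" by (rule ring[OF U])
    show ?thesis
    proof (rule ring_hom_memI)
      show "?g U x \<in> Sec A U" if "x \<in> Sec B U" for x by (rule gc[OF U that])
      fix x y assume x: "x \<in> Sec B U" and y: "y \<in> Sec B U"
      show "?g U (x \<otimes>\<^bsub>sect B U\<^esub> y) = ?g U x \<otimes>\<^bsub>sect A U\<^esub> ?g U y"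
        by (rule eqI[OF U]) (use gc[OF U] fg[OF U] x y in \<open>simp_all add: ring_hom_mult[OF f(1)[OF U]]\<close>)
      show "?g U (x \<oplus>\<^bsub>sect B U\<^esub> y) = ?g U x \<oplus>\<^bsub>sect A U\<^esub> ?g U y"
        by (rule eqI[OF U]) (use gc[OF U] fg[OF U] x y in \<open>simp_all add: ring_hom_add[OF f(1)[OF U]]\<close>)
    next
      show "?g U \<one>\<^bsub>sect B U\<^esub> = \<one>\<^bsub>sect A U\<^esub>"
        by (rule eqI[OF U]) (simp_all add: ring_hom_one[OF f(1)[OF U]])
    qed
  qed
  moreover have "commutes_with_res T B A ?g"
    unfolding commutes_with_res_def
  proof (intro allI impI ballI, elim conjE)
    fix U V x assume UV: "openin T U" "openin T V" "V \<subseteq> U" and x: "x \<in> Sec B U"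
    show "?g V (res B U V x) = res A U V (?g U x)"
      by (rule eqI[OF UV(2)]) (use UV x gc[OF UV(1) x] nat fg[OF UV(1) x] in auto)
  qed
  ultimately show ?thesis
    using f(2)[THEN bij_betw_inv_into] by (simp add: ring_sheaf_iso_def ring_sheaf_hom_def)
qed

context affine_presentation
begin

text \<open>By the basis property, the image of \<open>W\<close> is cut out by the set of all
  \<open>g\<close> with \<open>D g\<close> inside \<open>W\<close>.\<close>

lemma openin_image:
  assumes "openin T W" "W \<subseteq> U"
  shows "openin (zariski R) (\<phi> ` W)"
proof -
  define S where "S = {g \<in> carrier R. D g \<subseteq> W}"
  have "\<phi> ` W = {P \<in> Spec R. \<not> S \<subseteq> P}"
  proof (intro equalityI subsetI)
    fix P assume "P \<in> \<phi> ` W"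
    then obtain p where p: "p \<in> W" "P = \<phi> p" by blast
    obtain g where "g \<in> carrier R" "g \<notin> \<phi> p" "D g \<subseteq> W"
      using basis[OF assms p(1)] by blast
    then show "P \<in> {P \<in> Spec R. \<not> S \<subseteq> P}"
      using p assms(2) bij_betwE[OF bij] by (auto simp: S_def)
  next
    fix P assume P: "P \<in> {P \<in> Spec R. \<not> S \<subseteq> P}"
    then obtain p where "p \<in> U" "P = \<phi> p" using bij by (auto simp: bij_betw_def)
    moreover obtain g where "g \<in> S" "g \<notin> P" using P by blast
    ultimately show "P \<in> \<phi> ` W" by (auto simp: S_def)
  qed
  moreover have "S \<subseteq> carrier R" by (auto simp: S_def)
  ultimately show ?thesis unfolding openin_zariski by blast
qed

lemma openin_vimage:
  assumes "openin (zariski R) V"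
  shows "openin T {p \<in> U. \<phi> p \<in> V}"
proof -
  obtain S where S: "S \<subseteq> carrier R" "V = {P \<in> Spec R. \<not> S \<subseteq> P}"
    using assms unfolding openin_zariski by blast
  have "{p \<in> U. \<phi> p \<in> V} = (\<Union>s\<in>S. D s)"
    using bij_betwE[OF bij] by (auto simp: S(2))
  moreover have "openin T (\<Union>s\<in>S. D s)" using S(1) open_D by (intro openin_Union) blast
  ultimately show ?thesis by simp
qed

lemma openin_zariski_subset: "openin (zariski R) V \<Longrightarrow> V \<subseteq> Spec R"
  unfolding openin_zariski by blast

lemma topspace_zariski: "topspace (zariski R) = Spec R"
proof -
  have "openin (zariski R) (\<phi> ` U)" by (rule openin_image[OF open_U subset_refl])
  then have "openin (zariski R) (Spec R)" using bij by (simp add: bij_betw_def)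
  then show ?thesis using openin_zariski_subset
    by (metis openin_subset openin_topspace subset_antisym)
qed

lemma homeomorphic: "homeomorphic_map (subtopology T U) (zariski R) \<phi>"
proof (rule bijective_open_imp_homeomorphic_map)
  have U: "topspace (subtopology T U) = U"
    using openin_subset[OF open_U] by auto
  show "continuous_map (subtopology T U) (zariski R) \<phi>"
    unfolding continuous_map_def U topspace_zariski
  proof (intro conjI allI impI)
    show "\<phi> \<in> U \<rightarrow> Spec R" using bij_betwE[OF bij] by auto
    fix V assume "openin (zariski R) V"
    from openin_vimage[OF this] show "openin (subtopology T U) {x \<in> U. \<phi> x \<in> V}"
      using open_U by (simp add: openin_open_subtopology)
  qed
  show "open_map (subtopology T U) (zariski R) \<phi>"
    unfolding open_map_def using openin_image open_U by (simp add: openin_open_subtopology)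
  show "\<phi> ` topspace (subtopology T U) = topspace (zariski R)" "inj_on \<phi> (topspace (subtopology T U))"
    unfolding U topspace_zariski using bij by (simp_all add: bij_betw_def)
qed

end

section \<open>Comparison with the structure sheaf of the spectrum\<close>

locale ring_presentation = module_presentation T A U R \<phi> \<rho> "regular_sheaf A" "regular_module R" \<rho>
  for T :: "'p topology" and A :: "('p, 'a) ring_presheaf" and U :: "'p set"
    and R :: "'r ring" (structure) and \<phi> :: "'p \<Rightarrow> 'r set" and \<rho> :: "'r \<Rightarrow> 'a"
begin

text \<open>
  The value of a section at a point \<open>p\<close> as an element of the localisation at \<open>\<phi> p\<close>, in the encoding of
  fractions as sets of pairs.
\<close>

definition value_at :: "'p set \<Rightarrow> 'a \<Rightarrow> 'p \<Rightarrow> ('r \<times> 'r) set" where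
  "value_at V a p = {(n, t). n \<in> carrier R \<and> t \<in> carrier R - \<phi> p \<and>
    (\<exists>W. openin T W \<and> p \<in> W \<and> W \<subseteq> V \<and>
      res A U W (\<rho> t) \<otimes>\<^bsub>sect A W\<^esub> res A V W a = res A U W (\<rho> n))}"

text \<open>One local expression \<open>x/y\<close> of the section determines the whole set of
  pairs. A second expression \<open>n/t\<close> makes the difference of \<open>t \<otimes> x\<close>
  and \<open>y \<otimes> n\<close> vanish near \<open>p\<close>, and \<open>torsion\<close> converts
  this into equality of fractions. Conversely, an equality of fractions becomes an equality of
  sections after cancelling the unit \<open>u \<otimes> y\<close>.\<close>

lemma value_at_eq:
  assumes V: "openin T V" "V \<subseteq> U" and a: "a \<in> Sec A V" and p: "p \<in> V"
    and x: "x \<in> carrier R" and y: "y \<in> carrier R" "y \<notin> \<phi> p"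
    and W: "openin T W" "p \<in> W" "W \<subseteq> V"
    and eq: "res A U W (\<rho> y) \<otimes>\<^bsub>sect A W\<^esub> res A V W a = res A U W (\<rho> x)"
  shows "value_at V a p = fraction (regular_module R) (carrier R - \<phi> p) x y"
proof -
  have pU: "p \<in> U" using p V by blast
  have "(n, t) \<in> value_at V a p \<longleftrightarrow> (n, t) \<in> fraction (regular_module R) (carrier R - \<phi> p) x y"
    if n: "n \<in> carrier R" and t: "t \<in> carrier R" "t \<notin> \<phi> p" for n t
  proof
    assume "(n, t) \<in> value_at V a p"
    then obtain W' where W': "openin T W'" "p \<in> W'" "W' \<subseteq> V"
      and eq': "res A U W' (\<rho> t) \<otimes>\<^bsub>sect A W'\<^esub> res A V W' a = res A U W' (\<rho> n)"
      unfolding value_at_def by blast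
    define B where "B = W \<inter> W'"
    have B: "openin T B" "B \<subseteq> W" "B \<subseteq> W'" "p \<in> B" "B \<subseteq> U" "B \<subseteq> V" "W \<subseteq> U" "W' \<subseteq> U"
      using W W' V by (auto simp: B_def)
    interpret B: cring "sect A B" by (rule cring_sect[OF B(1)])
    have c: "res A U B (\<rho> y) \<in> Sec A B" "res A U B (\<rho> t) \<in> Sec A B"
      "res A V B a \<in> Sec A B" "res A U B (\<rho> x) \<in> Sec A B"
      "res A U B (\<rho> n) \<in> Sec A B"
      using B V open_U a x y n t by auto
    have 1: "res A U B (\<rho> y) \<otimes>\<^bsub>sect A B\<^esub> res A V B a = res A U B (\<rho> x)"
      using arg_cong[OF eq, of "res A W B"] B W(1,3) V open_U a x y by simp
    have 2: "res A U B (\<rho> t) \<otimes>\<^bsub>sect A B\<^esub> res A V B a = res A U B (\<rho> n)"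
      using arg_cong[OF eq', of "res A W' B"] B W'(1,3) V open_U a n t by simp
    have "res A U B (\<rho> t) \<otimes>\<^bsub>sect A B\<^esub> res A U B (\<rho> x) = res A U B (\<rho> y) \<otimes>\<^bsub>sect A B\<^esub> res A U B (\<rho> n)"
      unfolding 1[symmetric] 2[symmetric] using c(1-3) by (simp add: B.m_ac)
    moreover have "res A U B (\<rho> (t \<otimes> x \<oplus> \<ominus> (y \<otimes> n))) =
      res A U B (\<rho> t) \<otimes>\<^bsub>sect A B\<^esub> res A U B (\<rho> x) \<oplus>\<^bsub>sect A B\<^esub>
      \<ominus>\<^bsub>sect A B\<^esub> (res A U B (\<rho> y) \<otimes>\<^bsub>sect A B\<^esub> res A U B (\<rho> n))"
    proof -
      have h: "res A U B \<circ> \<rho> \<in> ring_hom R (sect A B)"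
        by (rule ring_hom_trans[OF hom res_ring_hom[OF open_U B(1,5)]])
      interpret h: ring_hom_cring R "sect A B" "res A U B \<circ> \<rho>"
        by (intro ring_hom_cring.intro R.is_cring B.is_cring ring_hom_cring_axioms.intro h)
      show ?thesis
        using h.hom_add[of "t \<otimes> x" "\<ominus> (y \<otimes> n)"] h.hom_a_inv[of "y \<otimes> n"] h.hom_mult[of t x]
          h.hom_mult[of y n] x y n t by simp
    qed
    ultimately have "res A U B (\<rho> (t \<otimes> x \<oplus> \<ominus> (y \<otimes> n))) = \<zero>\<^bsub>sect A B\<^esub>"
      using c by (simp add: B.r_neg)
    then obtain u where u: "u \<in> carrier R" "u \<notin> \<phi> p" "u \<otimes> (t \<otimes> x \<oplus> \<ominus> (y \<otimes> n)) = \<zero>"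
      using torsion[of "t \<otimes> x \<oplus> \<ominus> (y \<otimes> n)" B p] x y n t B by auto
    then have "u \<otimes> (t \<otimes> x) \<oplus> \<ominus> (u \<otimes> (y \<otimes> n)) = \<zero>"
      using x y n t by (simp add: R.r_distr R.r_minus)
    then have "u \<otimes> (t \<otimes> x) = u \<otimes> (y \<otimes> n)"
      using R.minus_equality[of "u \<otimes> (t \<otimes> x)" "\<ominus> (u \<otimes> (y \<otimes> n))"] u x y n t by simp
    then show "(n, t) \<in> fraction (regular_module R) (carrier R - \<phi> p) x y"
      using u n t by (auto simp: fraction_def)
  next
    assume "(n, t) \<in> fraction (regular_module R) (carrier R - \<phi> p) x y"
    then obtain u where u: "u \<in> carrier R" "u \<notin> \<phi> p" "u \<otimes> (t \<otimes> x) = u \<otimes> (y \<otimes> n)"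
      by (auto simp: fraction_def)
    interpret W: cring "sect A W" by (rule cring_sect[OF W(1)])
    have WU: "W \<subseteq> U" using W V by blast
    note r = open_U W(1) WU
    have c: "res A U W (\<rho> y) \<in> Sec A W" "res A U W (\<rho> t) \<in> Sec A W"
      "res A V W a \<in> Sec A W" "res A U W (\<rho> x) \<in> Sec A W"
      "res A U W (\<rho> n) \<in> Sec A W" "res A U W (\<rho> u) \<in> Sec A W"
      using r W V a x y n t u by auto
    have uy: "u \<otimes> y \<in> carrier R" "u \<otimes> y \<notin> \<phi> p" using not_mem_mult[OF pU] u y by auto
    define b where "b = res A U W (\<rho> t) \<otimes>\<^bsub>sect A W\<^esub> res A V W a"
    have "res A U W (\<rho> (u \<otimes> y)) \<otimes>\<^bsub>sect A W\<^esub> b =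
        res A U W (\<rho> u) \<otimes>\<^bsub>sect A W\<^esub> (res A U W (\<rho> t) \<otimes>\<^bsub>sect A W\<^esub> res A U W (\<rho> x))"
      unfolding eq[symmetric] b_def using c(1-3,6) r u y by (simp add: W.m_ac)
    also have "\<dots> = res A U W (\<rho> (u \<otimes> (t \<otimes> x)))" using r x t u(1,2) by simp
    also have "\<dots> = res A U W (\<rho> (u \<otimes> y)) \<otimes>\<^bsub>sect A W\<^esub> res A U W (\<rho> n)"
      unfolding u(3) using r u y n by (simp add: W.m_assoc)
    finally have fin: "res A U W (\<rho> (u \<otimes> y)) \<otimes>\<^bsub>sect A W\<^esub> b = res A U W (\<rho> (u \<otimes> y)) \<otimes>\<^bsub>sect A W\<^esub> res A U W (\<rho> n)" .
    have bc: "b \<in> Sec A W" using c by (simp add: b_def)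
    obtain W' where W': "openin T W'" "p \<in> W'" "W' \<subseteq> W" "res A W W' b = res A W W' (res A U W (\<rho> n))"
    proof (rule unit_at_cancel[OF open_U W(1) WU _ _ W(1,2) subset_refl, of "\<rho> (u \<otimes> y)" b "res A U W (\<rho> n)"])
      show "unit_at T A U (\<rho> (u \<otimes> y)) p" using unit_iff[OF uy(1) pU] uy(2) by blast
    qed (use fin bc c uy r in auto)
    have "res A U W' (\<rho> t) \<otimes>\<^bsub>sect A W'\<^esub> res A V W' a = res A U W' (\<rho> n)"
      using W'(4) W' W V open_U WU a t n by (simp add: b_def)
    then show "(n, t) \<in> value_at V a p"
      using W' W n t unfolding value_at_def by blast
  qed
  moreover have "(n, t) \<notin> value_at V a p \<and> (n, t) \<notin> fraction (regular_module R) (carrier R - \<phi> p) x y"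
    if "\<not> (n \<in> carrier R \<and> t \<in> carrier R \<and> t \<notin> \<phi> p)" for n t
    using that by (simp add: value_at_def fraction_def)
  ultimately have "z \<in> value_at V a p \<longleftrightarrow> z \<in> fraction (regular_module R) (carrier R - \<phi> p) x y" for z
    by (cases z) metis
  then show ?thesis by (rule Set.set_eqI)
qed

text \<open>The neighbourhood is cut down to \<open>D f\<close> because a local fraction on the
  spectrum needs a denominator outside every prime of its neighbourhood, not only outside
  \<open>\<phi> p\<close>.\<close>

lemma value_at_fraction:
  assumes V: "openin T V" "V \<subseteq> U" and a: "a \<in> Sec A V" and p: "p \<in> V"
  obtains x y W where "x \<in> carrier R" "y \<in> carrier R" "y \<notin> \<phi> p" "openin T W" "p \<in> W" "W \<subseteq> V"
    "res A U W (\<rho> y) \<otimes>\<^bsub>sect A W\<^esub> res A V W a = res A U W (\<rho> x)"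
    "\<forall>q\<in>W. y \<notin> \<phi> q"
proof -
  have "\<exists>W m f. openin T W \<and> p \<in> W \<and> W \<subseteq> V \<and> m \<in> carrier R \<and> f \<in> carrier R \<and> f \<notin> \<phi> p \<and>
      res A U W (\<rho> f) \<otimes>\<^bsub>sect A W\<^esub> res A V W a = res A U W (\<rho> m)"
    using fractions[OF V _ p, of a, simplified] a by blast
  then obtain W m f where W: "openin T W" "p \<in> W" "W \<subseteq> V" and m: "m \<in> carrier R"
    and f: "f \<in> carrier R" "f \<notin> \<phi> p"
    and eq: "res A U W (\<rho> f) \<otimes>\<^bsub>sect A W\<^esub> res A V W a = res A U W (\<rho> m)"
    by metis
  define B where "B = W \<inter> D f"
  have B: "openin T B" "p \<in> B" "B \<subseteq> V" "B \<subseteq> W" "B \<subseteq> U" "W \<subseteq> U"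
    using W p f V openin_Int[OF W(1) open_D[OF f(1)]] by (simp_all add: B_def le_infI1 subset_iff)
  have "res A W B (res A U W (\<rho> f) \<otimes>\<^bsub>sect A W\<^esub> res A V W a) = res A W B (res A U W (\<rho> m))"
    using eq by simp
  then have eq': "res A U B (\<rho> f) \<otimes>\<^bsub>sect A B\<^esub> res A V B a = res A U B (\<rho> m)"
    using B W V open_U a m f by simp
  have "\<forall>q\<in>B. f \<notin> \<phi> q" by (simp add: B_def)
  then show ?thesis by (rule that[OF m f B(1-3) eq'])
qed

lemma value_at_memD:
  assumes "(n, t) \<in> value_at V a p"
  obtains W where "n \<in> carrier R" "t \<in> carrier R" "t \<notin> \<phi> p" "openin T W" "p \<in> W" "W \<subseteq> V"
    "res A U W (\<rho> t) \<otimes>\<^bsub>sect A W\<^esub> res A V W a = res A U W (\<rho> n)"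
proof -
  have "n \<in> carrier R \<and> t \<in> carrier R \<and> t \<notin> \<phi> p \<and> (\<exists>W. openin T W \<and> p \<in> W \<and> W \<subseteq> V \<and>
      res A U W (\<rho> t) \<otimes>\<^bsub>sect A W\<^esub> res A V W a = res A U W (\<rho> n))"
    using assms by (simp add: value_at_def)
  then show ?thesis using that by metis
qed

lemma value_at_nonempty:
  assumes "openin T V" "V \<subseteq> U" "a \<in> Sec A V" "p \<in> V"
  obtains x y where "(x, y) \<in> value_at V a p"
proof -
  obtain x y W where "x \<in> carrier R" "y \<in> carrier R" "y \<notin> \<phi> p" "openin T W" "p \<in> W" "W \<subseteq> V"
    "res A U W (\<rho> y) \<otimes>\<^bsub>sect A W\<^esub> res A V W a = res A U W (\<rho> x)"
    by (rule value_at_fraction[OF assms], rule that)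
  then have "(x, y) \<in> value_at V a p" unfolding value_at_def by blast
  then show ?thesis by (rule that)
qed

text \<open>Equal values share a pair \<open>(x, y)\<close>. Both sections become
  \<open>\<rho> x\<close> after multiplication by \<open>\<rho> y\<close>, which is a unit at
  \<open>p\<close>.\<close>

lemma value_at_locally_eq:
  assumes V: "openin T V" "V \<subseteq> U" and a: "a \<in> Sec A V" and b: "b \<in> Sec A V"
    and p: "p \<in> V" and eq: "value_at V a p = value_at V b p"
  shows "\<exists>W. openin T W \<and> p \<in> W \<and> W \<subseteq> V \<and> res A V W a = res A V W b"
proof -
  have pU: "p \<in> U" using p V by blast
  obtain x y where xy: "(x, y) \<in> value_at V a p" by (rule value_at_nonempty[OF V a p])
  obtain W where W: "x \<in> carrier R" "y \<in> carrier R" "y \<notin> \<phi> p" "openin T W" "p \<in> W" "W \<subseteq> V"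
    "res A U W (\<rho> y) \<otimes>\<^bsub>sect A W\<^esub> res A V W a = res A U W (\<rho> x)" using xy by (rule value_at_memD)
  obtain W' where W': "openin T W'" "p \<in> W'" "W' \<subseteq> V"
    "res A U W' (\<rho> y) \<otimes>\<^bsub>sect A W'\<^esub> res A V W' b = res A U W' (\<rho> x)"
    using xy unfolding eq by (rule value_at_memD)
  define B where "B = W \<inter> W'"
  have B: "openin T B" "p \<in> B" "B \<subseteq> V" "B \<subseteq> W" "B \<subseteq> W'" "B \<subseteq> U" "W \<subseteq> U" "W' \<subseteq> U"
    using W W' V by (auto simp: B_def)
  have 1: "res A U B (\<rho> y) \<otimes>\<^bsub>sect A B\<^esub> res A V B a = res A U B (\<rho> x)"
    using arg_cong[OF W(7), of "res A W B"] B W(1-6) V open_U a by simp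
  have 2: "res A U B (\<rho> y) \<otimes>\<^bsub>sect A B\<^esub> res A V B b = res A U B (\<rho> x)"
    using arg_cong[OF W'(4), of "res A W' B"] B W(1-6) W'(1-3) V open_U b by simp
  obtain B' where "openin T B'" "p \<in> B'" "B' \<subseteq> B" "res A V B' a = res A V B' b"
  proof (rule unit_at_cancel[OF open_U V _ _ B(1-3), of "\<rho> y" a b])
    show "unit_at T A U (\<rho> y) p" using unit_iff[OF W(2) pU] W(3) by blast
  qed (use 1 2 W a b in auto)
  then show ?thesis using B(3) by (intro exI[of _ B']) auto
qed

lemma value_at_res:
  assumes V: "openin T V" "V \<subseteq> U" and a: "a \<in> Sec A V"
    and V': "openin T V'" "V' \<subseteq> V" and p: "p \<in> V'"
  shows "value_at V' (res A V V' a) p = value_at V a p"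
proof -
  have V'U: "V' \<subseteq> U" and pV: "p \<in> V" and a': "res A V V' a \<in> Sec A V'"
    using V V' p a by auto
  obtain x y W where W: "x \<in> carrier R" "y \<in> carrier R" "y \<notin> \<phi> p" "openin T W" "p \<in> W" "W \<subseteq> V'"
    "res A U W (\<rho> y) \<otimes>\<^bsub>sect A W\<^esub> res A V' W (res A V V' a) = res A U W (\<rho> x)"
    by (rule value_at_fraction[OF V'(1) V'U a' p], rule that)
  have WV: "W \<subseteq> V" using W(6) V'(2) by blast
  have eq: "res A U W (\<rho> y) \<otimes>\<^bsub>sect A W\<^esub> res A V W a = res A U W (\<rho> x)"
    using W(7) V V' W(4,6) a by simp
  show ?thesis
    unfolding value_at_eq[OF V'(1) V'U a' p W] value_at_eq[OF V a pV W(1-5) WV eq] ..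
qed

abbreviation pre :: "'r set set \<Rightarrow> 'p set" where "pre V \<equiv> {p \<in> U. \<phi> p \<in> V}"

definition germ_values :: "'r set set \<Rightarrow> 'a \<Rightarrow> 'r set \<Rightarrow> ('r \<times> 'r) set" where
  "germ_values V a = (\<lambda>P\<in>V. value_at (pre V) a (inv_into U \<phi> P))"

lemma germ_values_phi:
  "p \<in> pre V \<Longrightarrow> germ_values V a (\<phi> p) = value_at (pre V) a p"
  using inv_into_f_f[of \<phi> U p] bij by (simp add: germ_values_def bij_betw_def)

lemma point_of:
  assumes "openin (zariski R) V" "P \<in> V"
  obtains p where "p \<in> pre V" "P = \<phi> p"
proof -
  have "P \<in> \<phi> ` U" using openin_zariski_subset[OF assms(1)] assms(2) bij by (auto simp: bij_betw_def)
  then obtain p where "p \<in> U" "P = \<phi> p" by blast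
  then show ?thesis using that assms(2) by blast
qed

lemma germ_values_closed:
  assumes V: "openin (zariski R) V" and a: "a \<in> Sec A (pre V)"
  shows "germ_values V a \<in> local_fractions R (regular_module R) V"
proof -
  have pre: "openin T (pre V)" "pre V \<subseteq> U" using openin_vimage[OF V] by auto
  have 1: "germ_values V a P \<in> {fraction (regular_module R) (carrier R - P) m f |m f.
      m \<in> carrier (regular_module R) \<and> f \<in> carrier R - P}" if "P \<in> V" for P
  proof -
    obtain p where p: "p \<in> pre V" "P = \<phi> p" by (rule point_of[OF V \<open>P \<in> V\<close>])
    obtain x y W where W: "x \<in> carrier R" "y \<in> carrier R" "y \<notin> \<phi> p" "openin T W" "p \<in> W" "W \<subseteq> pre V"
      "res A U W (\<rho> y) \<otimes>\<^bsub>sect A W\<^esub> res A (pre V) W a = res A U W (\<rho> x)"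
      by (rule value_at_fraction[OF pre a p(1)], rule that)
    have "germ_values V a P = fraction (regular_module R) (carrier R - P) x y"
      unfolding p(2) germ_values_phi[OF p(1)] by (rule value_at_eq[OF pre a p(1) W])
    then show ?thesis using W p by auto
  qed
  have 2: "\<exists>V' m f. openin (zariski R) V' \<and> P \<in> V' \<and> V' \<subseteq> V \<and> m \<in> carrier (regular_module R) \<and>
      f \<in> carrier R \<and> (\<forall>Q\<in>V'. f \<notin> Q \<and> germ_values V a Q = fraction (regular_module R) (carrier R - Q) m f)"
    if "P \<in> V" for P
  proof -
    obtain p where p: "p \<in> pre V" "P = \<phi> p" by (rule point_of[OF V \<open>P \<in> V\<close>])
    obtain x y W where W: "x \<in> carrier R" "y \<in> carrier R" "y \<notin> \<phi> p" "openin T W" "p \<in> W" "W \<subseteq> pre V"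
      "res A U W (\<rho> y) \<otimes>\<^bsub>sect A W\<^esub> res A (pre V) W a = res A U W (\<rho> x)"
      and y: "\<forall>q\<in>W. y \<notin> \<phi> q"
      by (rule value_at_fraction[OF pre a p(1)])
    have "y \<notin> Q \<and> germ_values V a Q = fraction (regular_module R) (carrier R - Q) x y" if "Q \<in> \<phi> ` W" for Q
    proof -
      obtain q where q: "q \<in> W" "Q = \<phi> q" using \<open>Q \<in> \<phi> ` W\<close> by blast
      then have "q \<in> pre V" using W by blast
      then show ?thesis unfolding q(2) using germ_values_phi[of q V a]
          value_at_eq[OF pre a _ W(1,2) bspec[OF y q(1)] W(4) q(1) W(6,7)] bspec[OF y q(1)] by simp
    qed
    moreover have "openin (zariski R) (\<phi> ` W)" using openin_image[OF W(4)] W(6) by blast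
    moreover have "\<phi> ` W \<subseteq> V" "P \<in> \<phi> ` W" using W p by auto
    ultimately show ?thesis using W(1,2) by (intro exI[of _ "\<phi> ` W"] exI[of _ x] exI[of _ y]) simp
  qed
  have "germ_values V a \<in> (\<Pi>\<^sub>E P\<in>V. {fraction (regular_module R) (carrier R - P) m f |m f.
      m \<in> carrier (regular_module R) \<and> f \<in> carrier R - P})"
    by (intro PiE_I 1) (simp_all add: germ_values_def)
  then show ?thesis unfolding local_fractions_def using 2 by simp
qed

lemma germ_values_inj:
  assumes V: "openin (zariski R) V"
  shows "inj_on (germ_values V) (Sec A (pre V))"
proof (rule inj_onI)
  have pre: "openin T (pre V)" "pre V \<subseteq> U" using openin_vimage[OF V] by auto
  fix a b assume a: "a \<in> Sec A (pre V)" and b: "b \<in> Sec A (pre V)"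
    and eq: "germ_values V a = germ_values V b"
  show "a = b"
  proof (rule local_eq[OF pre(1) a b])
    fix p assume p: "p \<in> pre V"
    show "\<exists>W. openin T W \<and> p \<in> W \<and> W \<subseteq> pre V \<and> res A (pre V) W a = res A (pre V) W b"
      by (rule value_at_locally_eq[OF pre a b p])
        (simp only: germ_values_phi[OF p, symmetric] eq)
  qed
qed

text \<open>A fraction \<open>m/f\<close> over a neighbourhood is the value of
  \<open>\<rho> m\<close> times a local inverse of \<open>\<rho> f\<close>. The sections obtained in
  this way glue because a section is determined by its values.\<close>

lemma germ_values_surj:
  assumes V: "openin (zariski R) V" and s: "s \<in> local_fractions R (regular_module R) V"
  shows "\<exists>a\<in>Sec A (pre V). germ_values V a = s"
proof -
  have pre: "openin T (pre V)" "pre V \<subseteq> U" using openin_vimage[OF V] by auto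
  define Q where "Q W a \<longleftrightarrow> (\<forall>q\<in>W. value_at W a q = s (\<phi> q))" for W a
  have ex: "\<exists>W y. openin T W \<and> p \<in> W \<and> W \<subseteq> pre V \<and> y \<in> Sec A W \<and> Q W y"
    if p: "p \<in> pre V" for p
  proof -
    have "\<exists>V' m f. openin (zariski R) V' \<and> \<phi> p \<in> V' \<and> V' \<subseteq> V \<and> m \<in> carrier R \<and> f \<in> carrier R \<and>
        (\<forall>Q\<in>V'. f \<notin> Q \<and> s Q = fraction (regular_module R) (carrier R - Q) m f)"
    proof -
      have "\<forall>P\<in>V. \<exists>V' m f. openin (zariski R) V' \<and> P \<in> V' \<and> V' \<subseteq> V \<and> m \<in> carrier R \<and> f \<in> carrier R \<and>
          (\<forall>Q\<in>V'. f \<notin> Q \<and> s Q = fraction (regular_module R) (carrier R - Q) m f)"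
        using s unfolding local_fractions_def mem_Collect_eq regular_module_simps by (rule conjunct2)
      moreover have "\<phi> p \<in> V" using p by simp
      ultimately show ?thesis by (rule bspec)
    qed
    then obtain V' m f where V': "openin (zariski R) V'" "\<phi> p \<in> V'" "V' \<subseteq> V"
      and m: "m \<in> carrier R" and f: "f \<in> carrier R"
      and s': "\<And>Q. Q \<in> V' \<Longrightarrow> f \<notin> Q \<and> s Q = fraction (regular_module R) (carrier R - Q) m f"
      by metis
    have pU: "p \<in> U" using p by blast
    have "unit_at T A U (\<rho> f) p"
      by (rule unit_iff[OF f pU, THEN iffD2, OF s'[OF V'(2), THEN conjunct1]])
    then obtain W0 b where W0: "openin T W0" "p \<in> W0" "W0 \<subseteq> U" "b \<in> Sec A W0"
      "b \<otimes>\<^bsub>sect A W0\<^esub> res A U W0 (\<rho> f) = \<one>\<^bsub>sect A W0\<^esub>" unfolding unit_at_def by blast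
    define W where "W = W0 \<inter> pre V'"
    have W: "openin T W" "p \<in> W" "W \<subseteq> W0" "W \<subseteq> pre V" "W \<subseteq> U"
      using W0 pU V' openin_vimage[OF V'(1)] by (auto simp: W_def)
    interpret W: cring "sect A W" by (rule cring_sect[OF W(1)])
    define c where "c = res A W0 W b \<otimes>\<^bsub>sect A W\<^esub> res A U W (\<rho> m)"
    have cc: "c \<in> Sec A W" using W W0 open_U m by (auto simp: c_def)
    have inv: "res A W0 W b \<otimes>\<^bsub>sect A W\<^esub> res A U W (\<rho> f) = \<one>\<^bsub>sect A W\<^esub>"
      using arg_cong[OF W0(5), of "res A W0 W"] W0(1-4) W open_U f by simp
    have "res A U W (\<rho> f) \<otimes>\<^bsub>sect A W\<^esub> c = (res A W0 W b \<otimes>\<^bsub>sect A W\<^esub> res A U W (\<rho> f)) \<otimes>\<^bsub>sect A W\<^esub> res A U W (\<rho> m)"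
      using W W0(1-4) open_U m f by (simp add: c_def W.m_ac)
    also have "\<dots> = res A U W (\<rho> m)" unfolding inv using W open_U m by simp
    finally have eq: "res A U W (\<rho> f) \<otimes>\<^bsub>sect A W\<^esub> res A W W c = res A U W (\<rho> m)"
      using cc W by simp
    have "Q W c" unfolding Q_def
    proof
      fix q assume q: "q \<in> W"
      then have "\<phi> q \<in> V'" by (auto simp: W_def)
      then have "f \<notin> \<phi> q" "s (\<phi> q) = fraction (regular_module R) (carrier R - \<phi> q) m f" using s' by simp_all
      then show "value_at W c q = s (\<phi> q)"
        using value_at_eq[OF W(1,5) cc q m f _ W(1) q subset_refl eq] by simp
    qed
    then show "\<exists>W y. openin T W \<and> p \<in> W \<and> W \<subseteq> pre V \<and> y \<in> Sec A W \<and> Q W y"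
      using W cc by blast
  qed
  have "\<exists>a\<in>Sec A (pre V). \<forall>W b. openin T W \<and> W \<subseteq> pre V \<and> b \<in> Sec A W \<and> Q W b \<longrightarrow>
      res A (pre V) W a = b"
  proof (rule glue[OF pre(1), of Q])
    show "\<exists>W y. openin T W \<and> p \<in> W \<and> W \<subseteq> pre V \<and> y \<in> Sec A W \<and> Q W y" if "p \<in> pre V" for p
      by (rule ex[OF that])
  next
    fix W x W' y assume W: "openin T W" "W \<subseteq> pre V" "x \<in> Sec A W" "Q W x"
      and W': "openin T W'" "W' \<subseteq> pre V" "y \<in> Sec A W'" "Q W' y"
    define B where "B = W \<inter> W'"
    have B: "openin T B" "B \<subseteq> W" "B \<subseteq> W'" "B \<subseteq> U" "W \<subseteq> U" "W' \<subseteq> U" using W W' by (auto simp: B_def)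
    have xy: "res A W B x \<in> Sec A B" "res A W' B y \<in> Sec A B"
      using B W W' by auto
    have "res A W B x = res A W' B y"
    proof (rule local_eq[OF B(1) xy])
      fix p assume p: "p \<in> B"
      then have "value_at W x p = s (\<phi> p)" "value_at W' y p = s (\<phi> p)"
        using W(4) W'(4) B(2,3) unfolding Q_def by blast+
      then have "value_at B (res A W B x) p = value_at B (res A W' B y) p"
        using value_at_res[OF W(1) B(5) W(3) B(1,2) p] value_at_res[OF W'(1) B(6) W'(3) B(1,3) p] by simp
      then show "\<exists>Y. openin T Y \<and> p \<in> Y \<and> Y \<subseteq> B \<and> res A B Y (res A W B x) = res A B Y (res A W' B y)"
        by (rule value_at_locally_eq[OF B(1,4) xy p])
    qed
    then show "res A W (W \<inter> W') x = res A W' (W \<inter> W') y" by (simp add: B_def)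
  qed
  then obtain a where a: "a \<in> Sec A (pre V)"
    and "\<forall>W b. openin T W \<and> W \<subseteq> pre V \<and> b \<in> Sec A W \<and> Q W b \<longrightarrow> res A (pre V) W a = b"
    by (rule bexE)
  then have Qa: "openin T W \<Longrightarrow> W \<subseteq> pre V \<Longrightarrow> b \<in> Sec A W \<Longrightarrow> Q W b \<Longrightarrow> res A (pre V) W a = b" for W b
    by simp
  have "germ_values V a = s"
  proof
    fix P
    show "germ_values V a P = s P"
    proof (cases "P \<in> V")
      case False
      with s[unfolded local_fractions_def mem_Collect_eq, THEN conjunct1] have "s P = undefined"
        by (rule PiE_arb)
      then show ?thesis using False by (simp add: germ_values_def)
    next
      case True
      then obtain p where p: "p \<in> pre V" "P = \<phi> p" by (rule point_of[OF V])
      obtain W c where W: "openin T W" "p \<in> W" "W \<subseteq> pre V" "c \<in> Sec A W" "Q W c"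
        using ex[OF p(1)] by blast
      have "value_at (pre V) a p = value_at W (res A (pre V) W a) p"
        using value_at_res[OF pre a W(1,3,2)] by simp
      also have "\<dots> = s (\<phi> p)" using Qa[OF W(1,3,4,5)] W(2,5) unfolding Q_def by simp
      finally show ?thesis unfolding p(2) germ_values_phi[OF p(1)] .
    qed
  qed
  then show ?thesis using a by blast
qed

text \<open>Expressions of two sections, restricted to a common neighbourhood, multiply and add to
  expressions of the product and the sum, whichever pairs represent the two values. This is the
  independence of representatives that the unions in \<open>loc_ring\<close> require.\<close>

lemma value_at_mult:
  assumes V: "openin T V" "V \<subseteq> U" and a: "a \<in> Sec A V" and b: "b \<in> Sec A V"
    and p: "p \<in> V"
  shows "value_at V (a \<otimes>\<^bsub>sect A V\<^esub> b) p = value_at V a p \<otimes>\<^bsub>loc_ring R (carrier R - \<phi> p)\<^esub> value_at V b p"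
    and "value_at V (a \<oplus>\<^bsub>sect A V\<^esub> b) p = value_at V a p \<oplus>\<^bsub>loc_ring R (carrier R - \<phi> p)\<^esub> value_at V b p"
proof -
  let ?fr = "fraction (regular_module R) (carrier R - \<phi> p)"
  have pU: "p \<in> U" using p V by blast
  have *: "?fr (x \<otimes> y) (t \<otimes> u) = value_at V (a \<otimes>\<^bsub>sect A V\<^esub> b) p"
    "?fr (u \<otimes> x \<oplus> t \<otimes> y) (t \<otimes> u) = value_at V (a \<oplus>\<^bsub>sect A V\<^esub> b) p"
    if xt: "(x, t) \<in> value_at V a p" and yu: "(y, u) \<in> value_at V b p" for x t y u
  proof -
    obtain W where x: "x \<in> carrier R" "t \<in> carrier R" "t \<notin> \<phi> p" and W: "openin T W" "p \<in> W" "W \<subseteq> V"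
      and eq1: "res A U W (\<rho> t) \<otimes>\<^bsub>sect A W\<^esub> res A V W a = res A U W (\<rho> x)"
      using xt by (rule value_at_memD)
    obtain W' where y: "y \<in> carrier R" "u \<in> carrier R" "u \<notin> \<phi> p" and W': "openin T W'" "p \<in> W'" "W' \<subseteq> V"
      and eq2: "res A U W' (\<rho> u) \<otimes>\<^bsub>sect A W'\<^esub> res A V W' b = res A U W' (\<rho> y)"
      using yu by (rule value_at_memD)
    define B where "B = W \<inter> W'"
    have B: "openin T B" "p \<in> B" "B \<subseteq> V" "B \<subseteq> W" "B \<subseteq> W'" "B \<subseteq> U" "W \<subseteq> U" "W' \<subseteq> U"
      using W W' V by (auto simp: B_def)
    interpret B: cring "sect A B" by (rule cring_sect[OF B(1)])
    have c: "res A U B (\<rho> t) \<in> Sec A B" "res A U B (\<rho> u) \<in> Sec A B"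
      "res A V B a \<in> Sec A B" "res A V B b \<in> Sec A B"
      using B V open_U a b x y by auto
    have 1: "res A U B (\<rho> t) \<otimes>\<^bsub>sect A B\<^esub> res A V B a = res A U B (\<rho> x)"
      using arg_cong[OF eq1, of "res A W B"] B W V open_U a x by simp
    have 2: "res A U B (\<rho> u) \<otimes>\<^bsub>sect A B\<^esub> res A V B b = res A U B (\<rho> y)"
      using arg_cong[OF eq2, of "res A W' B"] B W' V open_U b y by simp
    have tu: "t \<otimes> u \<in> carrier R" "t \<otimes> u \<notin> \<phi> p" using not_mem_mult[OF pU] x y by auto
    have m: "res A U B (\<rho> (t \<otimes> u)) \<otimes>\<^bsub>sect A B\<^esub> res A V B (a \<otimes>\<^bsub>sect A V\<^esub> b) = res A U B (\<rho> (x \<otimes> y))"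
    proof -
      have "res A U B (\<rho> (t \<otimes> u)) \<otimes>\<^bsub>sect A B\<^esub> res A V B (a \<otimes>\<^bsub>sect A V\<^esub> b)
          = (res A U B (\<rho> t) \<otimes>\<^bsub>sect A B\<^esub> res A V B a) \<otimes>\<^bsub>sect A B\<^esub> (res A U B (\<rho> u) \<otimes>\<^bsub>sect A B\<^esub> res A V B b)"
        using B V open_U a b x y c by (simp add: B.m_ac)
      then show ?thesis unfolding 1 2 using B open_U x y by simp
    qed
    have s: "res A U B (\<rho> (t \<otimes> u)) \<otimes>\<^bsub>sect A B\<^esub> res A V B (a \<oplus>\<^bsub>sect A V\<^esub> b) = res A U B (\<rho> (u \<otimes> x \<oplus> t \<otimes> y))"
    proof -
      have "res A U B (\<rho> (t \<otimes> u)) \<otimes>\<^bsub>sect A B\<^esub> res A V B (a \<oplus>\<^bsub>sect A V\<^esub> b)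
          = res A U B (\<rho> u) \<otimes>\<^bsub>sect A B\<^esub> (res A U B (\<rho> t) \<otimes>\<^bsub>sect A B\<^esub> res A V B a)
            \<oplus>\<^bsub>sect A B\<^esub> res A U B (\<rho> t) \<otimes>\<^bsub>sect A B\<^esub> (res A U B (\<rho> u) \<otimes>\<^bsub>sect A B\<^esub> res A V B b)"
        using B V open_U a b x y c by (simp add: B.m_ac B.r_distr)
      then show ?thesis unfolding 1 2 using B open_U x y by simp
    qed
    have o: "a \<otimes>\<^bsub>sect A V\<^esub> b \<in> Sec A V" "a \<oplus>\<^bsub>sect A V\<^esub> b \<in> Sec A V"
      using V a b by auto
    show "?fr (x \<otimes> y) (t \<otimes> u) = value_at V (a \<otimes>\<^bsub>sect A V\<^esub> b) p"
      using value_at_eq[OF V o(1) p _ tu B(1-3) m] x y by simp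
    show "?fr (u \<otimes> x \<oplus> t \<otimes> y) (t \<otimes> u) = value_at V (a \<oplus>\<^bsub>sect A V\<^esub> b) p"
      using value_at_eq[OF V o(2) p _ tu B(1-3) s] x y by simp
  qed
  obtain x t where xt: "(x, t) \<in> value_at V a p" by (rule value_at_nonempty[OF V a p])
  obtain y u where yu: "(y, u) \<in> value_at V b p" by (rule value_at_nonempty[OF V b p])
  have "value_at V a p \<otimes>\<^bsub>loc_ring R (carrier R - \<phi> p)\<^esub> value_at V b p = value_at V (a \<otimes>\<^bsub>sect A V\<^esub> b) p"
    unfolding loc_ring_def Let_def monoid.simps by (rule UN_pair_const[OF xt yu *(1)])
  then show "value_at V (a \<otimes>\<^bsub>sect A V\<^esub> b) p = value_at V a p \<otimes>\<^bsub>loc_ring R (carrier R - \<phi> p)\<^esub> value_at V b p" ..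
  have "value_at V a p \<oplus>\<^bsub>loc_ring R (carrier R - \<phi> p)\<^esub> value_at V b p = value_at V (a \<oplus>\<^bsub>sect A V\<^esub> b) p"
    unfolding loc_ring_def Let_def ring.simps by (rule UN_pair_const[OF xt yu *(2)])
  then show "value_at V (a \<oplus>\<^bsub>sect A V\<^esub> b) p = value_at V a p \<oplus>\<^bsub>loc_ring R (carrier R - \<phi> p)\<^esub> value_at V b p" ..
qed

lemma value_at_one:
  assumes V: "openin T V" "V \<subseteq> U" and p: "p \<in> V"
  shows "value_at V \<one>\<^bsub>sect A V\<^esub> p = \<one>\<^bsub>loc_ring R (carrier R - \<phi> p)\<^esub>"
proof -
  interpret V: cring "sect A V" by (rule cring_sect[OF V(1)])
  have pU: "p \<in> U" using p V by blast
  have 1: "\<one> \<notin> \<phi> p" using D_one pU by blast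
  have "value_at V \<one>\<^bsub>sect A V\<^esub> p = fraction (regular_module R) (carrier R - \<phi> p) \<one> \<one>"
    by (rule value_at_eq[OF V V.one_closed p _ _ 1 V(1) p subset_refl]) (use V open_U in auto)
  then show ?thesis by (simp add: loc_ring_def Let_def)
qed

lemma germ_values_iso: "ring_sheaf_iso (zariski R) (direct_image U \<phi> A) (spec_sheaf R) germ_values"
proof -
  have di: "sect (direct_image U \<phi> A) V = sect A (pre V)"
    "res (direct_image U \<phi> A) V W = res A (pre V) (pre W)" for V W
    by (simp_all add: direct_image_def)
  have sp: "Sec (spec_sheaf R) V = local_fractions R (regular_module R) V"
    "res (spec_sheaf R) V W s = restrict s W"
    "x \<otimes>\<^bsub>sect (spec_sheaf R) V\<^esub> y = (\<lambda>P\<in>V. x P \<otimes>\<^bsub>loc_ring R (carrier R - P)\<^esub> y P)"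
    "x \<oplus>\<^bsub>sect (spec_sheaf R) V\<^esub> y = (\<lambda>P\<in>V. x P \<oplus>\<^bsub>loc_ring R (carrier R - P)\<^esub> y P)"
    "\<one>\<^bsub>sect (spec_sheaf R) V\<^esub> = (\<lambda>P\<in>V. \<one>\<^bsub>loc_ring R (carrier R - P)\<^esub>)" for V W s x y
    by (simp_all add: spec_sheaf_def)
  have eqI: "germ_values V a = (\<lambda>P\<in>V. f P)"
    if V: "openin (zariski R) V" and eq: "\<And>p. p \<in> pre V \<Longrightarrow> value_at (pre V) a p = f (\<phi> p)" for V a f
  proof
    fix P show "germ_values V a P = (\<lambda>P\<in>V. f P) P"
    proof (cases "P \<in> V")
      case True
      then obtain p where p: "p \<in> pre V" "P = \<phi> p" by (rule point_of[OF V])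
      show ?thesis unfolding p(2) germ_values_phi[OF p(1)] using eq[OF p(1)] p by simp
    qed (simp add: germ_values_def)
  qed
  have "germ_values V \<in> ring_hom (sect A (pre V)) (sect (spec_sheaf R) V)"
    if V: "openin (zariski R) V" for V
  proof -
    have pre: "openin T (pre V)" "pre V \<subseteq> U" using openin_vimage[OF V] by auto
    show ?thesis
    proof (rule ring_hom_memI)
      show "germ_values V a \<in> Sec (spec_sheaf R) V" if "a \<in> Sec A (pre V)" for a
        unfolding sp by (rule germ_values_closed[OF V that])
    next
      fix a b assume a: "a \<in> Sec A (pre V)" and b: "b \<in> Sec A (pre V)"
      show "germ_values V (a \<otimes>\<^bsub>sect A (pre V)\<^esub> b) = germ_values V a \<otimes>\<^bsub>sect (spec_sheaf R) V\<^esub> germ_values V b"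
        unfolding sp by (rule eqI[OF V]) (simp only: germ_values_phi value_at_mult[OF pre a b])
      show "germ_values V (a \<oplus>\<^bsub>sect A (pre V)\<^esub> b) = germ_values V a \<oplus>\<^bsub>sect (spec_sheaf R) V\<^esub> germ_values V b"
        unfolding sp by (rule eqI[OF V]) (simp only: germ_values_phi value_at_mult[OF pre a b])
    next
      show "germ_values V \<one>\<^bsub>sect A (pre V)\<^esub> = \<one>\<^bsub>sect (spec_sheaf R) V\<^esub>"
        unfolding sp by (rule eqI[OF V]) (rule value_at_one[OF pre])
    qed
  qed
  moreover have "bij_betw (germ_values V) (Sec A (pre V)) (local_fractions R (regular_module R) V)"
    if V: "openin (zariski R) V" for V
    using germ_values_inj[OF V] germ_values_closed[OF V] germ_values_surj[OF V] unfolding bij_betw_def by blast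
  moreover have "germ_values W (res A (pre V) (pre W) a) = restrict (germ_values V a) W"
    if V: "openin (zariski R) V" and W: "openin (zariski R) W" "W \<subseteq> V"
      and a: "a \<in> Sec A (pre V)" for V W a
  proof (rule eqI[OF W(1)])
    fix p assume p: "p \<in> pre W"
    have pV: "openin T (pre V)" "pre V \<subseteq> U" "openin T (pre W)" "pre W \<subseteq> pre V" "p \<in> pre V"
      using openin_vimage[OF V] openin_vimage[OF W(1)] W(2) p by auto
    show "value_at (pre W) (res A (pre V) (pre W) a) p = germ_values V a (\<phi> p)"
      unfolding germ_values_phi[OF pV(5)] by (rule value_at_res[OF pV(1,2) a pV(3,4) p])
  qed
  ultimately show ?thesis
    by (simp add: ring_sheaf_iso_def ring_sheaf_hom_def commutes_with_res_def di sp)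
qed

theorem affine_chart: "\<exists>\<psi>. affine_chart T A U R \<phi> \<psi>"
proof -
  have "is_presheaf (zariski R) (direct_image U \<phi> A)"
    unfolding is_presheaf_def direct_image_def presheaf.simps
  proof (intro conjI allI impI ballI; (elim conjE)?)
    fix V x assume V: "openin (zariski R) V" and x: "x \<in> Sec A (pre V)"
    then show "res A (pre V) (pre V) x = x" using openin_vimage[OF V] by simp
  next
    fix V W assume V: "openin (zariski R) V" "openin (zariski R) W" "W \<subseteq> V"
    then have "pre W \<subseteq> pre V" by blast
    then show "res A (pre V) (pre W) \<in> Sec A (pre V) \<rightarrow> Sec A (pre W)"
      using V(1,2)[THEN openin_vimage] by blast
  next
    fix V W W' x assume V: "openin (zariski R) V" "openin (zariski R) W" "openin (zariski R) W'"
      and sub: "W' \<subseteq> W" "W \<subseteq> V" and x: "x \<in> Sec A (pre V)"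
    have "pre W \<subseteq> pre V" "pre W' \<subseteq> pre W" using sub by blast+
    then show "res A (pre W) (pre W') (res A (pre V) (pre W) x) = res A (pre V) (pre W') x"
      using V[THEN openin_vimage] x by simp
  qed
  moreover have "ring (sect (direct_image U \<phi> A) V)" if "openin (zariski R) V" for V
    using cring_sect[OF openin_vimage[OF that]] by (simp add: direct_image_def cring.axioms)
  ultimately have "\<exists>\<psi>. ring_sheaf_iso (zariski R) (spec_sheaf R) (direct_image U \<phi> A) \<psi>"
    using ring_sheaf_iso_inverse[OF germ_values_iso] by blast
  then show ?thesis unfolding affine_chart_def using open_U R.is_cring homeomorphic by blast
qed

end

section \<open>From affine charts to presentations\<close>

lemma homeomorphic_zariskiD:
  assumes hom: "homeomorphic_map (subtopology T U) (zariski R) \<phi>" and U: "openin T U"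
  shows "bij_betw \<phi> U (Spec R)"
    and "openin (zariski R) V \<Longrightarrow> openin T {p \<in> U. \<phi> p \<in> V}"
    and "\<lbrakk>openin T W; W \<subseteq> U\<rbrakk> \<Longrightarrow> openin (zariski R) (\<phi> ` W)"
proof -
  have tU: "topspace (subtopology T U) = U" using openin_subset[OF U] by auto
  \<comment> \<open>A prime ideal is proper, so the set \<open>carrier R\<close> defines the whole
    spectrum as an open set.\<close>
  have "openin (zariski R) (Spec R)"
  proof -
    have "\<not> carrier R \<subseteq> P" if "P \<in> Spec R" for P
    proof -
      interpret primeideal P R using that by (simp add: Spec_def)
      show ?thesis using I_notcarr Icarr by blast
    qed
    then have "Spec R = {P \<in> Spec R. \<not> carrier R \<subseteq> P}" by blast
    then show ?thesis unfolding openin_zariski by blast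
  qed
  moreover have "V \<subseteq> Spec R" if "openin (zariski R) V" for V
    using that unfolding openin_zariski by blast
  ultimately have tR: "topspace (zariski R) = Spec R"
    by (metis openin_subset openin_topspace subset_antisym)
  show "bij_betw \<phi> U (Spec R)"
    using hom homeomorphic_imp_surjective_map homeomorphic_imp_injective_map tU tR
    unfolding bij_betw_def by metis
  show "openin T {p \<in> U. \<phi> p \<in> V}" if "openin (zariski R) V"
  proof -
    have "continuous_map (subtopology T U) (zariski R) \<phi>"
      using hom by (rule homeomorphic_imp_continuous_map)
    then have "openin (subtopology T U) {p \<in> U. \<phi> p \<in> V}"
      using that unfolding continuous_map_def tU by blast
    then show ?thesis using U by (simp add: openin_open_subtopology)
  qed
  show "openin (zariski R) (\<phi> ` W)" if "openin T W" "W \<subseteq> U"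
    using homeomorphic_imp_open_map[OF hom] that U by (simp add: open_map_def openin_open_subtopology)
qed

section \<open>Fractions of a module at a prime ideal\<close>

locale module_at_prime = module R M + prime: primeideal P R
  for R :: "'r ring" (structure) and M :: "('r, 'm) module" and P :: "'r set"
begin

lemma not_in_prime:
  "\<one> \<in> carrier R - P"
  "\<lbrakk>s \<in> carrier R - P; t \<in> carrier R - P\<rbrakk> \<Longrightarrow> s \<otimes> t \<in> carrier R - P"
  using prime.I_notcarr prime.one_imp_carrier prime.I_prime by auto

lemma fraction_self: "\<lbrakk>m \<in> carrier M; s \<in> carrier R - P\<rbrakk> \<Longrightarrow> (m, s) \<in> fraction M (carrier R - P) m s"
  using not_in_prime(1) by (auto simp: fraction_def)

text \<open>Transitivity of equality of fractions. If \<open>u\<close> witnesses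
  \<open>m/s = n/t\<close> and \<open>w\<close> witnesses \<open>m/s = k/v\<close>, then
  \<open>u \<otimes> w \<otimes> s\<close> witnesses \<open>n/t = k/v\<close>, and all three factors
  avoid \<open>P\<close>.\<close>

lemma fraction_subset:
  assumes m: "m \<in> carrier M" and n: "n \<in> carrier M" and s: "s \<in> carrier R - P" and t: "t \<in> carrier R - P"
    and u: "u \<in> carrier R - P" and eq: "u \<odot>\<^bsub>M\<^esub> (t \<odot>\<^bsub>M\<^esub> m) = u \<odot>\<^bsub>M\<^esub> (s \<odot>\<^bsub>M\<^esub> n)"
  shows "fraction M (carrier R - P) m s \<subseteq> fraction M (carrier R - P) n t"
proof (rule subrelI)
  fix k v assume "(k, v) \<in> fraction M (carrier R - P) m s"
  then obtain w where k: "k \<in> carrier M" and v: "v \<in> carrier R - P" and w: "w \<in> carrier R - P"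
    and eq': "w \<odot>\<^bsub>M\<^esub> (v \<odot>\<^bsub>M\<^esub> m) = w \<odot>\<^bsub>M\<^esub> (s \<odot>\<^bsub>M\<^esub> k)" by (auto simp: fraction_def)
  have c: "u \<in> carrier R" "s \<in> carrier R" "t \<in> carrier R" "v \<in> carrier R" "w \<in> carrier R"
    using u s t v w by auto
  have "(u \<otimes> w \<otimes> s) \<odot>\<^bsub>M\<^esub> (v \<odot>\<^bsub>M\<^esub> n) = (w \<otimes> v) \<odot>\<^bsub>M\<^esub> (u \<odot>\<^bsub>M\<^esub> (s \<odot>\<^bsub>M\<^esub> n))"
    using c n by (simp add: smult_assoc1[symmetric] m_ac)
  also have "\<dots> = (u \<otimes> t) \<odot>\<^bsub>M\<^esub> (w \<odot>\<^bsub>M\<^esub> (v \<odot>\<^bsub>M\<^esub> m))"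
    unfolding eq[symmetric] using c m by (simp add: smult_assoc1[symmetric] m_ac)
  also have "\<dots> = (u \<otimes> w \<otimes> s) \<odot>\<^bsub>M\<^esub> (t \<odot>\<^bsub>M\<^esub> k)"
    unfolding eq' using c k by (simp add: smult_assoc1[symmetric] m_ac)
  finally show "(k, v) \<in> fraction M (carrier R - P) n t"
    using k v not_in_prime(2)[OF not_in_prime(2)[OF u w] s] unfolding fraction_def by blast
qed

lemma fraction_eqI:
  assumes "m \<in> carrier M" "n \<in> carrier M" "s \<in> carrier R - P" "t \<in> carrier R - P"
    "u \<in> carrier R - P" "u \<odot>\<^bsub>M\<^esub> (t \<odot>\<^bsub>M\<^esub> m) = u \<odot>\<^bsub>M\<^esub> (s \<odot>\<^bsub>M\<^esub> n)"
  shows "fraction M (carrier R - P) m s = fraction M (carrier R - P) n t"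
  using fraction_subset[OF assms] fraction_subset[OF assms(2,1,4,3,5) assms(6)[symmetric]] by blast

lemma fraction_eqD:
  assumes "m \<in> carrier M" "n \<in> carrier M" "s \<in> carrier R - P" "t \<in> carrier R - P"
    "fraction M (carrier R - P) m s = fraction M (carrier R - P) n t"
  obtains u where "u \<in> carrier R - P" "u \<odot>\<^bsub>M\<^esub> (t \<odot>\<^bsub>M\<^esub> m) = u \<odot>\<^bsub>M\<^esub> (s \<odot>\<^bsub>M\<^esub> n)"
proof -
  have "(n, t) \<in> fraction M (carrier R - P) m s" using fraction_self[OF assms(2,4)] assms(5) by simp
  then show ?thesis using that by (auto simp: fraction_def)
qed

text \<open>Independence of representatives: if \<open>u\<close> and \<open>v\<close> witness the
  changes of representative of the two summands, then \<open>u \<otimes> v\<close> witnesses the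
  change of the sum.\<close>

lemma fraction_add:
  assumes m: "m \<in> carrier M" and n: "n \<in> carrier M" and s: "s \<in> carrier R - P" and t: "t \<in> carrier R - P"
  shows "fraction M (carrier R - P) m s \<oplus>\<^bsub>loc_module R (carrier R - P) M\<^esub> fraction M (carrier R - P) n t
    = fraction M (carrier R - P) (t \<odot>\<^bsub>M\<^esub> m \<oplus>\<^bsub>M\<^esub> s \<odot>\<^bsub>M\<^esub> n) (s \<otimes> t)"
proof -
  let ?fr = "fraction M (carrier R - P)"
  have *: "?fr (t' \<odot>\<^bsub>M\<^esub> m' \<oplus>\<^bsub>M\<^esub> s' \<odot>\<^bsub>M\<^esub> n') (s' \<otimes> t') = ?fr (t \<odot>\<^bsub>M\<^esub> m \<oplus>\<^bsub>M\<^esub> s \<odot>\<^bsub>M\<^esub> n) (s \<otimes> t)"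
    if ms: "(m', s') \<in> ?fr m s" and nt: "(n', t') \<in> ?fr n t" for m' s' n' t'
  proof -
    obtain u where m': "m' \<in> carrier M" and s': "s' \<in> carrier R - P" and u: "u \<in> carrier R - P"
      "u \<odot>\<^bsub>M\<^esub> (s' \<odot>\<^bsub>M\<^esub> m) = u \<odot>\<^bsub>M\<^esub> (s \<odot>\<^bsub>M\<^esub> m')" using ms by (auto simp: fraction_def)
    obtain v where n': "n' \<in> carrier M" and t': "t' \<in> carrier R - P" and v: "v \<in> carrier R - P"
      "v \<odot>\<^bsub>M\<^esub> (t' \<odot>\<^bsub>M\<^esub> n) = v \<odot>\<^bsub>M\<^esub> (t \<odot>\<^bsub>M\<^esub> n')" using nt by (auto simp: fraction_def)
    have c: "u \<in> carrier R" "v \<in> carrier R" "s \<in> carrier R" "s' \<in> carrier R" "t \<in> carrier R" "t' \<in> carrier R"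
      using u v s s' t t' by auto
    have "(u \<otimes> v) \<odot>\<^bsub>M\<^esub> ((s \<otimes> t) \<odot>\<^bsub>M\<^esub> (t' \<odot>\<^bsub>M\<^esub> m' \<oplus>\<^bsub>M\<^esub> s' \<odot>\<^bsub>M\<^esub> n'))
        = (v \<otimes> t \<otimes> t') \<odot>\<^bsub>M\<^esub> (u \<odot>\<^bsub>M\<^esub> (s \<odot>\<^bsub>M\<^esub> m')) \<oplus>\<^bsub>M\<^esub> (u \<otimes> s \<otimes> s') \<odot>\<^bsub>M\<^esub> (v \<odot>\<^bsub>M\<^esub> (t \<odot>\<^bsub>M\<^esub> n'))"
      using c m' n' by (simp add: smult_assoc1[symmetric] smult_r_distr m_ac)
    also have "\<dots> = (u \<otimes> v) \<odot>\<^bsub>M\<^esub> ((s' \<otimes> t') \<odot>\<^bsub>M\<^esub> (t \<odot>\<^bsub>M\<^esub> m \<oplus>\<^bsub>M\<^esub> s \<odot>\<^bsub>M\<^esub> n))"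
      unfolding u(2)[symmetric] v(2)[symmetric]
      using c m n by (simp add: smult_assoc1[symmetric] smult_r_distr m_ac)
    finally show ?thesis
      by (intro fraction_eqI[OF _ _ _ _ not_in_prime(2)[OF u(1) v(1)]])
        (use c m n m' n' not_in_prime(2) s s' t t' in auto)
  qed
  show ?thesis unfolding loc_module_def ring.simps
    by (rule UN_pair_const[OF fraction_self[OF m s] fraction_self[OF n t] *])
qed

lemma fraction_smult:
  assumes a: "a \<in> carrier R" and n: "n \<in> carrier M" and s: "s \<in> carrier R - P" and t: "t \<in> carrier R - P"
  shows "fraction (regular_module R) (carrier R - P) a s \<odot>\<^bsub>loc_module R (carrier R - P) M\<^esub>
    fraction M (carrier R - P) n t = fraction M (carrier R - P) (a \<odot>\<^bsub>M\<^esub> n) (s \<otimes> t)"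
proof -
  let ?fr = "fraction M (carrier R - P)" and ?fa = "fraction (regular_module R) (carrier R - P)"
  have *: "?fr (a' \<odot>\<^bsub>M\<^esub> n') (s' \<otimes> t') = ?fr (a \<odot>\<^bsub>M\<^esub> n) (s \<otimes> t)"
    if ms: "(a', s') \<in> ?fa a s" and nt: "(n', t') \<in> ?fr n t" for a' s' n' t'
  proof -
    obtain u where a': "a' \<in> carrier R" and s': "s' \<in> carrier R - P" and u: "u \<in> carrier R - P"
      "u \<otimes> (s' \<otimes> a) = u \<otimes> (s \<otimes> a')" using ms by (auto simp: fraction_def)
    obtain v where n': "n' \<in> carrier M" and t': "t' \<in> carrier R - P" and v: "v \<in> carrier R - P"
      "v \<odot>\<^bsub>M\<^esub> (t' \<odot>\<^bsub>M\<^esub> n) = v \<odot>\<^bsub>M\<^esub> (t \<odot>\<^bsub>M\<^esub> n')" using nt by (auto simp: fraction_def)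
    have c: "u \<in> carrier R" "v \<in> carrier R" "s \<in> carrier R" "s' \<in> carrier R" "t \<in> carrier R" "t' \<in> carrier R"
      using u v s s' t t' by auto
    have "(u \<otimes> v) \<odot>\<^bsub>M\<^esub> ((s \<otimes> t) \<odot>\<^bsub>M\<^esub> (a' \<odot>\<^bsub>M\<^esub> n')) = (u \<otimes> (s \<otimes> a')) \<odot>\<^bsub>M\<^esub> (v \<odot>\<^bsub>M\<^esub> (t \<odot>\<^bsub>M\<^esub> n'))"
      using c a' n' by (simp add: smult_assoc1[symmetric] m_ac)
    also have "\<dots> = (u \<otimes> v) \<odot>\<^bsub>M\<^esub> ((s' \<otimes> t') \<odot>\<^bsub>M\<^esub> (a \<odot>\<^bsub>M\<^esub> n))"
      unfolding u(2)[symmetric] v(2)[symmetric] using c a n by (simp add: smult_assoc1[symmetric] m_ac)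
    finally show ?thesis
      by (intro fraction_eqI[OF _ _ _ _ not_in_prime(2)[OF u(1) v(1)]])
        (use c a n a' n' not_in_prime(2) s s' t t' in auto)
  qed
  interpret reg: module_at_prime R "regular_module R" P
    by (intro module_at_prime.intro regular_module_module is_cring prime.primeideal)
  have "(a, s) \<in> ?fa a s" using reg.fraction_self[of a s] a s by simp
  then show ?thesis unfolding loc_module_def module.simps
    by (rule UN_pair_const[OF _ fraction_self[OF n t] *])
qed

end

lemma loc_ring_regular:
  "x \<otimes>\<^bsub>loc_ring R S\<^esub> y = x \<odot>\<^bsub>loc_module R S (regular_module R)\<^esub> y"
  "x \<oplus>\<^bsub>loc_ring R S\<^esub> y = x \<oplus>\<^bsub>loc_module R S (regular_module R)\<^esub> y"
  by (simp_all add: loc_ring_def loc_module_def Let_def)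

lemma direct_image_simps [simp]:
  "sect (direct_image U \<phi> F) V = sect F {p \<in> U. \<phi> p \<in> V}"
  "res (direct_image U \<phi> F) V W = res F {p \<in> U. \<phi> p \<in> V} {p \<in> U. \<phi> p \<in> W}"
  by (simp_all add: direct_image_def)

lemma restrict_scalars_simps [simp]:
  "Sec (restrict_scalars h F) U = Sec F U"
  "ring.add (sect (restrict_scalars h F) U) = ring.add (sect F U)"
  "ring.zero (sect (restrict_scalars h F) U) = ring.zero (sect F U)"
  "c \<odot>\<^bsub>sect (restrict_scalars h F) U\<^esub> x = h U c \<odot>\<^bsub>sect F U\<^esub> x"
  "res (restrict_scalars h F) = res F"
  by (simp_all add: restrict_scalars_def)

lemma tilde_simps [simp]:
  "Sec (tilde R M) V = local_fractions R M V"
  "x \<oplus>\<^bsub>sect (tilde R M) V\<^esub> y = (\<lambda>P\<in>V. x P \<oplus>\<^bsub>loc_module R (carrier R - P) M\<^esub> y P)"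
  "r \<odot>\<^bsub>sect (tilde R M) V\<^esub> y = (\<lambda>P\<in>V. r P \<odot>\<^bsub>loc_module R (carrier R - P) M\<^esub> y P)"
  "res (tilde R M) V W s = restrict s W"
  by (simp_all add: tilde_def)

lemma spec_sheaf_simps [simp]:
  "Sec (spec_sheaf R) V = local_fractions R (regular_module R) V"
  "res (spec_sheaf R) V W s = restrict s W"
  "x \<otimes>\<^bsub>sect (spec_sheaf R) V\<^esub> y = (\<lambda>P\<in>V. x P \<otimes>\<^bsub>loc_ring R (carrier R - P)\<^esub> y P)"
  "x \<oplus>\<^bsub>sect (spec_sheaf R) V\<^esub> y = (\<lambda>P\<in>V. x P \<oplus>\<^bsub>loc_ring R (carrier R - P)\<^esub> y P)"
  "\<one>\<^bsub>sect (spec_sheaf R) V\<^esub> = (\<lambda>P\<in>V. \<one>\<^bsub>loc_ring R (carrier R - P)\<^esub>)"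
  by (simp_all add: spec_sheaf_def)

text \<open>The section of the sheaf of \<open>M\<close> given by one fraction over all of
  \<open>V\<close>. With denominator one and \<open>V\<close> the whole spectrum it is the global
  section attached to \<open>m\<close>.\<close>

definition const_fraction ::
  "'r ring \<Rightarrow> ('r, 'm) module \<Rightarrow> 'r set set \<Rightarrow> 'm \<Rightarrow> 'r \<Rightarrow> 'r set \<Rightarrow> ('m \<times> 'r) set" where
  "const_fraction R M V m f = (\<lambda>P\<in>V. fraction M (carrier R - P) m f)"

section \<open>From a chart of a coherent sheaf to a presentation\<close>

locale module_chart = module_sheaf_on T A F + M: module R M
  for T :: "'p topology" and A :: "('p, 'a) ring_presheaf" and F :: "('p, 'a, 'm) mod_presheaf"
    and R :: "'r ring" (structure) and M :: "('r, 'n) module" +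
  fixes U :: "'p set" and \<phi> :: "'p \<Rightarrow> 'r set"
    and \<psi> :: "'r set set \<Rightarrow> ('r set \<Rightarrow> ('r \<times> 'r) set) \<Rightarrow> 'a"
    and \<theta> :: "'r set set \<Rightarrow> ('r set \<Rightarrow> ('n \<times> 'r) set) \<Rightarrow> 'm"
  assumes chart: "affine_chart T A U R \<phi> \<psi>"
    and theta_bij: "openin (zariski R) V \<Longrightarrow>
      bij_betw (\<theta> V) (Sec (tilde R M) V) (Sec (direct_image U \<phi> F) V)"
    and theta_hom: "mod_sheaf_hom (zariski R) (spec_sheaf R) (tilde R M)
      (restrict_scalars \<psi> (direct_image U \<phi> F)) \<theta>"
begin

lemma open_U: "openin T U" using chart by (simp add: affine_chart_def)

lemmas top = homeomorphic_zariskiD[OF _ open_U, of R \<phi>]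

lemma homeo: "homeomorphic_map (subtopology T U) (zariski R) \<phi>"
  using chart by (simp add: affine_chart_def)

lemmas bij = top(1)[OF homeo]
lemmas open_pre = top(2)[OF homeo]
lemmas open_image = top(3)[OF homeo]

abbreviation pre :: "'r set set \<Rightarrow> 'p set" where "pre V \<equiv> {p \<in> U. \<phi> p \<in> V}"

lemma open_Spec: "openin (zariski R) (Spec R)"
  using open_image[OF open_U subset_refl] bij by (simp add: bij_betw_def)

lemma pre_Spec: "pre (Spec R) = U"
  using bij_betwE[OF bij] by blast

lemma pre_image: "W \<subseteq> U \<Longrightarrow> pre (\<phi> ` W) = W"
  using bij by (auto simp: bij_betw_def inj_on_def)

lemma open_sub: "openin (zariski R) V \<Longrightarrow> V \<subseteq> Spec R"
  unfolding openin_zariski by blast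

lemma at_prime: "P \<in> Spec R \<Longrightarrow> module_at_prime R M P"
  by (intro module_at_prime.intro M.module_axioms) (simp add: Spec_def)

lemma regular_at_prime: "P \<in> Spec R \<Longrightarrow> module_at_prime R (regular_module R) P"
  by (intro module_at_prime.intro regular_module_module M.R.is_cring) (simp add: Spec_def)

lemma const_fraction_closed:
  assumes V: "openin (zariski R) V" and m: "m \<in> carrier N" and f: "f \<in> carrier R" "\<And>P. P \<in> V \<Longrightarrow> f \<notin> P"
  shows "const_fraction R N V m f \<in> local_fractions R N V"
proof -
  have "\<exists>V' m' f'. openin (zariski R) V' \<and> P \<in> V' \<and> V' \<subseteq> V \<and> m' \<in> carrier N \<and> f' \<in> carrier R \<and>
      (\<forall>Q\<in>V'. f' \<notin> Q \<and> const_fraction R N V m f Q = fraction N (carrier R - Q) m' f')" if "P \<in> V" for P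
    using assms that by (intro exI[of _ V] exI[of _ m] exI[of _ f]) (auto simp: const_fraction_def)
  moreover have "const_fraction R N V m f \<in>
      (\<Pi>\<^sub>E P\<in>V. {fraction N (carrier R - P) m f | m f. m \<in> carrier N \<and> f \<in> carrier R - P})"
    using m f unfolding const_fraction_def by (intro restrict_PiE_iff[THEN iffD2]) blast
  ultimately show ?thesis unfolding local_fractions_def by blast
qed

lemma one_notin: "P \<in> Spec R \<Longrightarrow> \<one> \<notin> P"
  using module_at_prime.not_in_prime(1)[OF at_prime] by blast

lemma restrict_const_fraction: "V \<subseteq> V' \<Longrightarrow> restrict (const_fraction R N V' m f) V = const_fraction R N V m f"
  by (auto simp: const_fraction_def restrict_def fun_eq_iff)

definition \<rho> where "\<rho> r = \<psi> (Spec R) (const_fraction R (regular_module R) (Spec R) r \<one>)"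
definition \<tau> where "\<tau> m = \<theta> (Spec R) (const_fraction R M (Spec R) m \<one>)"

lemma psi_iso: "ring_sheaf_iso (zariski R) (spec_sheaf R) (direct_image U \<phi> A) \<psi>"
  using chart by (simp add: affine_chart_def)

lemma psi_hom: "openin (zariski R) V \<Longrightarrow> \<psi> V \<in> ring_hom (sect (spec_sheaf R) V) (sect A (pre V))"
  using psi_iso by (simp add: ring_sheaf_iso_def ring_sheaf_hom_def)

lemma psi_bij: "openin (zariski R) V \<Longrightarrow>
    bij_betw (\<psi> V) (local_fractions R (regular_module R) V) (Sec A (pre V))"
  using psi_iso by (simp add: ring_sheaf_iso_def)

lemma psi_res: "\<lbrakk>openin (zariski R) V; openin (zariski R) W; W \<subseteq> V;
    s \<in> local_fractions R (regular_module R) V\<rbrakk> \<Longrightarrow> \<psi> W (restrict s W) = res A (pre V) (pre W) (\<psi> V s)"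
  using psi_iso by (simp add: ring_sheaf_iso_def ring_sheaf_hom_def commutes_with_res_def)

lemma theta_res: "\<lbrakk>openin (zariski R) V; openin (zariski R) W; W \<subseteq> V; s \<in> local_fractions R M V\<rbrakk>
    \<Longrightarrow> \<theta> W (restrict s W) = res F (pre V) (pre W) (\<theta> V s)"
  using theta_hom by (simp add: mod_sheaf_hom_def commutes_with_res_def)

lemma theta_bij': "openin (zariski R) V \<Longrightarrow>
    bij_betw (\<theta> V) (local_fractions R M V) (Sec F (pre V))"
  using theta_bij by simp

lemma theta_add: "\<lbrakk>openin (zariski R) V; x \<in> local_fractions R M V; y \<in> local_fractions R M V\<rbrakk>
    \<Longrightarrow> \<theta> V (\<lambda>P\<in>V. x P \<oplus>\<^bsub>loc_module R (carrier R - P) M\<^esub> y P) = \<theta> V x \<oplus>\<^bsub>sect F (pre V)\<^esub> \<theta> V y"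
  using theta_hom by (simp add: mod_sheaf_hom_def)

lemma theta_smult: "\<lbrakk>openin (zariski R) V; r \<in> local_fractions R (regular_module R) V; y \<in> local_fractions R M V\<rbrakk>
    \<Longrightarrow> \<theta> V (\<lambda>P\<in>V. r P \<odot>\<^bsub>loc_module R (carrier R - P) M\<^esub> y P) = \<psi> V r \<odot>\<^bsub>sect F (pre V)\<^esub> \<theta> V y"
  using theta_hom by (simp add: mod_sheaf_hom_def)

lemma res_rho:
  assumes V: "openin (zariski R) V" and r: "r \<in> carrier R"
  shows "res A U (pre V) (\<rho> r) = \<psi> V (const_fraction R (regular_module R) V r \<one>)"
proof -
  have "const_fraction R (regular_module R) (Spec R) r \<one> \<in> local_fractions R (regular_module R) (Spec R)"
    by (rule const_fraction_closed[OF open_Spec]) (use r one_notin in auto)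
  from psi_res[OF open_Spec V open_sub[OF V] this] show ?thesis
    unfolding \<rho>_def restrict_const_fraction[OF open_sub[OF V]] pre_Spec ..
qed

lemma res_tau:
  assumes V: "openin (zariski R) V" and m: "m \<in> carrier M"
  shows "res F U (pre V) (\<tau> m) = \<theta> V (const_fraction R M V m \<one>)"
proof -
  have "const_fraction R M (Spec R) m \<one> \<in> local_fractions R M (Spec R)"
    by (rule const_fraction_closed[OF open_Spec]) (use m one_notin in auto)
  from theta_res[OF open_Spec V open_sub[OF V] this] show ?thesis
    unfolding \<tau>_def restrict_const_fraction[OF open_sub[OF V]] pre_Spec ..
qed

lemma const_smult:
  assumes V: "V \<subseteq> Spec R" and a: "a \<in> carrier R" and m: "m \<in> carrier M"
    and s: "s \<in> carrier R" "\<And>P. P \<in> V \<Longrightarrow> s \<notin> P" and t: "t \<in> carrier R" "\<And>P. P \<in> V \<Longrightarrow> t \<notin> P"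
  shows "(\<lambda>P\<in>V. const_fraction R (regular_module R) V a s P \<odot>\<^bsub>loc_module R (carrier R - P) M\<^esub>
    const_fraction R M V m t P) = const_fraction R M V (a \<odot>\<^bsub>M\<^esub> m) (s \<otimes> t)"
proof
  fix P
  show "(\<lambda>P\<in>V. const_fraction R (regular_module R) V a s P \<odot>\<^bsub>loc_module R (carrier R - P) M\<^esub>
    const_fraction R M V m t P) P = const_fraction R M V (a \<odot>\<^bsub>M\<^esub> m) (s \<otimes> t) P"
  proof (cases "P \<in> V")
    case True
    then interpret module_at_prime R M P using V by (intro at_prime) blast
    show ?thesis using True s t fraction_smult[OF a m, of s t] by (simp add: const_fraction_def)
  qed (simp add: const_fraction_def)
qed

lemma const_add:
  assumes V: "V \<subseteq> Spec R" and m: "m \<in> carrier M" and n: "n \<in> carrier M"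
  shows "(\<lambda>P\<in>V. const_fraction R M V m \<one> P \<oplus>\<^bsub>loc_module R (carrier R - P) M\<^esub>
    const_fraction R M V n \<one> P) = const_fraction R M V (m \<oplus>\<^bsub>M\<^esub> n) \<one>"
proof
  fix P
  show "(\<lambda>P\<in>V. const_fraction R M V m \<one> P \<oplus>\<^bsub>loc_module R (carrier R - P) M\<^esub>
    const_fraction R M V n \<one> P) P = const_fraction R M V (m \<oplus>\<^bsub>M\<^esub> n) \<one> P"
  proof (cases "P \<in> V")
    case True
    then interpret module_at_prime R M P using V by (intro at_prime) blast
    show ?thesis using True fraction_add[OF m n not_in_prime(1) not_in_prime(1)] m n
      by (simp add: const_fraction_def)
  qed (simp add: const_fraction_def)
qed

lemma const_cancel:
  assumes V: "V \<subseteq> Spec R" and m: "m \<in> carrier M"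
    and s: "s \<in> carrier R" "\<And>P. P \<in> V \<Longrightarrow> s \<notin> P"
  shows "const_fraction R M V (s \<odot>\<^bsub>M\<^esub> m) s = const_fraction R M V m \<one>"
proof
  fix P
  show "const_fraction R M V (s \<odot>\<^bsub>M\<^esub> m) s P = const_fraction R M V m \<one> P"
  proof (cases "P \<in> V")
    case True
    then interpret module_at_prime R M P using V by (intro at_prime) blast
    show ?thesis using True s m
      fraction_eqI[of "s \<odot>\<^bsub>M\<^esub> m" m s \<one> \<one>, OF _ m _ not_in_prime(1) not_in_prime(1)]
      by (simp add: const_fraction_def)
  qed (simp add: const_fraction_def)
qed

text \<open>Sees the chart of the ring as a chart of the module \<open>R\<close> over itself, so
  that the facts proved for \<open>\<theta>\<close> apply to \<open>\<psi>\<close> and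
  multiplication of fractions is treated once.\<close>

lemma regular_chart: "module_chart T A (regular_sheaf A) R (regular_module R) U \<phi> \<psi> \<psi>"
proof (rule module_chart.intro[OF regular_module_sheaf_on regular_module_module[OF M.R.is_cring]],
    rule module_chart_axioms.intro[OF chart])
  show "bij_betw (\<psi> V) (Sec (tilde R (regular_module R)) V)
      (Sec (direct_image U \<phi> (regular_sheaf A)) V)" if "openin (zariski R) V" for V
    using psi_bij[OF that] by simp
  show "mod_sheaf_hom (zariski R) (spec_sheaf R) (tilde R (regular_module R))
      (restrict_scalars \<psi> (direct_image U \<phi> (regular_sheaf A))) \<psi>"
    unfolding mod_sheaf_hom_def
  proof (intro conjI allI impI)
    fix V assume V: "openin (zariski R) V"
    note h = psi_hom[OF V]
    show "\<psi> V \<in> Sec (tilde R (regular_module R)) V \<rightarrow>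
        Sec (restrict_scalars \<psi> (direct_image U \<phi> (regular_sheaf A))) V"
      using ring_hom_closed[OF h] by simp
    show "\<forall>x\<in>Sec (tilde R (regular_module R)) V. \<forall>y\<in>Sec (tilde R (regular_module R)) V.
        \<psi> V (x \<oplus>\<^bsub>sect (tilde R (regular_module R)) V\<^esub> y) =
        \<psi> V x \<oplus>\<^bsub>sect (restrict_scalars \<psi> (direct_image U \<phi> (regular_sheaf A))) V\<^esub> \<psi> V y"
      using ring_hom_add[OF h] by (simp add: loc_ring_regular)
    show "\<forall>a\<in>Sec (spec_sheaf R) V. \<forall>x\<in>Sec (tilde R (regular_module R)) V.
        \<psi> V (a \<odot>\<^bsub>sect (tilde R (regular_module R)) V\<^esub> x) =
        a \<odot>\<^bsub>sect (restrict_scalars \<psi> (direct_image U \<phi> (regular_sheaf A))) V\<^esub> \<psi> V x"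
      using ring_hom_mult[OF h] by (simp add: loc_ring_regular)
  next
    show "commutes_with_res (zariski R) (tilde R (regular_module R))
        (restrict_scalars \<psi> (direct_image U \<phi> (regular_sheaf A))) \<psi>"
      using psi_res by (simp add: commutes_with_res_def)
  qed
qed

text \<open>The substantial condition links invertibility of \<open>\<rho> r\<close> near
  \<open>p\<close> with \<open>r \<notin> \<phi> p\<close>; it is read off from the fractions that
  represent sections on the spectrum.\<close>

lemma affine_presentation: "affine_presentation T A U R \<phi> \<rho>"
proof -
  interpret reg: module_chart T A "regular_sheaf A" R "regular_module R" U \<phi> \<psi> \<psi>
    by (rule regular_chart)
  have rho_tau: "\<rho> = reg.\<tau>" unfolding \<rho>_def reg.\<tau>_def ..
  have open_D: "openin (zariski R) {P \<in> Spec R. r \<notin> P}" if "r \<in> carrier R" for r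
    unfolding openin_zariski using that by (intro exI[of _ "{r}"]) simp
  have pre_D: "pre {P \<in> Spec R. r \<notin> P} = {q \<in> U. r \<notin> \<phi> q}" for r
    using bij_betwE[OF bij] by blast
  have one: "\<one>\<^bsub>sect (spec_sheaf R) V\<^esub> = const_fraction R (regular_module R) V \<one> \<one>" for V
    by (simp add: const_fraction_def loc_ring_def Let_def)
  have c1: "const_fraction R (regular_module R) (Spec R) r \<one> \<in> local_fractions R (regular_module R) (Spec R)"
    if "r \<in> carrier R" for r
    by (rule const_fraction_closed[OF open_Spec]) (use that in \<open>simp_all add: one_notin\<close>)
  show ?thesis
  proof (intro affine_presentation.intro affine_presentation_axioms.intro ring_sheaf_on_axioms
      M.R.is_cring open_U bij)
    show "openin T {q \<in> U. r \<notin> \<phi> q}" if "r \<in> carrier R" for r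
      using open_pre[OF open_D[OF that]] unfolding pre_D .
    show "\<exists>r\<in>carrier R. r \<notin> \<phi> p \<and> {q \<in> U. r \<notin> \<phi> q} \<subseteq> V" if V: "openin T V" "V \<subseteq> U" "p \<in> V" for V p
    proof -
      \<comment> \<open>An open set of the spectrum consists of the primes that do not contain some
        set \<open>S\<close>, so a member of \<open>S\<close> outside \<open>\<phi> p\<close> has
        its basic open set inside it.\<close>
      obtain S where S: "S \<subseteq> carrier R" "\<phi> ` V = {P \<in> Spec R. \<not> S \<subseteq> P}"
        using open_image[OF V(1,2)] unfolding openin_zariski by blast
      have "\<phi> p \<in> \<phi> ` V" using V(3) by blast
      then obtain g where g: "g \<in> S" "g \<notin> \<phi> p" unfolding S(2) by blast
      have "q \<in> V" if "q \<in> U" "g \<notin> \<phi> q" for q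
      proof -
        have "\<phi> q \<in> \<phi> ` V" unfolding S(2) using that g bij_betwE[OF bij] by blast
        then show ?thesis using that V(2) bij unfolding bij_betw_def inj_on_def by blast
      qed
      then show ?thesis using g S(1) by blast
    qed
    show "\<rho> \<in> ring_hom R (sect A U)"
    proof (rule ring_hom_memI)
      show "\<rho> r \<in> Sec A U" if "r \<in> carrier R" for r
        using ring_hom_closed[OF psi_hom[OF open_Spec]] c1[OF that] unfolding \<rho>_def pre_Spec by simp
    next
      fix r s assume r: "r \<in> carrier R" and s: "s \<in> carrier R"
      show "\<rho> (r \<otimes> s) = \<rho> r \<otimes>\<^bsub>sect A U\<^esub> \<rho> s"
        using reg.theta_smult[OF open_Spec c1[OF r] c1[OF s]]
          reg.const_smult[OF subset_refl r _ M.R.one_closed one_notin M.R.one_closed one_notin, of s] s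
        unfolding \<rho>_def pre_Spec by simp
      show "\<rho> (r \<oplus> s) = \<rho> r \<oplus>\<^bsub>sect A U\<^esub> \<rho> s"
        using reg.theta_add[OF open_Spec c1[OF r] c1[OF s]]
          reg.const_add[OF subset_refl, of r s] r s
        unfolding \<rho>_def pre_Spec by simp
    next
      show "\<rho> \<one> = \<one>\<^bsub>sect A U\<^esub>"
        using ring_hom_one[OF psi_hom[OF open_Spec]] unfolding \<rho>_def pre_Spec one .
    qed
    show "unit_at T A U (\<rho> r) p \<longleftrightarrow> r \<notin> \<phi> p" if r: "r \<in> carrier R" and p: "p \<in> U" for r p
    proof
      assume "unit_at T A U (\<rho> r) p"
      then obtain W b where W: "openin T W" "p \<in> W" "W \<subseteq> U" and b: "b \<in> Sec A W"
        "b \<otimes>\<^bsub>sect A W\<^esub> res A U W (\<rho> r) = \<one>\<^bsub>sect A W\<^esub>" unfolding unit_at_def by blast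
      define V where "V = \<phi> ` W"
      have V: "openin (zariski R) V" "pre V = W" "\<phi> p \<in> V" "V \<subseteq> Spec R"
        unfolding V_def
        by (rule open_image[OF W(1,3)], rule pre_image[OF W(3)], rule imageI[OF W(2)], rule open_sub[OF open_image[OF W(1,3)]])
      have "b \<in> \<psi> V ` local_fractions R (regular_module R) V"
        using bij_betw_imp_surj_on[OF psi_bij[OF V(1)]] b(1) unfolding V(2) by simp
      then obtain s where s: "s \<in> local_fractions R (regular_module R) V" "\<psi> V s = b"
        by (elim imageE) simp
      \<comment> \<open>Near \<open>p\<close> the inverse \<open>b\<close> is a fraction
        \<open>n/g\<close>. Then \<open>(n \<otimes> r)/g\<close> equals
        \<open>\<one>/\<one>\<close> at \<open>\<phi> p\<close>, so
        \<open>u \<otimes> n \<otimes> r\<close> equals \<open>u \<otimes> g\<close>, which lies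
        outside the prime; hence so does \<open>r\<close>.\<close>
      have "\<forall>P\<in>V. \<exists>V' m f. openin (zariski R) V' \<and> P \<in> V' \<and> V' \<subseteq> V \<and> m \<in> carrier (regular_module R) \<and>
          f \<in> carrier R \<and> (\<forall>Q\<in>V'. f \<notin> Q \<and> s Q = fraction (regular_module R) (carrier R - Q) m f)"
        using s(1) unfolding local_fractions_def mem_Collect_eq by (rule conjunct2)
      from bspec[OF this V(3)] obtain V' n g where V': "openin (zariski R) V'" "\<phi> p \<in> V'" "V' \<subseteq> V"
        and n: "n \<in> carrier (regular_module R)" and g: "g \<in> carrier R"
        and sg: "\<forall>Q\<in>V'. g \<notin> Q \<and> s Q = fraction (regular_module R) (carrier R - Q) n g" by metis
      have gV: "g \<notin> Q" if "Q \<in> V'" for Q using sg that by blast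
      have V'S: "V' \<subseteq> Spec R" by (rule open_sub[OF V'(1)])
      have oV: "\<one> \<notin> Q" if "Q \<in> V'" for Q using that V'S one_notin by blast
      have n': "n \<in> carrier R" using n by simp
      have r': "r \<in> carrier (regular_module R)" using r by simp
      have nr: "n \<otimes> r \<in> carrier (regular_module R)" "\<one> \<in> carrier (regular_module R)" using n' r by simp_all
      let ?c = "const_fraction R (regular_module R) V'"
      have "restrict s V' = ?c n g"
        unfolding const_fraction_def by (rule restrict_ext) (use sg in blast)
      then have b': "res A W (pre V') b = \<psi> V' (?c n g)"
        using psi_res[OF V(1) V'(1,3) s(1)] s(2) V(2) by simp
      have pW: "openin T (pre V')" "pre V' \<subseteq> W" using open_pre[OF V'(1)] V'(3) V(2) by blast+
      have "res A W (pre V') b \<otimes>\<^bsub>sect A (pre V')\<^esub> res A U (pre V') (\<rho> r) = \<one>\<^bsub>sect A (pre V')\<^esub>"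
        using arg_cong[OF b(2), of "res A W (pre V')"] b(1) pW W open_U
          ring_hom_closed[OF psi_hom[OF open_Spec] ] c1[OF r] unfolding \<rho>_def pre_Spec by simp
      then have "\<psi> V' (?c n g) \<otimes>\<^bsub>sect A (pre V')\<^esub> \<psi> V' (?c r \<one>) = \<one>\<^bsub>sect A (pre V')\<^esub>"
        unfolding b' res_rho[OF V'(1) r] .
      moreover have cc: "?c n g \<in> local_fractions R (regular_module R) V'"
        "?c r \<one> \<in> local_fractions R (regular_module R) V'"
        "?c (n \<otimes> r) (g \<otimes> \<one>) \<in> local_fractions R (regular_module R) V'"
        "?c \<one> \<one> \<in> local_fractions R (regular_module R) V'"
        using const_fraction_closed[OF V'(1) n g gV] const_fraction_closed[OF V'(1) r' M.R.one_closed oV]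
          const_fraction_closed[OF V'(1) nr(1) g gV] g const_fraction_closed[OF V'(1) nr(2) M.R.one_closed oV]
        by simp_all
      ultimately have "\<psi> V' (?c (n \<otimes> r) (g \<otimes> \<one>)) = \<psi> V' \<one>\<^bsub>sect (spec_sheaf R) V'\<^esub>"
        using reg.theta_smult[OF V'(1) cc(1,2)] reg.const_smult[OF V'S n' r' g gV M.R.one_closed oV]
          ring_hom_one[OF psi_hom[OF V'(1)]] by simp
      then have "?c (n \<otimes> r) (g \<otimes> \<one>) = ?c \<one> \<one>"
        using psi_bij[OF V'(1)] cc(3,4) unfolding bij_betw_def one by (meson inj_onD)
      from fun_cong[OF this, of "\<phi> p"] have feq: "fraction (regular_module R) (carrier R - \<phi> p) (n \<otimes> r) g
          = fraction (regular_module R) (carrier R - \<phi> p) \<one> \<one>"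
        using V'(2) g by (simp add: const_fraction_def)
      interpret at: module_at_prime R "regular_module R" "\<phi> p"
        using regular_at_prime V(3,4) by blast
      have ng: "n \<in> carrier R" "g \<in> carrier R - \<phi> p" using n' g gV[OF V'(2)] by auto
      obtain u where "u \<in> carrier R - \<phi> p"
        "u \<odot>\<^bsub>regular_module R\<^esub> (\<one> \<odot>\<^bsub>regular_module R\<^esub> (n \<otimes> r)) = u \<odot>\<^bsub>regular_module R\<^esub> (g \<odot>\<^bsub>regular_module R\<^esub> \<one>)"
        by (rule at.fraction_eqD[OF nr ng(2) at.not_in_prime(1) feq])
      then have u: "u \<in> carrier R - \<phi> p" "u \<otimes> (\<one> \<otimes> (n \<otimes> r)) = u \<otimes> (g \<otimes> \<one>)" by simp_all
      have "u \<otimes> g \<notin> \<phi> p" using at.not_in_prime(2)[OF u(1) ng(2)] by blast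
      moreover have "u \<otimes> g = (u \<otimes> n) \<otimes> r" using u ng r by (simp add: M.R.m_assoc)
      ultimately show "r \<notin> \<phi> p" using at.prime.I_l_closed[of r "u \<otimes> n"] u ng r by auto
    next
      assume rp: "r \<notin> \<phi> p"
      \<comment> \<open>Over the basic open set of \<open>r\<close> the fraction
        \<open>\<one>/r\<close> is an inverse.\<close>
      define V where "V = {P \<in> Spec R. r \<notin> P}"
      have V: "openin (zariski R) V" "V \<subseteq> Spec R" using open_D[OF r] by (auto simp: V_def)
      have preV: "p \<in> pre V" "openin T (pre V)" "pre V \<subseteq> U"
        using p rp bij_betwE[OF bij] open_pre[OF V(1)] by (auto simp: V_def)
      have rV: "r \<notin> P" if "P \<in> V" for P using that by (simp add: V_def)
      have oV: "\<one> \<notin> P" if "P \<in> V" for P using that one_notin V(2) by blast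
      have c: "const_fraction R (regular_module R) V \<one> r \<in> local_fractions R (regular_module R) V"
        "const_fraction R (regular_module R) V r \<one> \<in> local_fractions R (regular_module R) V"
        by (rule const_fraction_closed[OF V(1)]; use r rV oV in simp)+
      let ?b = "\<psi> V (const_fraction R (regular_module R) V \<one> r)"
      have "?b \<otimes>\<^bsub>sect A (pre V)\<^esub> res A U (pre V) (\<rho> r) = \<psi> V (const_fraction R (regular_module R) V (\<one> \<otimes> r) (r \<otimes> \<one>))"
        using reg.theta_smult[OF V(1) c] reg.const_smult[OF V(2) M.R.one_closed _ r rV M.R.one_closed oV, of r] r
          res_rho[OF V(1) r] by simp
      also have "const_fraction R (regular_module R) V (\<one> \<otimes> r) (r \<otimes> \<one>) = \<one>\<^bsub>sect (spec_sheaf R) V\<^esub>"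
        using reg.const_cancel[OF V(2) _ r rV, of \<one>] r unfolding one by simp
      also have "\<psi> V \<one>\<^bsub>sect (spec_sheaf R) V\<^esub> = \<one>\<^bsub>sect A (pre V)\<^esub>"
        by (rule ring_hom_one[OF psi_hom[OF V(1)]])
      finally have "?b \<otimes>\<^bsub>sect A (pre V)\<^esub> res A U (pre V) (\<rho> r) = \<one>\<^bsub>sect A (pre V)\<^esub>" .
      moreover have "?b \<in> Sec A (pre V)"
        using bij_betwE[OF psi_bij[OF V(1)]] c(1) by blast
      ultimately show "unit_at T A U (\<rho> r) p" using preV unfolding unit_at_def by blast
    qed
  qed
qed

text \<open>The two stalk conditions are surjectivity and injectivity of \<open>\<theta>\<close>
  seen at a prime: a section over \<open>V\<close> comes from a local fraction near each point, and
  an \<open>m\<close> that vanishes near \<open>p\<close> satisfies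
  \<open>m/\<one> = \<zero>/\<one>\<close> at \<open>\<phi> p\<close>.\<close>

theorem module_presentation: "module_presentation T A U R \<phi> \<rho> F M \<tau>"
proof -
  interpret affine_presentation T A U R \<phi> \<rho> by (rule affine_presentation)
  have c1: "const_fraction R M V m \<one> \<in> local_fractions R M V"
    if "m \<in> carrier M" "openin (zariski R) V" for m V
    by (rule const_fraction_closed[OF that(2)]) (use that open_sub[OF that(2)] in \<open>simp_all add: one_notin subset_iff\<close>)
  have c2: "const_fraction R (regular_module R) V f \<one> \<in> local_fractions R (regular_module R) V"
    if "f \<in> carrier R" "openin (zariski R) V" for f V
    by (rule const_fraction_closed[OF that(2)]) (use that open_sub[OF that(2)] in \<open>simp_all add: one_notin subset_iff\<close>)
  have tau_closed: "\<tau> m \<in> Sec F U" if "m \<in> carrier M" for m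
    using bij_betwE[OF theta_bij'[OF open_Spec]] c1[OF that open_Spec] unfolding \<tau>_def pre_Spec by blast
  have tau_add: "\<tau> (m \<oplus>\<^bsub>M\<^esub> n) = \<tau> m \<oplus>\<^bsub>sect F U\<^esub> \<tau> n" if m: "m \<in> carrier M" and n: "n \<in> carrier M" for m n
    using theta_add[OF open_Spec c1[OF m open_Spec] c1[OF n open_Spec]] const_add[OF subset_refl m n]
    unfolding \<tau>_def pre_Spec by simp
  have tau_smult: "\<tau> (r \<odot>\<^bsub>M\<^esub> m) = \<rho> r \<odot>\<^bsub>sect F U\<^esub> \<tau> m" if r: "r \<in> carrier R" and m: "m \<in> carrier M" for r m
    using theta_smult[OF open_Spec c2[OF r open_Spec] c1[OF m open_Spec]]
      const_smult[OF subset_refl r m M.R.one_closed one_notin M.R.one_closed one_notin]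
    unfolding \<rho>_def \<tau>_def pre_Spec by simp
  interpret FU: module "sect A U" "sect F U" by (rule module_sect[OF open_U])
  have tau_zero: "\<tau> \<zero>\<^bsub>M\<^esub> = \<zero>\<^bsub>sect F U\<^esub>"
    using tau_add[of "\<zero>\<^bsub>M\<^esub>" "\<zero>\<^bsub>M\<^esub>"] tau_closed[of "\<zero>\<^bsub>M\<^esub>"] FU.M.add.l_cancel_one by simp
  show ?thesis
  proof (intro module_presentation.intro module_presentation_axioms.intro affine_presentation
      module_sheaf_on_axioms M.module_axioms tau_closed tau_add tau_smult)
    fix V y p assume V: "openin T V" "V \<subseteq> U" and y: "y \<in> Sec F V" and p: "p \<in> V"
    define V' where "V' = \<phi> ` V"
    have V': "openin (zariski R) V'" "pre V' = V" "\<phi> p \<in> V'"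
      unfolding V'_def by (rule open_image[OF V], rule pre_image[OF V(2)], rule imageI[OF p])
    have "y \<in> \<theta> V' ` local_fractions R M V'"
      using bij_betw_imp_surj_on[OF theta_bij'[OF V'(1)]] y unfolding V'(2) by simp
    then obtain s where s: "s \<in> local_fractions R M V'" "\<theta> V' s = y"
      by (elim imageE) simp
    have "\<forall>P\<in>V'. \<exists>V m f. openin (zariski R) V \<and> P \<in> V \<and> V \<subseteq> V' \<and> m \<in> carrier M \<and> f \<in> carrier R \<and>
        (\<forall>Q\<in>V. f \<notin> Q \<and> s Q = fraction M (carrier R - Q) m f)"
      using s(1) unfolding local_fractions_def mem_Collect_eq by (rule conjunct2)
    from bspec[OF this V'(3)] obtain V2 m f where V2: "openin (zariski R) V2" "\<phi> p \<in> V2" "V2 \<subseteq> V'"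
      and m: "m \<in> carrier M" and f: "f \<in> carrier R"
      and sf: "\<forall>Q\<in>V2. f \<notin> Q \<and> s Q = fraction M (carrier R - Q) m f" by metis
    have f': "f \<notin> Q" if "Q \<in> V2" for Q using sf that by blast
    have V2': "V2 \<subseteq> Spec R" using open_sub[OF V2(1)] .
    have o: "\<one> \<notin> Q" if "Q \<in> V2" for Q using that V2' one_notin by blast
    have "restrict s V2 = const_fraction R M V2 m f"
      unfolding const_fraction_def by (rule restrict_ext) (use sf in blast)
    then have y': "res F V (pre V2) y = \<theta> V2 (const_fraction R M V2 m f)"
      using theta_res[OF V'(1) V2(1,3) s(1)] s(2) V'(2) by simp
    have cm: "const_fraction R M V2 m f \<in> local_fractions R M V2"
      by (rule const_fraction_closed[OF V2(1) m f f'])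
    have "res A U (pre V2) (\<rho> f) \<odot>\<^bsub>sect F (pre V2)\<^esub> res F V (pre V2) y
        = \<theta> V2 (const_fraction R M V2 (f \<odot>\<^bsub>M\<^esub> m) (\<one> \<otimes> f))"
      unfolding y' res_rho[OF V2(1) f]
      using theta_smult[OF V2(1) c2[OF f V2(1)] cm] const_smult[OF V2' f m M.R.one_closed o f f'] by simp
    also have "const_fraction R M V2 (f \<odot>\<^bsub>M\<^esub> m) (\<one> \<otimes> f) = const_fraction R M V2 m \<one>"
      using const_cancel[OF V2' m f f'] f by simp
    also have "\<theta> V2 (const_fraction R M V2 m \<one>) = res F U (pre V2) (\<tau> m)"
      using res_tau[OF V2(1) m] by simp
    finally have eq: "res A U (pre V2) (\<rho> f) \<odot>\<^bsub>sect F (pre V2)\<^esub> res F V (pre V2) y = res F U (pre V2) (\<tau> m)" .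
    have "p \<in> pre V2" "pre V2 \<subseteq> V" using V2 V p V'(2) by blast+
    then show "\<exists>W m f. openin T W \<and> p \<in> W \<and> W \<subseteq> V \<and> m \<in> carrier M \<and> f \<in> carrier R \<and> f \<notin> \<phi> p \<and>
        res A U W (\<rho> f) \<odot>\<^bsub>sect F W\<^esub> res F V W y = res F U W (\<tau> m)"
      using eq open_pre[OF V2(1)] m f f'[OF V2(2)]
      by (intro exI[of _ "pre V2"] exI[of _ m] exI[of _ f]) simp
  next
    fix m W p assume m: "m \<in> carrier M" and W: "openin T W" "p \<in> W" "W \<subseteq> U"
      and z: "res F U W (\<tau> m) = \<zero>\<^bsub>sect F W\<^esub>"
    define V where "V = \<phi> ` W"
    have V: "openin (zariski R) V" "pre V = W" "\<phi> p \<in> V" "V \<subseteq> Spec R"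
      unfolding V_def
        by (rule open_image[OF W(1,3)], rule pre_image[OF W(3)], rule imageI[OF W(2)], rule open_sub[OF open_image[OF W(1,3)]])
    have "\<theta> V (const_fraction R M V m \<one>) = \<theta> V (const_fraction R M V \<zero>\<^bsub>M\<^esub> \<one>)"
      using res_tau[OF V(1) m] res_tau[OF V(1), of "\<zero>\<^bsub>M\<^esub>"] z V(2) tau_zero open_U W by simp
    then have "const_fraction R M V m \<one> = const_fraction R M V \<zero>\<^bsub>M\<^esub> \<one>"
      using theta_bij'[OF V(1)] c1[OF m V(1)] c1[OF M.M.zero_closed V(1)] unfolding bij_betw_def
      by (meson inj_onD)
    from fun_cong[OF this, of "\<phi> p"] have eq: "fraction M (carrier R - \<phi> p) m \<one> = fraction M (carrier R - \<phi> p) \<zero>\<^bsub>M\<^esub> \<one>"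
      using V(3) by (simp add: const_fraction_def)
    interpret at: module_at_prime R M "\<phi> p" using at_prime V(3,4) by blast
    obtain u where "u \<in> carrier R - \<phi> p" "u \<odot>\<^bsub>M\<^esub> (\<one> \<odot>\<^bsub>M\<^esub> m) = u \<odot>\<^bsub>M\<^esub> (\<one> \<odot>\<^bsub>M\<^esub> \<zero>\<^bsub>M\<^esub>)"
      by (rule at.fraction_eqD[OF m M.M.zero_closed at.not_in_prime(1) at.not_in_prime(1) eq])
    then show "\<exists>u\<in>carrier R. u \<notin> \<phi> p \<and> u \<odot>\<^bsub>M\<^esub> m = \<zero>\<^bsub>M\<^esub>" using m by auto
  qed
qed

end

section \<open>Presentations by rings of sections\<close>

lemma (in ring_presentation) nonunits_iff:
  "\<lbrakk>r \<in> carrier R; p \<in> U\<rbrakk> \<Longrightarrow> \<rho> r \<in> nonunits T A U p \<longleftrightarrow> r \<in> \<phi> p"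
  using unit_iff[of r p] rho_closed[of r] by (simp add: nonunits_def)

lemma (in ring_presentation) rho_surj: "g \<in> Sec A U \<Longrightarrow> \<exists>r\<in>carrier R. \<rho> r = g"
  using tau_surj[of g] by simp

text \<open>Since \<open>\<rho>\<close> is onto, the nonunits at \<open>p\<close> are the image of
  the prime \<open>\<phi> p\<close>, and the conditions on a prime ideal are transported along
  \<open>\<rho>\<close>.\<close>

lemma (in ring_presentation) primeideal_nonunits:
  assumes p: "p \<in> U"
  shows "primeideal (nonunits T A U p) (sect A U)"
proof -
  have AU: "cring (sect A U)" by (rule cring_sect[OF open_U])
  interpret P: primeideal "\<phi> p" R by (rule prime[OF p])
  have sub: "nonunits T A U p \<subseteq> Sec A U" by (auto simp: nonunits_def)
  have lift: "\<exists>r\<in>\<phi> p. \<rho> r = g" if gn: "g \<in> nonunits T A U p" for g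
  proof -
    obtain r where r: "r \<in> carrier R" "\<rho> r = g" using rho_surj[OF subsetD[OF sub gn]] by (elim bexE) simp
    then have "r \<in> \<phi> p" using nonunits_iff[OF r(1) p] gn by simp
    then show ?thesis using r(2) by (rule bexI[rotated])
  qed
  have mem: "\<rho> r \<in> nonunits T A U p" if "r \<in> \<phi> p" for r
    using nonunits_iff[of r p] that p P.Icarr by blast
  show ?thesis
  proof (rule primeidealI[OF cring.cring_idealI[OF AU] AU])
    show "nonunits T A U p \<subseteq> Sec A U" by fact
    show "\<zero>\<^bsub>sect A U\<^esub> \<in> nonunits T A U p" using mem[OF P.zero_closed] by simp
    fix x y assume "x \<in> nonunits T A U p" "y \<in> nonunits T A U p"
    then obtain r s where "r \<in> \<phi> p" "\<rho> r = x" "s \<in> \<phi> p" "\<rho> s = y" using lift by metis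
    then show "x \<oplus>\<^bsub>sect A U\<^esub> y \<in> nonunits T A U p"
      using mem[OF P.a_closed, of r s] P.Icarr rho_add[of r s] by simp
  next
    fix x y assume "x \<in> Sec A U" "y \<in> nonunits T A U p"
    then obtain r s where "r \<in> carrier R" "\<rho> r = x" "s \<in> \<phi> p" "\<rho> s = y" using lift rho_surj by metis
    then show "x \<otimes>\<^bsub>sect A U\<^esub> y \<in> nonunits T A U p"
      using mem[OF P.I_l_closed, of s r] P.Icarr rho_mult[of r s] by simp
  next
    have "\<rho> \<one> \<notin> nonunits T A U p"
      using nonunits_iff[OF R.one_closed p] D_one p by blast
    then show "Sec A U \<noteq> nonunits T A U p" by auto
    fix x y assume x: "x \<in> Sec A U" and y: "y \<in> Sec A U"
      and xy: "x \<otimes>\<^bsub>sect A U\<^esub> y \<in> nonunits T A U p"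
    obtain r s where rs: "r \<in> carrier R" "\<rho> r = x" "s \<in> carrier R" "\<rho> s = y" using x y rho_surj by metis
    then have "r \<otimes> s \<in> \<phi> p" using xy nonunits_iff[of "r \<otimes> s" p] p by simp
    then have "r \<in> \<phi> p \<or> s \<in> \<phi> p" by (rule P.I_prime[OF rs(1,3)])
    then show "x \<in> nonunits T A U p \<or> y \<in> nonunits T A U p" using mem rs by blast
  qed
qed

text \<open>
  Passing to sections over \<open>U\<close> lets the ring chart and the module chart, and later the chart of the
  extension, share one ring.
\<close>

lemma (in ring_presentation) canonical_affine:
  "affine_presentation T A U (sect A U) (nonunits T A U) id"
proof (intro affine_presentation.intro affine_presentation_axioms.intro ring_sheaf_on_axioms
    cring_sect[OF open_U] open_U)
  show "bij_betw (nonunits T A U) U (Spec (sect A U))"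
  proof (rule bij_betwI')
    fix p q assume p: "p \<in> U" and q: "q \<in> U"
    show "nonunits T A U p = nonunits T A U q \<longleftrightarrow> p = q"
    proof
      assume eq: "nonunits T A U p = nonunits T A U q"
      have "\<phi> p \<subseteq> carrier R" "\<phi> q \<subseteq> carrier R"
        using primeideal.axioms(1)[OF prime[OF p]] primeideal.axioms(1)[OF prime[OF q]]
        by (simp_all add: additive_subgroup.a_subset ideal.axioms(1))
      moreover have "r \<in> \<phi> p \<longleftrightarrow> r \<in> \<phi> q" if "r \<in> carrier R" for r
        using nonunits_iff[OF that p] nonunits_iff[OF that q] eq by simp
      ultimately have "\<phi> p = \<phi> q" by blast
      then show "p = q" using bij p q unfolding bij_betw_def inj_on_def by blast
    qed simp
  next
    fix p assume "p \<in> U"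
    then show "nonunits T A U p \<in> Spec (sect A U)" using primeideal_nonunits by (simp add: Spec_def)
  next
    fix Q assume "Q \<in> Spec (sect A U)"
    then have Q: "primeideal Q (sect A U)" by (simp add: Spec_def)
    interpret Q: primeideal Q "sect A U" by (rule Q)
    interpret rho: ring_hom_ring R "sect A U" \<rho>
      by (intro ring_hom_ring.intro R.ring_axioms cring.axioms(1)[OF cring_sect[OF open_U]] ring_hom_ring_axioms.intro hom)
    \<comment> \<open>The preimage of \<open>Q\<close> in \<open>R\<close> is some
      \<open>\<phi> p\<close>; surjectivity of \<open>\<rho>\<close> then recovers \<open>Q\<close>
      as the set of nonunits at \<open>p\<close>.\<close>
    have "{r \<in> carrier R. \<rho> r \<in> Q} \<in> Spec R"
      using rho.primeideal_vimage[OF R.is_cring Q] by (simp add: Spec_def)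
    then obtain p where p: "p \<in> U" "\<phi> p = {r \<in> carrier R. \<rho> r \<in> Q}"
      using bij unfolding bij_betw_def by (metis (no_types, lifting) imageE)
    have "g \<in> Q \<longleftrightarrow> g \<in> nonunits T A U p" if g: "g \<in> Sec A U" for g
    proof -
      obtain r where "r \<in> carrier R" "\<rho> r = g" using rho_surj[OF g] by (elim bexE) simp
      then show ?thesis using nonunits_iff[of r p] p by auto
    qed
    moreover have "Q \<subseteq> Sec A U"
      by (rule additive_subgroup.a_subset[OF ideal.axioms(1)[OF primeideal.axioms(1)[OF Q]]])
    moreover have "nonunits T A U p \<subseteq> Sec A U" by (auto simp: nonunits_def)
    ultimately have "Q = nonunits T A U p" by blast
    then show "\<exists>p\<in>U. Q = nonunits T A U p" using p(1) by blast
  qed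
  show "openin T {q \<in> U. g \<notin> nonunits T A U q}" if g: "g \<in> Sec A U" for g
  proof -
    obtain r where r: "r \<in> carrier R" "\<rho> r = g" using rho_surj[OF g] by (elim bexE) simp
    then have "{q \<in> U. g \<notin> nonunits T A U q} = D r" using nonunits_iff[OF r(1)] by blast
    then show ?thesis using open_D[OF r(1)] by simp
  qed
  show "\<exists>g\<in>Sec A U. g \<notin> nonunits T A U p \<and> {q \<in> U. g \<notin> nonunits T A U q} \<subseteq> V"
    if V: "openin T V" "V \<subseteq> U" "p \<in> V" for V p
  proof -
    obtain r where r: "r \<in> carrier R" "r \<notin> \<phi> p" "D r \<subseteq> V" using basis[OF V] by blast
    have "p \<in> U" using V by blast
    then show ?thesis using r nonunits_iff[OF r(1)] rho_closed[OF r(1)] by (intro bexI[of _ "\<rho> r"]) auto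
  qed
  show "id \<in> ring_hom (sect A U) (sect A U)" by (rule ring_hom_memI) simp_all
  show "unit_at T A U (id g) p \<longleftrightarrow> g \<notin> nonunits T A U p" if "g \<in> Sec A U" for g p
    using that by (simp add: nonunits_def)
qed

text \<open>Fractions carry over by applying \<open>\<rho>\<close> and \<open>\<tau>\<close>. For
  torsion, a section over \<open>U\<close> is first lifted to \<open>M\<close>, which is where
  \<open>tau_surj\<close> enters.\<close>

lemma canonical_module:
  assumes ring: "ring_presentation T A U R \<phi> \<rho>" and mod: "module_presentation T A U R \<phi> \<rho> F M \<tau>"
  shows "module_presentation T A U (sect A U) (nonunits T A U) id F (sect F U) id"
proof -
  interpret ring_presentation T A U R \<phi> \<rho> by (rule ring)
  interpret F: module_presentation T A U R \<phi> \<rho> F M \<tau> by (rule mod)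
  show ?thesis
  proof (intro module_presentation.intro module_presentation_axioms.intro canonical_affine
      F.module_sheaf_on_axioms F.module_sect open_U)
    show "\<exists>W m f. openin T W \<and> p \<in> W \<and> W \<subseteq> V \<and> m \<in> Sec F U \<and> f \<in> Sec A U \<and>
        f \<notin> nonunits T A U p \<and> res A U W (id f) \<odot>\<^bsub>sect F W\<^esub> res F V W y = res F U W (id m)"
      if V: "openin T V" "V \<subseteq> U" and y: "y \<in> Sec F V" and p: "p \<in> V" for V y p
    proof -
      obtain W m f where W: "openin T W" "p \<in> W" "W \<subseteq> V" and m: "m \<in> carrier M"
        and f: "f \<in> carrier R" "f \<notin> \<phi> p"
        and eq: "res A U W (\<rho> f) \<odot>\<^bsub>sect F W\<^esub> res F V W y = res F U W (\<tau> m)"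
        using F.fractions[OF V y p] by blast
      have pU: "p \<in> U" using p V by blast
      have "\<rho> f \<notin> nonunits T A U p" using nonunits_iff[OF f(1) pU] f(2) by blast
      then show ?thesis
        using W eq rho_closed[OF f(1)] F.tau_closed[OF m]
        by (intro exI[of _ W] exI[of _ "\<tau> m"] exI[of _ "\<rho> f"]) simp
    qed
    show "\<exists>u\<in>Sec A U. u \<notin> nonunits T A U p \<and> u \<odot>\<^bsub>sect F U\<^esub> m = \<zero>\<^bsub>sect F U\<^esub>"
      if m: "m \<in> Sec F U" and W: "openin T W" "p \<in> W" "W \<subseteq> U"
        and z: "res F U W (id m) = \<zero>\<^bsub>sect F W\<^esub>" for m W p
    proof -
      obtain n where n: "n \<in> carrier M" "\<tau> n = m" using F.tau_surj[OF m] by blast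
      have "res F U W (\<tau> n) = \<zero>\<^bsub>sect F W\<^esub>" using z n(2) by simp
      then obtain u where u: "u \<in> carrier R" "u \<notin> \<phi> p" "u \<odot>\<^bsub>M\<^esub> n = \<zero>\<^bsub>M\<^esub>"
        using F.torsion[OF n(1) W] by blast
      have pU: "p \<in> U" using W by blast
      have "\<rho> u \<odot>\<^bsub>sect F U\<^esub> m = \<zero>\<^bsub>sect F U\<^esub>" using F.tau_smult[OF u(1) n(1)] u(3) n(2) by simp
      moreover have "\<rho> u \<notin> nonunits T A U p" using nonunits_iff[OF u(1) pU] u(2) by blast
      ultimately show ?thesis using rho_closed[OF u(1)] by blast
    qed
  qed simp_all
qed

text \<open>A chart of the coherent sheaf provides a ring and a module over the same open set, so
  both presentations can be taken over the one ring \<open>sect A U\<close>.\<close>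

lemma coherent_presentations:
  assumes A: "ring_sheaf T A" and F: "coherent T A F" and p: "p \<in> topspace T"
  obtains U where "p \<in> U" "ring_presentation T A U (sect A U) (nonunits T A U) id"
    "module_presentation T A U (sect A U) (nonunits T A U) id F (sect F U) id"
proof -
  obtain U and R :: "'b ring" and \<phi> \<psi> and M :: "('b, 'c) module" and \<theta> where
    U: "p \<in> U" "affine_chart T A U R \<phi> \<psi>" and M: "Module.module R M" and \<theta>:
      "\<And>V. openin (zariski R) V \<Longrightarrow>
        bij_betw (\<theta> V) (Sec (tilde R M) V) (Sec (direct_image U \<phi> F) V)"
      "mod_sheaf_hom (zariski R) (spec_sheaf R) (tilde R M)
        (restrict_scalars \<psi> (direct_image U \<phi> F)) \<theta>"
    using F p unfolding coherent_def by metis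
  interpret module_sheaf_on T A F
    by (rule module_sheaf_onI[OF A]) (use F in \<open>simp add: coherent_def\<close>)
  interpret module_chart T A F R M U \<phi> \<psi> \<theta>
    by (intro module_chart.intro module_sheaf_on_axioms M module_chart_axioms.intro U \<theta>)
  interpret reg: module_chart T A "regular_sheaf A" R "regular_module R" U \<phi> \<psi> \<psi>
    by (rule regular_chart)
  have "\<rho> = reg.\<tau>" unfolding \<rho>_def reg.\<tau>_def ..
  then have ring: "ring_presentation T A U R \<phi> \<rho>"
    using reg.module_presentation by (simp add: ring_presentation_def)
  have "module_presentation T A U (sect A U) (nonunits T A U) id (regular_sheaf A) (sect (regular_sheaf A) U) id"
    by (rule canonical_module[OF ring]) (use ring in \<open>simp add: ring_presentation_def\<close>)
  then have "ring_presentation T A U (sect A U) (nonunits T A U) id"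
    by (simp add: ring_presentation_def)
  then show ?thesis using that U(1) canonical_module[OF ring module_presentation] by blast
qed

text \<open>The chart ring is the ring of sections itself, which has the type that the definition of
  a scheme prescribes for chart rings.\<close>

lemma scheme_of_presentations:
  fixes A :: "('p, 'a) ring_presheaf"
  assumes A: "ring_sheaf T A"
    and ex: "\<And>p. p \<in> topspace T \<Longrightarrow> \<exists>U. p \<in> U \<and> ring_presentation T A U (sect A U) (nonunits T A U) id"
  shows "scheme T A"
  unfolding scheme_def
proof (intro conjI ballI A)
  fix p assume "p \<in> topspace T"
  from ex[OF this] obtain U where U: "p \<in> U" "ring_presentation T A U (sect A U) (nonunits T A U) id"
    by (elim exE conjE)
  from ring_presentation.affine_chart[OF U(2)] obtain \<psi>
    where "affine_chart T A U (sect A U) (nonunits T A U) \<psi>" by (rule exE)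
  with U(1) show "\<exists>U (R :: 'a ring) \<phi> \<psi>. p \<in> U \<and> affine_chart T A U R \<phi> \<psi>"
    by (intro exI conjI)
qed

section \<open>Tensor powers\<close>

text \<open>Only generators have to be checked in order to send one subgroup of a free abelian group
  into another. In this way the scalar action and restriction descend to tensor powers.\<close>

lemma frag_extend_generate:
  assumes "S \<subseteq> carrier (free_Abelian_group B)"
    and rel: "\<And>r. r \<in> S \<Longrightarrow> frag_extend g r \<in> generate (free_Abelian_group C) S'"
    and S': "S' \<subseteq> carrier (free_Abelian_group C)"
    and c: "c \<in> generate (free_Abelian_group B) S"
  shows "frag_extend g c \<in> generate (free_Abelian_group C) S'"
  using c
proof (induction c rule: generate.induct)
  case one
  show ?case using generate.one[of "free_Abelian_group C" S'] by simp
next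
  case (incl h)
  then show ?case by (rule rel)
next
  case (inv h)
  interpret C: group "free_Abelian_group C" by simp
  interpret sub: subgroup "generate (free_Abelian_group C) S'" "free_Abelian_group C"
    by (rule C.generate_is_subgroup[OF S'])
  have "Poly_Mapping.keys h \<subseteq> B" using subsetD[OF assms(1) inv] by simp
  moreover have "inv\<^bsub>free_Abelian_group C\<^esub> frag_extend g h \<in> generate (free_Abelian_group C) S'"
    using rel[OF inv] by (rule sub.m_inv_closed)
  moreover have "Poly_Mapping.keys (frag_extend g h) \<subseteq> C"
    using sub.mem_carrier[OF rel[OF inv]] by simp
  ultimately show ?case by (simp add: frag_extend_minus)
next
  case (eng h1 h2)
  then show ?case
    using generate.eng[of "frag_extend g h1" "free_Abelian_group C" S' "frag_extend g h2"]
    by (simp add: frag_extend_add)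
qed

lemma tuples_update: "\<lbrakk>xs \<in> tuples M n; x \<in> carrier M\<rbrakk> \<Longrightarrow> xs[i := x] \<in> tuples M n"
  unfolding tuples_def using set_update_subset_insert[of xs i x] by auto

lemma tuples_nth: "\<lbrakk>xs \<in> tuples M n; i < n\<rbrakk> \<Longrightarrow> xs ! i \<in> carrier M"
  unfolding tuples_def by (auto simp: subset_iff)

text \<open>Positivity of \<open>n\<close> provides the slot \<open>0\<close> on which scalars
  act.\<close>

locale tensor_power_on = module R M
  for R :: "'r ring" (structure) and M :: "('r, 'm) module" and n :: nat +
  assumes n_pos: "0 < n"
begin

abbreviation free where "free \<equiv> free_Abelian_group (tuples M n)"
abbreviation null where "null \<equiv> tensor_null R M n"
abbreviation cls where "cls \<equiv> tensor_class R M n"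
abbreviation act where "act a \<equiv> frag_extend (\<lambda>xs. frag_of (xs[0 := a \<odot>\<^bsub>M\<^esub> xs ! 0]))"

sublocale free: comm_group free by (rule abelian_free_Abelian_group)

lemma relations_subset: "tensor_relations R M n \<subseteq> carrier free"
proof
  fix r assume "r \<in> tensor_relations R M n"
  then consider (add) xs i x y where "xs \<in> tuples M n" "i < n" "x \<in> carrier M" "y \<in> carrier M"
      "r = frag_of (xs[i := x \<oplus>\<^bsub>M\<^esub> y]) - frag_of (xs[i := x]) - frag_of (xs[i := y])"
    | (scal) xs i j a where "xs \<in> tuples M n" "i < n" "j < n" "a \<in> carrier R"
      "r = frag_of (xs[i := a \<odot>\<^bsub>M\<^esub> xs ! i]) - frag_of (xs[j := a \<odot>\<^bsub>M\<^esub> xs ! j])"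
    unfolding tensor_relations_def by blast
  then show "r \<in> carrier free"
  proof cases
    case add
    then show ?thesis
      using keys_diff[of "frag_of (xs[i := x \<oplus>\<^bsub>M\<^esub> y]) - frag_of (xs[i := x])" "frag_of (xs[i := y])"]
        keys_diff[of "frag_of (xs[i := x \<oplus>\<^bsub>M\<^esub> y])" "frag_of (xs[i := x])"] tuples_update[OF add(1)]
      by (simp add: subset_iff) blast
  next
    case scal
    then show ?thesis
      using keys_diff[of "frag_of (xs[i := a \<odot>\<^bsub>M\<^esub> xs ! i])" "frag_of (xs[j := a \<odot>\<^bsub>M\<^esub> xs ! j])"]
        tuples_update[OF scal(1)] tuples_nth[OF scal(1)]
      by (simp add: subset_iff) blast
  qed
qed

sublocale null: subgroup null free
  unfolding tensor_null_def by (rule free.generate_is_subgroup[OF relations_subset])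

lemma normal: "normal null free"
  by (rule free.normal_iff_subgroup[THEN iffD2]) (rule null.subgroup_axioms)

lemma relation_null: "r \<in> tensor_relations R M n \<Longrightarrow> r \<in> null"
  unfolding tensor_null_def by (rule generate.incl)

lemma cls_mem: "c' \<in> cls c \<longleftrightarrow> c' - c \<in> null"
  unfolding tensor_class_def r_coset_def by (auto simp: algebra_simps intro!: bexI[of _ "c' - c"])

lemma null_diff: "\<lbrakk>c \<in> null; d \<in> null\<rbrakk> \<Longrightarrow> c - d \<in> null"
proof -
  assume c: "c \<in> null" and d: "d \<in> null"
  have "inv\<^bsub>free\<^esub> d = - d" using null.mem_carrier[OF d] by simp
  then have "- d \<in> null" using null.m_inv_closed[OF d] by simp
  from null.m_closed[OF c this] show ?thesis by simp
qed

lemma null_add: "\<lbrakk>c \<in> null; d \<in> null\<rbrakk> \<Longrightarrow> c + d \<in> null"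
  using null.m_closed[of c d] by simp

lemma null_zero: "0 \<in> null"
  using null.one_closed by simp

lemma cls_self: "c \<in> cls c"
  by (simp add: cls_mem null_zero)

lemma cls_eqI: "c - d \<in> null \<Longrightarrow> cls c = cls d"
proof -
  assume cd: "c - d \<in> null"
  have "x - c \<in> null \<longleftrightarrow> x - d \<in> null" for x
    using null_add[OF _ cd, of "x - c"] null_diff[OF _ cd, of "x - d"] by (auto simp: algebra_simps)
  then show ?thesis by (auto simp: cls_mem)
qed

lemma carrier_tensor_power: "carrier (tensor_power R M n) = cls ` carrier free"
  unfolding tensor_power_def by (auto simp: FactGroup_def RCOSETS_def tensor_class_def)

lemma cls_closed: "c \<in> carrier free \<Longrightarrow> cls c \<in> carrier (tensor_power R M n)"
  unfolding carrier_tensor_power by (rule imageI)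

lemma cls_add:
  assumes "c \<in> carrier free" "d \<in> carrier free"
  shows "cls c \<oplus>\<^bsub>tensor_power R M n\<^esub> cls d = cls (c + d)"
  using normal.rcos_sum[OF normal assms]
  by (simp add: tensor_power_def FactGroup_def tensor_class_def)

text \<open>Maps on cosets are encoded as unions over representatives; invariance under
  \<open>null\<close> makes the union the value at any one of them.\<close>

lemma UN_cls:
  assumes "\<And>c'. c' \<in> null \<Longrightarrow> f (c + c') = f c"
  shows "(\<Union>c'\<in>cls c. f c') = f c"
proof -
  have "f c' = f c" if "c' \<in> cls c" for c'
    using assms[of "c' - c"] that by (simp add: cls_mem)
  then have "(\<Union>c'\<in>cls c. f c') = (\<Union>c'\<in>cls c. f c)" by (intro SUP_cong refl)
  then show ?thesis using cls_self[of c] by auto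
qed

lemma act_update:
  assumes xs: "xs \<in> tuples M n" and i: "i < n"
  shows "(xs[i := z])[0 := a \<odot>\<^bsub>M\<^esub> (xs[i := z]) ! 0] =
    (if i = 0 then xs[0 := a \<odot>\<^bsub>M\<^esub> z] else (xs[0 := a \<odot>\<^bsub>M\<^esub> xs ! 0])[i := z])"
  using assms n_pos by (auto simp: tuples_def list_update_swap)

text \<open>Scaling slot \<open>0\<close> turns an additivity relation in another slot into the same
  relation for the scaled tuple; in slot \<open>0\<close> itself it uses distributivity. For scalar
  relations, commutativity of \<open>R\<close> allows the two scalings of slot \<open>0\<close> to
  be exchanged.\<close>

lemma act_relation:
  assumes a: "a \<in> carrier R" and r: "r \<in> tensor_relations R M n"
  shows "act a r \<in> null"
proof -
  from r consider (add) xs i x y where "xs \<in> tuples M n" "i < n" "x \<in> carrier M" "y \<in> carrier M"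
      "r = frag_of (xs[i := x \<oplus>\<^bsub>M\<^esub> y]) - frag_of (xs[i := x]) - frag_of (xs[i := y])"
    | (scal) xs i j b where "xs \<in> tuples M n" "i < n" "j < n" "b \<in> carrier R"
      "r = frag_of (xs[i := b \<odot>\<^bsub>M\<^esub> xs ! i]) - frag_of (xs[j := b \<odot>\<^bsub>M\<^esub> xs ! j])"
    unfolding tensor_relations_def by blast
  then show ?thesis
  proof cases
    case add
    define ys where "ys = xs[0 := a \<odot>\<^bsub>M\<^esub> xs ! 0]"
    have ys: "ys \<in> tuples M n"
      unfolding ys_def using tuples_update[OF add(1)] tuples_nth[OF add(1) n_pos] a by simp
    have rel: "frag_of (zs[i := u \<oplus>\<^bsub>M\<^esub> v]) - frag_of (zs[i := u]) - frag_of (zs[i := v]) \<in> null"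
      if "zs \<in> tuples M n" "u \<in> carrier M" "v \<in> carrier M" for zs u v
      by (rule relation_null) (use that add(2) in \<open>auto simp: tensor_relations_def\<close>)
    show ?thesis
    proof (cases "i = 0")
      case True
      then show ?thesis
        using rel[OF add(1), of "a \<odot>\<^bsub>M\<^esub> x" "a \<odot>\<^bsub>M\<^esub> y"] a add(1,3,4) n_pos
        by (simp add: add(5) frag_extend_diff smult_r_distr tuples_def)
    next
      case False
      then show ?thesis
        using rel[OF ys add(3,4)] list_update_swap[OF False, of xs]
        by (simp add: add(5) frag_extend_diff ys_def)
    qed
  next
    case scal
    define ys where "ys = xs[0 := a \<odot>\<^bsub>M\<^esub> xs ! 0]"
    have x0: "xs ! 0 \<in> carrier M" by (rule tuples_nth[OF scal(1) n_pos])
    have len: "length xs = n" using scal(1) by (simp add: tuples_def)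
    have ys: "ys \<in> tuples M n"
      unfolding ys_def using tuples_update[OF scal(1)] x0 a by simp
    have upd: "(xs[k := b \<odot>\<^bsub>M\<^esub> xs ! k])[0 := a \<odot>\<^bsub>M\<^esub> (xs[k := b \<odot>\<^bsub>M\<^esub> xs ! k]) ! 0] = ys[k := b \<odot>\<^bsub>M\<^esub> ys ! k]"
      if "k < n" for k
    proof (cases "k = 0")
      case True
      then show ?thesis using act_update[OF scal(1) that, of "b \<odot>\<^bsub>M\<^esub> xs ! k" a] x0 a scal(4) n_pos len
        by (simp add: ys_def smult_assoc1[symmetric] m_comm)
    next
      case False
      then show ?thesis using act_update[OF scal(1) that, of "b \<odot>\<^bsub>M\<^esub> xs ! k" a] by (simp add: ys_def)
    qed
    have "frag_of (ys[i := b \<odot>\<^bsub>M\<^esub> ys ! i]) - frag_of (ys[j := b \<odot>\<^bsub>M\<^esub> ys ! j]) \<in> null"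
      by (rule relation_null) (use scal ys in \<open>auto simp: tensor_relations_def\<close>)
    then show ?thesis using upd[OF scal(2)] upd[OF scal(3)] by (simp add: scal(5) frag_extend_diff)
  qed
qed

lemma act_null: "\<lbrakk>a \<in> carrier R; c \<in> null\<rbrakk> \<Longrightarrow> act a c \<in> null"
  using frag_extend_generate[OF relations_subset _ relations_subset, of "\<lambda>xs. frag_of (xs[0 := a \<odot>\<^bsub>M\<^esub> xs ! 0])" c]
    act_relation unfolding tensor_null_def by blast

lemma act_closed:
  assumes a: "a \<in> carrier R" and c: "c \<in> carrier free"
  shows "act a c \<in> carrier free"
proof -
  have "xs[0 := a \<odot>\<^bsub>M\<^esub> xs ! 0] \<in> tuples M n" if "xs \<in> tuples M n" for xs
    using tuples_update[OF that] tuples_nth[OF that n_pos] a by simp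
  then show ?thesis
    using c keys_frag_extend[of "\<lambda>xs. frag_of (xs[0 := a \<odot>\<^bsub>M\<^esub> xs ! 0])" c] by fastforce
qed

lemma cls_smult:
  assumes a: "a \<in> carrier R"
  shows "a \<odot>\<^bsub>tensor_power R M n\<^esub> cls c = cls (act a c)"
proof -
  have "cls (act a (c + c')) = cls (act a c)" if "c' \<in> null" for c'
    by (rule cls_eqI) (use act_null[OF a that] in \<open>simp add: frag_extend_add\<close>)
  then show ?thesis using UN_cls[of "\<lambda>c. cls (act a c)" c] by (simp add: tensor_power_def)
qed

text \<open>Pure tensors generate the tensor power as a group, so additive maps are compared on
  them. The maps stay abstract because they are applied to composites, such as a homomorphism
  followed by a restriction.\<close>

lemma cls_frag_induct:
  assumes f: "\<And>x. x \<in> carrier (tensor_power R M n) \<Longrightarrow> f x \<in> carrier N"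
    and f_add: "\<And>x y. \<lbrakk>x \<in> carrier (tensor_power R M n); y \<in> carrier (tensor_power R M n)\<rbrakk>
      \<Longrightarrow> f (x \<oplus>\<^bsub>tensor_power R M n\<^esub> y) = f x \<oplus>\<^bsub>N\<^esub> f y"
    and g: "\<And>x. x \<in> carrier (tensor_power R M n) \<Longrightarrow> g x \<in> carrier N"
    and g_add: "\<And>x y. \<lbrakk>x \<in> carrier (tensor_power R M n); y \<in> carrier (tensor_power R M n)\<rbrakk>
      \<Longrightarrow> g (x \<oplus>\<^bsub>tensor_power R M n\<^esub> y) = g x \<oplus>\<^bsub>N\<^esub> g y"
    and N: "abelian_group N"
    and eq: "\<And>xs. xs \<in> tuples M n \<Longrightarrow> f (cls (frag_of xs)) = g (cls (frag_of xs))"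
    and x: "x \<in> carrier (tensor_power R M n)"
  shows "f x = g x"
proof -
  interpret N: abelian_group N by (rule N)
  obtain c where c: "Poly_Mapping.keys c \<subseteq> tuples M n" "x = cls c"
    using x unfolding carrier_tensor_power by auto
  have cl: "cls d \<in> carrier (tensor_power R M n)" if "Poly_Mapping.keys d \<subseteq> tuples M n" for d
    using that by (intro cls_closed) simp
  have ad: "cls d \<oplus>\<^bsub>tensor_power R M n\<^esub> cls e = cls (d + e)"
    if "Poly_Mapping.keys d \<subseteq> tuples M n" "Poly_Mapping.keys e \<subseteq> tuples M n" for d e
    using that by (intro cls_add) simp_all
  have "f (cls c) = g (cls c)"
  proof (rule free_Abelian_group_induct[OF c(1)])
    have z: "cls 0 \<in> carrier (tensor_power R M n)" by (rule cl) simp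
    have "cls 0 \<oplus>\<^bsub>tensor_power R M n\<^esub> cls 0 = cls 0" using ad[of 0 0] by simp
    then have "f (cls 0) = f (cls 0) \<oplus>\<^bsub>N\<^esub> f (cls 0)" "g (cls 0) = g (cls 0) \<oplus>\<^bsub>N\<^esub> g (cls 0)"
      using f_add[OF z z] g_add[OF z z] by simp_all
    then have "f (cls 0) = \<zero>\<^bsub>N\<^esub>" "g (cls 0) = \<zero>\<^bsub>N\<^esub>"
      using f[OF z] g[OF z] N.add.l_cancel_one' by metis+
    then show "f (cls 0) = g (cls 0)" by simp
  next
    fix d e assume 2: "Poly_Mapping.keys d \<subseteq> tuples M n" "Poly_Mapping.keys e \<subseteq> tuples M n"
      "f (cls d) = g (cls d)" "f (cls e) = g (cls e)"
    have k: "Poly_Mapping.keys (d - e) \<subseteq> tuples M n" using 2(1,2) keys_diff[of d e] by blast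
    note cl' = cl[OF k] cl[OF 2(1)] cl[OF 2(2)]
    have "f (cls (d - e)) \<oplus>\<^bsub>N\<^esub> f (cls e) = g (cls (d - e)) \<oplus>\<^bsub>N\<^esub> g (cls e)"
      using f_add[OF cl'(1,3)] g_add[OF cl'(1,3)] ad[OF k 2(2)] 2(3) by simp
    then show "f (cls (d - e)) = g (cls (d - e))"
      using f[OF cl'(1)] g[OF cl'(1)] f[OF cl'(3)] 2(4) N.add.r_cancel by simp
  qed (rule eq)
  then show ?thesis by (simp add: c(2))
qed

end

definition multilinear ::
  "'r ring \<Rightarrow> ('r, 'm) module \<Rightarrow> nat \<Rightarrow> ('r, 'n) module \<Rightarrow> ('m list \<Rightarrow> 'n) \<Rightarrow> bool" where
  "multilinear R M n N b \<longleftrightarrow>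
    (\<forall>xs\<in>tuples M n. b xs \<in> carrier N) \<and>
    (\<forall>xs\<in>tuples M n. \<forall>i<n. \<forall>x\<in>carrier M. \<forall>y\<in>carrier M.
      b (xs[i := x \<oplus>\<^bsub>M\<^esub> y]) = b (xs[i := x]) \<oplus>\<^bsub>N\<^esub> b (xs[i := y])) \<and>
    (\<forall>xs\<in>tuples M n. \<forall>i<n. \<forall>a\<in>carrier R. b (xs[i := a \<odot>\<^bsub>M\<^esub> xs ! i]) = a \<odot>\<^bsub>N\<^esub> b xs)"

lemma (in tensor_power_on) tensor_universal:
  assumes N: "Module.module R N" and b: "multilinear R M n N b"
  obtains \<beta> where "\<beta> \<in> carrier (tensor_power R M n) \<rightarrow> carrier N"
    "\<forall>x\<in>carrier (tensor_power R M n). \<forall>y\<in>carrier (tensor_power R M n).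
      \<beta> (x \<oplus>\<^bsub>tensor_power R M n\<^esub> y) = \<beta> x \<oplus>\<^bsub>N\<^esub> \<beta> y"
    "\<forall>a\<in>carrier R. \<forall>x\<in>carrier (tensor_power R M n). \<beta> (a \<odot>\<^bsub>tensor_power R M n\<^esub> x) = a \<odot>\<^bsub>N\<^esub> \<beta> x"
    "\<forall>xs\<in>tuples M n. \<beta> (cls (frag_of xs)) = b xs"
proof -
  interpret N: module R N by (rule N)
  have bc: "b xs \<in> carrier N" if "xs \<in> tuples M n" for xs
    using b that by (simp add: multilinear_def)
  obtain k where k: "k \<in> hom free (add_monoid N)" "\<And>xs. xs \<in> tuples M n \<Longrightarrow> k (frag_of xs) = b xs"
    using comm_group.free_Abelian_group_universal[OF N.M.a_comm_group, of b "tuples M n"] bc by auto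
  interpret k: group_hom free "add_monoid N" k
    by (intro group_hom.intro free.is_group N.M.a_group group_hom_axioms.intro k)
  have kc: "k c \<in> carrier N" if "c \<in> carrier free" for c
    using k.hom_closed[OF that] by simp
  have kadd: "k (c + d) = k c \<oplus>\<^bsub>N\<^esub> k d" if "c \<in> carrier free" "d \<in> carrier free" for c d
    using k.hom_mult[OF that] by simp
  have cadd: "c + d \<in> carrier free" if "c \<in> carrier free" "d \<in> carrier free" for c d
    using free.m_closed[OF that] by simp
  have cdiff: "c - d \<in> carrier free" if "c \<in> carrier free" "d \<in> carrier free" for c d
    using that keys_diff[of c d] by auto
  have kdiff: "k (c - d) \<oplus>\<^bsub>N\<^esub> k d = k c" if "c \<in> carrier free" "d \<in> carrier free" for c d
    using kadd[OF cdiff[OF that] that(2)] by simp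
  have kzeroI: "k (c - d) = \<zero>\<^bsub>N\<^esub>" if "c \<in> carrier free" "d \<in> carrier free" "k c = k d" for c d
    using kdiff[OF that(1,2)] that kc[OF cdiff[OF that(1,2)]] kc[OF that(2)] N.M.add.r_cancel_one by simp
  \<comment> \<open>Multilinearity of \<open>b\<close> makes the homomorphism induced on the free
    group vanish on the tensor relations.\<close>
  have rel: "k r = \<zero>\<^bsub>N\<^esub>" if "r \<in> tensor_relations R M n" for r
  proof -
    from that consider (add) xs i x y where "xs \<in> tuples M n" "i < n" "x \<in> carrier M" "y \<in> carrier M"
        "r = frag_of (xs[i := x \<oplus>\<^bsub>M\<^esub> y]) - frag_of (xs[i := x]) - frag_of (xs[i := y])"
      | (scal) xs i j a where "xs \<in> tuples M n" "i < n" "j < n" "a \<in> carrier R"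
        "r = frag_of (xs[i := a \<odot>\<^bsub>M\<^esub> xs ! i]) - frag_of (xs[j := a \<odot>\<^bsub>M\<^esub> xs ! j])"
      unfolding tensor_relations_def by blast
    then show ?thesis
    proof cases
      case add
      let ?f = "\<lambda>z. frag_of (xs[i := z])"
      have f: "?f z \<in> carrier free" "k (?f z) = b (xs[i := z])" if "z \<in> carrier M" for z
        using tuples_update[OF add(1) that] k(2) by simp_all
      have "k (?f (x \<oplus>\<^bsub>M\<^esub> y)) = k (?f x) \<oplus>\<^bsub>N\<^esub> k (?f y)"
        using b add by (simp add: f multilinear_def)
      then have eq: "k (?f (x \<oplus>\<^bsub>M\<^esub> y)) = k (?f x + ?f y)" using kadd[OF f(1)[OF add(3)] f(1)[OF add(4)]] by simp
      have "k (?f (x \<oplus>\<^bsub>M\<^esub> y) - (?f x + ?f y)) = \<zero>\<^bsub>N\<^esub>"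
        by (rule kzeroI[OF f(1) cadd[OF f(1)[OF add(3)] f(1)[OF add(4)]] eq]) (use add in simp)
      then show ?thesis by (simp add: add(5) diff_diff_eq)
    next
      case scal
      have f: "frag_of (xs[l := a \<odot>\<^bsub>M\<^esub> xs ! l]) \<in> carrier free"
        "k (frag_of (xs[l := a \<odot>\<^bsub>M\<^esub> xs ! l])) = a \<odot>\<^bsub>N\<^esub> b xs" if "l < n" for l
        using tuples_update[OF scal(1), of "a \<odot>\<^bsub>M\<^esub> xs ! l" l] tuples_nth[OF scal(1) that] k(2) scal that b
        by (simp_all add: multilinear_def)
      show ?thesis unfolding scal(5)
        by (rule kzeroI[OF f(1)[OF scal(2)] f(1)[OF scal(3)]]) (simp add: f(2) scal)
    qed
  qed
  have null: "k c = \<zero>\<^bsub>N\<^esub>" if "c \<in> null" for c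
    using that unfolding tensor_null_def
  proof (induction c rule: generate.induct)
    case (inv h)
    have "\<ominus>\<^bsub>N\<^esub> \<zero>\<^bsub>N\<^esub> = \<zero>\<^bsub>N\<^esub>" using N.M.minus_equality[of "\<zero>\<^bsub>N\<^esub>" "\<zero>\<^bsub>N\<^esub>"] by simp
    then show ?case
      using k.hom_inv[OF subsetD[OF relations_subset inv]] rel[OF inv] by (simp add: a_inv_def[symmetric])
  next
    case (eng h1 h2)
    then have "h1 \<in> carrier free" "h2 \<in> carrier free"
      using null.mem_carrier unfolding tensor_null_def by auto
    then show ?case using kadd[of h1 h2] eng by simp
  qed (use k.hom_one rel in auto)
  \<comment> \<open>Any representative of a class may be chosen, since \<open>k\<close> vanishes on
    \<open>null\<close>.\<close>
  define \<beta> where "\<beta> C = k (SOME c. c \<in> C)" for C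
  have \<beta>: "\<beta> (cls c) = k c" if c: "c \<in> carrier free" for c
  proof -
    have "(SOME c'. c' \<in> cls c) \<in> cls c" by (rule someI[of _ c]) (rule cls_self)
    then have d: "(SOME c'. c' \<in> cls c) - c \<in> null" by (simp add: cls_mem)
    have "k ((SOME c'. c' \<in> cls c) - c + c) = k c"
      using kadd[OF null.mem_carrier[OF d] c] null[OF d] kc[OF c] by simp
    then show ?thesis by (simp add: \<beta>_def)
  qed
  have act: "k (act a c) = a \<odot>\<^bsub>N\<^esub> k c" if a: "a \<in> carrier R" and c: "Poly_Mapping.keys c \<subseteq> tuples M n" for a c
  proof (rule free_Abelian_group_induct[OF c])
    show "k (act a 0) = a \<odot>\<^bsub>N\<^esub> k 0" using k.hom_one a by simp
  next
    fix x y assume 2: "Poly_Mapping.keys x \<subseteq> tuples M n" "Poly_Mapping.keys y \<subseteq> tuples M n"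
      "k (act a x) = a \<odot>\<^bsub>N\<^esub> k x" "k (act a y) = a \<odot>\<^bsub>N\<^esub> k y"
    have xy: "x \<in> carrier free" "y \<in> carrier free" "x - y \<in> carrier free" using 2 cdiff by simp_all
    have "k (act a (x - y)) \<oplus>\<^bsub>N\<^esub> k (act a y) = k (act a x)"
      using kdiff[OF act_closed[OF a xy(1)] act_closed[OF a xy(2)]] by (simp add: frag_extend_diff)
    also have "\<dots> = a \<odot>\<^bsub>N\<^esub> (k (x - y) \<oplus>\<^bsub>N\<^esub> k y)" using 2(3) kdiff[OF xy(1,2)] by simp
    also have "\<dots> = a \<odot>\<^bsub>N\<^esub> k (x - y) \<oplus>\<^bsub>N\<^esub> k (act a y)"
      using 2(4) N.smult_r_distr[OF a kc[OF xy(3)] kc[OF xy(2)]] by simp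
    finally show "k (act a (x - y)) = a \<odot>\<^bsub>N\<^esub> k (x - y)"
      using N.M.add.r_cancel kc[OF act_closed[OF a xy(3)]] kc[OF act_closed[OF a xy(2)]] a kc[OF xy(3)] by simp
  next
    fix xs assume 3: "xs \<in> tuples M n"
    then have "xs[0 := a \<odot>\<^bsub>M\<^esub> xs ! 0] \<in> tuples M n"
      using tuples_update[OF 3] tuples_nth[OF 3 n_pos] a by simp
    then show "k (act a (frag_of xs)) = a \<odot>\<^bsub>N\<^esub> k (frag_of xs)" using b 3 a n_pos by (simp add: k(2) multilinear_def)
  qed
  show ?thesis
  proof (rule that[of \<beta>])
    show "\<beta> \<in> carrier (tensor_power R M n) \<rightarrow> carrier N"
      unfolding carrier_tensor_power using \<beta> kc by auto
    show "\<forall>x\<in>carrier (tensor_power R M n). \<forall>y\<in>carrier (tensor_power R M n).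
        \<beta> (x \<oplus>\<^bsub>tensor_power R M n\<^esub> y) = \<beta> x \<oplus>\<^bsub>N\<^esub> \<beta> y"
    proof (intro ballI)
      fix x y assume "x \<in> carrier (tensor_power R M n)" "y \<in> carrier (tensor_power R M n)"
      then obtain c d where c: "c \<in> carrier free" "x = cls c" and d: "d \<in> carrier free" "y = cls d"
        unfolding carrier_tensor_power by (elim imageE) simp
      show "\<beta> (x \<oplus>\<^bsub>tensor_power R M n\<^esub> y) = \<beta> x \<oplus>\<^bsub>N\<^esub> \<beta> y"
        unfolding c(2) d(2) cls_add[OF c(1) d(1)] \<beta>[OF c(1)] \<beta>[OF d(1)] \<beta>[OF cadd[OF c(1) d(1)]]
        by (rule kadd[OF c(1) d(1)])
    qed
    show "\<forall>a\<in>carrier R. \<forall>x\<in>carrier (tensor_power R M n). \<beta> (a \<odot>\<^bsub>tensor_power R M n\<^esub> x) = a \<odot>\<^bsub>N\<^esub> \<beta> x"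
      unfolding carrier_tensor_power using act act_closed by (simp add: cls_smult \<beta>)
    show "\<forall>xs\<in>tuples M n. \<beta> (cls (frag_of xs)) = b xs"
      using \<beta> k(2) by simp
  qed
qed

section \<open>Sheafification\<close>

context presheaf_on
begin

lemma germ_self: "\<lbrakk>openin T U; p \<in> U; x \<in> Sec F U\<rbrakk> \<Longrightarrow> (U, x) \<in> germ T F p U x"
  unfolding germ_def by (intro CollectI case_prodI conjI exI[of _ U]) auto

lemma germ_memD:
  assumes "(V, y) \<in> germ T F p U x"
  obtains W where "openin T V" "p \<in> V" "y \<in> Sec F V" "openin T W" "p \<in> W" "W \<subseteq> U" "W \<subseteq> V"
    "res F U W x = res F V W y"
proof -
  have "openin T V \<and> p \<in> V \<and> y \<in> Sec F V \<and>
      (\<exists>W. openin T W \<and> p \<in> W \<and> W \<subseteq> U \<inter> V \<and> res F U W x = res F V W y)"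
    using assms by (simp only: germ_def mem_Collect_eq case_prod_conv)
  then show ?thesis using that by (elim conjE exE) simp
qed

text \<open>A germ is encoded as its whole class of pairs. A pair equivalent to one representative
  is equivalent to the other over the intersection of the two witnessing neighbourhoods.\<close>

lemma germ_subset:
  assumes U: "openin T U" and x: "x \<in> Sec F U"
    and V: "openin T V" and y: "y \<in> Sec F V"
    and W: "openin T W" "p \<in> W" "W \<subseteq> U" "W \<subseteq> V" and eq: "res F U W x = res F V W y"
  shows "germ T F p U x \<subseteq> germ T F p V y"
proof (rule subrelI)
  fix V' z assume "(V', z) \<in> germ T F p U x"
  then obtain W' where V': "openin T V'" "p \<in> V'" "z \<in> Sec F V'"
    and W': "openin T W'" "p \<in> W'" "W' \<subseteq> U" "W' \<subseteq> V'" and eq': "res F U W' x = res F V' W' z"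
    by (rule germ_memD)
  let ?W = "W \<inter> W'"
  have o: "openin T ?W" using W W' by blast
  have s: "?W \<subseteq> W" "?W \<subseteq> W'" by auto
  have "res F V ?W y = res F U ?W x"
    by (rule res_eq_mono[OF V U W(1) o s(1) W(4,3) y x eq[symmetric]])
  also have "\<dots> = res F V' ?W z"
    by (rule res_eq_mono[OF U V'(1) W'(1) o s(2) W'(3,4) x V'(3) eq'])
  finally have "res F V ?W y = res F V' ?W z" .
  moreover have "p \<in> ?W" "?W \<subseteq> V \<inter> V'" using W W' by auto
  ultimately show "(V', z) \<in> germ T F p V y"
    unfolding germ_def using V' o by (intro CollectI case_prodI conjI exI[of _ ?W])
qed

lemma germ_eqI:
  assumes "openin T U" "x \<in> Sec F U" "openin T V" "y \<in> Sec F V"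
    "openin T W" "p \<in> W" "W \<subseteq> U" "W \<subseteq> V" "res F U W x = res F V W y"
  shows "germ T F p U x = germ T F p V y"
  using germ_subset[OF assms] germ_subset[OF assms(3,4,1,2,5,6,8,7) assms(9)[symmetric]] by (rule equalityI)

lemma germ_eqD:
  assumes "germ T F p U x = germ T F p V y" "openin T V" "p \<in> V" "y \<in> Sec F V"
  obtains W where "openin T W" "p \<in> W" "W \<subseteq> U" "W \<subseteq> V" "res F U W x = res F V W y"
proof -
  have "(V, y) \<in> germ T F p U x" unfolding assms(1) by (rule germ_self[OF assms(2-4)])
  show ?thesis by (rule germ_memD[OF \<open>(V, y) \<in> germ T F p U x\<close>], rule that)
qed

lemma germ_res:
  assumes "openin T U" "x \<in> Sec F U" "openin T V" "V \<subseteq> U" "p \<in> V"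
  shows "germ T F p V (res F U V x) = germ T F p U x"
  by (rule germ_eqI[of _ _ _ _ V]) (use assms in simp_all)

end

definition section_of ::
  "'p topology \<Rightarrow> ('p, ('x, 'e) partial_object_scheme, 'x) presheaf \<Rightarrow> 'p set \<Rightarrow> 'x \<Rightarrow> 'p \<Rightarrow> ('p set \<times> 'x) set"
  where "section_of T F U x = (\<lambda>q\<in>U. germ T F q U x)"

lemma pure_tensor_section:
  "pure_tensor T A G U xs = section_of T (tensor_presheaf A G (length xs)) U
    (tensor_class (sect A U) (sect G U) (length xs) (frag_of xs))"
  by (simp add: pure_tensor_def section_of_def)

text \<open>Asks for closed operations compatible with restriction, so that tensor presheaves and
  their sheafifications qualify without a proof that they consist of modules.\<close>

locale linear_presheaf = ring_sheaf_on T A + P: presheaf_on T P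
  for T :: "'p topology" and A :: "('p, 'a) ring_presheaf" and P :: "('p, 'a, 'n) mod_presheaf" +
  assumes P_add [simp, intro]: "\<lbrakk>openin T U; x \<in> Sec P U; y \<in> Sec P U\<rbrakk>
      \<Longrightarrow> x \<oplus>\<^bsub>sect P U\<^esub> y \<in> Sec P U"
    and P_smult [simp, intro]: "\<lbrakk>openin T U; a \<in> Sec A U; x \<in> Sec P U\<rbrakk>
      \<Longrightarrow> a \<odot>\<^bsub>sect P U\<^esub> x \<in> Sec P U"
    and P_res_add [simp]: "\<lbrakk>openin T U; openin T V; V \<subseteq> U; x \<in> Sec P U; y \<in> Sec P U\<rbrakk>
      \<Longrightarrow> res P U V (x \<oplus>\<^bsub>sect P U\<^esub> y) = res P U V x \<oplus>\<^bsub>sect P V\<^esub> res P U V y"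
    and P_res_smult [simp]: "\<lbrakk>openin T U; openin T V; V \<subseteq> U; a \<in> Sec A U; x \<in> Sec P U\<rbrakk>
      \<Longrightarrow> res P U V (a \<odot>\<^bsub>sect P U\<^esub> x) = res A U V a \<odot>\<^bsub>sect P V\<^esub> res P U V x"
begin

abbreviation sh where "sh \<equiv> sheafification T A P"
abbreviation sec where "sec \<equiv> section_of T P"

lemma sh_carrier: "s \<in> Sec sh U \<longleftrightarrow> s \<in> (\<Pi>\<^sub>E p\<in>U. germs T P p) \<and>
    (\<forall>p\<in>U. \<exists>V x. openin T V \<and> p \<in> V \<and> V \<subseteq> U \<and> x \<in> Sec P V \<and> (\<forall>q\<in>V. s q = germ T P q V x))"
  by (simp add: sheafification_def)

text \<open>Local representability already places the values among the germs, which leaves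
  extensionality as the only further condition.\<close>

lemma sh_carrierI:
  assumes "s \<in> extensional U"
    and loc: "\<And>p. p \<in> U \<Longrightarrow> \<exists>V x. openin T V \<and> p \<in> V \<and> V \<subseteq> U \<and> x \<in> Sec P V \<and>
      (\<forall>q\<in>V. s q = germ T P q V x)"
  shows "s \<in> Sec sh U"
proof -
  have "s p \<in> germs T P p" if p: "p \<in> U" for p
  proof -
    from loc[OF p] obtain V x where V: "openin T V" "p \<in> V" "x \<in> Sec P V"
      and eq: "\<forall>q\<in>V. s q = germ T P q V x" by (elim exE conjE) simp
    have "s p = germ T P p V x" using eq V(2) by (rule bspec)
    then show ?thesis using V unfolding germs_def by (intro CollectI exI conjI)
  qed
  then have "s \<in> (\<Pi>\<^sub>E p\<in>U. germs T P p)"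
    using extensional_arb[OF assms(1)] by (rule PiE_I)
  then show ?thesis unfolding sh_carrier
    by (rule conjI) (rule ballI, rule loc)
qed

lemma sh_local:
  assumes "s \<in> Sec sh U" "p \<in> U"
  obtains V x where "openin T V" "p \<in> V" "V \<subseteq> U" "x \<in> Sec P V" "\<forall>q\<in>V. s q = germ T P q V x"
proof -
  have "\<exists>V x. openin T V \<and> p \<in> V \<and> V \<subseteq> U \<and> x \<in> Sec P V \<and> (\<forall>q\<in>V. s q = germ T P q V x)"
    by (rule bspec[OF conjunct2[OF assms(1)[unfolded sh_carrier]] assms(2)])
  then show ?thesis by (elim exE conjE) (rule that)
qed

lemma sh_extensional: "s \<in> Sec sh U \<Longrightarrow> s \<in> extensional U"
  unfolding sh_carrier by (elim conjE) (simp add: PiE_def)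

lemma sec_closed: "\<lbrakk>openin T U; x \<in> Sec P U\<rbrakk> \<Longrightarrow> sec U x \<in> Sec sh U"
  by (rule sh_carrierI) (auto simp: section_of_def)

lemma sh_res: "res sh U V s = restrict s V"
  by (simp add: sheafification_def)

lemma germ_shrink:
  assumes "openin T V" "x \<in> Sec P V" "\<forall>q\<in>V. s q = germ T P q V x" "openin T W" "W \<subseteq> V"
  shows "\<forall>q\<in>W. s q = germ T P q W (res P V W x)"
  using assms P.germ_res[OF assms(1,2,4,5)] by (simp add: subset_iff)

lemma restrict_eq_sec: "\<forall>q\<in>V. s q = germ T P q V x \<Longrightarrow> restrict s V = sec V x"
  unfolding section_of_def by (intro restrict_ext) simp

lemma sh_res_closed:
  assumes "openin T V" "V \<subseteq> U" "s \<in> Sec sh U"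
  shows "restrict s V \<in> Sec sh V"
proof (rule sh_carrierI)
  fix p assume p: "p \<in> V"
  then have "p \<in> U" using assms(2) by blast
  then obtain W x where W: "openin T W" "p \<in> W" "W \<subseteq> U" "x \<in> Sec P W"
    and eq: "\<forall>q\<in>W. s q = germ T P q W x" by (rule sh_local[OF assms(3)])
  have o: "openin T (V \<inter> W)" using assms W by blast
  have "\<forall>q\<in>V \<inter> W. s q = germ T P q (V \<inter> W) (res P W (V \<inter> W) x)"
    by (rule germ_shrink[OF W(1,4) eq o]) blast
  then show "\<exists>W x. openin T W \<and> p \<in> W \<and> W \<subseteq> V \<and> x \<in> Sec P W \<and>
      (\<forall>q\<in>W. restrict s V q = germ T P q W x)"
    using p W o by (intro exI[of _ "V \<inter> W"] exI[of _ "res P W (V \<inter> W) x"]) simp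
qed simp

text \<open>The sum of two sections at a point is a union over all pairs of representatives.
  Representatives over a common neighbourhood compute it, because every other pair agrees with them
  on a smaller one.\<close>

lemma sh_add_at:
  assumes V: "openin T V" and x: "x \<in> Sec P V" and y: "y \<in> Sec P V"
    and p: "p \<in> V" "p \<in> U" and s: "s p = germ T P p V x" and t: "t p = germ T P p V y"
  shows "(s \<oplus>\<^bsub>sect sh U\<^esub> t) p = germ T P p V (x \<oplus>\<^bsub>sect P V\<^esub> y)"
proof -
  have "(\<Union>(W, x')\<in>s p. \<Union>(W', y')\<in>t p. germ T P p (W \<inter> W')
      (res P W (W \<inter> W') x' \<oplus>\<^bsub>sect P (W \<inter> W')\<^esub> res P W' (W \<inter> W') y')) = germ T P p V (x \<oplus>\<^bsub>sect P V\<^esub> y)"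
  proof (rule UN_pair_const)
    show "(V, x) \<in> s p" "(V, y) \<in> t p" unfolding s t by (rule P.germ_self[OF V p(1)], fact)+
    fix W x' W' y' assume 1: "(W, x') \<in> s p" and 2: "(W', y') \<in> t p"
    obtain B where B: "openin T W" "p \<in> W" "x' \<in> Sec P W" "openin T B" "p \<in> B" "B \<subseteq> V" "B \<subseteq> W"
      "res P V B x = res P W B x'" using 1 unfolding s by (rule P.germ_memD)
    obtain B' where B': "openin T W'" "p \<in> W'" "y' \<in> Sec P W'" "openin T B'" "p \<in> B'" "B' \<subseteq> V" "B' \<subseteq> W'"
      "res P V B' y = res P W' B' y'" using 2 unfolding t by (rule P.germ_memD)
    have o: "openin T (W \<inter> W')" "openin T (B \<inter> B')" using B B' by auto
    have s: "W \<inter> W' \<subseteq> W" "W \<inter> W' \<subseteq> W'" "B \<inter> B' \<subseteq> W \<inter> W'" "B \<inter> B' \<subseteq> V" "B \<inter> B' \<subseteq> B" "B \<inter> B' \<subseteq> B'"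
      "B \<inter> B' \<subseteq> W" "B \<inter> B' \<subseteq> W'" using B B' by auto
    have c: "res P W (W \<inter> W') x' \<in> Sec P (W \<inter> W')" "res P W' (W \<inter> W') y' \<in> Sec P (W \<inter> W')"
      by (rule P.res_closed[OF B(1) o(1) s(1) B(3)], rule P.res_closed[OF B'(1) o(1) s(2) B'(3)])
    have e: "res P W (B \<inter> B') x' = res P V (B \<inter> B') x" "res P W' (B \<inter> B') y' = res P V (B \<inter> B') y"
      by (rule P.res_eq_mono[OF B(1) V B(4) o(2) s(5) B(7,6,3) x B(8)[symmetric]],
        rule P.res_eq_mono[OF B'(1) V B'(4) o(2) s(6) B'(7,6,3) y B'(8)[symmetric]])
    show "germ T P p (W \<inter> W') (res P W (W \<inter> W') x' \<oplus>\<^bsub>sect P (W \<inter> W')\<^esub> res P W' (W \<inter> W') y')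
        = germ T P p V (x \<oplus>\<^bsub>sect P V\<^esub> y)"
    proof (rule P.germ_eqI[OF o(1) P_add[OF o(1) c] V P_add[OF V x y] o(2) _ s(3,4)])
      show "p \<in> B \<inter> B'" using B B' by simp
      show "res P (W \<inter> W') (B \<inter> B') (res P W (W \<inter> W') x' \<oplus>\<^bsub>sect P (W \<inter> W')\<^esub> res P W' (W \<inter> W') y')
          = res P V (B \<inter> B') (x \<oplus>\<^bsub>sect P V\<^esub> y)"
        unfolding P_res_add[OF o s(3) c] P_res_add[OF V o(2) s(4) x y]
          P.res_res[OF B(1) o s(3,1) B(3)] P.res_res[OF B'(1) o s(3,2) B'(3)] e ..
    qed
  qed
  then show ?thesis using p by (simp add: sheafification_def)
qed

lemma sh_smult_at:
  assumes U: "openin T U" and V: "openin T V" "V \<subseteq> U" and x: "x \<in> Sec P V"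
    and a: "a \<in> Sec A U" and p: "p \<in> V" and s: "s p = germ T P p V x"
  shows "(a \<odot>\<^bsub>sect sh U\<^esub> s) p = germ T P p V (res A U V a \<odot>\<^bsub>sect P V\<^esub> x)"
proof -
  let ?g = "\<lambda>W x'. germ T P p (U \<inter> W) (res A U (U \<inter> W) a \<odot>\<^bsub>sect P (U \<inter> W)\<^esub> res P W (U \<inter> W) x')"
  have aV: "res A U V a \<in> Sec A V" using U V a by simp
  have g: "?g W x' = germ T P p V (res A U V a \<odot>\<^bsub>sect P V\<^esub> x)" if 1: "(W, x') \<in> s p" for W x'
  proof -
    obtain B where B: "openin T W" "p \<in> W" "x' \<in> Sec P W" "openin T B" "p \<in> B" "B \<subseteq> V" "B \<subseteq> W"
      "res P V B x = res P W B x'" using 1 unfolding s by (rule P.germ_memD)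
    have o: "openin T (U \<inter> W)" using B U by auto
    have s: "U \<inter> W \<subseteq> U" "U \<inter> W \<subseteq> W" "B \<subseteq> U \<inter> W" "B \<subseteq> U" using B V by auto
    have c: "res A U (U \<inter> W) a \<in> Sec A (U \<inter> W)" "res P W (U \<inter> W) x' \<in> Sec P (U \<inter> W)"
      by (rule res_closed[OF U o s(1) a], rule P.res_closed[OF B(1) o s(2) B(3)])
    show ?thesis
    proof (rule P.germ_eqI[OF o P_smult[OF o c] V(1) P_smult[OF V(1) aV x] B(4,5) s(3) B(6)])
      show "res P (U \<inter> W) B (res A U (U \<inter> W) a \<odot>\<^bsub>sect P (U \<inter> W)\<^esub> res P W (U \<inter> W) x')
          = res P V B (res A U V a \<odot>\<^bsub>sect P V\<^esub> x)"
        unfolding P_res_smult[OF o B(4) s(3) c] P_res_smult[OF V(1) B(4,6) aV x]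
          P.res_res[OF B(1) o B(4) s(3,2) B(3)] res_res[OF U o B(4) s(3,1) a]
          res_res[OF U V(1) B(4,6) V(2) a] B(8) ..
    qed
  qed
  have ne: "(V, x) \<in> s p" unfolding s by (rule P.germ_self[OF V(1) p x])
  have "(\<Union>(W, x')\<in>s p. ?g W x') = (\<Union>(W, x')\<in>s p. germ T P p V (res A U V a \<odot>\<^bsub>sect P V\<^esub> x))"
    by (rule SUP_cong[OF refl]) (use g in \<open>simp add: case_prod_unfold\<close>)
  also have "\<dots> = germ T P p V (res A U V a \<odot>\<^bsub>sect P V\<^esub> x)" using ne by (auto simp: case_prod_unfold)
  finally show ?thesis using p V by (simp add: sheafification_def subset_iff)
qed

lemma sh_common:
  assumes U: "openin T U" and s: "s \<in> Sec sh U" and t: "t \<in> Sec sh U" and p: "p \<in> U"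
  obtains V x y where "openin T V" "p \<in> V" "V \<subseteq> U" "x \<in> Sec P V" "y \<in> Sec P V"
    "\<forall>q\<in>V. s q = germ T P q V x" "\<forall>q\<in>V. t q = germ T P q V y"
proof -
  obtain V x where V: "openin T V" "p \<in> V" "V \<subseteq> U" "x \<in> Sec P V" "\<forall>q\<in>V. s q = germ T P q V x"
    by (rule sh_local[OF s p])
  obtain W y where W: "openin T W" "p \<in> W" "W \<subseteq> U" "y \<in> Sec P W" "\<forall>q\<in>W. t q = germ T P q W y"
    by (rule sh_local[OF t p])
  have o: "openin T (V \<inter> W)" using V W by blast
  have sb: "V \<inter> W \<subseteq> V" "V \<inter> W \<subseteq> W" by auto
  show ?thesis
    by (rule that[OF o _ _ P.res_closed[OF V(1) o sb(1) V(4)] P.res_closed[OF W(1) o sb(2) W(4)]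
        germ_shrink[OF V(1,4,5) o sb(1)] germ_shrink[OF W(1,4,5) o sb(2)]]) (use V W in auto)
qed

lemma sh_add_local:
  assumes "openin T V" "V \<subseteq> U" "x \<in> Sec P V" "y \<in> Sec P V"
    "\<forall>q\<in>V. s q = germ T P q V x" "\<forall>q\<in>V. t q = germ T P q V y"
  shows "\<forall>q\<in>V. (s \<oplus>\<^bsub>sect sh U\<^esub> t) q = germ T P q V (x \<oplus>\<^bsub>sect P V\<^esub> y)"
proof
  fix q assume q: "q \<in> V"
  show "(s \<oplus>\<^bsub>sect sh U\<^esub> t) q = germ T P q V (x \<oplus>\<^bsub>sect P V\<^esub> y)"
    by (rule sh_add_at[where s = s and t = t and p = q, OF assms(1,3,4) q subsetD[OF assms(2) q] bspec[OF assms(5) q] bspec[OF assms(6) q]])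
qed

lemma sh_smult_local:
  assumes "openin T U" "openin T V" "V \<subseteq> U" "x \<in> Sec P V" "a \<in> Sec A U"
    "\<forall>q\<in>V. s q = germ T P q V x"
  shows "\<forall>q\<in>V. (a \<odot>\<^bsub>sect sh U\<^esub> s) q = germ T P q V (res A U V a \<odot>\<^bsub>sect P V\<^esub> x)"
proof
  fix q assume q: "q \<in> V"
  show "(a \<odot>\<^bsub>sect sh U\<^esub> s) q = germ T P q V (res A U V a \<odot>\<^bsub>sect P V\<^esub> x)"
    by (rule sh_smult_at[where s = s and p = q, OF assms(1-5) q bspec[OF assms(6) q]])
qed

lemma sh_add_closed:
  assumes U: "openin T U" and s: "s \<in> Sec sh U" and t: "t \<in> Sec sh U"
  shows "s \<oplus>\<^bsub>sect sh U\<^esub> t \<in> Sec sh U"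
proof (rule sh_carrierI)
  show "s \<oplus>\<^bsub>sect sh U\<^esub> t \<in> extensional U" by (simp add: sheafification_def)
  fix p assume p: "p \<in> U"
  obtain V x y where V: "openin T V" "p \<in> V" "V \<subseteq> U" "x \<in> Sec P V" "y \<in> Sec P V"
    "\<forall>q\<in>V. s q = germ T P q V x" "\<forall>q\<in>V. t q = germ T P q V y" by (rule sh_common[OF U s t p])
  then show "\<exists>V x. openin T V \<and> p \<in> V \<and> V \<subseteq> U \<and> x \<in> Sec P V \<and>
      (\<forall>q\<in>V. (s \<oplus>\<^bsub>sect sh U\<^esub> t) q = germ T P q V x)"
    using sh_add_local[OF V(1,3-7)] P_add[OF V(1,4,5)] by (intro exI conjI)
qed

lemma sh_smult_closed:
  assumes U: "openin T U" and s: "s \<in> Sec sh U" and a: "a \<in> Sec A U"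
  shows "a \<odot>\<^bsub>sect sh U\<^esub> s \<in> Sec sh U"
proof (rule sh_carrierI)
  show "a \<odot>\<^bsub>sect sh U\<^esub> s \<in> extensional U" by (simp add: sheafification_def)
  fix p assume p: "p \<in> U"
  obtain V x where V: "openin T V" "p \<in> V" "V \<subseteq> U" "x \<in> Sec P V" "\<forall>q\<in>V. s q = germ T P q V x"
    by (rule sh_local[OF s p])
  then show "\<exists>V x. openin T V \<and> p \<in> V \<and> V \<subseteq> U \<and> x \<in> Sec P V \<and>
      (\<forall>q\<in>V. (a \<odot>\<^bsub>sect sh U\<^esub> s) q = germ T P q V x)"
    using sh_smult_local[OF U V(1,3,4) a V(5)] P_smult[OF V(1) res_closed[OF U V(1,3) a] V(4)]
    by (intro exI conjI)
qed

lemma sec_add: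
  assumes U: "openin T U" and x: "x \<in> Sec P U" and y: "y \<in> Sec P U"
  shows "sec U x \<oplus>\<^bsub>sect sh U\<^esub> sec U y = sec U (x \<oplus>\<^bsub>sect P U\<^esub> y)"
proof -
  have "\<forall>q\<in>U. (sec U x \<oplus>\<^bsub>sect sh U\<^esub> sec U y) q = germ T P q U (x \<oplus>\<^bsub>sect P U\<^esub> y)"
    by (rule sh_add_local[OF U subset_refl x y]) (simp_all add: section_of_def)
  moreover have "sec U x \<oplus>\<^bsub>sect sh U\<^esub> sec U y \<in> extensional U" by (simp add: sheafification_def)
  ultimately show ?thesis using restrict_eq_sec extensional_restrict by metis
qed

lemma sec_smult:
  assumes U: "openin T U" and x: "x \<in> Sec P U" and a: "a \<in> Sec A U"
  shows "a \<odot>\<^bsub>sect sh U\<^esub> sec U x = sec U (a \<odot>\<^bsub>sect P U\<^esub> x)"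
proof -
  have "\<forall>q\<in>U. (a \<odot>\<^bsub>sect sh U\<^esub> sec U x) q = germ T P q U (res A U U a \<odot>\<^bsub>sect P U\<^esub> x)"
    by (rule sh_smult_local[OF U U subset_refl x a]) (simp add: section_of_def)
  then have "\<forall>q\<in>U. (a \<odot>\<^bsub>sect sh U\<^esub> sec U x) q = germ T P q U (a \<odot>\<^bsub>sect P U\<^esub> x)"
    using U a by simp
  moreover have "a \<odot>\<^bsub>sect sh U\<^esub> sec U x \<in> extensional U" by (simp add: sheafification_def)
  ultimately show ?thesis using restrict_eq_sec extensional_restrict by metis
qed

lemma sec_res:
  assumes "openin T U" "x \<in> Sec P U" "openin T V" "V \<subseteq> U"
  shows "restrict (sec U x) V = sec V (res P U V x)"
  by (rule restrict_eq_sec[OF germ_shrink[OF assms(1,2) _ assms(3,4)]]) (simp add: section_of_def)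

text \<open>Every section of the sheafification is locally of the form \<open>sec V x\<close>, and
  in the sheaf \<open>G\<close> local agreement is equality.\<close>

lemma sheafification_hom_unique:
  assumes G: "module_sheaf_on T A G"
    and f: "mod_sheaf_hom T A sh G f" and g: "mod_sheaf_hom T A sh G g"
    and eq: "\<And>U x. \<lbrakk>openin T U; x \<in> Sec P U\<rbrakk> \<Longrightarrow> f U (sec U x) = g U (sec U x)"
    and U: "openin T U" and s: "s \<in> Sec sh U"
  shows "f U s = g U s"
proof -
  interpret G: module_sheaf_on T A G by (rule G)
  have c: "f U s \<in> Sec G U" "g U s \<in> Sec G U"
    using f g U s by (auto simp: mod_sheaf_hom_def)
  have res: "k V (restrict s V) = res G U V (k U s)"
    if "mod_sheaf_hom T A sh G k" "openin T V" "V \<subseteq> U" for k V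
    using that U s by (simp add: mod_sheaf_hom_def commutes_with_res_def sh_res)
  show ?thesis
  proof (rule G.F.local_eq[OF U c])
    fix p assume p: "p \<in> U"
    obtain V x where V: "openin T V" "p \<in> V" "V \<subseteq> U" "x \<in> Sec P V" "\<forall>q\<in>V. s q = germ T P q V x"
      by (rule sh_local[OF s p])
    have "f V (restrict s V) = g V (restrict s V)"
      unfolding restrict_eq_sec[OF V(5)] by (rule eq[OF V(1,4)])
    then show "\<exists>W. openin T W \<and> p \<in> W \<and> W \<subseteq> U \<and> res G U W (f U s) = res G U W (g U s)"
      using V res[OF f V(1,3)] res[OF g V(1,3)] by (intro exI[of _ V]) simp
  qed
qed

text \<open>The value on \<open>s\<close> is glued from the sections \<open>\<beta> W x\<close> over
  the open sets \<open>W\<close> where \<open>s\<close> is represented by \<open>x\<close>.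
  Additivity and linearity are then checked locally, where they are the properties of
  \<open>\<beta>\<close>.\<close>

lemma sheafification_universal:
  assumes G: "module_sheaf_on T A G"
    and c: "\<And>U x. \<lbrakk>openin T U; x \<in> Sec P U\<rbrakk> \<Longrightarrow> \<beta> U x \<in> Sec G U"
    and add: "\<And>U x y. \<lbrakk>openin T U; x \<in> Sec P U; y \<in> Sec P U\<rbrakk>
      \<Longrightarrow> \<beta> U (x \<oplus>\<^bsub>sect P U\<^esub> y) = \<beta> U x \<oplus>\<^bsub>sect G U\<^esub> \<beta> U y"
    and smult: "\<And>U a x. \<lbrakk>openin T U; a \<in> Sec A U; x \<in> Sec P U\<rbrakk>
      \<Longrightarrow> \<beta> U (a \<odot>\<^bsub>sect P U\<^esub> x) = a \<odot>\<^bsub>sect G U\<^esub> \<beta> U x"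
    and nat: "\<And>U V x. \<lbrakk>openin T U; openin T V; V \<subseteq> U; x \<in> Sec P U\<rbrakk>
      \<Longrightarrow> \<beta> V (res P U V x) = res G U V (\<beta> U x)"
  obtains f where "mod_sheaf_hom T A sh G f"
    "\<forall>U. openin T U \<longrightarrow> (\<forall>x\<in>Sec P U. f U (sec U x) = \<beta> U x)"
proof -
  interpret G: module_sheaf_on T A G by (rule G)
  define ext where "ext U s y \<longleftrightarrow> y \<in> Sec G U \<and> (\<forall>W x. openin T W \<and> W \<subseteq> U \<and>
    x \<in> Sec P W \<and> (\<forall>q\<in>W. s q = germ T P q W x) \<longrightarrow> res G U W y = \<beta> W x)" for U s y
  have extD: "res G U W y = \<beta> W x" if "ext U s y" "openin T W" "W \<subseteq> U" "x \<in> Sec P W"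
    "\<forall>q\<in>W. s q = germ T P q W x" for U s y W x
    using that unfolding ext_def by simp
  \<comment> \<open>Sections of the presheaf with equal germs may differ, but their images coincide
    because \<open>G\<close> is a sheaf. This makes the data to be glued compatible.\<close>
  have same: "\<beta> V x = \<beta> V y" if V: "openin T V" and x: "x \<in> Sec P V" and y: "y \<in> Sec P V"
    and eq: "\<forall>q\<in>V. germ T P q V x = germ T P q V y" for V x y
  proof (rule G.F.local_eq[OF V c[OF V x] c[OF V y]])
    fix p assume p: "p \<in> V"
    obtain W where W: "openin T W" "p \<in> W" "W \<subseteq> V" "res P V W x = res P V W y"
      by (rule P.germ_eqD[OF bspec[OF eq p] V p y])
    have "res G V W (\<beta> V x) = res G V W (\<beta> V y)"
      using nat[OF V W(1,3) x] nat[OF V W(1,3) y] W(4) by simp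
    then show "\<exists>W. openin T W \<and> p \<in> W \<and> W \<subseteq> V \<and> res G V W (\<beta> V x) = res G V W (\<beta> V y)"
      using W by (intro exI conjI)
  qed
  have ex: "\<exists>y. ext U s y" if U: "openin T U" and s: "s \<in> Sec sh U" for U s
  proof -
    define Q where "Q W y \<longleftrightarrow> (\<exists>x\<in>Sec P W. (\<forall>q\<in>W. s q = germ T P q W x) \<and> y = \<beta> W x)" for W y
    have "\<exists>y\<in>Sec G U. \<forall>W z. openin T W \<and> W \<subseteq> U \<and> z \<in> Sec G W \<and> Q W z \<longrightarrow> res G U W y = z"
    proof (rule G.F.glue[OF U])
      fix p assume p: "p \<in> U"
      obtain V x where V: "openin T V" "p \<in> V" "V \<subseteq> U" "x \<in> Sec P V" "\<forall>q\<in>V. s q = germ T P q V x"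
        by (rule sh_local[OF s p])
      have "Q V (\<beta> V x)" unfolding Q_def using V(4,5) by (intro bexI[of _ x] conjI refl)
      then show "\<exists>W y. openin T W \<and> p \<in> W \<and> W \<subseteq> U \<and> y \<in> Sec G W \<and> Q W y"
        using V c[OF V(1,4)] by (intro exI conjI)
    next
      fix V z W w assume V: "openin T V" "V \<subseteq> U" "Q V z" and W: "openin T W" "W \<subseteq> U" "Q W w"
      obtain x where x: "x \<in> Sec P V" "\<forall>q\<in>V. s q = germ T P q V x" "z = \<beta> V x"
        using V(3) unfolding Q_def by (elim bexE conjE)
      obtain y where y: "y \<in> Sec P W" "\<forall>q\<in>W. s q = germ T P q W y" "w = \<beta> W y"
        using W(3) unfolding Q_def by (elim bexE conjE)
      have o: "openin T (V \<inter> W)" using V W by blast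
      have sb: "V \<inter> W \<subseteq> V" "V \<inter> W \<subseteq> W" by auto
      have "\<beta> (V \<inter> W) (res P V (V \<inter> W) x) = \<beta> (V \<inter> W) (res P W (V \<inter> W) y)"
        by (rule same[OF o P.res_closed[OF V(1) o sb(1) x(1)] P.res_closed[OF W(1) o sb(2) y(1)]])
          (use germ_shrink[OF V(1) x(1,2) o sb(1)] germ_shrink[OF W(1) y(1,2) o sb(2)] in simp)
      then show "res G V (V \<inter> W) z = res G W (V \<inter> W) w"
        unfolding x(3) y(3) nat[OF V(1) o sb(1) x(1)] nat[OF W(1) o sb(2) y(1)] .
    qed
    then obtain y where y: "y \<in> Sec G U"
      "\<forall>W z. openin T W \<and> W \<subseteq> U \<and> z \<in> Sec G W \<and> Q W z \<longrightarrow> res G U W y = z" by (rule bexE)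
    have "res G U W y = \<beta> W x" if "openin T W" "W \<subseteq> U" "x \<in> Sec P W" "\<forall>q\<in>W. s q = germ T P q W x" for W x
    proof -
      have "Q W (\<beta> W x)" unfolding Q_def using that(3,4) by (intro bexI[of _ x] conjI refl)
      then show ?thesis using y(2)[rule_format, of W "\<beta> W x"] that(1,2) c[OF that(1,3)] by simp
    qed
    then show ?thesis using y(1) unfolding ext_def by (intro exI[of _ y] conjI allI impI) simp_all
  qed
  \<comment> \<open>Uniqueness yields naturality later: the restriction of the value on
    \<open>s\<close> satisfies the description of the value on the restriction of
    \<open>s\<close>.\<close>
  have uniq: "y = z" if U: "openin T U" and s: "s \<in> Sec sh U" and y: "ext U s y" and z: "ext U s z"
    for U s y z
  proof (rule G.F.local_eq[OF U])
    show "y \<in> Sec G U" "z \<in> Sec G U" using y z by (simp_all add: ext_def)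
    fix p assume p: "p \<in> U"
    obtain V x where V: "openin T V" "p \<in> V" "V \<subseteq> U" "x \<in> Sec P V" "\<forall>q\<in>V. s q = germ T P q V x"
      by (rule sh_local[OF s p])
    have "res G U V y = res G U V z" using extD[OF y V(1,3-5)] extD[OF z V(1,3-5)] by simp
    then show "\<exists>W. openin T W \<and> p \<in> W \<and> W \<subseteq> U \<and> res G U W y = res G U W z"
      using V(1-3) by (intro exI conjI)
  qed
  define f where "f U s = (SOME y. ext U s y)" for U s
  have f: "ext U s (f U s)" if "openin T U" "s \<in> Sec sh U" for U s
    unfolding f_def by (rule someI_ex[OF ex[OF that]])
  have fc: "f U s \<in> Sec G U" if "openin T U" "s \<in> Sec sh U" for U s
    using f[OF that] by (simp add: ext_def)
  have f_sec: "f U (sec U x) = \<beta> U x" if U: "openin T U" and x: "x \<in> Sec P U" for U x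
  proof -
    have "res G U U (f U (sec U x)) = \<beta> U x"
      by (rule extD[OF f[OF U sec_closed[OF U x]] U subset_refl x]) (simp add: section_of_def)
    then show ?thesis using fc[OF U sec_closed[OF U x]] U by simp
  qed
  have fadd: "f U (s \<oplus>\<^bsub>sect sh U\<^esub> t) = f U s \<oplus>\<^bsub>sect G U\<^esub> f U t"
    if U: "openin T U" and s: "s \<in> Sec sh U" and t: "t \<in> Sec sh U" for U s t
  proof (rule G.F.local_eq[OF U fc[OF U sh_add_closed[OF U s t]] G.F_sect_simps(3)[OF U fc[OF U s] fc[OF U t]]])
    fix p assume p: "p \<in> U"
    obtain V x y where V: "openin T V" "p \<in> V" "V \<subseteq> U" "x \<in> Sec P V" "y \<in> Sec P V"
      "\<forall>q\<in>V. s q = germ T P q V x" "\<forall>q\<in>V. t q = germ T P q V y" by (rule sh_common[OF U s t p])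
    have "res G U V (f U (s \<oplus>\<^bsub>sect sh U\<^esub> t)) = \<beta> V (x \<oplus>\<^bsub>sect P V\<^esub> y)"
      by (rule extD[OF f[OF U sh_add_closed[OF U s t]] V(1,3) P_add[OF V(1,4,5)] sh_add_local[OF V(1,3-7)]])
    also have "\<dots> = res G U V (f U s \<oplus>\<^bsub>sect G U\<^esub> f U t)"
      unfolding add[OF V(1,4,5)] G.F_res_add[OF U V(1,3) fc[OF U s] fc[OF U t]]
        extD[OF f[OF U s] V(1,3,4,6)] extD[OF f[OF U t] V(1,3,5,7)] ..
    finally show "\<exists>W. openin T W \<and> p \<in> W \<and> W \<subseteq> U \<and>
        res G U W (f U (s \<oplus>\<^bsub>sect sh U\<^esub> t)) = res G U W (f U s \<oplus>\<^bsub>sect G U\<^esub> f U t)"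
      using V(1-3) by (intro exI conjI)
  qed
  have fsmult: "f U (a \<odot>\<^bsub>sect sh U\<^esub> s) = a \<odot>\<^bsub>sect G U\<^esub> f U s"
    if U: "openin T U" and s: "s \<in> Sec sh U" and a: "a \<in> Sec A U" for U s a
  proof (rule G.F.local_eq[OF U fc[OF U sh_smult_closed[OF U s a]] G.F_sect_simps(2)[OF U a fc[OF U s]]])
    fix p assume p: "p \<in> U"
    obtain V x where V: "openin T V" "p \<in> V" "V \<subseteq> U" "x \<in> Sec P V" "\<forall>q\<in>V. s q = germ T P q V x"
      by (rule sh_local[OF s p])
    have aV: "res A U V a \<in> Sec A V" using U V a by simp
    have "res G U V (f U (a \<odot>\<^bsub>sect sh U\<^esub> s)) = \<beta> V (res A U V a \<odot>\<^bsub>sect P V\<^esub> x)"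
      by (rule extD[OF f[OF U sh_smult_closed[OF U s a]] V(1,3) P_smult[OF V(1) aV V(4)]
          sh_smult_local[OF U V(1,3,4) a V(5)]])
    also have "\<dots> = res G U V (a \<odot>\<^bsub>sect G U\<^esub> f U s)"
      unfolding smult[OF V(1) aV V(4)] G.F_res_smult[OF U V(1,3) a fc[OF U s]]
        extD[OF f[OF U s] V(1,3-5)] ..
    finally show "\<exists>W. openin T W \<and> p \<in> W \<and> W \<subseteq> U \<and>
        res G U W (f U (a \<odot>\<^bsub>sect sh U\<^esub> s)) = res G U W (a \<odot>\<^bsub>sect G U\<^esub> f U s)"
      using V(1-3) by (intro exI conjI)
  qed
  have fres: "f V (restrict s V) = res G U V (f U s)"
    if U: "openin T U" and V: "openin T V" "V \<subseteq> U" and s: "s \<in> Sec sh U" for U V s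
  proof (rule uniq[OF V(1) sh_res_closed[OF V s] f[OF V(1) sh_res_closed[OF V s]]])
    have "res G V W (res G U V (f U s)) = \<beta> W x"
      if W: "openin T W" "W \<subseteq> V" and x: "x \<in> Sec P W" and eq: "\<forall>q\<in>W. restrict s V q = germ T P q W x" for W x
    proof -
      have WU: "W \<subseteq> U" using W(2) V(2) by (rule subset_trans)
      have "\<forall>q\<in>W. s q = germ T P q W x" using eq W(2) by (simp add: subset_iff)
      from extD[OF f[OF U s] W(1) WU x this] show ?thesis
        using G.F.res_res[OF U V(1) W(1,2) V(2) fc[OF U s]] by simp
    qed
    then show "ext V (restrict s V) (res G U V (f U s))"
      unfolding ext_def using G.F.res_closed[OF U V fc[OF U s]] by (intro conjI allI impI) simp_all
  qed
  have "mod_sheaf_hom T A sh G f"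
    unfolding mod_sheaf_hom_def commutes_with_res_def sh_res
  proof (intro conjI allI impI ballI; (elim conjE)?)
    fix U assume "openin T U"
    then show "f U \<in> Sec sh U \<rightarrow> Sec G U" by (intro Pi_I fc)
  qed (rule fadd fsmult fres; assumption)+
  then show ?thesis using f_sec by (intro that allI impI ballI)
qed

end

section \<open>Sheaves of tensor powers and their homomorphisms\<close>

lemma tensor_presheaf_simps [simp]:
  "sect (tensor_presheaf A G n) U = tensor_power (sect A U) (sect G U) n"
  by (simp add: tensor_presheaf_def)

locale tensor_presheaf_on = module_sheaf_on T A G
  for T :: "'p topology" and A :: "('p, 'a) ring_presheaf" and G :: "('p, 'a, 'm) mod_presheaf" +
  fixes n :: nat
  assumes pos: "0 < n"
begin

abbreviation cls where "cls U \<equiv> tensor_class (sect A U) (sect G U) n"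
abbreviation tup where "tup U \<equiv> tuples (sect G U) n"
abbreviation rmap where "rmap U V \<equiv> frag_extend (\<lambda>xs. frag_of (map (res G U V) xs))"

lemma tp: "openin T U \<Longrightarrow> tensor_power_on (sect A U) (sect G U) n"
  by (intro tensor_power_on.intro module_sect tensor_power_on_axioms.intro pos)

lemma map_tuples: "\<lbrakk>openin T U; openin T V; V \<subseteq> U; xs \<in> tup U\<rbrakk> \<Longrightarrow> map (res G U V) xs \<in> tup V"
  by (auto simp: tuples_def subset_iff)

lemma rmap_relation:
  assumes U: "openin T U" and V: "openin T V" "V \<subseteq> U"
    and r: "r \<in> tensor_relations (sect A U) (sect G U) n"
  shows "rmap U V r \<in> tensor_relations (sect A V) (sect G V) n"
proof -
  let ?f = "res G U V"
  from r consider (add) xs i x y where "xs \<in> tup U" "i < n" "x \<in> Sec G U" "y \<in> Sec G U"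
      "r = frag_of (xs[i := x \<oplus>\<^bsub>sect G U\<^esub> y]) - frag_of (xs[i := x]) - frag_of (xs[i := y])"
    | (scal) xs i j a where "xs \<in> tup U" "i < n" "j < n" "a \<in> Sec A U"
      "r = frag_of (xs[i := a \<odot>\<^bsub>sect G U\<^esub> xs ! i]) - frag_of (xs[j := a \<odot>\<^bsub>sect G U\<^esub> xs ! j])"
    unfolding tensor_relations_def by blast
  then show ?thesis
  proof cases
    case add
    have "rmap U V r = frag_of ((map ?f xs)[i := ?f x \<oplus>\<^bsub>sect G V\<^esub> ?f y]) - frag_of ((map ?f xs)[i := ?f x])
        - frag_of ((map ?f xs)[i := ?f y])"
      using add U V by (simp add: frag_extend_diff map_update)
    moreover have "map ?f xs \<in> tup V" by (rule map_tuples[OF U V add(1)])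
    moreover have "?f x \<in> Sec G V" "?f y \<in> Sec G V" using add U V by auto
    ultimately show ?thesis using add(2) unfolding tensor_relations_def by blast
  next
    case scal
    have nth: "?f (xs ! k) = map ?f xs ! k" "xs ! k \<in> Sec G U" if "k < n" for k
      using that scal(1) tuples_nth[OF scal(1) that] by (simp_all add: tuples_def)
    have "rmap U V r = frag_of ((map ?f xs)[i := res A U V a \<odot>\<^bsub>sect G V\<^esub> map ?f xs ! i])
        - frag_of ((map ?f xs)[j := res A U V a \<odot>\<^bsub>sect G V\<^esub> map ?f xs ! j])"
      using scal(4,5) U V nth[OF scal(2)] nth[OF scal(3)] by (simp add: frag_extend_diff map_update)
    moreover have "map ?f xs \<in> tup V" by (rule map_tuples[OF U V scal(1)])
    moreover have "res A U V a \<in> Sec A V" using scal U V by auto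
    ultimately show ?thesis using scal(2,3) unfolding tensor_relations_def by blast
  qed
qed

lemma rmap_null:
  assumes U: "openin T U" and V: "openin T V" "V \<subseteq> U"
    and c: "c \<in> tensor_null (sect A U) (sect G U) n"
  shows "rmap U V c \<in> tensor_null (sect A V) (sect G V) n"
proof -
  interpret U: tensor_power_on "sect A U" "sect G U" n by (rule tp[OF U])
  interpret V: tensor_power_on "sect A V" "sect G V" n by (rule tp[OF V(1)])
  show ?thesis unfolding tensor_null_def
    by (rule frag_extend_generate[OF U.relations_subset _ V.relations_subset c[unfolded tensor_null_def]])
      (rule generate.incl[OF rmap_relation[OF U V]])
qed

lemma res_cls:
  assumes U: "openin T U" and V: "openin T V" "V \<subseteq> U"
  shows "res (tensor_presheaf A G n) U V (cls U c) = cls V (rmap U V c)"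
proof -
  interpret U: tensor_power_on "sect A U" "sect G U" n by (rule tp[OF U])
  interpret V: tensor_power_on "sect A V" "sect G V" n by (rule tp[OF V(1)])
  have "cls V (rmap U V (c + c')) = cls V (rmap U V c)" if "c' \<in> tensor_null (sect A U) (sect G U) n" for c'
    by (rule V.cls_eqI) (use rmap_null[OF U V that] in \<open>simp add: frag_extend_add\<close>)
  then show ?thesis using U.UN_cls[of "\<lambda>c. cls V (rmap U V c)" c] by (simp add: tensor_presheaf_def)
qed

lemma rmap_closed:
  assumes "openin T U" "openin T V" "V \<subseteq> U" "Poly_Mapping.keys c \<subseteq> tup U"
  shows "Poly_Mapping.keys (rmap U V c) \<subseteq> tup V"
  using keys_frag_extend[of "\<lambda>xs. frag_of (map (res G U V) xs)" c] map_tuples[OF assms(1-3)] assms(4)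
  by fastforce

lemma tensor_carrierE:
  assumes "openin T U" "x \<in> carrier (tensor_power (sect A U) (sect G U) n)"
  obtains c where "Poly_Mapping.keys c \<subseteq> tup U" "x = cls U c"
  using assms(2) unfolding tensor_power_on.carrier_tensor_power[OF tp[OF assms(1)]]
  by (elim imageE) (simp add: that)

lemma tensor_linear_presheaf: "linear_presheaf T A (tensor_presheaf A G n)"
proof -
  have presheaf: "is_presheaf T (tensor_presheaf A G n)"
    unfolding is_presheaf_def tensor_presheaf_simps
  proof (intro conjI allI impI ballI; (elim conjE)?)
    fix U x assume U: "openin T U" and x: "x \<in> carrier (tensor_power (sect A U) (sect G U) n)"
    obtain c where c: "Poly_Mapping.keys c \<subseteq> tup U" "x = cls U c" by (rule tensor_carrierE[OF U x])
    have "map (res G U U) xs = xs" if "xs \<in> tup U" for xs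
      by (rule map_idI) (use that U in \<open>auto simp: tuples_def subset_iff\<close>)
    then have "rmap U U c = frag_extend frag_of c"
      using c(1) by (intro frag_extend_eq) (auto simp: subset_iff)
    then show "res (tensor_presheaf A G n) U U x = x"
      unfolding c(2) res_cls[OF U U subset_refl] frag_expansion[symmetric] by simp
  next
    fix U V assume U: "openin T U" "openin T V" "V \<subseteq> U"
    show "res (tensor_presheaf A G n) U V \<in> carrier (tensor_power (sect A U) (sect G U) n) \<rightarrow>
        carrier (tensor_power (sect A V) (sect G V) n)"
    proof
      fix x assume x: "x \<in> carrier (tensor_power (sect A U) (sect G U) n)"
      obtain c where c: "Poly_Mapping.keys c \<subseteq> tup U" "x = cls U c" by (rule tensor_carrierE[OF U(1) x])
      show "res (tensor_presheaf A G n) U V x \<in> carrier (tensor_power (sect A V) (sect G V) n)"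
        unfolding c(2) res_cls[OF U] using rmap_closed[OF U c(1)]
        by (intro tensor_power_on.cls_closed[OF tp[OF U(2)]]) simp
    qed
  next
    fix U V W x assume o: "openin T U" "openin T V" "openin T W" and s: "W \<subseteq> V" "V \<subseteq> U"
      and x: "x \<in> carrier (tensor_power (sect A U) (sect G U) n)"
    have WU: "W \<subseteq> U" using s by blast
    obtain c where c: "Poly_Mapping.keys c \<subseteq> tup U" "x = cls U c" by (rule tensor_carrierE[OF o(1) x])
    have "rmap V W (rmap U V c) = frag_extend ((\<lambda>xs. frag_of (map (res G V W) xs)) \<circ> map (res G U V)) c"
      using frag_extend_compose[of "\<lambda>xs. frag_of (map (res G V W) xs)" "map (res G U V)" c]
      by (simp add: comp_def)
    also have "\<dots> = rmap U W c"
      by (rule frag_extend_eq) (use c(1) o s in \<open>auto simp: tuples_def subset_iff frag_of_eq\<close>)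
    finally show "res (tensor_presheaf A G n) V W (res (tensor_presheaf A G n) U V x)
        = res (tensor_presheaf A G n) U W x"
      unfolding c(2) res_cls[OF o(1,2) s(2)] res_cls[OF o(2,3) s(1)] res_cls[OF o(1,3) WU] by simp
  qed
  show ?thesis
  proof (intro linear_presheaf.intro linear_presheaf_axioms.intro ring_sheaf_on_axioms
      presheaf_on.intro presheaf)
    fix U x y assume U: "openin T U" and x: "x \<in> Sec (tensor_presheaf A G n) U"
      and y: "y \<in> Sec (tensor_presheaf A G n) U"
    interpret U: tensor_power_on "sect A U" "sect G U" n by (rule tp[OF U])
    obtain c where c: "Poly_Mapping.keys c \<subseteq> tup U" "x = cls U c"
      using x by (auto elim: tensor_carrierE[OF U])
    obtain d where d: "Poly_Mapping.keys d \<subseteq> tup U" "y = cls U d"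
      using y by (auto elim: tensor_carrierE[OF U])
    have cd: "c \<in> carrier U.free" "d \<in> carrier U.free" using c d by simp_all
    have k: "Poly_Mapping.keys (c + d) \<subseteq> tup U" using U.free.m_closed[OF cd] by simp
    show "x \<oplus>\<^bsub>sect (tensor_presheaf A G n) U\<^esub> y \<in> Sec (tensor_presheaf A G n) U"
      unfolding c(2) d(2) tensor_presheaf_simps U.cls_add[OF cd] using k by (intro U.cls_closed) simp
    fix V assume V: "openin T V" "V \<subseteq> U"
    interpret V: tensor_power_on "sect A V" "sect G V" n by (rule tp[OF V(1)])
    have "rmap U V c \<in> carrier V.free" "rmap U V d \<in> carrier V.free"
      using rmap_closed[OF U V c(1)] rmap_closed[OF U V d(1)] by simp_all
    then show "res (tensor_presheaf A G n) U V (x \<oplus>\<^bsub>sect (tensor_presheaf A G n) U\<^esub> y) =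
        res (tensor_presheaf A G n) U V x \<oplus>\<^bsub>sect (tensor_presheaf A G n) V\<^esub> res (tensor_presheaf A G n) U V y"
      unfolding c(2) d(2) tensor_presheaf_simps U.cls_add[OF cd] res_cls[OF U V]
      by (simp add: V.cls_add frag_extend_add)
  next
    fix U a x assume U: "openin T U" and a: "a \<in> Sec A U"
      and x: "x \<in> Sec (tensor_presheaf A G n) U"
    interpret U: tensor_power_on "sect A U" "sect G U" n by (rule tp[OF U])
    obtain c where c: "Poly_Mapping.keys c \<subseteq> tup U" "x = cls U c"
      using x by (auto elim: tensor_carrierE[OF U])
    have "c \<in> carrier U.free" using c by simp
    then show "a \<odot>\<^bsub>sect (tensor_presheaf A G n) U\<^esub> x \<in> Sec (tensor_presheaf A G n) U"
      unfolding c(2) tensor_presheaf_simps U.cls_smult[OF a] by (intro U.cls_closed U.act_closed a)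
    fix V assume V: "openin T V" "V \<subseteq> U"
    interpret V: tensor_power_on "sect A V" "sect G V" n by (rule tp[OF V(1)])
    have aV: "res A U V a \<in> Sec A V" using U V a by simp
    let ?r = "map (res G U V)" and ?u = "\<lambda>xs. xs[0 := a \<odot>\<^bsub>sect G U\<^esub> xs ! 0]"
      and ?v = "\<lambda>xs. xs[0 := res A U V a \<odot>\<^bsub>sect G V\<^esub> xs ! 0]"
    \<comment> \<open>Both composites are induced by maps of tuples, and these agree because
      restricting a scaled first entry scales the restricted entry.\<close>
    have "rmap U V (U.act a c) = frag_extend (frag_of \<circ> (?r \<circ> ?u)) c"
      using frag_extend_compose[of "\<lambda>xs. frag_of (?r xs)" ?u c] by (simp add: comp_def)
    also have "\<dots> = frag_extend (frag_of \<circ> (?v \<circ> ?r)) c"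
    proof (rule frag_extend_eq)
      fix xs assume "xs \<in> Poly_Mapping.keys c"
      then have xs: "xs \<in> tup U" using c(1) by blast
      have "xs ! 0 \<in> Sec G U" by (rule tuples_nth[OF xs pos])
      then show "(frag_of \<circ> (?r \<circ> ?u)) xs = (frag_of \<circ> (?v \<circ> ?r)) xs"
        using xs pos U V a by (simp add: map_update tuples_def)
    qed
    also have "\<dots> = V.act (res A U V a) (rmap U V c)"
      using frag_extend_compose[of "\<lambda>xs. frag_of (?v xs)" ?r c] by (simp add: comp_def)
    finally show "res (tensor_presheaf A G n) U V (a \<odot>\<^bsub>sect (tensor_presheaf A G n) U\<^esub> x) =
        res A U V a \<odot>\<^bsub>sect (tensor_presheaf A G n) V\<^esub> res (tensor_presheaf A G n) U V x"
      unfolding c(2) tensor_presheaf_simps U.cls_smult[OF a] res_cls[OF U V] V.cls_smult[OF aV] by simp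
  qed
qed

sublocale linear_presheaf T A "tensor_presheaf A G n"
  by (rule tensor_linear_presheaf)

end

lemma (in linear_presheaf) sh_linear_presheaf: "linear_presheaf T A sh"
proof -
  have presheaf: "is_presheaf T sh"
    unfolding is_presheaf_def sh_res
  proof (intro conjI allI impI ballI; (elim conjE)?)
    fix U s assume "s \<in> Sec sh U"
    then show "restrict s U = s" by (intro extensional_restrict sh_extensional)
  next
    fix U V assume "openin T V" "V \<subseteq> U"
    then show "(\<lambda>s. restrict s V) \<in> Sec sh U \<rightarrow> Sec sh V"
      by (intro Pi_I sh_res_closed)
  next
    fix V W :: "'p set" and s :: "'p \<Rightarrow> ('p set \<times> 'n) set" assume "W \<subseteq> V"
    then show "restrict (restrict s V) W = restrict s W" by (simp add: Int_absorb1)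
  qed
  show ?thesis
  proof (intro linear_presheaf.intro linear_presheaf_axioms.intro ring_sheaf_on_axioms
      presheaf_on.intro presheaf sh_add_closed sh_smult_closed)
    fix U V :: "'p set" and s t assume UV: "V \<subseteq> U"
    show "res sh U V (s \<oplus>\<^bsub>sect sh U\<^esub> t) = res sh U V s \<oplus>\<^bsub>sect sh V\<^esub> res sh U V t"
    proof
      fix q show "res sh U V (s \<oplus>\<^bsub>sect sh U\<^esub> t) q = (res sh U V s \<oplus>\<^bsub>sect sh V\<^esub> res sh U V t) q"
        using UV by (cases "q \<in> V") (auto simp: sheafification_def)
    qed
  next
    fix U V a s assume U: "openin T U" and V: "openin T V" "V \<subseteq> U" and a: "a \<in> Sec A U"
      and s: "s \<in> Sec sh U"
    have aV: "res A U V a \<in> Sec A V" using U V a by simp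
    show "res sh U V (a \<odot>\<^bsub>sect sh U\<^esub> s) = res A U V a \<odot>\<^bsub>sect sh V\<^esub> res sh U V s"
      unfolding sh_res
    proof
      fix q show "restrict (a \<odot>\<^bsub>sect sh U\<^esub> s) V q = (res A U V a \<odot>\<^bsub>sect sh V\<^esub> restrict s V) q"
      proof (cases "q \<in> V")
        case False
        then show ?thesis by (simp add: sheafification_def)
      next
        case True
        obtain W x where W: "openin T W" "q \<in> W" "W \<subseteq> V" "x \<in> Sec P W"
          "\<forall>r\<in>W. restrict s V r = germ T P r W x"
          by (rule sh_local[OF sh_res_closed[OF V s] True])
        have WU: "W \<subseteq> U" using W V by blast
        have eqV: "restrict s V q = germ T P q W x" by (rule bspec[OF W(5,2)])
        then have eqU: "s q = germ T P q W x" using True by simp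
        have "(a \<odot>\<^bsub>sect sh U\<^esub> s) q = germ T P q W (res A U W a \<odot>\<^bsub>sect P W\<^esub> x)"
          by (rule sh_smult_at[where s = s and p = q, OF U W(1) WU W(4) a W(2) eqU])
        moreover have "(res A U V a \<odot>\<^bsub>sect sh V\<^esub> restrict s V) q
            = germ T P q W (res A V W (res A U V a) \<odot>\<^bsub>sect P W\<^esub> x)"
          by (rule sh_smult_at[where s = "restrict s V" and p = q, OF V(1) W(1,3,4) aV W(2) eqV])
        ultimately show ?thesis using True res_res[OF U V(1) W(1,3) V(2) a] by simp
      qed
    qed
  qed
qed

lemma (in module_sheaf_on) linear_presheaf: "linear_presheaf T A F"
  by (intro linear_presheaf.intro linear_presheaf_axioms.intro ring_sheaf_on_axioms
      F.presheaf_on_axioms F_sect_simps F_res_add F_res_smult)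

section \<open>The module of sheaf homomorphisms\<close>

locale hom_module_on = module_sheaf_on T A N + S: linear_presheaf T A S
  for T :: "'p topology" and A :: "('p, 'a) ring_presheaf"
    and S :: "('p, 'a, 'm) mod_presheaf" and N :: "('p, 'a, 'n) mod_presheaf"
begin

abbreviation H where "H \<equiv> hom_module T A S N"

lemma H_carrier: "f \<in> carrier H \<longleftrightarrow> mod_sheaf_hom T A S N f \<and> normalize_family T S f = f"
  by (simp add: hom_module_def)

lemma normalize_apply [simp]:
  "\<lbrakk>openin T U; x \<in> Sec S U\<rbrakk> \<Longrightarrow> normalize_family T S f U x = f U x"
  by (simp add: normalize_family_def)

lemma normalize_closed:
  assumes "mod_sheaf_hom T A S N f"
  shows "normalize_family T S f \<in> carrier H"
proof -
  have "normalize_family T S (normalize_family T S f) = normalize_family T S f"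
    by (simp add: normalize_family_def fun_eq_iff)
  moreover have "mod_sheaf_hom T A S N (normalize_family T S f)"
    using assms unfolding mod_sheaf_hom_def commutes_with_res_def
    by (auto simp: Pi_iff)
  ultimately show ?thesis by (simp add: H_carrier)
qed

lemma H_apply:
  assumes "f \<in> carrier H" "openin T U"
  shows "x \<in> Sec S U \<Longrightarrow> f U x \<in> Sec N U"
    and "\<lbrakk>x \<in> Sec S U; y \<in> Sec S U\<rbrakk> \<Longrightarrow> f U (x \<oplus>\<^bsub>sect S U\<^esub> y) = f U x \<oplus>\<^bsub>sect N U\<^esub> f U y"
    and "\<lbrakk>a \<in> Sec A U; x \<in> Sec S U\<rbrakk> \<Longrightarrow> f U (a \<odot>\<^bsub>sect S U\<^esub> x) = a \<odot>\<^bsub>sect N U\<^esub> f U x"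
    and "\<lbrakk>openin T V; V \<subseteq> U; x \<in> Sec S U\<rbrakk> \<Longrightarrow> f V (res S U V x) = res N U V (f U x)"
  using assms by (auto simp: H_carrier mod_sheaf_hom_def commutes_with_res_def)

text \<open>Normalisation fixes the values outside the open sets and the carriers, so agreement on
  sections is equality of functions.\<close>

lemma H_ext:
  assumes f: "f \<in> carrier H" and g: "g \<in> carrier H"
    and eq: "\<And>U x. \<lbrakk>openin T U; x \<in> Sec S U\<rbrakk> \<Longrightarrow> f U x = g U x"
  shows "f = g"
proof -
  have "normalize_family T S f = normalize_family T S g"
    using eq by (auto simp: normalize_family_def fun_eq_iff restrict_def)
  then show ?thesis using f g by (simp add: H_carrier)
qed

lemma H_ops:
  "f \<oplus>\<^bsub>H\<^esub> g = normalize_family T S (\<lambda>U x. f U x \<oplus>\<^bsub>sect N U\<^esub> g U x)"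
  "\<zero>\<^bsub>H\<^esub> = normalize_family T S (\<lambda>U x. \<zero>\<^bsub>sect N U\<^esub>)"
  "a \<odot>\<^bsub>H\<^esub> f = normalize_family T S (\<lambda>U x. res A (topspace T) U a \<odot>\<^bsub>sect N U\<^esub> f U x)"
  by (simp_all add: hom_module_def)

lemma H_ops_apply [simp]:
  assumes "openin T U" "x \<in> Sec S U"
  shows "(f \<oplus>\<^bsub>H\<^esub> g) U x = f U x \<oplus>\<^bsub>sect N U\<^esub> g U x" "\<zero>\<^bsub>H\<^esub> U x = \<zero>\<^bsub>sect N U\<^esub>"
    "(a \<odot>\<^bsub>H\<^esub> f) U x = res A (topspace T) U a \<odot>\<^bsub>sect N U\<^esub> f U x"
  using assms by (simp_all add: H_ops)

lemma mod_sheaf_homI: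
  assumes "\<And>U x. \<lbrakk>openin T U; x \<in> Sec S U\<rbrakk> \<Longrightarrow> f U x \<in> Sec N U"
    and "\<And>U x y. \<lbrakk>openin T U; x \<in> Sec S U; y \<in> Sec S U\<rbrakk>
      \<Longrightarrow> f U (x \<oplus>\<^bsub>sect S U\<^esub> y) = f U x \<oplus>\<^bsub>sect N U\<^esub> f U y"
    and "\<And>U a x. \<lbrakk>openin T U; a \<in> Sec A U; x \<in> Sec S U\<rbrakk>
      \<Longrightarrow> f U (a \<odot>\<^bsub>sect S U\<^esub> x) = a \<odot>\<^bsub>sect N U\<^esub> f U x"
    and "\<And>U V x. \<lbrakk>openin T U; openin T V; V \<subseteq> U; x \<in> Sec S U\<rbrakk>
      \<Longrightarrow> f V (res S U V x) = res N U V (f U x)"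
  shows "mod_sheaf_hom T A S N f"
  unfolding mod_sheaf_hom_def commutes_with_res_def using assms by simp

lemma H_zero_closed: "\<zero>\<^bsub>H\<^esub> \<in> carrier H"
  unfolding H_ops
proof (intro normalize_closed mod_sheaf_homI)
  fix U assume U: "openin T U"
  interpret U: module "sect A U" "sect N U" by (rule module_sect[OF U])
  show "\<zero>\<^bsub>sect N U\<^esub> \<in> Sec N U" "\<zero>\<^bsub>sect N U\<^esub> = \<zero>\<^bsub>sect N U\<^esub> \<oplus>\<^bsub>sect N U\<^esub> \<zero>\<^bsub>sect N U\<^esub>"
    by simp_all
  show "\<zero>\<^bsub>sect N U\<^esub> = a \<odot>\<^bsub>sect N U\<^esub> \<zero>\<^bsub>sect N U\<^esub>" if "a \<in> Sec A U" for a
    using that by simp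
  show "\<zero>\<^bsub>sect N V\<^esub> = res N U V \<zero>\<^bsub>sect N U\<^esub>" if "openin T V" "V \<subseteq> U" for V
    using that U by simp
qed

lemma H_add_closed:
  assumes f: "f \<in> carrier H" and g: "g \<in> carrier H"
  shows "f \<oplus>\<^bsub>H\<^esub> g \<in> carrier H"
  unfolding H_ops
proof (intro normalize_closed mod_sheaf_homI)
  fix U x assume U: "openin T U" and x: "x \<in> Sec S U"
  interpret U: module "sect A U" "sect N U" by (rule module_sect[OF U])
  note fU = H_apply[OF f U] and gU = H_apply[OF g U]
  show "f U x \<oplus>\<^bsub>sect N U\<^esub> g U x \<in> Sec N U" using fU(1)[OF x] gU(1)[OF x] by simp
  show "f U (x \<oplus>\<^bsub>sect S U\<^esub> y) \<oplus>\<^bsub>sect N U\<^esub> g U (x \<oplus>\<^bsub>sect S U\<^esub> y) =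
      f U x \<oplus>\<^bsub>sect N U\<^esub> g U x \<oplus>\<^bsub>sect N U\<^esub> (f U y \<oplus>\<^bsub>sect N U\<^esub> g U y)" if y: "y \<in> Sec S U" for y
    using fU(1)[OF x] gU(1)[OF x] fU(1)[OF y] gU(1)[OF y]
    by (simp add: fU(2)[OF x y] gU(2)[OF x y] U.M.a_ac)
  show "f V (res S U V x) \<oplus>\<^bsub>sect N V\<^esub> g V (res S U V x) = res N U V (f U x \<oplus>\<^bsub>sect N U\<^esub> g U x)"
    if V: "openin T V" "V \<subseteq> U" for V
    using fU(1)[OF x] gU(1)[OF x] by (simp add: fU(4)[OF V x] gU(4)[OF V x] U V)
next
  fix U a x assume U: "openin T U" and a: "a \<in> Sec A U" and x: "x \<in> Sec S U"
  interpret U: module "sect A U" "sect N U" by (rule module_sect[OF U])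
  note fU = H_apply[OF f U] and gU = H_apply[OF g U]
  show "f U (a \<odot>\<^bsub>sect S U\<^esub> x) \<oplus>\<^bsub>sect N U\<^esub> g U (a \<odot>\<^bsub>sect S U\<^esub> x) = a \<odot>\<^bsub>sect N U\<^esub> (f U x \<oplus>\<^bsub>sect N U\<^esub> g U x)"
    using fU(1)[OF x] gU(1)[OF x] a by (simp add: fU(3)[OF a x] gU(3)[OF a x] U.smult_r_distr)
qed

text \<open>A global section acts through its restrictions. The product is again linear because the
  rings of sections are commutative, and natural because restrictions compose.\<close>

lemma H_smult_closed:
  assumes f: "f \<in> carrier H" and c: "c \<in> Sec A (topspace T)"
  shows "c \<odot>\<^bsub>H\<^esub> f \<in> carrier H"
  unfolding H_ops
proof (intro normalize_closed mod_sheaf_homI)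
  have top: "openin T (topspace T)" by simp
  have cU: "res A (topspace T) U c \<in> Sec A U" if "openin T U" for U
    using that c openin_subset[OF that] by simp
  fix U x assume U: "openin T U" and x: "x \<in> Sec S U"
  interpret U: module "sect A U" "sect N U" by (rule module_sect[OF U])
  note fU = H_apply[OF f U]
  let ?c = "res A (topspace T) U c"
  show "?c \<odot>\<^bsub>sect N U\<^esub> f U x \<in> Sec N U" using fU(1)[OF x] cU[OF U] by simp
  show "?c \<odot>\<^bsub>sect N U\<^esub> f U (x \<oplus>\<^bsub>sect S U\<^esub> y) = ?c \<odot>\<^bsub>sect N U\<^esub> f U x \<oplus>\<^bsub>sect N U\<^esub> ?c \<odot>\<^bsub>sect N U\<^esub> f U y"
    if y: "y \<in> Sec S U" for y
    using fU(1)[OF x] fU(1)[OF y] cU[OF U] by (simp add: fU(2)[OF x y] U.smult_r_distr)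
  show "res A (topspace T) V c \<odot>\<^bsub>sect N V\<^esub> f V (res S U V x) = res N U V (?c \<odot>\<^bsub>sect N U\<^esub> f U x)"
    if V: "openin T V" "V \<subseteq> U" for V
    using fU(1)[OF x] cU[OF U] c openin_subset[OF U] by (simp add: fU(4)[OF V x] U V)
  show "?c \<odot>\<^bsub>sect N U\<^esub> f U (a \<odot>\<^bsub>sect S U\<^esub> x) = a \<odot>\<^bsub>sect N U\<^esub> (?c \<odot>\<^bsub>sect N U\<^esub> f U x)"
    if a: "a \<in> Sec A U" for a
    using fU(1)[OF x] cU[OF U] a by (simp add: fU(3)[OF a x] U.smult_assoc1[symmetric] U.R.m_comm)
qed

definition H_minus where
  "H_minus f = normalize_family T S (\<lambda>U x. \<ominus>\<^bsub>sect N U\<^esub> f U x)"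

lemma H_minus_apply [simp]:
  "\<lbrakk>openin T U; x \<in> Sec S U\<rbrakk> \<Longrightarrow> H_minus f U x = \<ominus>\<^bsub>sect N U\<^esub> f U x"
  by (simp add: H_minus_def)

lemma H_minus_closed:
  assumes f: "f \<in> carrier H"
  shows "H_minus f \<in> carrier H"
  unfolding H_minus_def
proof (intro normalize_closed mod_sheaf_homI)
  fix U x assume U: "openin T U" and x: "x \<in> Sec S U"
  interpret U: module "sect A U" "sect N U" by (rule module_sect[OF U])
  note fU = H_apply[OF f U]
  show "\<ominus>\<^bsub>sect N U\<^esub> f U x \<in> Sec N U" using fU(1)[OF x] by simp
  show "\<ominus>\<^bsub>sect N U\<^esub> f U (x \<oplus>\<^bsub>sect S U\<^esub> y) = \<ominus>\<^bsub>sect N U\<^esub> f U x \<oplus>\<^bsub>sect N U\<^esub> \<ominus>\<^bsub>sect N U\<^esub> f U y"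
    if y: "y \<in> Sec S U" for y
    using fU(1)[OF x] fU(1)[OF y] by (simp add: fU(2)[OF x y] U.M.minus_add)
  show "\<ominus>\<^bsub>sect N V\<^esub> f V (res S U V x) = res N U V (\<ominus>\<^bsub>sect N U\<^esub> f U x)"
    if V: "openin T V" "V \<subseteq> U" for V
    using fU(1)[OF x] by (simp add: fU(4)[OF V x] U V)
  show "\<ominus>\<^bsub>sect N U\<^esub> f U (a \<odot>\<^bsub>sect S U\<^esub> x) = a \<odot>\<^bsub>sect N U\<^esub> (\<ominus>\<^bsub>sect N U\<^esub> f U x)"
    if a: "a \<in> Sec A U" for a
    using fU(1)[OF x] a by (simp add: fU(3)[OF a x] U.smult_r_minus)
qed

lemma H_minus_left:
  assumes f: "f \<in> carrier H"
  shows "H_minus f \<oplus>\<^bsub>H\<^esub> f = \<zero>\<^bsub>H\<^esub>"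
proof (rule H_ext[OF H_add_closed[OF H_minus_closed[OF f] f] H_zero_closed])
  fix U x assume U: "openin T U" and x: "x \<in> Sec S U"
  interpret U: module "sect A U" "sect N U" by (rule module_sect[OF U])
  show "(H_minus f \<oplus>\<^bsub>H\<^esub> f) U x = \<zero>\<^bsub>H\<^esub> U x"
    using U x H_apply(1)[OF f U x] by (simp add: U.M.l_neg)
qed

lemma H_abelian_group: "abelian_group H"
proof (rule abelian_groupI)
  fix f g k assume f: "f \<in> carrier H" and g: "g \<in> carrier H" and k: "k \<in> carrier H"
  show "f \<oplus>\<^bsub>H\<^esub> g \<in> carrier H" by (rule H_add_closed[OF f g])
  show "f \<oplus>\<^bsub>H\<^esub> g \<oplus>\<^bsub>H\<^esub> k = f \<oplus>\<^bsub>H\<^esub> (g \<oplus>\<^bsub>H\<^esub> k)"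
  proof (rule H_ext[OF H_add_closed[OF H_add_closed[OF f g] k] H_add_closed[OF f H_add_closed[OF g k]]])
    fix U x assume U: "openin T U" and x: "x \<in> Sec S U"
    interpret U: module "sect A U" "sect N U" by (rule module_sect[OF U])
    show "(f \<oplus>\<^bsub>H\<^esub> g \<oplus>\<^bsub>H\<^esub> k) U x = (f \<oplus>\<^bsub>H\<^esub> (g \<oplus>\<^bsub>H\<^esub> k)) U x"
      using U x H_apply(1)[OF f U x] H_apply(1)[OF g U x] H_apply(1)[OF k U x] by (simp add: U.M.a_assoc)
  qed
  show "f \<oplus>\<^bsub>H\<^esub> g = g \<oplus>\<^bsub>H\<^esub> f"
  proof (rule H_ext[OF H_add_closed[OF f g] H_add_closed[OF g f]])
    fix U x assume U: "openin T U" and x: "x \<in> Sec S U"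
    interpret U: module "sect A U" "sect N U" by (rule module_sect[OF U])
    show "(f \<oplus>\<^bsub>H\<^esub> g) U x = (g \<oplus>\<^bsub>H\<^esub> f) U x"
      using U x H_apply(1)[OF f U x] H_apply(1)[OF g U x] by (simp add: U.M.a_comm)
  qed
next
  fix f assume f: "f \<in> carrier H"
  show "\<zero>\<^bsub>H\<^esub> \<oplus>\<^bsub>H\<^esub> f = f"
  proof (rule H_ext[OF H_add_closed[OF H_zero_closed f] f])
    fix U x assume U: "openin T U" and x: "x \<in> Sec S U"
    interpret U: module "sect A U" "sect N U" by (rule module_sect[OF U])
    show "(\<zero>\<^bsub>H\<^esub> \<oplus>\<^bsub>H\<^esub> f) U x = f U x" using U x H_apply(1)[OF f U x] by simp
  qed
  show "\<exists>g\<in>carrier H. g \<oplus>\<^bsub>H\<^esub> f = \<zero>\<^bsub>H\<^esub>"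
    using H_minus_left[OF f] H_minus_closed[OF f] by (rule bexI)
qed (rule H_zero_closed)

end

section \<open>Homomorphisms out of tensor powers as multilinear families\<close>

definition multilinear_family where
  "multilinear_family T A G n N b \<longleftrightarrow>
    (\<forall>U. openin T U \<longrightarrow> multilinear (sect A U) (sect G U) n (sect N U) (b U)) \<and>
    (\<forall>U V. openin T U \<and> openin T V \<and> V \<subseteq> U \<longrightarrow>
      (\<forall>xs\<in>tuples (sect G U) n. b V (map (res G U V) xs) = res N U V (b U xs)))"

locale tensor_hom_on = tensor_presheaf_on T A G n + target: module_sheaf_on T A N
  for T :: "'p topology" and A :: "('p, 'a) ring_presheaf" and G :: "('p, 'a, 'm) mod_presheaf"
    and n :: nat and N :: "('p, 'a, 'n) mod_presheaf"
begin

sublocale hom: hom_module_on T A "tensor_sheaf T A G n" N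
  unfolding tensor_sheaf_def
  by (intro hom_module_on.intro target.module_sheaf_on_axioms sh_linear_presheaf)

lemma pure_sec: "xs \<in> tup U \<Longrightarrow> pure_tensor T A G U xs = sec U (cls U (frag_of xs))"
  by (simp add: pure_tensor_section tuples_def)

lemma cls_tup: "\<lbrakk>openin T U; xs \<in> tup U\<rbrakk> \<Longrightarrow> cls U (frag_of xs) \<in> Sec (tensor_presheaf A G n) U"
  unfolding tensor_presheaf_simps by (rule tensor_power_on.cls_closed[OF tp]) simp_all

lemma pure_closed: "\<lbrakk>openin T U; xs \<in> tup U\<rbrakk> \<Longrightarrow> pure_tensor T A G U xs \<in> Sec (tensor_sheaf T A G n) U"
  unfolding tensor_sheaf_def pure_sec by (rule sec_closed[OF _ cls_tup])

lemma pure_res: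
  assumes "openin T U" "openin T V" "V \<subseteq> U" "xs \<in> tup U"
  shows "res (tensor_sheaf T A G n) U V (pure_tensor T A G U xs) = pure_tensor T A G V (map (res G U V) xs)"
  unfolding tensor_sheaf_def sh_res pure_sec[OF assms(4)] pure_sec[OF map_tuples[OF assms]]
    sec_res[OF assms(1) cls_tup[OF assms(1,4)] assms(2,3)] res_cls[OF assms(1-3)] by simp

lemma pure_add:
  assumes U: "openin T U" and xs: "xs \<in> tup U" and i: "i < n"
    and x: "x \<in> Sec G U" and y: "y \<in> Sec G U"
  shows "pure_tensor T A G U (xs[i := x \<oplus>\<^bsub>sect G U\<^esub> y]) =
    pure_tensor T A G U (xs[i := x]) \<oplus>\<^bsub>sect (tensor_sheaf T A G n) U\<^esub> pure_tensor T A G U (xs[i := y])"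
proof -
  interpret U: tensor_power_on "sect A U" "sect G U" n by (rule tp[OF U])
  have t: "xs[i := x] \<in> tup U" "xs[i := y] \<in> tup U" "xs[i := x \<oplus>\<^bsub>sect G U\<^esub> y] \<in> tup U"
    using tuples_update[OF xs] x y U by simp_all
  have f: "frag_of (xs[i := x]) \<in> carrier U.free" "frag_of (xs[i := y]) \<in> carrier U.free"
    using t by simp_all
  have rel: "frag_of (xs[i := x \<oplus>\<^bsub>sect G U\<^esub> y]) - (frag_of (xs[i := x]) + frag_of (xs[i := y])) \<in> U.null"
    unfolding diff_diff_eq[symmetric]
    by (rule U.relation_null) (use xs i x y in \<open>auto simp: tensor_relations_def\<close>)
  show ?thesis
    unfolding tensor_sheaf_def pure_sec[OF t(1)] pure_sec[OF t(2)] pure_sec[OF t(3)]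
      sec_add[OF U cls_tup[OF U t(1)] cls_tup[OF U t(2)]] tensor_presheaf_simps U.cls_add[OF f]
      U.cls_eqI[OF rel] ..
qed

text \<open>The scalar action is defined on slot \<open>0\<close>; the second kind of tensor
  relations moves the scalar there from slot \<open>i\<close>.\<close>

lemma pure_smult:
  assumes U: "openin T U" and xs: "xs \<in> tup U" and i: "i < n" and a: "a \<in> Sec A U"
  shows "pure_tensor T A G U (xs[i := a \<odot>\<^bsub>sect G U\<^esub> xs ! i]) =
    a \<odot>\<^bsub>sect (tensor_sheaf T A G n) U\<^esub> pure_tensor T A G U xs"
proof -
  interpret U: tensor_power_on "sect A U" "sect G U" n by (rule tp[OF U])
  have t: "xs[i := a \<odot>\<^bsub>sect G U\<^esub> xs ! i] \<in> tup U"
    using tuples_update[OF xs] tuples_nth[OF xs i] a U by simp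
  have rel: "frag_of (xs[i := a \<odot>\<^bsub>sect G U\<^esub> xs ! i]) - frag_of (xs[0 := a \<odot>\<^bsub>sect G U\<^esub> xs ! 0]) \<in> U.null"
    by (rule U.relation_null) (unfold tensor_relations_def, use xs i pos a in blast)
  show ?thesis
    unfolding tensor_sheaf_def pure_sec[OF t] pure_sec[OF xs]
      sec_smult[OF U cls_tup[OF U xs] a] tensor_presheaf_simps U.cls_smult[OF a] frag_extend_of
      U.cls_eqI[OF rel] ..
qed

lemma hom_multilinear:
  assumes f: "f \<in> carrier hom.H"
  shows "multilinear_family T A G n N (\<lambda>U xs. f U (pure_tensor T A G U xs))"
  unfolding multilinear_family_def multilinear_def
proof (intro conjI allI impI ballI; (elim conjE)?)
  fix U xs assume U: "openin T U" and xs: "xs \<in> tup U"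
  note fU = hom.H_apply[OF f U]
  show "f U (pure_tensor T A G U xs) \<in> Sec N U" by (rule fU(1)[OF pure_closed[OF U xs]])
  fix i assume i: "i < n"
  show "f U (pure_tensor T A G U (xs[i := a \<odot>\<^bsub>sect G U\<^esub> xs ! i])) = a \<odot>\<^bsub>sect N U\<^esub> f U (pure_tensor T A G U xs)"
    if a: "a \<in> Sec A U" for a
    unfolding pure_smult[OF U xs i a] by (rule fU(3)[OF a pure_closed[OF U xs]])
  fix x y assume x: "x \<in> Sec G U" and y: "y \<in> Sec G U"
  show "f U (pure_tensor T A G U (xs[i := x \<oplus>\<^bsub>sect G U\<^esub> y])) =
      f U (pure_tensor T A G U (xs[i := x])) \<oplus>\<^bsub>sect N U\<^esub> f U (pure_tensor T A G U (xs[i := y]))"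
    unfolding pure_add[OF U xs i x y]
    by (rule fU(2)[OF pure_closed[OF U tuples_update[OF xs x]] pure_closed[OF U tuples_update[OF xs y]]])
next
  fix U V xs assume U: "openin T U" and V: "openin T V" "V \<subseteq> U" and xs: "xs \<in> tup U"
  show "f V (pure_tensor T A G V (map (res G U V) xs)) = res N U V (f U (pure_tensor T A G U xs))"
    unfolding pure_res[OF U V xs, symmetric] by (rule hom.H_apply(4)[OF f U V pure_closed[OF U xs]])
qed

text \<open>Two reductions: from the sheaf to the presheaf by locality, and from the tensor power to
  pure tensors by additivity.\<close>

lemma hom_pure_unique:
  assumes f: "f \<in> carrier hom.H" and g: "g \<in> carrier hom.H"
    and eq: "\<And>U xs. \<lbrakk>openin T U; xs \<in> tup U\<rbrakk> \<Longrightarrow> f U (pure_tensor T A G U xs) = g U (pure_tensor T A G U xs)"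
  shows "f = g"
proof (rule hom.H_ext[OF f g])
  fix U s assume U: "openin T U" and s: "s \<in> Sec (tensor_sheaf T A G n) U"
  show "f U s = g U s"
  proof (rule sheafification_hom_unique[OF target.module_sheaf_on_axioms _ _ _ U s[unfolded tensor_sheaf_def]])
    show "mod_sheaf_hom T A sh N f" "mod_sheaf_hom T A sh N g"
      using f g unfolding hom.H_carrier by (simp_all add: tensor_sheaf_def)
    fix U x assume U: "openin T U" and x: "x \<in> Sec (tensor_presheaf A G n) U"
    interpret U: tensor_power_on "sect A U" "sect G U" n by (rule tp[OF U])
    have x': "x \<in> carrier (tensor_power (sect A U) (sect G U) n)" using x by simp
    have cl: "sec U y \<in> Sec (tensor_sheaf T A G n) U"
      if "y \<in> carrier (tensor_power (sect A U) (sect G U) n)" for y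
      unfolding tensor_sheaf_def by (rule sec_closed[OF U]) (use that in simp)
    have ad: "sec U (y \<oplus>\<^bsub>tensor_power (sect A U) (sect G U) n\<^esub> z) =
        sec U y \<oplus>\<^bsub>sect (tensor_sheaf T A G n) U\<^esub> sec U z"
      if "y \<in> carrier (tensor_power (sect A U) (sect G U) n)" "z \<in> carrier (tensor_power (sect A U) (sect G U) n)" for y z
      unfolding tensor_sheaf_def using sec_add[OF U, of y z] that by simp
    show "f U (sec U x) = g U (sec U x)"
    proof (rule U.cls_frag_induct[where f = "\<lambda>x. f U (sec U x)" and g = "\<lambda>x. g U (sec U x)" and N = "sect N U", OF _ _ _ _ _ _ x'])
      show "abelian_group (sect N U)"
        using target.module_sect[OF U] by (simp add: module_def)
      show "f U (sec U (cls U (frag_of xs))) = g U (sec U (cls U (frag_of xs)))" if "xs \<in> tup U" for xs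
        using eq[OF U that] unfolding pure_sec[OF that] .
    qed (simp_all only: ad hom.H_apply[OF f U] hom.H_apply[OF g U] cl)
  qed
qed

lemma hom_of_multilinear:
  assumes b: "multilinear_family T A G n N b"
  obtains f where "f \<in> carrier hom.H"
    "\<forall>U. openin T U \<longrightarrow> (\<forall>xs\<in>tup U. f U (pure_tensor T A G U xs) = b U xs)"
proof -
  let ?TP = "\<lambda>U. tensor_power (sect A U) (sect G U) n"
  \<comment> \<open>The maps given by the universal property are chosen for each \<open>U\<close>
    separately. They commute with restriction because both composites are additive and agree on pure
    tensors.\<close>
  have "\<exists>\<beta>. openin T U \<longrightarrow> (\<beta> \<in> carrier (?TP U) \<rightarrow> Sec N U \<and>
      (\<forall>x\<in>carrier (?TP U). \<forall>y\<in>carrier (?TP U). \<beta> (x \<oplus>\<^bsub>?TP U\<^esub> y) = \<beta> x \<oplus>\<^bsub>sect N U\<^esub> \<beta> y) \<and>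
      (\<forall>a\<in>Sec A U. \<forall>x\<in>carrier (?TP U). \<beta> (a \<odot>\<^bsub>?TP U\<^esub> x) = a \<odot>\<^bsub>sect N U\<^esub> \<beta> x) \<and>
      (\<forall>xs\<in>tup U. \<beta> (cls U (frag_of xs)) = b U xs))" for U
  proof (cases "openin T U")
    case True
    have "multilinear (sect A U) (sect G U) n (sect N U) (b U)"
      using b True by (simp add: multilinear_family_def)
    then show ?thesis
      by (rule tensor_power_on.tensor_universal[OF tp[OF True] target.module_sect[OF True]])
        (intro exI impI conjI)
  qed simp
  then obtain \<beta> where \<beta>: "\<And>U. openin T U \<Longrightarrow> \<beta> U \<in> carrier (?TP U) \<rightarrow> Sec N U \<and>
      (\<forall>x\<in>carrier (?TP U). \<forall>y\<in>carrier (?TP U). \<beta> U (x \<oplus>\<^bsub>?TP U\<^esub> y) = \<beta> U x \<oplus>\<^bsub>sect N U\<^esub> \<beta> U y) \<and>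
      (\<forall>a\<in>Sec A U. \<forall>x\<in>carrier (?TP U). \<beta> U (a \<odot>\<^bsub>?TP U\<^esub> x) = a \<odot>\<^bsub>sect N U\<^esub> \<beta> U x) \<and>
      (\<forall>xs\<in>tup U. \<beta> U (cls U (frag_of xs)) = b U xs)"
    by metis
  have \<beta>c: "\<beta> U x \<in> Sec N U" if "openin T U" "x \<in> carrier (?TP U)" for U x
    using \<beta>[OF that(1)] that(2) by blast
  have \<beta>add: "\<beta> U (x \<oplus>\<^bsub>?TP U\<^esub> y) = \<beta> U x \<oplus>\<^bsub>sect N U\<^esub> \<beta> U y"
    if "openin T U" "x \<in> carrier (?TP U)" "y \<in> carrier (?TP U)" for U x y
    using \<beta>[OF that(1)] that(2,3) by simp
  have \<beta>smult: "\<beta> U (a \<odot>\<^bsub>?TP U\<^esub> x) = a \<odot>\<^bsub>sect N U\<^esub> \<beta> U x"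
    if "openin T U" "a \<in> Sec A U" "x \<in> carrier (?TP U)" for U a x
    using \<beta>[OF that(1)] that(2,3) by simp
  have \<beta>pure: "\<beta> U (cls U (frag_of xs)) = b U xs" if "openin T U" "xs \<in> tup U" for U xs
    using \<beta>[OF that(1)] that(2) by simp
  have nat: "\<beta> V (res (tensor_presheaf A G n) U V x) = res N U V (\<beta> U x)"
    if U: "openin T U" and V: "openin T V" "V \<subseteq> U" and x: "x \<in> carrier (?TP U)" for U V x
  proof -
    interpret U: tensor_power_on "sect A U" "sect G U" n by (rule tp[OF U])
    let ?r = "res (tensor_presheaf A G n) U V"
    have rc: "?r y \<in> carrier (?TP V)" if "y \<in> carrier (?TP U)" for y
      using P.res_closed[OF U V, of y] that by simp
    have radd: "?r (y \<oplus>\<^bsub>?TP U\<^esub> z) = ?r y \<oplus>\<^bsub>?TP V\<^esub> ?r z"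
      if "y \<in> carrier (?TP U)" "z \<in> carrier (?TP U)" for y z
      using P_res_add[OF U V, of y z] that by simp
    show ?thesis
    proof (rule U.cls_frag_induct[where f = "\<lambda>x. \<beta> V (?r x)" and g = "\<lambda>x. res N U V (\<beta> U x)" and N = "sect N V", OF _ _ _ _ _ _ x])
      show "abelian_group (sect N V)"
        using target.module_sect[OF V(1)] by (simp add: module_def)
      show "\<beta> V (?r (cls U (frag_of xs))) = res N U V (\<beta> U (cls U (frag_of xs)))" if xs: "xs \<in> tup U" for xs
        using b U V xs \<beta>pure[OF V(1) map_tuples[OF U V xs]] \<beta>pure[OF U xs]
        unfolding res_cls[OF U V] by (simp add: multilinear_family_def)
    qed (simp_all add: radd rc \<beta>add \<beta>c U V)
  qed
  obtain f where f: "mod_sheaf_hom T A sh N f"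
    "\<forall>U. openin T U \<longrightarrow> (\<forall>x\<in>Sec (tensor_presheaf A G n) U. f U (sec U x) = \<beta> U x)"
  proof (rule sheafification_universal[OF target.module_sheaf_on_axioms, of \<beta>])
  qed (simp_all add: \<beta>c \<beta>add \<beta>smult nat)
  have "mod_sheaf_hom T A (tensor_sheaf T A G n) N f" using f(1) by (simp add: tensor_sheaf_def)
  then have "normalize_family T (tensor_sheaf T A G n) f \<in> carrier hom.H" by (rule hom.normalize_closed)
  moreover have "normalize_family T (tensor_sheaf T A G n) f U (pure_tensor T A G U xs) = b U xs"
    if U: "openin T U" and xs: "xs \<in> tup U" for U xs
  proof -
    have "normalize_family T (tensor_sheaf T A G n) f U (pure_tensor T A G U xs) = f U (pure_tensor T A G U xs)"
      by (rule hom.normalize_apply[OF U pure_closed[OF U xs]])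
    also have "\<dots> = \<beta> U (cls U (frag_of xs))"
      unfolding pure_sec[OF xs] using f(2) U cls_tup[OF U xs] by blast
    also have "\<dots> = b U xs" by (rule \<beta>pure[OF U xs])
    finally show ?thesis .
  qed
  ultimately show ?thesis by (intro that allI impI ballI)
qed

end

text \<open>The module laws pass through the ring homomorphisms \<open>h U\<close>, and naturality
  of \<open>h\<close> makes restriction linear for the new scalars.\<close>

lemma restrict_scalars_mod_sheaf:
  assumes C: "ring_sheaf T C" and h: "ring_sheaf_hom T C A h" and F: "module_sheaf_on T A F"
  shows "module_sheaf_on T C (restrict_scalars h F)"
proof -
  interpret C: ring_sheaf_on T C by (rule ring_sheaf_onI[OF C])
  interpret module_sheaf_on T A F by (rule F)
  have hc: "h U \<in> ring_hom (sect C U) (sect A U)" if "openin T U" for U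
    using h that by (simp add: ring_sheaf_hom_def)
  have hres: "h V (res C U V x) = res A U V (h U x)"
    if "openin T U" "openin T V" "V \<subseteq> U" "x \<in> Sec C U" for U V x
    using h that by (simp add: ring_sheaf_hom_def commutes_with_res_def)
  have "Module.module (sect C U) (sect (restrict_scalars h F) U)" if U: "openin T U" for U
  proof -
    interpret U: module "sect A U" "sect F U" by (rule module_sect[OF U])
    note hU = ring_hom_closed[OF hc[OF U]] ring_hom_add[OF hc[OF U]] ring_hom_mult[OF hc[OF U]]
      ring_hom_one[OF hc[OF U]]
    show ?thesis
    proof (rule moduleI)
      show "abelian_group (sect (restrict_scalars h F) U)"
      proof (rule abelian_groupI)
        fix x assume "x \<in> Sec (restrict_scalars h F) U"
        then show "\<exists>y\<in>Sec (restrict_scalars h F) U.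
            y \<oplus>\<^bsub>sect (restrict_scalars h F) U\<^esub> x = \<zero>\<^bsub>sect (restrict_scalars h F) U\<^esub>"
          by (intro bexI[of _ "\<ominus>\<^bsub>sect F U\<^esub> x"]) (simp_all add: U.M.l_neg)
      qed (simp_all add: U.M.a_ac)
    qed (simp_all add: hU U.smult_l_distr U.smult_r_distr U.smult_assoc1 C.cring_sect[OF U])
  qed
  moreover have "is_sheaf T (restrict_scalars h F)"
    using F.sheaf is_sheaf_cong[of "restrict_scalars h F" F T] by simp
  ultimately have "mod_sheaf T C (restrict_scalars h F)"
    unfolding mod_sheaf_def using ring_hom_closed[OF hc] hres by simp
  then show ?thesis by (rule module_sheaf_onI[OF C])
qed

section \<open>Cochains as multilinear families\<close>

lemma algebra_as_module_simps [simp]: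
  "Sec (algebra_as_module h A) U = Sec A U"
  "ring.add (sect (algebra_as_module h A) U) = ring.add (sect A U)"
  "c \<odot>\<^bsub>sect (algebra_as_module h A) U\<^esub> x = h U c \<otimes>\<^bsub>sect A U\<^esub> x"
  "res (algebra_as_module h A) = res A"
  by (simp_all add: algebra_as_module_def)

lemma ball_tuples_2: "(\<forall>xs\<in>tuples M 2. P xs) \<longleftrightarrow> (\<forall>x\<in>carrier M. \<forall>y\<in>carrier M. P [x, y])"
proof -
  have "tuples M 2 = (\<lambda>(x, y). [x, y]) ` (carrier M \<times> carrier M)"
    by (auto simp: tuples_def numeral_2_eq_2 length_Suc_conv)
  then show ?thesis by auto
qed

lemma ball_tuples_3:
  "(\<forall>xs\<in>tuples M 3. P xs) \<longleftrightarrow> (\<forall>x\<in>carrier M. \<forall>y\<in>carrier M. \<forall>z\<in>carrier M. P [x, y, z])"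
proof -
  have "tuples M 3 = (\<lambda>(x, y, z). [x, y, z]) ` (carrier M \<times> carrier M \<times> carrier M)"
    by (auto simp: tuples_def numeral_3_eq_3 length_Suc_conv image_iff)
  then show ?thesis by auto
qed

lemma all_less_2: "(\<forall>i<2. P i) \<longleftrightarrow> P 0 \<and> P (1::nat)"
  by (auto simp: less_2_cases_iff)

lemma all_less_3: "(\<forall>i<3. P i) \<longleftrightarrow> P 0 \<and> P (1::nat) \<and> P 2"
  by (auto simp: numeral_3_eq_3 less_Suc_eq numeral_2_eq_2)

locale extension_setting =
  fixes T :: "'p topology" and OZ :: "('p, 'c) ring_presheaf" and OY :: "('p, 'a) ring_presheaf"
    and h :: "'p set \<Rightarrow> 'c \<Rightarrow> 'a" and F :: "('p, 'a, 'm) mod_presheaf"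
  assumes OZ: "ring_sheaf T OZ" and OY: "ring_sheaf T OY" and h: "ring_sheaf_hom T OZ OY h"
    and F: "mod_sheaf T OY F"
begin

abbreviation R where "R \<equiv> sect OY"
abbreviation M where "M \<equiv> sect F"

sublocale Y: module_sheaf_on T OY F
  by (rule module_sheaf_onI[OF OY F])

sublocale Z: ring_sheaf_on T OZ
  by (rule ring_sheaf_onI[OF OZ])

lemma h_hom: "openin T U \<Longrightarrow> h U \<in> ring_hom (sect OZ U) (R U)"
  using h by (simp add: ring_sheaf_hom_def)

lemma h_closed [simp, intro]: "\<lbrakk>openin T U; c \<in> Sec OZ U\<rbrakk> \<Longrightarrow> h U c \<in> Sec OY U"
  by (rule ring_hom_closed[OF h_hom])

lemma h_res [simp]:
  "\<lbrakk>openin T U; openin T V; V \<subseteq> U; c \<in> Sec OZ U\<rbrakk> \<Longrightarrow> h V (res OZ U V c) = res OY U V (h U c)"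
  using h by (simp add: ring_sheaf_hom_def commutes_with_res_def)

abbreviation YM where "YM \<equiv> algebra_as_module h OY"
abbreviation FZ where "FZ \<equiv> restrict_scalars h F"

lemma YM_sheaf: "module_sheaf_on T OZ YM"
  unfolding algebra_as_module_def
  by (rule restrict_scalars_mod_sheaf[OF OZ h Y.regular_module_sheaf_on])

lemma FZ_sheaf: "module_sheaf_on T OZ FZ"
  by (rule restrict_scalars_mod_sheaf[OF OZ h Y.module_sheaf_on_axioms])

lemma tensor_hom: "0 < n \<Longrightarrow> tensor_hom_on T OZ YM n FZ"
  by (intro tensor_hom_on.intro tensor_presheaf_on.intro YM_sheaf FZ_sheaf tensor_presheaf_on_axioms.intro)

lemma hom1: "hom_module_on T OZ YM FZ"
  by (intro hom_module_on.intro FZ_sheaf module_sheaf_on.linear_presheaf YM_sheaf)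

abbreviation C1 where "C1 \<equiv> cochains1 T OZ OY h F"
abbreviation C2 where "C2 \<equiv> cochains T OZ OY h F 2"
abbreviation C3 where "C3 \<equiv> cochains T OZ OY h F 3"
abbreviation d0 where "d0 \<equiv> \<delta>\<^sub>0 T OZ OY h F"
abbreviation d1 where "d1 \<equiv> \<delta>\<^sub>1 T OZ OY h F"
abbreviation ev where "ev f U x y \<equiv> f U (tens T OZ OY h U [x, y])"
abbreviation ev3 where "ev3 f U x y z \<equiv> f U (tens T OZ OY h U [x, y, z])"

definition linear_family :: "('p set \<Rightarrow> 'a \<Rightarrow> 'm) \<Rightarrow> bool" where
  "linear_family g \<longleftrightarrow>
    (\<forall>U. openin T U \<longrightarrow> (\<forall>x\<in>Sec OY U. g U x \<in> Sec F U \<and>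
      (\<forall>y\<in>Sec OY U. g U (x \<oplus>\<^bsub>R U\<^esub> y) = g U x \<oplus>\<^bsub>M U\<^esub> g U y) \<and>
      (\<forall>c\<in>Sec OZ U. g U (h U c \<otimes>\<^bsub>R U\<^esub> x) = h U c \<odot>\<^bsub>M U\<^esub> g U x) \<and>
      (\<forall>V. openin T V \<and> V \<subseteq> U \<longrightarrow> g V (res OY U V x) = res F U V (g U x))))"

definition bilinear_family :: "('p set \<Rightarrow> 'a \<Rightarrow> 'a \<Rightarrow> 'm) \<Rightarrow> bool" where
  "bilinear_family b \<longleftrightarrow>
    (\<forall>U. openin T U \<longrightarrow> (\<forall>x\<in>Sec OY U. \<forall>y\<in>Sec OY U.
      b U x y \<in> Sec F U \<and>
      (\<forall>z\<in>Sec OY U.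
        b U (x \<oplus>\<^bsub>R U\<^esub> z) y = b U x y \<oplus>\<^bsub>M U\<^esub> b U z y \<and>
        b U x (y \<oplus>\<^bsub>R U\<^esub> z) = b U x y \<oplus>\<^bsub>M U\<^esub> b U x z) \<and>
      (\<forall>c\<in>Sec OZ U.
        b U (h U c \<otimes>\<^bsub>R U\<^esub> x) y = h U c \<odot>\<^bsub>M U\<^esub> b U x y \<and>
        b U x (h U c \<otimes>\<^bsub>R U\<^esub> y) = h U c \<odot>\<^bsub>M U\<^esub> b U x y) \<and>
      (\<forall>V. openin T V \<and> V \<subseteq> U \<longrightarrow> b V (res OY U V x) (res OY U V y) = res F U V (b U x y))))"

definition trilinear_family :: "('p set \<Rightarrow> 'a \<Rightarrow> 'a \<Rightarrow> 'a \<Rightarrow> 'm) \<Rightarrow> bool" where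
  "trilinear_family b \<longleftrightarrow>
    (\<forall>U. openin T U \<longrightarrow> (\<forall>x\<in>Sec OY U. \<forall>y\<in>Sec OY U. \<forall>z\<in>Sec OY U.
      b U x y z \<in> Sec F U \<and>
      (\<forall>w\<in>Sec OY U.
        b U (x \<oplus>\<^bsub>R U\<^esub> w) y z = b U x y z \<oplus>\<^bsub>M U\<^esub> b U w y z \<and>
        b U x (y \<oplus>\<^bsub>R U\<^esub> w) z = b U x y z \<oplus>\<^bsub>M U\<^esub> b U x w z \<and>
        b U x y (z \<oplus>\<^bsub>R U\<^esub> w) = b U x y z \<oplus>\<^bsub>M U\<^esub> b U x y w) \<and>
      (\<forall>c\<in>Sec OZ U.
        b U (h U c \<otimes>\<^bsub>R U\<^esub> x) y z = h U c \<odot>\<^bsub>M U\<^esub> b U x y z \<and>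
        b U x (h U c \<otimes>\<^bsub>R U\<^esub> y) z = h U c \<odot>\<^bsub>M U\<^esub> b U x y z \<and>
        b U x y (h U c \<otimes>\<^bsub>R U\<^esub> z) = h U c \<odot>\<^bsub>M U\<^esub> b U x y z) \<and>
      (\<forall>V. openin T V \<and> V \<subseteq> U \<longrightarrow>
        b V (res OY U V x) (res OY U V y) (res OY U V z) = res F U V (b U x y z))))"

lemma bilinear_familyD:
  assumes "bilinear_family b" "openin T U" "x \<in> Sec OY U" "y \<in> Sec OY U"
  shows "b U x y \<in> Sec F U"
    and "z \<in> Sec OY U \<Longrightarrow> b U (x \<oplus>\<^bsub>R U\<^esub> z) y = b U x y \<oplus>\<^bsub>M U\<^esub> b U z y"
    and "z \<in> Sec OY U \<Longrightarrow> b U x (y \<oplus>\<^bsub>R U\<^esub> z) = b U x y \<oplus>\<^bsub>M U\<^esub> b U x z"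
    and "c \<in> Sec OZ U \<Longrightarrow> b U (h U c \<otimes>\<^bsub>R U\<^esub> x) y = h U c \<odot>\<^bsub>M U\<^esub> b U x y"
    and "c \<in> Sec OZ U \<Longrightarrow> b U x (h U c \<otimes>\<^bsub>R U\<^esub> y) = h U c \<odot>\<^bsub>M U\<^esub> b U x y"
    and "\<lbrakk>openin T V; V \<subseteq> U\<rbrakk> \<Longrightarrow> b V (res OY U V x) (res OY U V y) = res F U V (b U x y)"
  using assms unfolding bilinear_family_def by simp_all

lemma trilinear_familyD:
  assumes "trilinear_family b" "openin T U" "x \<in> Sec OY U" "y \<in> Sec OY U"
    "z \<in> Sec OY U"
  shows "b U x y z \<in> Sec F U"
    and "w \<in> Sec OY U \<Longrightarrow> b U (x \<oplus>\<^bsub>R U\<^esub> w) y z = b U x y z \<oplus>\<^bsub>M U\<^esub> b U w y z"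
    and "w \<in> Sec OY U \<Longrightarrow> b U x (y \<oplus>\<^bsub>R U\<^esub> w) z = b U x y z \<oplus>\<^bsub>M U\<^esub> b U x w z"
    and "w \<in> Sec OY U \<Longrightarrow> b U x y (z \<oplus>\<^bsub>R U\<^esub> w) = b U x y z \<oplus>\<^bsub>M U\<^esub> b U x y w"
    and "c \<in> Sec OZ U \<Longrightarrow> b U (h U c \<otimes>\<^bsub>R U\<^esub> x) y z = h U c \<odot>\<^bsub>M U\<^esub> b U x y z"
    and "c \<in> Sec OZ U \<Longrightarrow> b U x (h U c \<otimes>\<^bsub>R U\<^esub> y) z = h U c \<odot>\<^bsub>M U\<^esub> b U x y z"
    and "c \<in> Sec OZ U \<Longrightarrow> b U x y (h U c \<otimes>\<^bsub>R U\<^esub> z) = h U c \<odot>\<^bsub>M U\<^esub> b U x y z"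
    and "\<lbrakk>openin T V; V \<subseteq> U\<rbrakk>
      \<Longrightarrow> b V (res OY U V x) (res OY U V y) (res OY U V z) = res F U V (b U x y z)"
  using assms unfolding trilinear_family_def by simp_all

text \<open>Unpacks tuples of length two into two arguments, so that cochains can be handled as
  ordinary bilinear maps.\<close>

lemma multilinear_2_iff:
  "multilinear_family T OZ YM 2 FZ (\<lambda>U xs. b U (xs ! 0) (xs ! 1)) \<longleftrightarrow> bilinear_family b"
proof
  assume "bilinear_family b"
  note b = bilinear_familyD[OF this]
  show "multilinear_family T OZ YM 2 FZ (\<lambda>U xs. b U (xs ! 0) (xs ! 1))"
    unfolding multilinear_family_def multilinear_def ball_tuples_2 all_less_2
    by (auto simp: b)
next
  assume "multilinear_family T OZ YM 2 FZ (\<lambda>U xs. b U (xs ! 0) (xs ! 1))"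
  then show "bilinear_family b"
    unfolding multilinear_family_def multilinear_def ball_tuples_2 all_less_2 bilinear_family_def
    by simp
qed

lemma multilinear_3:
  assumes "trilinear_family b"
  shows "multilinear_family T OZ YM 3 FZ (\<lambda>U xs. b U (xs ! 0) (xs ! 1) (xs ! 2))"
proof -
  note b = trilinear_familyD[OF assms]
  show ?thesis
    unfolding multilinear_family_def multilinear_def ball_tuples_3 all_less_3
    by (auto simp: b)
qed

lemma tup_2: "\<lbrakk>x \<in> Sec OY U; y \<in> Sec OY U\<rbrakk> \<Longrightarrow> [x, y] \<in> tuples (sect YM U) 2"
  by (simp add: tuples_def)

lemma tup_3: "\<lbrakk>x \<in> Sec OY U; y \<in> Sec OY U; z \<in> Sec OY U\<rbrakk>
    \<Longrightarrow> [x, y, z] \<in> tuples (sect YM U) 3"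
  by (simp add: tuples_def)

lemma C2_bilinear:
  assumes f: "f \<in> carrier C2"
  shows "bilinear_family (ev f)"
proof -
  interpret C2: tensor_hom_on T OZ YM 2 FZ by (rule tensor_hom) simp
  have "multilinear_family T OZ YM 2 FZ (\<lambda>U xs. f U (tens T OZ OY h U xs))"
    using f unfolding cochains_def by (rule C2.hom_multilinear)
  then have "multilinear_family T OZ YM 2 FZ (\<lambda>U xs. ev f U (xs ! 0) (xs ! 1))"
    unfolding multilinear_family_def multilinear_def ball_tuples_2 all_less_2 by simp
  then show ?thesis by (rule multilinear_2_iff[THEN iffD1])
qed

lemma C2_ext:
  assumes "f \<in> carrier C2" "g \<in> carrier C2"
    and "\<And>U x y. \<lbrakk>openin T U; x \<in> Sec OY U; y \<in> Sec OY U\<rbrakk> \<Longrightarrow> ev f U x y = ev g U x y"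
  shows "f = g"
proof -
  interpret C2: tensor_hom_on T OZ YM 2 FZ by (rule tensor_hom) simp
  have "\<forall>xs\<in>tuples (sect YM U) 2. f U (tens T OZ OY h U xs) = g U (tens T OZ OY h U xs)" if "openin T U" for U
    unfolding ball_tuples_2 using assms(3)[OF that] by simp
  then show ?thesis using assms(1,2) unfolding cochains_def by (intro C2.hom_pure_unique) simp_all
qed

text \<open>Together with \<open>C2_bilinear\<close> and \<open>C2_ext\<close> this identifies
  cochains of degree two with bilinear families; later computations are carried out on
  \<open>ev f\<close>.\<close>

lemma C2_exists:
  assumes "bilinear_family b"
  obtains f where "f \<in> carrier C2"
    "\<forall>U. openin T U \<longrightarrow> (\<forall>x\<in>Sec OY U. \<forall>y\<in>Sec OY U. ev f U x y = b U x y)"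
proof -
  interpret C2: tensor_hom_on T OZ YM 2 FZ by (rule tensor_hom) simp
  obtain f where f: "f \<in> carrier C2.hom.H"
    "\<forall>U. openin T U \<longrightarrow> (\<forall>xs\<in>tuples (sect YM U) 2. f U (tens T OZ OY h U xs) = b U (xs ! 0) (xs ! 1))"
    by (rule C2.hom_of_multilinear[OF multilinear_2_iff[THEN iffD2, OF assms]])
  show ?thesis
  proof (rule that[of f])
    show "f \<in> carrier C2" using f(1) by (simp add: cochains_def)
    show "\<forall>U. openin T U \<longrightarrow> (\<forall>x\<in>Sec OY U. \<forall>y\<in>Sec OY U. ev f U x y = b U x y)"
      using f(2) unfolding ball_tuples_2 by simp
  qed
qed

lemma C3_ext:
  assumes "f \<in> carrier C3" "g \<in> carrier C3"
    and "\<And>U x y z. \<lbrakk>openin T U; x \<in> Sec OY U; y \<in> Sec OY U; z \<in> Sec OY U\<rbrakk>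
      \<Longrightarrow> ev3 f U x y z = ev3 g U x y z"
  shows "f = g"
proof -
  interpret C3: tensor_hom_on T OZ YM 3 FZ by (rule tensor_hom) simp
  have "\<forall>xs\<in>tuples (sect YM U) 3. f U (tens T OZ OY h U xs) = g U (tens T OZ OY h U xs)" if "openin T U" for U
    unfolding ball_tuples_3 using assms(3)[OF that] by simp
  then show ?thesis using assms(1,2) unfolding cochains_def by (intro C3.hom_pure_unique) simp_all
qed

lemma C3_exists:
  assumes "trilinear_family b"
  obtains f where "f \<in> carrier C3"
    "\<forall>U. openin T U \<longrightarrow> (\<forall>x\<in>Sec OY U. \<forall>y\<in>Sec OY U. \<forall>z\<in>Sec OY U.
      ev3 f U x y z = b U x y z)"
proof -
  interpret C3: tensor_hom_on T OZ YM 3 FZ by (rule tensor_hom) simp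
  obtain f where f: "f \<in> carrier C3.hom.H"
    "\<forall>U. openin T U \<longrightarrow> (\<forall>xs\<in>tuples (sect YM U) 3. f U (tens T OZ OY h U xs) = b U (xs ! 0) (xs ! 1) (xs ! 2))"
    by (rule C3.hom_of_multilinear[OF multilinear_3[OF assms]])
  show ?thesis
  proof (rule that[of f])
    show "f \<in> carrier C3" using f(1) by (simp add: cochains_def)
    show "\<forall>U. openin T U \<longrightarrow> (\<forall>x\<in>Sec OY U. \<forall>y\<in>Sec OY U. \<forall>z\<in>Sec OY U.
        ev3 f U x y z = b U x y z)"
      using f(2) unfolding ball_tuples_3 by simp
  qed
qed

lemma C3_zero:
  "\<zero>\<^bsub>C3\<^esub> \<in> carrier C3"
  "\<lbrakk>openin T U; x \<in> Sec OY U; y \<in> Sec OY U; z \<in> Sec OY U\<rbrakk>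
    \<Longrightarrow> ev3 \<zero>\<^bsub>C3\<^esub> U x y z = \<zero>\<^bsub>M U\<^esub>"
proof -
  interpret C3: tensor_hom_on T OZ YM 3 FZ by (rule tensor_hom) simp
  show "\<zero>\<^bsub>C3\<^esub> \<in> carrier C3" unfolding cochains_def by (rule C3.hom.H_zero_closed)
  assume "openin T U" "x \<in> Sec OY U" "y \<in> Sec OY U" "z \<in> Sec OY U"
  then show "ev3 \<zero>\<^bsub>C3\<^esub> U x y z = \<zero>\<^bsub>M U\<^esub>"
    unfolding cochains_def using C3.pure_closed[OF _ tup_3] by simp
qed

lemma C2_group: "abelian_group C2"
proof -
  interpret C2: tensor_hom_on T OZ YM 2 FZ by (rule tensor_hom) simp
  show ?thesis unfolding cochains_def by (rule C2.hom.H_abelian_group)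
qed

lemma C2_smult_closed:
  "\<lbrakk>f \<in> carrier C2; c \<in> Sec OZ (topspace T)\<rbrakk> \<Longrightarrow> c \<odot>\<^bsub>C2\<^esub> f \<in> carrier C2"
proof -
  interpret C2: tensor_hom_on T OZ YM 2 FZ by (rule tensor_hom) simp
  show "\<lbrakk>f \<in> carrier C2; c \<in> Sec OZ (topspace T)\<rbrakk> \<Longrightarrow> c \<odot>\<^bsub>C2\<^esub> f \<in> carrier C2"
    unfolding cochains_def by (rule C2.hom.H_smult_closed)
qed

lemma ev_ops [simp]:
  assumes "openin T U" "x \<in> Sec OY U" "y \<in> Sec OY U"
  shows "ev (f \<oplus>\<^bsub>C2\<^esub> g) U x y = ev f U x y \<oplus>\<^bsub>M U\<^esub> ev g U x y"
    and "ev \<zero>\<^bsub>C2\<^esub> U x y = \<zero>\<^bsub>M U\<^esub>"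
    and "ev (c \<odot>\<^bsub>C2\<^esub> f) U x y = h U (res OZ (topspace T) U c) \<odot>\<^bsub>M U\<^esub> ev f U x y"
    and "f \<in> carrier C2 \<Longrightarrow> ev (\<ominus>\<^bsub>C2\<^esub> f) U x y = \<ominus>\<^bsub>M U\<^esub> ev f U x y"
proof -
  interpret C2: tensor_hom_on T OZ YM 2 FZ by (rule tensor_hom) simp
  interpret G: abelian_group C2 by (rule C2_group)
  have p: "tens T OZ OY h U [x, y] \<in> Sec (tensor_sheaf T OZ YM 2) U"
    by (rule C2.pure_closed[OF assms(1) tup_2[OF assms(2,3)]])
  show add: "ev (f \<oplus>\<^bsub>C2\<^esub> g) U x y = ev f U x y \<oplus>\<^bsub>M U\<^esub> ev g U x y" for f g
    unfolding cochains_def using assms p by simp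
  show zero: "ev \<zero>\<^bsub>C2\<^esub> U x y = \<zero>\<^bsub>M U\<^esub>"
    and "ev (c \<odot>\<^bsub>C2\<^esub> f) U x y = h U (res OZ (topspace T) U c) \<odot>\<^bsub>M U\<^esub> ev f U x y"
    unfolding cochains_def using assms p by simp_all
  assume f: "f \<in> carrier C2"
  interpret FU: module "R U" "M U" by (rule Y.module_sect[OF assms(1)])
  have "ev (\<ominus>\<^bsub>C2\<^esub> f) U x y \<oplus>\<^bsub>M U\<^esub> ev f U x y = \<zero>\<^bsub>M U\<^esub>"
    using add[of "\<ominus>\<^bsub>C2\<^esub> f" f] G.l_neg[OF f] zero by simp
  then show "ev (\<ominus>\<^bsub>C2\<^esub> f) U x y = \<ominus>\<^bsub>M U\<^esub> ev f U x y"
    using bilinear_familyD(1)[OF C2_bilinear assms] f G.a_inv_closed[OF f] FU.M.minus_equality by metis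
qed

lemma C1_linear:
  assumes "g \<in> carrier C1"
  shows "linear_family g"
proof -
  interpret H1: hom_module_on T OZ YM FZ by (rule hom1)
  note g = H1.H_apply[OF assms[unfolded cochains1_def]]
  show ?thesis unfolding linear_family_def using g by simp
qed

lemma C1_exists:
  assumes g: "linear_family g"
  obtains g' where "g' \<in> carrier C1" "\<forall>U. openin T U \<longrightarrow> (\<forall>x\<in>Sec OY U. g' U x = g U x)"
proof -
  interpret H1: hom_module_on T OZ YM FZ by (rule hom1)
  have "mod_sheaf_hom T OZ YM FZ g"
    by (rule H1.mod_sheaf_homI) (use g in \<open>simp_all add: linear_family_def\<close>)
  then have "normalize_family T YM g \<in> carrier C1" unfolding cochains1_def by (rule H1.normalize_closed)
  then show ?thesis by (rule that) (simp add: H1.normalize_apply)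
qed

end

text \<open>Puts the cocycle condition into a form without subtraction, the one in which
  associativity of the twisted product presents it.\<close>

lemma (in abelian_group) cocycle_sum_zero_iff:
  assumes "a \<in> carrier G" "b \<in> carrier G" "c \<in> carrier G" "d \<in> carrier G"
  shows "a \<ominus> b \<oplus> c \<ominus> d = \<zero> \<longleftrightarrow> a \<oplus> c = b \<oplus> d"
proof -
  have "a \<ominus> b \<oplus> c \<ominus> d = (a \<oplus> c) \<ominus> (b \<oplus> d)"
    using assms by (simp add: minus_eq minus_add a_ac)
  moreover have "x \<ominus> y = \<zero> \<longleftrightarrow> x = y" if "x \<in> carrier G" "y \<in> carrier G" for x y
    using that minus_equality[of x "\<ominus> y"] by (auto simp: minus_eq r_neg)
  ultimately show ?thesis using assms by simp
qed

text \<open>The middle term \<open>q\<close> cancels. Applied to coboundaries, this is the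
  cancellation behind the vanishing of the composite of the two differentials.\<close>

lemma (in abelian_group) telescope:
  assumes "p \<in> carrier G" "q \<in> carrier G" "r \<in> carrier G" "s \<in> carrier G" "t \<in> carrier G"
  shows "(p \<ominus> q \<oplus> r) \<oplus> (q \<ominus> s \<oplus> t) = p \<ominus> s \<oplus> (r \<oplus> t)"
proof -
  have "(p \<ominus> q \<oplus> r) \<oplus> (q \<ominus> s \<oplus> t) = (\<ominus> q \<oplus> q) \<oplus> (p \<ominus> s \<oplus> (r \<oplus> t))"
    unfolding minus_eq using assms by (simp only: a_ac a_closed a_inv_closed)
  then show ?thesis using assms by (simp add: l_neg)
qed

section \<open>The differentials of the complex\<close>

context extension_setting
begin

abbreviation cob where
  "cob g U x y \<equiv> x \<odot>\<^bsub>M U\<^esub> g U y \<ominus>\<^bsub>M U\<^esub> g U (x \<otimes>\<^bsub>R U\<^esub> y) \<oplus>\<^bsub>M U\<^esub> y \<odot>\<^bsub>M U\<^esub> g U x"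

lemma linear_familyD:
  assumes "linear_family g" "openin T U" "x \<in> Sec OY U"
  shows "g U x \<in> Sec F U"
    and "y \<in> Sec OY U \<Longrightarrow> g U (x \<oplus>\<^bsub>R U\<^esub> y) = g U x \<oplus>\<^bsub>M U\<^esub> g U y"
    and "c \<in> Sec OZ U \<Longrightarrow> g U (h U c \<otimes>\<^bsub>R U\<^esub> x) = h U c \<odot>\<^bsub>M U\<^esub> g U x"
    and "\<lbrakk>openin T V; V \<subseteq> U\<rbrakk> \<Longrightarrow> g V (res OY U V x) = res F U V (g U x)"
  using assms unfolding linear_family_def by simp_all

text \<open>Scalars from \<open>OZ\<close> act through \<open>h\<close> and move past the factors
  \<open>x\<close> and \<open>y\<close> by commutativity; the rest is distributivity and
  naturality.\<close>

lemma bilinear_cob: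
  assumes "linear_family g"
  shows "bilinear_family (cob g)"
  unfolding bilinear_family_def
proof (intro allI impI ballI conjI; (elim conjE)?)
  fix U x y assume U: "openin T U" and x: "x \<in> Sec OY U" and y: "y \<in> Sec OY U"
  interpret U: module "R U" "M U" by (rule Y.module_sect[OF U])
  note g = linear_familyD[OF assms U]
  have gc: "g U x \<in> Sec F U" "g U y \<in> Sec F U" "g U (x \<otimes>\<^bsub>R U\<^esub> y) \<in> Sec F U"
    using x y by (simp_all add: g(1))
  show "cob g U x y \<in> Sec F U" using x y gc by simp
  show "cob g U (x \<oplus>\<^bsub>R U\<^esub> z) y = cob g U x y \<oplus>\<^bsub>M U\<^esub> cob g U z y" if z: "z \<in> Sec OY U" for z
    using x y z gc
    by (simp add: g U.R.l_distr U.smult_l_distr U.smult_r_distr U.M.minus_eq U.M.minus_add U.M.a_ac)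
  show "cob g U x (y \<oplus>\<^bsub>R U\<^esub> z) = cob g U x y \<oplus>\<^bsub>M U\<^esub> cob g U x z" if z: "z \<in> Sec OY U" for z
    using x y z gc
    by (simp add: g U.R.r_distr U.smult_l_distr U.smult_r_distr U.M.minus_eq U.M.minus_add U.M.a_ac)
  fix c assume c: "c \<in> Sec OZ U"
  have hc: "h U c \<in> Sec OY U" using U c by simp
  have e: "(h U c \<otimes>\<^bsub>R U\<^esub> x) \<otimes>\<^bsub>R U\<^esub> y = h U c \<otimes>\<^bsub>R U\<^esub> (x \<otimes>\<^bsub>R U\<^esub> y)"
    "x \<otimes>\<^bsub>R U\<^esub> (h U c \<otimes>\<^bsub>R U\<^esub> y) = h U c \<otimes>\<^bsub>R U\<^esub> (x \<otimes>\<^bsub>R U\<^esub> y)"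
    using hc x y by (simp_all add: U.R.m_ac)
  have e': "y \<odot>\<^bsub>M U\<^esub> (h U c \<odot>\<^bsub>M U\<^esub> m) = h U c \<odot>\<^bsub>M U\<^esub> (y \<odot>\<^bsub>M U\<^esub> m)"
    "x \<odot>\<^bsub>M U\<^esub> (h U c \<odot>\<^bsub>M U\<^esub> m) = h U c \<odot>\<^bsub>M U\<^esub> (x \<odot>\<^bsub>M U\<^esub> m)"
    if "m \<in> Sec F U" for m
    using that hc x y U.R.m_comm by (simp_all add: U.smult_assoc1[symmetric])
  have m: "h U c \<odot>\<^bsub>M U\<^esub> cob g U x y = h U c \<odot>\<^bsub>M U\<^esub> (x \<odot>\<^bsub>M U\<^esub> g U y)
      \<ominus>\<^bsub>M U\<^esub> h U c \<odot>\<^bsub>M U\<^esub> g U (x \<otimes>\<^bsub>R U\<^esub> y) \<oplus>\<^bsub>M U\<^esub> h U c \<odot>\<^bsub>M U\<^esub> (y \<odot>\<^bsub>M U\<^esub> g U x)"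
    using hc x y gc by (simp add: U.smult_r_distr U.smult_r_minus U.M.minus_eq)
  show "cob g U (h U c \<otimes>\<^bsub>R U\<^esub> x) y = h U c \<odot>\<^bsub>M U\<^esub> cob g U x y"
    unfolding m e using hc x y gc by (simp add: g(3)[OF _ c] U.smult_assoc1 e')
  show "cob g U x (h U c \<otimes>\<^bsub>R U\<^esub> y) = h U c \<odot>\<^bsub>M U\<^esub> cob g U x y"
    unfolding m e using hc x y gc by (simp add: g(3)[OF _ c] U.smult_assoc1 e')
next
  fix U x y V assume U: "openin T U" and x: "x \<in> Sec OY U" and y: "y \<in> Sec OY U"
    and V: "openin T V" "V \<subseteq> U"
  interpret U: module "R U" "M U" by (rule Y.module_sect[OF U])
  interpret V: module "R V" "M V" by (rule Y.module_sect[OF V(1)])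
  note g = linear_familyD[OF assms U]
  have gc: "g U x \<in> Sec F U" "g U y \<in> Sec F U" "g U (x \<otimes>\<^bsub>R U\<^esub> y) \<in> Sec F U"
    using x y by (simp_all add: g(1))
  have "g V (res OY U V x \<otimes>\<^bsub>R V\<^esub> res OY U V y) = res F U V (g U (x \<otimes>\<^bsub>R U\<^esub> y))"
    using g(4)[of "x \<otimes>\<^bsub>R U\<^esub> y", OF _ V] x y U V by simp
  then show "cob g V (res OY U V x) (res OY U V y) = res F U V (cob g U x y)"
    using U V x y gc by (simp add: g(4)[OF _ V] U.M.minus_eq V.M.minus_eq)
qed

text \<open>The differential is a definite description: a cochain with the prescribed values exists
  by \<open>C2_exists\<close> and is unique by \<open>C2_ext\<close>.\<close>

lemma d0:
  assumes "g \<in> carrier C1"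
  shows "d0 g \<in> carrier C2"
    and "\<lbrakk>openin T U; x \<in> Sec OY U; y \<in> Sec OY U\<rbrakk> \<Longrightarrow> ev (d0 g) U x y = cob g U x y"
proof -
  let ?P = "\<lambda>f. f \<in> carrier C2 \<and>
    (\<forall>U. openin T U \<longrightarrow> (\<forall>x\<in>Sec OY U. \<forall>y\<in>Sec OY U. ev f U x y = cob g U x y))"
  obtain f where f: "f \<in> carrier C2"
    "\<forall>U. openin T U \<longrightarrow> (\<forall>x\<in>Sec OY U. \<forall>y\<in>Sec OY U. ev f U x y = cob g U x y)"
    by (rule C2_exists[OF bilinear_cob[OF C1_linear[OF assms]]])
  have "?P (THE f. ?P f)"
  proof (rule theI[of ?P f])
    show "?P f" using f by simp
    show "k = f" if "?P k" for k using that f by (intro C2_ext) simp_all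
  qed
  then have P: "?P (d0 g)" unfolding \<delta>\<^sub>0_def .
  then show "d0 g \<in> carrier C2" by simp
  show "\<lbrakk>openin T U; x \<in> Sec OY U; y \<in> Sec OY U\<rbrakk> \<Longrightarrow> ev (d0 g) U x y = cob g U x y"
    using P by simp
qed

abbreviation cob1 where
  "cob1 b U x y z \<equiv> x \<odot>\<^bsub>M U\<^esub> b U y z \<ominus>\<^bsub>M U\<^esub> b U (x \<otimes>\<^bsub>R U\<^esub> y) z
    \<oplus>\<^bsub>M U\<^esub> b U x (y \<otimes>\<^bsub>R U\<^esub> z) \<ominus>\<^bsub>M U\<^esub> z \<odot>\<^bsub>M U\<^esub> b U x y"

lemma trilinear_cob1:
  assumes "bilinear_family b"
  shows "trilinear_family (cob1 b)"
  unfolding trilinear_family_def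
proof (intro allI impI ballI conjI; (elim conjE)?)
  fix U x y z assume U: "openin T U" and x: "x \<in> Sec OY U" and y: "y \<in> Sec OY U"
    and z: "z \<in> Sec OY U"
  interpret U: module "R U" "M U" by (rule Y.module_sect[OF U])
  note b = bilinear_familyD[OF assms U]
  show "cob1 b U x y z \<in> Sec F U" using x y z by (simp add: b(1))
  show "cob1 b U (x \<oplus>\<^bsub>R U\<^esub> w) y z = cob1 b U x y z \<oplus>\<^bsub>M U\<^esub> cob1 b U w y z"
    "cob1 b U x (y \<oplus>\<^bsub>R U\<^esub> w) z = cob1 b U x y z \<oplus>\<^bsub>M U\<^esub> cob1 b U x w z"
    "cob1 b U x y (z \<oplus>\<^bsub>R U\<^esub> w) = cob1 b U x y z \<oplus>\<^bsub>M U\<^esub> cob1 b U x y w"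
    if w: "w \<in> Sec OY U" for w
    using x y z w
    by (simp_all add: b(1-3) U.R.l_distr U.R.r_distr U.smult_l_distr U.smult_r_distr U.M.minus_eq U.M.minus_add U.M.a_ac)
  fix c assume c: "c \<in> Sec OZ U"
  have hc: "h U c \<in> Sec OY U" using U c by simp
  have e: "(h U c \<otimes>\<^bsub>R U\<^esub> v) \<otimes>\<^bsub>R U\<^esub> w = h U c \<otimes>\<^bsub>R U\<^esub> (v \<otimes>\<^bsub>R U\<^esub> w)"
    "v \<otimes>\<^bsub>R U\<^esub> (h U c \<otimes>\<^bsub>R U\<^esub> w) = h U c \<otimes>\<^bsub>R U\<^esub> (v \<otimes>\<^bsub>R U\<^esub> w)"
    if "v \<in> Sec OY U" "w \<in> Sec OY U" for v w
    using hc that by (simp_all add: U.R.m_ac)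
  have e': "v \<odot>\<^bsub>M U\<^esub> (h U c \<odot>\<^bsub>M U\<^esub> m) = h U c \<odot>\<^bsub>M U\<^esub> (v \<odot>\<^bsub>M U\<^esub> m)"
    if "v \<in> Sec OY U" "m \<in> Sec F U" for v m
    using that hc U.R.m_comm by (simp_all add: U.smult_assoc1[symmetric])
  have m: "h U c \<odot>\<^bsub>M U\<^esub> cob1 b U x y z = h U c \<odot>\<^bsub>M U\<^esub> (x \<odot>\<^bsub>M U\<^esub> b U y z)
      \<ominus>\<^bsub>M U\<^esub> h U c \<odot>\<^bsub>M U\<^esub> b U (x \<otimes>\<^bsub>R U\<^esub> y) z
      \<oplus>\<^bsub>M U\<^esub> h U c \<odot>\<^bsub>M U\<^esub> b U x (y \<otimes>\<^bsub>R U\<^esub> z)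
      \<ominus>\<^bsub>M U\<^esub> h U c \<odot>\<^bsub>M U\<^esub> (z \<odot>\<^bsub>M U\<^esub> b U x y)"
    using hc x y z by (simp add: b(1) U.smult_r_distr U.smult_r_minus U.M.minus_eq)
  show "cob1 b U (h U c \<otimes>\<^bsub>R U\<^esub> x) y z = h U c \<odot>\<^bsub>M U\<^esub> cob1 b U x y z"
    unfolding m using hc x y z by (simp add: b(1) b(4,5)[OF _ _ c] U.smult_assoc1 e e')
  show "cob1 b U x (h U c \<otimes>\<^bsub>R U\<^esub> y) z = h U c \<odot>\<^bsub>M U\<^esub> cob1 b U x y z"
    unfolding m using hc x y z by (simp add: b(1) b(4,5)[OF _ _ c] U.smult_assoc1 e e')
  show "cob1 b U x y (h U c \<otimes>\<^bsub>R U\<^esub> z) = h U c \<odot>\<^bsub>M U\<^esub> cob1 b U x y z"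
    unfolding m using hc x y z by (simp add: b(1) b(4,5)[OF _ _ c] U.smult_assoc1 e e')
next
  fix U x y z V assume U: "openin T U" and x: "x \<in> Sec OY U" and y: "y \<in> Sec OY U"
    and z: "z \<in> Sec OY U" and V: "openin T V" "V \<subseteq> U"
  interpret U: module "R U" "M U" by (rule Y.module_sect[OF U])
  interpret V: module "R V" "M V" by (rule Y.module_sect[OF V(1)])
  note b = bilinear_familyD[OF assms U]
  have xy: "x \<otimes>\<^bsub>R U\<^esub> y \<in> Sec OY U" "y \<otimes>\<^bsub>R U\<^esub> z \<in> Sec OY U"
    using x y z by simp_all
  have "b V (res OY U V x \<otimes>\<^bsub>R V\<^esub> res OY U V y) (res OY U V z) = res F U V (b U (x \<otimes>\<^bsub>R U\<^esub> y) z)"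
    "b V (res OY U V x) (res OY U V y \<otimes>\<^bsub>R V\<^esub> res OY U V z) = res F U V (b U x (y \<otimes>\<^bsub>R U\<^esub> z))"
    using b(6)[OF xy(1) z V] b(6)[OF x xy(2) V] x y z U V by simp_all
  then show "cob1 b V (res OY U V x) (res OY U V y) (res OY U V z) = res F U V (cob1 b U x y z)"
    using U V x y z by (simp add: b(1) b(6)[OF _ _ V] U.M.minus_eq V.M.minus_eq)
qed

lemma d1:
  assumes "f \<in> carrier C2"
  shows "d1 f \<in> carrier C3"
    and "\<lbrakk>openin T U; x \<in> Sec OY U; y \<in> Sec OY U; z \<in> Sec OY U\<rbrakk>
      \<Longrightarrow> ev3 (d1 f) U x y z = cob1 (ev f) U x y z"
proof -
  let ?P = "\<lambda>k. k \<in> carrier C3 \<and>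
    (\<forall>U. openin T U \<longrightarrow> (\<forall>x\<in>Sec OY U. \<forall>y\<in>Sec OY U. \<forall>z\<in>Sec OY U.
      ev3 k U x y z = cob1 (ev f) U x y z))"
  obtain k where k: "k \<in> carrier C3"
    "\<forall>U. openin T U \<longrightarrow> (\<forall>x\<in>Sec OY U. \<forall>y\<in>Sec OY U. \<forall>z\<in>Sec OY U.
      ev3 k U x y z = cob1 (ev f) U x y z)"
    by (rule C3_exists[OF trilinear_cob1[OF C2_bilinear[OF assms]]])
  have "?P (THE k. ?P k)"
  proof (rule theI[of ?P k])
    show "?P k" using k by simp
    show "l = k" if "?P l" for l using that k by (intro C3_ext) simp_all
  qed
  then have P: "?P (d1 f)" unfolding \<delta>\<^sub>1_def .
  then show "d1 f \<in> carrier C3" by simp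
  show "\<lbrakk>openin T U; x \<in> Sec OY U; y \<in> Sec OY U; z \<in> Sec OY U\<rbrakk>
      \<Longrightarrow> ev3 (d1 f) U x y z = cob1 (ev f) U x y z"
    using P by simp
qed

section \<open>Cocycles, symmetric cocycles and coboundaries\<close>

definition cocycle_family :: "('p set \<Rightarrow> 'a \<Rightarrow> 'a \<Rightarrow> 'm) \<Rightarrow> bool" where
  "cocycle_family b \<longleftrightarrow> (\<forall>U. openin T U \<longrightarrow>
    (\<forall>x\<in>Sec OY U. \<forall>y\<in>Sec OY U. \<forall>z\<in>Sec OY U.
      x \<odot>\<^bsub>M U\<^esub> b U y z \<oplus>\<^bsub>M U\<^esub> b U x (y \<otimes>\<^bsub>R U\<^esub> z) =
      b U (x \<otimes>\<^bsub>R U\<^esub> y) z \<oplus>\<^bsub>M U\<^esub> z \<odot>\<^bsub>M U\<^esub> b U x y))"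

definition symmetric_family :: "('p set \<Rightarrow> 'a \<Rightarrow> 'a \<Rightarrow> 'm) \<Rightarrow> bool" where
  "symmetric_family b \<longleftrightarrow> (\<forall>U. openin T U \<longrightarrow>
    (\<forall>x\<in>Sec OY U. \<forall>y\<in>Sec OY U. b U x y = b U y x))"

abbreviation ZC where "ZC \<equiv> cocycles T OZ OY h F"
abbreviation BC where "BC \<equiv> coboundaries T OZ OY h F"
abbreviation SC where "SC \<equiv> symmetric_cocycles T OZ OY h F"

lemma cocycles_iff: "f \<in> ZC \<longleftrightarrow> f \<in> carrier C2 \<and> cocycle_family (ev f)"
proof -
  have "d1 f = \<zero>\<^bsub>C3\<^esub> \<longleftrightarrow> cocycle_family (ev f)" if f: "f \<in> carrier C2"
  proof -
    have "ev3 (d1 f) U x y z = \<zero>\<^bsub>M U\<^esub> \<longleftrightarrow>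
        x \<odot>\<^bsub>M U\<^esub> ev f U y z \<oplus>\<^bsub>M U\<^esub> ev f U x (y \<otimes>\<^bsub>R U\<^esub> z) =
        ev f U (x \<otimes>\<^bsub>R U\<^esub> y) z \<oplus>\<^bsub>M U\<^esub> z \<odot>\<^bsub>M U\<^esub> ev f U x y"
      if U: "openin T U" and x: "x \<in> Sec OY U" and y: "y \<in> Sec OY U"
        and z: "z \<in> Sec OY U" for U x y z
    proof -
      interpret U: module "R U" "M U" by (rule Y.module_sect[OF U])
      note b = bilinear_familyD(1)[OF C2_bilinear[OF f] U]
      show ?thesis unfolding d1(2)[OF f U x y z]
        by (rule U.M.cocycle_sum_zero_iff) (use x y z in \<open>simp_all add: b\<close>)
    qed
    then have "cocycle_family (ev f) \<longleftrightarrow> (\<forall>U. openin T U \<longrightarrow>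
        (\<forall>x\<in>Sec OY U. \<forall>y\<in>Sec OY U. \<forall>z\<in>Sec OY U.
          ev3 (d1 f) U x y z = \<zero>\<^bsub>M U\<^esub>))"
      unfolding cocycle_family_def by simp
    moreover have "d1 f = \<zero>\<^bsub>C3\<^esub> \<longleftrightarrow> (\<forall>U. openin T U \<longrightarrow>
        (\<forall>x\<in>Sec OY U. \<forall>y\<in>Sec OY U. \<forall>z\<in>Sec OY U.
          ev3 (d1 f) U x y z = \<zero>\<^bsub>M U\<^esub>))"
    proof
      assume "d1 f = \<zero>\<^bsub>C3\<^esub>"
      then show "\<forall>U. openin T U \<longrightarrow>
        (\<forall>x\<in>Sec OY U. \<forall>y\<in>Sec OY U. \<forall>z\<in>Sec OY U.
          ev3 (d1 f) U x y z = \<zero>\<^bsub>M U\<^esub>)" by (simp add: C3_zero(2))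
    next
      assume "\<forall>U. openin T U \<longrightarrow>
        (\<forall>x\<in>Sec OY U. \<forall>y\<in>Sec OY U. \<forall>z\<in>Sec OY U.
          ev3 (d1 f) U x y z = \<zero>\<^bsub>M U\<^esub>)"
      then show "d1 f = \<zero>\<^bsub>C3\<^esub>" by (intro C3_ext[OF d1(1)[OF f] C3_zero(1)]) (simp add: C3_zero(2))
    qed
    ultimately show ?thesis by simp
  qed
  then show ?thesis unfolding cocycles_def a_kernel_def' by blast
qed

lemma symmetric_cocycles_iff:
  "f \<in> SC \<longleftrightarrow> f \<in> carrier C2 \<and> cocycle_family (ev f) \<and> symmetric_family (ev f)"
  by (simp add: symmetric_cocycles_def cocycles_iff symmetric_map_def symmetric_family_def)

text \<open>Accepts any linear family; it is normalised outside the carriers before it counts as a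
  cochain.\<close>

lemma coboundariesI:
  assumes k: "k \<in> carrier C2" and g: "linear_family g"
    and eq: "\<And>U x y. \<lbrakk>openin T U; x \<in> Sec OY U; y \<in> Sec OY U\<rbrakk> \<Longrightarrow> ev k U x y = cob g U x y"
  shows "k \<in> BC"
proof -
  obtain g' where g': "g' \<in> carrier C1" "\<forall>U. openin T U \<longrightarrow> (\<forall>x\<in>Sec OY U. g' U x = g U x)"
    by (rule C1_exists[OF g])
  have "k = d0 g'"
  proof (rule C2_ext[OF k d0(1)[OF g'(1)]])
    fix U x y assume a: "openin T U" "x \<in> Sec OY U" "y \<in> Sec OY U"
    then show "ev k U x y = ev (d0 g') U x y"
      using g'(2) by (simp add: d0(2)[OF g'(1)] eq)
  qed
  then show ?thesis using g'(1) unfolding coboundaries_def by (rule image_eqI)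
qed

lemma coboundariesE:
  assumes "k \<in> BC"
  obtains g where "k \<in> carrier C2" "linear_family g"
    "\<forall>U. openin T U \<longrightarrow> (\<forall>x\<in>Sec OY U. \<forall>y\<in>Sec OY U. ev k U x y = cob g U x y)"
proof -
  obtain g where g: "g \<in> carrier C1" "k = d0 g" using assms unfolding coboundaries_def by (elim imageE)
  show ?thesis by (rule that[of g]) (use g d0 C1_linear in simp_all)
qed

text \<open>Both sides of the cocycle identity collapse by telescoping, and symmetry is visible from
  the formula because \<open>OY\<close> is commutative. Hence the symmetric classes form the
  quotient of the symmetric cocycles by all coboundaries.\<close>

lemma coboundaries_subset: "BC \<subseteq> SC"
proof
  fix k assume "k \<in> BC"
  then obtain g where k: "k \<in> carrier C2" and g: "linear_family g"
    and eq: "\<forall>U. openin T U \<longrightarrow> (\<forall>x\<in>Sec OY U. \<forall>y\<in>Sec OY U. ev k U x y = cob g U x y)"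
    by (rule coboundariesE)
  have "cocycle_family (ev k)" unfolding cocycle_family_def
  proof (intro allI impI ballI)
    fix U x y z assume U: "openin T U" and x: "x \<in> Sec OY U" and y: "y \<in> Sec OY U"
      and z: "z \<in> Sec OY U"
    interpret U: module "R U" "M U" by (rule Y.module_sect[OF U])
    note gc = linear_familyD(1)[OF g U]
    have e: "ev k U v w = cob g U v w" if "v \<in> Sec OY U" "w \<in> Sec OY U" for v w
      using eq U that by simp
    have c: "x \<otimes>\<^bsub>R U\<^esub> y \<in> Sec OY U" "y \<otimes>\<^bsub>R U\<^esub> z \<in> Sec OY U"
      using x y z by simp_all
    \<comment> \<open>\<open>p\<close>, \<open>r\<close>, \<open>t\<close> contain \<open>g\<close>
      of a single factor, \<open>q\<close> and \<open>w\<close> contain \<open>g\<close> of a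
      product of two, and \<open>s\<close> is \<open>g\<close> of the triple product. The terms
      \<open>q\<close> and \<open>w\<close> cancel, and both sides become
      \<open>p \<ominus> s \<oplus> (r \<oplus> t)\<close>.\<close>
    define p q r s t w where "p = (x \<otimes>\<^bsub>R U\<^esub> y) \<odot>\<^bsub>M U\<^esub> g U z"
      and "q = x \<odot>\<^bsub>M U\<^esub> g U (y \<otimes>\<^bsub>R U\<^esub> z)" and "r = (x \<otimes>\<^bsub>R U\<^esub> z) \<odot>\<^bsub>M U\<^esub> g U y"
      and "s = g U (x \<otimes>\<^bsub>R U\<^esub> (y \<otimes>\<^bsub>R U\<^esub> z))" and "t = (y \<otimes>\<^bsub>R U\<^esub> z) \<odot>\<^bsub>M U\<^esub> g U x"
      and "w = z \<odot>\<^bsub>M U\<^esub> g U (x \<otimes>\<^bsub>R U\<^esub> y)"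
    have cl: "p \<in> Sec F U" "q \<in> Sec F U" "r \<in> Sec F U"
      "s \<in> Sec F U" "t \<in> Sec F U" "w \<in> Sec F U"
      unfolding p_def q_def r_def s_def t_def w_def using x y z gc by simp_all
    have 1: "x \<odot>\<^bsub>M U\<^esub> ev k U y z = p \<ominus>\<^bsub>M U\<^esub> q \<oplus>\<^bsub>M U\<^esub> r"
      unfolding e[OF y z] p_def q_def r_def using x y z gc
      by (simp add: U.smult_r_distr U.smult_r_minus U.M.minus_eq U.smult_assoc1)
    have 2: "ev k U x (y \<otimes>\<^bsub>R U\<^esub> z) = q \<ominus>\<^bsub>M U\<^esub> s \<oplus>\<^bsub>M U\<^esub> t"
      unfolding e[OF x c(2)] q_def s_def t_def ..
    have 3: "ev k U (x \<otimes>\<^bsub>R U\<^esub> y) z = p \<ominus>\<^bsub>M U\<^esub> s \<oplus>\<^bsub>M U\<^esub> w"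
      unfolding e[OF c(1) z] p_def s_def w_def using x y z by (simp add: U.R.m_assoc)
    have 4: "z \<odot>\<^bsub>M U\<^esub> ev k U x y = r \<ominus>\<^bsub>M U\<^esub> w \<oplus>\<^bsub>M U\<^esub> t"
      unfolding e[OF x y] r_def w_def t_def using x y z gc
      by (simp add: U.smult_r_distr U.smult_r_minus U.M.minus_eq U.smult_assoc1[symmetric] U.R.m_comm)
    have "p \<ominus>\<^bsub>M U\<^esub> s \<oplus>\<^bsub>M U\<^esub> w \<oplus>\<^bsub>M U\<^esub> (r \<ominus>\<^bsub>M U\<^esub> w \<oplus>\<^bsub>M U\<^esub> t)
        = p \<ominus>\<^bsub>M U\<^esub> s \<oplus>\<^bsub>M U\<^esub> (r \<oplus>\<^bsub>M U\<^esub> t)"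
    proof -
      have "p \<ominus>\<^bsub>M U\<^esub> s \<oplus>\<^bsub>M U\<^esub> w \<oplus>\<^bsub>M U\<^esub> (r \<ominus>\<^bsub>M U\<^esub> w \<oplus>\<^bsub>M U\<^esub> t) =
          (r \<ominus>\<^bsub>M U\<^esub> w \<oplus>\<^bsub>M U\<^esub> t) \<oplus>\<^bsub>M U\<^esub> (w \<ominus>\<^bsub>M U\<^esub> s \<oplus>\<^bsub>M U\<^esub> p)"
        using cl by (simp add: U.M.minus_eq U.M.a_ac)
      also have "\<dots> = p \<ominus>\<^bsub>M U\<^esub> s \<oplus>\<^bsub>M U\<^esub> (r \<oplus>\<^bsub>M U\<^esub> t)"
        unfolding U.M.telescope[OF cl(3,6,5,4,1)] using cl by (simp add: U.M.minus_eq U.M.a_ac)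
      finally show ?thesis .
    qed
    then show "x \<odot>\<^bsub>M U\<^esub> ev k U y z \<oplus>\<^bsub>M U\<^esub> ev k U x (y \<otimes>\<^bsub>R U\<^esub> z) =
        ev k U (x \<otimes>\<^bsub>R U\<^esub> y) z \<oplus>\<^bsub>M U\<^esub> z \<odot>\<^bsub>M U\<^esub> ev k U x y"
      unfolding 1 2 3 4 U.M.telescope[OF cl(1,2,3,4,5)] by simp
  qed
  moreover have "symmetric_family (ev k)" unfolding symmetric_family_def
  proof (intro allI impI ballI)
    fix U x y assume U: "openin T U" and x: "x \<in> Sec OY U" and y: "y \<in> Sec OY U"
    interpret U: module "R U" "M U" by (rule Y.module_sect[OF U])
    show "ev k U x y = ev k U y x"
      using eq U x y linear_familyD(1)[OF g U] by (simp add: U.M.minus_eq U.M.a_ac U.R.m_comm)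
  qed
  ultimately show "k \<in> SC" using k by (simp add: symmetric_cocycles_iff)
qed

end

section \<open>Cohomology classes\<close>

text \<open>The additive group of the quotient module and the factor group are different records
  with the same operations; this carries subgroups from one to the other.\<close>

lemma subgroup_cong:
  assumes "carrier G = carrier G'" "monoid.mult G = monoid.mult G'" "one G = one G'"
  shows "subgroup H G \<longleftrightarrow> subgroup H G'"
  unfolding subgroup_def m_inv_def assms ..

context extension_setting
begin

lemma res_top [simp, intro]: "\<lbrakk>openin T U; c \<in> Sec OZ (topspace T)\<rbrakk>
    \<Longrightarrow> h U (res OZ (topspace T) U c) \<in> Sec OY U"
  using Z.res_closed[of "topspace T" U c] openin_subset[of T U] by simp

lemma cocycle_add:
  assumes fC: "f \<in> carrier C2" and gC: "g \<in> carrier C2"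
    and f: "cocycle_family (ev f)" and g: "cocycle_family (ev g)"
  shows "cocycle_family (ev (f \<oplus>\<^bsub>C2\<^esub> g))"
  unfolding cocycle_family_def
proof (intro allI impI ballI)
  note bf = bilinear_familyD(1)[OF C2_bilinear[OF fC]] and bg = bilinear_familyD(1)[OF C2_bilinear[OF gC]]
  fix U x y z assume U: "openin T U" and x: "x \<in> Sec OY U" and y: "y \<in> Sec OY U"
    and z: "z \<in> Sec OY U"
  interpret U: module "R U" "M U" by (rule Y.module_sect[OF U])
  have c: "x \<otimes>\<^bsub>R U\<^esub> y \<in> Sec OY U" "y \<otimes>\<^bsub>R U\<^esub> z \<in> Sec OY U"
    using x y z by simp_all
  have "x \<odot>\<^bsub>M U\<^esub> ev (f \<oplus>\<^bsub>C2\<^esub> g) U y z \<oplus>\<^bsub>M U\<^esub> ev (f \<oplus>\<^bsub>C2\<^esub> g) U x (y \<otimes>\<^bsub>R U\<^esub> z)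
    = (x \<odot>\<^bsub>M U\<^esub> ev f U y z \<oplus>\<^bsub>M U\<^esub> ev f U x (y \<otimes>\<^bsub>R U\<^esub> z)) \<oplus>\<^bsub>M U\<^esub>
      (x \<odot>\<^bsub>M U\<^esub> ev g U y z \<oplus>\<^bsub>M U\<^esub> ev g U x (y \<otimes>\<^bsub>R U\<^esub> z))"
    using U x y z c bf[OF U] bg[OF U] by (simp add: U.smult_r_distr U.M.a_ac)
  also have "\<dots> = (ev f U (x \<otimes>\<^bsub>R U\<^esub> y) z \<oplus>\<^bsub>M U\<^esub> z \<odot>\<^bsub>M U\<^esub> ev f U x y) \<oplus>\<^bsub>M U\<^esub>
      (ev g U (x \<otimes>\<^bsub>R U\<^esub> y) z \<oplus>\<^bsub>M U\<^esub> z \<odot>\<^bsub>M U\<^esub> ev g U x y)"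
    using f g U x y z by (simp add: cocycle_family_def)
  also have "\<dots> = ev (f \<oplus>\<^bsub>C2\<^esub> g) U (x \<otimes>\<^bsub>R U\<^esub> y) z \<oplus>\<^bsub>M U\<^esub> z \<odot>\<^bsub>M U\<^esub> ev (f \<oplus>\<^bsub>C2\<^esub> g) U x y"
    using U x y z c bf[OF U] bg[OF U] by (simp add: U.smult_r_distr U.M.a_ac)
  finally show "x \<odot>\<^bsub>M U\<^esub> ev (f \<oplus>\<^bsub>C2\<^esub> g) U y z \<oplus>\<^bsub>M U\<^esub> ev (f \<oplus>\<^bsub>C2\<^esub> g) U x (y \<otimes>\<^bsub>R U\<^esub> z)
    = ev (f \<oplus>\<^bsub>C2\<^esub> g) U (x \<otimes>\<^bsub>R U\<^esub> y) z \<oplus>\<^bsub>M U\<^esub> z \<odot>\<^bsub>M U\<^esub> ev (f \<oplus>\<^bsub>C2\<^esub> g) U x y" .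
qed

lemma cocycle_smult:
  assumes fC: "f \<in> carrier C2" and f: "cocycle_family (ev f)" and c: "c \<in> Sec OZ (topspace T)"
  shows "cocycle_family (ev (c \<odot>\<^bsub>C2\<^esub> f))"
  unfolding cocycle_family_def
proof (intro allI impI ballI)
  note bf = bilinear_familyD(1)[OF C2_bilinear[OF fC]]
  fix U x y z assume U: "openin T U" and x: "x \<in> Sec OY U" and y: "y \<in> Sec OY U"
    and z: "z \<in> Sec OY U"
  interpret U: module "R U" "M U" by (rule Y.module_sect[OF U])
  define a where "a = h U (res OZ (topspace T) U c)"
  have a: "a \<in> Sec OY U" using U c by (simp add: a_def)
  have e: "ev (c \<odot>\<^bsub>C2\<^esub> f) U v w = a \<odot>\<^bsub>M U\<^esub> ev f U v w"
    if "v \<in> Sec OY U" "w \<in> Sec OY U" for v w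
    unfolding a_def by (rule ev_ops(3)[OF U that])
  have l: "v \<odot>\<^bsub>M U\<^esub> (a \<odot>\<^bsub>M U\<^esub> m) = a \<odot>\<^bsub>M U\<^esub> (v \<odot>\<^bsub>M U\<^esub> m)"
    if "v \<in> Sec OY U" "m \<in> Sec F U" for v m
    using that a U.R.m_comm by (simp add: U.smult_assoc1[symmetric])
  have xy: "x \<otimes>\<^bsub>R U\<^esub> y \<in> Sec OY U" "y \<otimes>\<^bsub>R U\<^esub> z \<in> Sec OY U"
    using x y z by simp_all
  have "x \<odot>\<^bsub>M U\<^esub> ev (c \<odot>\<^bsub>C2\<^esub> f) U y z \<oplus>\<^bsub>M U\<^esub> ev (c \<odot>\<^bsub>C2\<^esub> f) U x (y \<otimes>\<^bsub>R U\<^esub> z)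
    = a \<odot>\<^bsub>M U\<^esub> (x \<odot>\<^bsub>M U\<^esub> ev f U y z \<oplus>\<^bsub>M U\<^esub> ev f U x (y \<otimes>\<^bsub>R U\<^esub> z))"
    using x y z xy a bf[OF U] by (simp only: e l U.smult_r_distr U.smult_closed)
  also have "\<dots> = a \<odot>\<^bsub>M U\<^esub> (ev f U (x \<otimes>\<^bsub>R U\<^esub> y) z \<oplus>\<^bsub>M U\<^esub> z \<odot>\<^bsub>M U\<^esub> ev f U x y)"
    using f U x y z by (simp add: cocycle_family_def)
  also have "\<dots> = ev (c \<odot>\<^bsub>C2\<^esub> f) U (x \<otimes>\<^bsub>R U\<^esub> y) z \<oplus>\<^bsub>M U\<^esub> z \<odot>\<^bsub>M U\<^esub> ev (c \<odot>\<^bsub>C2\<^esub> f) U x y"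
    using x y z xy a bf[OF U] by (simp only: e l U.smult_r_distr U.smult_closed)
  finally show "x \<odot>\<^bsub>M U\<^esub> ev (c \<odot>\<^bsub>C2\<^esub> f) U y z \<oplus>\<^bsub>M U\<^esub> ev (c \<odot>\<^bsub>C2\<^esub> f) U x (y \<otimes>\<^bsub>R U\<^esub> z)
    = ev (c \<odot>\<^bsub>C2\<^esub> f) U (x \<otimes>\<^bsub>R U\<^esub> y) z \<oplus>\<^bsub>M U\<^esub> z \<odot>\<^bsub>M U\<^esub> ev (c \<odot>\<^bsub>C2\<^esub> f) U x y" .
qed

lemma C2_minus:
  assumes f: "f \<in> carrier C2"
  shows "(\<ominus>\<^bsub>sect OZ (topspace T)\<^esub> \<one>\<^bsub>sect OZ (topspace T)\<^esub>) \<odot>\<^bsub>C2\<^esub> f = \<ominus>\<^bsub>C2\<^esub> f"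
proof -
  interpret G: abelian_group C2 by (rule C2_group)
  interpret top: cring "sect OZ (topspace T)" by (rule Z.cring_sect) simp
  have m1: "\<ominus>\<^bsub>sect OZ (topspace T)\<^esub> \<one>\<^bsub>sect OZ (topspace T)\<^esub> \<in> Sec OZ (topspace T)" by simp
  show ?thesis
  proof (rule C2_ext[OF C2_smult_closed[OF f m1] G.a_inv_closed[OF f]])
    fix U x y assume U: "openin T U" and x: "x \<in> Sec OY U" and y: "y \<in> Sec OY U"
    have UT: "U \<subseteq> topspace T" using openin_subset[OF U] .
    interpret U: module "R U" "M U" by (rule Y.module_sect[OF U])
    have "h U \<circ> res OZ (topspace T) U \<in> ring_hom (sect OZ (topspace T)) (R U)"
      by (rule ring_hom_trans[OF Z.res_ring_hom[OF _ U UT] h_hom[OF U]]) simp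
    then interpret hom: ring_hom_cring "sect OZ (topspace T)" "R U" "h U \<circ> res OZ (topspace T) U"
      by (intro ring_hom_cring.intro top.is_cring U.R.is_cring ring_hom_cring_axioms.intro)
    have "h U (res OZ (topspace T) U (\<ominus>\<^bsub>sect OZ (topspace T)\<^esub> \<one>\<^bsub>sect OZ (topspace T)\<^esub>)) =
        \<ominus>\<^bsub>R U\<^esub> \<one>\<^bsub>R U\<^esub>"
      using hom.hom_a_inv[OF top.one_closed] hom.hom_one by simp
    then show "ev ((\<ominus>\<^bsub>sect OZ (topspace T)\<^esub> \<one>\<^bsub>sect OZ (topspace T)\<^esub>) \<odot>\<^bsub>C2\<^esub> f) U x y = ev (\<ominus>\<^bsub>C2\<^esub> f) U x y"
      using U x y f bilinear_familyD(1)[OF C2_bilinear[OF f] U x y] by (simp add: U.smult_l_minus)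
  qed
qed

text \<open>Closure under inverses comes from the scalar \<open>-1\<close> among the global sections
  of \<open>OZ\<close>, so closure under scalars does double duty.\<close>

lemma C2_subgroupI:
  assumes sub: "S \<subseteq> carrier C2" and ne: "S \<noteq> {}"
    and add: "\<And>f g. \<lbrakk>f \<in> S; g \<in> S\<rbrakk> \<Longrightarrow> f \<oplus>\<^bsub>C2\<^esub> g \<in> S"
    and smult: "\<And>c f. \<lbrakk>c \<in> Sec OZ (topspace T); f \<in> S\<rbrakk> \<Longrightarrow> c \<odot>\<^bsub>C2\<^esub> f \<in> S"
  shows "subgroup S (add_monoid C2)"
proof -
  interpret G: abelian_group C2 by (rule C2_group)
  interpret top: cring "sect OZ (topspace T)" by (rule Z.cring_sect) simp
  show ?thesis
  proof (rule group.subgroupI[OF G.a_group])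
    fix f assume f: "f \<in> S"
    then have "\<ominus>\<^bsub>C2\<^esub> f \<in> S"
      using smult[of "\<ominus>\<^bsub>sect OZ (topspace T)\<^esub> \<one>\<^bsub>sect OZ (topspace T)\<^esub>" f] C2_minus[of f] sub by (simp add: subset_iff)
    then show "inv\<^bsub>add_monoid C2\<^esub> f \<in> S" by (simp add: a_inv_def)
  qed (use sub ne add in simp_all)
qed

lemma linear_family_add:
  assumes f: "linear_family f" and g: "linear_family g"
  shows "linear_family (\<lambda>U x. f U x \<oplus>\<^bsub>M U\<^esub> g U x)"
  unfolding linear_family_def
proof (intro allI impI ballI conjI; (elim conjE)?)
  fix U x assume U: "openin T U" and x: "x \<in> Sec OY U"
  interpret U: module "R U" "M U" by (rule Y.module_sect[OF U])
  note f = linear_familyD[OF f U] and g = linear_familyD[OF g U]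
  show "f U x \<oplus>\<^bsub>M U\<^esub> g U x \<in> Sec F U" using x by (simp add: f g)
  show "f U (x \<oplus>\<^bsub>R U\<^esub> y) \<oplus>\<^bsub>M U\<^esub> g U (x \<oplus>\<^bsub>R U\<^esub> y) =
      f U x \<oplus>\<^bsub>M U\<^esub> g U x \<oplus>\<^bsub>M U\<^esub> (f U y \<oplus>\<^bsub>M U\<^esub> g U y)" if "y \<in> Sec OY U" for y
    using x that by (simp add: f g U.M.a_ac)
  show "f U (h U c \<otimes>\<^bsub>R U\<^esub> x) \<oplus>\<^bsub>M U\<^esub> g U (h U c \<otimes>\<^bsub>R U\<^esub> x) =
      h U c \<odot>\<^bsub>M U\<^esub> (f U x \<oplus>\<^bsub>M U\<^esub> g U x)" if "c \<in> Sec OZ U" for c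
    using x that U by (simp add: f(1) f(3)[OF x that] g(1) g(3)[OF x that] U.smult_r_distr)
  show "f V (res OY U V x) \<oplus>\<^bsub>M V\<^esub> g V (res OY U V x) = res F U V (f U x \<oplus>\<^bsub>M U\<^esub> g U x)"
    if "openin T V" "V \<subseteq> U" for V
    using x that U by (simp add: f(1) f(4)[OF x that] g(1) g(4)[OF x that])
qed

lemma linear_family_smult:
  assumes g: "linear_family g" and c: "c \<in> Sec OZ (topspace T)"
  shows "linear_family (\<lambda>U x. h U (res OZ (topspace T) U c) \<odot>\<^bsub>M U\<^esub> g U x)"
  unfolding linear_family_def
proof (intro allI impI ballI conjI; (elim conjE)?)
  fix U x assume U: "openin T U" and x: "x \<in> Sec OY U"
  interpret U: module "R U" "M U" by (rule Y.module_sect[OF U])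
  note g = linear_familyD[OF g U]
  define a where "a = h U (res OZ (topspace T) U c)"
  have a: "a \<in> Sec OY U" using U c by (simp add: a_def)
  show "a \<odot>\<^bsub>M U\<^esub> g U x \<in> Sec F U" using x a by (simp add: g)
  show "a \<odot>\<^bsub>M U\<^esub> g U (x \<oplus>\<^bsub>R U\<^esub> y) = a \<odot>\<^bsub>M U\<^esub> g U x \<oplus>\<^bsub>M U\<^esub> a \<odot>\<^bsub>M U\<^esub> g U y"
    if "y \<in> Sec OY U" for y
    using x that a by (simp add: g U.smult_r_distr)
  show "a \<odot>\<^bsub>M U\<^esub> g U (h U d \<otimes>\<^bsub>R U\<^esub> x) = h U d \<odot>\<^bsub>M U\<^esub> (a \<odot>\<^bsub>M U\<^esub> g U x)"
    if "d \<in> Sec OZ U" for d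
    unfolding g(3)[OF x that] using x that U a
    by (simp add: g(1) U.smult_assoc1[symmetric] U.R.m_comm)
  show "h V (res OZ (topspace T) V c) \<odot>\<^bsub>M V\<^esub> g V (res OY U V x) = res F U V (a \<odot>\<^bsub>M U\<^esub> g U x)"
    if V: "openin T V" "V \<subseteq> U" for V
  proof -
    have "res OY U V a = h V (res OZ (topspace T) V c)"
      using h_res[OF U V, of "res OZ (topspace T) U c"] openin_subset[OF U] U V c by (simp add: a_def)
    then show ?thesis using x V U a by (simp add: g(1) g(4)[OF x V])
  qed
qed

lemma BC_add: "\<lbrakk>f \<in> BC; g \<in> BC\<rbrakk> \<Longrightarrow> f \<oplus>\<^bsub>C2\<^esub> g \<in> BC"
proof -
  assume f: "f \<in> BC" and g: "g \<in> BC"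
  interpret G: abelian_group C2 by (rule C2_group)
  obtain k where fC: "f \<in> carrier C2" and k: "linear_family k"
    "\<forall>U. openin T U \<longrightarrow> (\<forall>x\<in>Sec OY U. \<forall>y\<in>Sec OY U. ev f U x y = cob k U x y)"
    using f by (rule coboundariesE)
  obtain l where gC: "g \<in> carrier C2" and l: "linear_family l"
    "\<forall>U. openin T U \<longrightarrow> (\<forall>x\<in>Sec OY U. \<forall>y\<in>Sec OY U. ev g U x y = cob l U x y)"
    using g by (rule coboundariesE)
  show ?thesis
  proof (rule coboundariesI[OF G.a_closed[OF fC gC] linear_family_add[OF k(1) l(1)]])
    fix U x y assume U: "openin T U" and x: "x \<in> Sec OY U" and y: "y \<in> Sec OY U"
    interpret U: module "R U" "M U" by (rule Y.module_sect[OF U])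
    have "ev (f \<oplus>\<^bsub>C2\<^esub> g) U x y = cob k U x y \<oplus>\<^bsub>M U\<^esub> cob l U x y"
      using U x y k(2) l(2) by simp
    then show "ev (f \<oplus>\<^bsub>C2\<^esub> g) U x y = cob (\<lambda>U x. k U x \<oplus>\<^bsub>M U\<^esub> l U x) U x y"
      using x y linear_familyD(1)[OF k(1) U] linear_familyD(1)[OF l(1) U]
      by (simp add: U.smult_r_distr U.M.minus_eq U.M.minus_add U.M.a_ac)
  qed
qed

lemma BC_smult: "\<lbrakk>c \<in> Sec OZ (topspace T); f \<in> BC\<rbrakk> \<Longrightarrow> c \<odot>\<^bsub>C2\<^esub> f \<in> BC"
proof -
  assume c: "c \<in> Sec OZ (topspace T)" and f: "f \<in> BC"
  obtain k where fC: "f \<in> carrier C2" and k: "linear_family k"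
    "\<forall>U. openin T U \<longrightarrow> (\<forall>x\<in>Sec OY U. \<forall>y\<in>Sec OY U. ev f U x y = cob k U x y)"
    using f by (rule coboundariesE)
  show ?thesis
  proof (rule coboundariesI[OF C2_smult_closed[OF fC c] linear_family_smult[OF k(1) c]])
    fix U x y assume U: "openin T U" and x: "x \<in> Sec OY U" and y: "y \<in> Sec OY U"
    interpret U: module "R U" "M U" by (rule Y.module_sect[OF U])
    define a where "a = h U (res OZ (topspace T) U c)"
    have a: "a \<in> Sec OY U" using U c by (simp add: a_def)
    have l: "v \<odot>\<^bsub>M U\<^esub> (a \<odot>\<^bsub>M U\<^esub> m) = a \<odot>\<^bsub>M U\<^esub> (v \<odot>\<^bsub>M U\<^esub> m)"
      if "v \<in> Sec OY U" "m \<in> Sec F U" for v m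
      using that a U.R.m_comm by (simp add: U.smult_assoc1[symmetric])
    have "ev (c \<odot>\<^bsub>C2\<^esub> f) U x y = a \<odot>\<^bsub>M U\<^esub> cob k U x y"
      using U x y k(2) by (simp add: a_def)
    then show "ev (c \<odot>\<^bsub>C2\<^esub> f) U x y =
        cob (\<lambda>U x. h U (res OZ (topspace T) U c) \<odot>\<^bsub>M U\<^esub> k U x) U x y"
      unfolding a_def[symmetric] using x y a linear_familyD(1)[OF k(1) U]
      by (simp add: l U.smult_r_distr U.smult_r_minus U.M.minus_eq)
  qed
qed

lemma BC_nonempty: "BC \<noteq> {}"
proof -
  have "linear_family (\<lambda>U x. \<zero>\<^bsub>M U\<^esub>)" unfolding linear_family_def
  proof (intro allI impI ballI conjI; (elim conjE)?)
    fix U assume U: "openin T U"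
    interpret U: module "R U" "M U" by (rule Y.module_sect[OF U])
    show "\<zero>\<^bsub>M U\<^esub> \<in> Sec F U" "\<zero>\<^bsub>M U\<^esub> = \<zero>\<^bsub>M U\<^esub> \<oplus>\<^bsub>M U\<^esub> \<zero>\<^bsub>M U\<^esub>" by simp_all
    show "\<zero>\<^bsub>M U\<^esub> = h U c \<odot>\<^bsub>M U\<^esub> \<zero>\<^bsub>M U\<^esub>" if "c \<in> Sec OZ U" for c
      using U that by simp
    show "\<zero>\<^bsub>M V\<^esub> = res F U V \<zero>\<^bsub>M U\<^esub>" if "openin T V" "V \<subseteq> U" for V using U that by simp
  qed
  then show ?thesis unfolding coboundaries_def by (rule C1_exists) blast
qed

lemma subgroups:
  "subgroup ZC (add_monoid C2)" "subgroup SC (add_monoid C2)" "subgroup BC (add_monoid C2)"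
proof -
  interpret G: abelian_group C2 by (rule C2_group)
  have SZ: "SC \<subseteq> ZC" by (auto simp: symmetric_cocycles_def)
  have ne: "SC \<noteq> {}" "ZC \<noteq> {}" using BC_nonempty coboundaries_subset SZ by auto
  show "subgroup ZC (add_monoid C2)"
    by (rule C2_subgroupI)
      (use ne cocycle_add cocycle_smult C2_smult_closed in \<open>simp_all add: cocycles_iff subset_iff\<close>)
  show "subgroup SC (add_monoid C2)"
  proof (rule C2_subgroupI)
    show "f \<oplus>\<^bsub>C2\<^esub> g \<in> SC" if "f \<in> SC" "g \<in> SC" for f g
      using that cocycle_add by (simp add: symmetric_cocycles_iff symmetric_family_def)
    show "c \<odot>\<^bsub>C2\<^esub> f \<in> SC" if "c \<in> Sec OZ (topspace T)" "f \<in> SC" for c f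
      using that cocycle_smult C2_smult_closed by (simp add: symmetric_cocycles_iff symmetric_family_def)
  qed (use ne in \<open>simp_all add: symmetric_cocycles_iff subset_iff\<close>)
  show "subgroup BC (add_monoid C2)"
    by (rule C2_subgroupI[OF _ BC_nonempty BC_add BC_smult])
      (use coboundaries_subset in \<open>auto simp: symmetric_cocycles_iff subset_iff\<close>)
qed

lemma SC_smult: "\<lbrakk>c \<in> Sec OZ (topspace T); f \<in> SC\<rbrakk> \<Longrightarrow> c \<odot>\<^bsub>C2\<^esub> f \<in> SC"
  using cocycle_smult C2_smult_closed by (simp add: symmetric_cocycles_iff symmetric_family_def)

abbreviation HC where "HC \<equiv> H2_class T OZ OY h F"

lemma HC_eq_iff:
  assumes f: "f \<in> carrier C2" and g: "g \<in> carrier C2"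
  shows "HC f = HC g \<longleftrightarrow> f \<ominus>\<^bsub>C2\<^esub> g \<in> BC"
proof -
  interpret G: abelian_group C2 by (rule C2_group)
  interpret B: subgroup BC "add_monoid C2" by (rule subgroups(3))
  have HC: "HC k = BC #>\<^bsub>add_monoid C2\<^esub> k" for k by (simp add: H2_class_def a_r_coset_def)
  show ?thesis
  proof
    assume "HC f = HC g"
    then have "f \<in> BC #>\<^bsub>add_monoid C2\<^esub> g"
      using group.rcos_self[OF G.a_group _ subgroups(3), of f] f unfolding HC by simp
    then obtain b where b: "b \<in> BC" "f = b \<oplus>\<^bsub>C2\<^esub> g" by (auto simp: r_coset_def)
    have "b \<in> carrier C2" using B.mem_carrier[OF b(1)] by simp
    then have "f \<ominus>\<^bsub>C2\<^esub> g = b" unfolding b(2) using g by (simp add: G.minus_eq G.a_assoc G.r_neg)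
    then show "f \<ominus>\<^bsub>C2\<^esub> g \<in> BC" using b(1) by simp
  next
    assume b: "f \<ominus>\<^bsub>C2\<^esub> g \<in> BC"
    have "f = (f \<ominus>\<^bsub>C2\<^esub> g) \<oplus>\<^bsub>C2\<^esub> g" using f g by (simp add: G.minus_eq G.a_assoc G.l_neg)
    then have "f \<in> BC #>\<^bsub>add_monoid C2\<^esub> g" using b by (auto simp: r_coset_def)
    then show "HC f = HC g"
      using group.repr_independence[OF G.a_group _ _ subgroups(3), of f g] g unfolding HC by simp
  qed
qed

text \<open>The symmetric classes are the image of the symmetric cocycles under the quotient
  homomorphism. Scalars act on classes because the coboundaries are closed under them.\<close>

theorem H2_S_submodule: "submodule (H2_S T OZ OY h F) (sect OZ (topspace T)) (H2 T OZ OY h F)"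
proof -
  interpret G: abelian_group C2 by (rule C2_group)
  interpret B: subgroup BC "add_monoid C2" by (rule subgroups(3))
  define K where "K = C2\<lparr>carrier := ZC\<rparr>"
  have KM: "carrier (add_monoid K) = ZC" "monoid.mult (add_monoid K) = monoid.mult (add_monoid C2)"
    "one (add_monoid K) = one (add_monoid C2)" by (simp_all add: K_def)
  have sub: "BC \<subseteq> SC" "SC \<subseteq> ZC" using coboundaries_subset by (auto simp: symmetric_cocycles_def)
  \<comment> \<open>The additive group of cocycles is written multiplicatively, where the factor
    group and its quotient homomorphism are available.\<close>
  let ?Z = "(add_monoid C2)\<lparr>carrier := ZC\<rparr>"
  have "group ?Z" by (rule subgroup.subgroup_is_group[OF subgroups(1) G.a_group])
  then interpret Z: comm_group ?Z
    by (rule group.group_comm_groupI)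
      (use subgroup.mem_carrier[OF subgroups(1)] G.a_comm in simp)
  have BZ: "subgroup BC ?Z" and SZ: "subgroup SC ?Z"
    using group.subgroup_incl[OF G.a_group _ subgroups(1)] subgroups(2,3) sub by auto
  interpret N: normal BC ?Z using Z.normal_iff_subgroup BZ by blast
  interpret q: group_hom ?Z "?Z Mod BC" "\<lambda>f. BC #>\<^bsub>?Z\<^esub> f"
    by (intro group_hom.intro Z.is_group N.factorgroup_is_group group_hom_axioms.intro N.r_coset_hom_Mod)
  have HC: "HC f = BC #>\<^bsub>?Z\<^esub> f" for f by (simp add: H2_class_def a_r_coset_def r_coset_def)
  have "subgroup (H2_S T OZ OY h F) (?Z Mod BC)"
    using q.subgroup_img_is_subgroup[OF SZ] unfolding H2_S_def HC .
  moreover have "carrier (add_monoid (H2 T OZ OY h F)) = carrier (?Z Mod BC)"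
    "monoid.mult (add_monoid (H2 T OZ OY h F)) = monoid.mult (?Z Mod BC)"
    "one (add_monoid (H2 T OZ OY h F)) = one (?Z Mod BC)"
    by (simp_all add: H2_def quotient_module_def FactGroup_def A_RCOSETS_def RCOSETS_def
        r_coset_def set_add_def set_mult_def fun_eq_iff)
  ultimately have sg: "subgroup (H2_S T OZ OY h F) (add_monoid (H2 T OZ OY h F))"
    using subgroup_cong by blast
  have smult: "c \<odot>\<^bsub>H2 T OZ OY h F\<^esub> HC f = HC (c \<odot>\<^bsub>C2\<^esub> f)"
    if c: "c \<in> Sec OZ (topspace T)" and f: "f \<in> carrier C2" for c f
  proof -
    have "HC (c \<odot>\<^bsub>C2\<^esub> k) = HC (c \<odot>\<^bsub>C2\<^esub> f)" if "k \<in> HC f" for k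
    proof -
      obtain b where b: "b \<in> BC" "k = b \<oplus>\<^bsub>C2\<^esub> f"
        using \<open>k \<in> HC f\<close> by (auto simp: H2_class_def a_r_coset_def r_coset_def)
      have bC: "b \<in> carrier C2" using B.mem_carrier[OF b(1)] by simp
      have cl: "c \<odot>\<^bsub>C2\<^esub> b \<in> carrier C2" "c \<odot>\<^bsub>C2\<^esub> f \<in> carrier C2" "c \<odot>\<^bsub>C2\<^esub> k \<in> carrier C2"
        using C2_smult_closed c bC f b(2) by simp_all
      have "c \<odot>\<^bsub>C2\<^esub> k = c \<odot>\<^bsub>C2\<^esub> b \<oplus>\<^bsub>C2\<^esub> c \<odot>\<^bsub>C2\<^esub> f"
      proof (rule C2_ext[OF cl(3) G.a_closed[OF cl(1,2)]])
        fix U x y assume U: "openin T U" and x: "x \<in> Sec OY U" and y: "y \<in> Sec OY U"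
        interpret U: module "R U" "M U" by (rule Y.module_sect[OF U])
        show "ev (c \<odot>\<^bsub>C2\<^esub> k) U x y = ev (c \<odot>\<^bsub>C2\<^esub> b \<oplus>\<^bsub>C2\<^esub> c \<odot>\<^bsub>C2\<^esub> f) U x y"
          using U x y c bilinear_familyD(1)[OF C2_bilinear[OF bC] U x y]
            bilinear_familyD(1)[OF C2_bilinear[OF f] U x y] by (simp add: b(2) U.smult_r_distr)
      qed
      then have "c \<odot>\<^bsub>C2\<^esub> k \<ominus>\<^bsub>C2\<^esub> c \<odot>\<^bsub>C2\<^esub> f = c \<odot>\<^bsub>C2\<^esub> b"
        using cl by (simp add: G.minus_eq G.a_assoc G.r_neg)
      then show ?thesis using HC_eq_iff[OF cl(3,2)] BC_smult[OF c b(1)] by simp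
    qed
    then have "(\<Union>k\<in>HC f. HC (c \<odot>\<^bsub>C2\<^esub> k)) = (\<Union>k\<in>HC f. HC (c \<odot>\<^bsub>C2\<^esub> f))" by (intro SUP_cong refl)
    moreover have "f \<in> HC f"
      using group.rcos_self[OF G.a_group _ subgroups(3), of f] f by (simp add: H2_class_def a_r_coset_def)
    ultimately have "(\<Union>k\<in>HC f. HC (c \<odot>\<^bsub>C2\<^esub> k)) = HC (c \<odot>\<^bsub>C2\<^esub> f)" by auto
    then show ?thesis
      by (simp add: H2_def quotient_module_def H2_class_def a_r_coset_def r_coset_def)
  qed
  have "c \<odot>\<^bsub>H2 T OZ OY h F\<^esub> s \<in> H2_S T OZ OY h F"
    if c: "c \<in> Sec OZ (topspace T)" and s: "s \<in> H2_S T OZ OY h F" for c s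
  proof -
    obtain f where f: "f \<in> SC" "s = HC f" using s unfolding H2_S_def by (elim imageE)
    then have "f \<in> carrier C2" by (simp add: symmetric_cocycles_iff)
    then show ?thesis unfolding f(2) smult[OF c \<open>f \<in> carrier C2\<close>] H2_S_def
      by (intro imageI SC_smult c f(1))
  qed
  then show ?thesis by (intro submodule.intro sg submodule_axioms.intro)
qed

end

section \<open>The extension attached to a symmetric cocycle\<close>

locale cocycle_setting = extension_setting T OZ OY h F
  for T :: "'p topology" and OZ :: "('p, 'c) ring_presheaf" and OY :: "('p, 'a) ring_presheaf"
    and h :: "'p set \<Rightarrow> 'c \<Rightarrow> 'a" and F :: "('p, 'a, 'm) mod_presheaf" +
  fixes f
  assumes f: "f \<in> symmetric_cocycles T OZ OY h F"
begin

abbreviation E where "E \<equiv> cocycle_extension T OZ OY h F f"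
abbreviation Tot where "Tot \<equiv> total E"
abbreviation b where "b \<equiv> ev f"

text \<open>The second component of the unit of the twisted product; it is zero when the cocycle is
  normalised.\<close>

definition e where "e U = \<ominus>\<^bsub>M U\<^esub> b U \<one>\<^bsub>R U\<^esub> \<one>\<^bsub>R U\<^esub>"

lemma E_simps [simp]:
  "Sec Tot U = Sec OY U \<times> Sec F U"
  "(x, m) \<otimes>\<^bsub>sect Tot U\<^esub> (y, n) = (x \<otimes>\<^bsub>R U\<^esub> y,
    x \<odot>\<^bsub>M U\<^esub> n \<oplus>\<^bsub>M U\<^esub> y \<odot>\<^bsub>M U\<^esub> m \<oplus>\<^bsub>M U\<^esub> b U x y)"
  "\<one>\<^bsub>sect Tot U\<^esub> = (\<one>\<^bsub>R U\<^esub>, e U)"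
  "\<zero>\<^bsub>sect Tot U\<^esub> = (\<zero>\<^bsub>R U\<^esub>, \<zero>\<^bsub>M U\<^esub>)"
  "(x, m) \<oplus>\<^bsub>sect Tot U\<^esub> (y, n) = (x \<oplus>\<^bsub>R U\<^esub> y, m \<oplus>\<^bsub>M U\<^esub> n)"
  "res Tot U V (x, m) = (res OY U V x, res F U V m)"
  "proj E U = fst"
  "incl E U m = (\<zero>\<^bsub>R U\<^esub>, m)"
  "scal E U z = (h U z, h U z \<odot>\<^bsub>M U\<^esub> e U)"
  by (simp_all add: cocycle_extension_def Let_def e_def)

lemma f_C2: "f \<in> carrier C2" using f by (simp add: symmetric_cocycles_iff)

lemmas b_fam = bilinear_familyD[OF C2_bilinear[OF f_C2]]

lemma b_closed [simp, intro]:
  "\<lbrakk>openin T U; x \<in> Sec OY U; y \<in> Sec OY U\<rbrakk> \<Longrightarrow> b U x y \<in> Sec F U"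
  by (rule b_fam(1))

lemma b_add:
  assumes "openin T U" "x \<in> Sec OY U" "y \<in> Sec OY U" "z \<in> Sec OY U"
  shows "b U (x \<oplus>\<^bsub>R U\<^esub> z) y = b U x y \<oplus>\<^bsub>M U\<^esub> b U z y"
    and "b U x (y \<oplus>\<^bsub>R U\<^esub> z) = b U x y \<oplus>\<^bsub>M U\<^esub> b U x z"
  using assms by (simp_all add: b_fam)

lemma b_res [simp]:
  "\<lbrakk>openin T U; openin T V; V \<subseteq> U; x \<in> Sec OY U; y \<in> Sec OY U\<rbrakk>
    \<Longrightarrow> b V (res OY U V x) (res OY U V y) = res F U V (b U x y)"
  by (rule b_fam(6))

lemma b_sym: "\<lbrakk>openin T U; x \<in> Sec OY U; y \<in> Sec OY U\<rbrakk> \<Longrightarrow> b U x y = b U y x"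
  using f by (simp add: symmetric_cocycles_iff symmetric_family_def)

lemma b_cocycle:
  "\<lbrakk>openin T U; x \<in> Sec OY U; y \<in> Sec OY U; z \<in> Sec OY U\<rbrakk> \<Longrightarrow>
    x \<odot>\<^bsub>M U\<^esub> b U y z \<oplus>\<^bsub>M U\<^esub> b U x (y \<otimes>\<^bsub>R U\<^esub> z) =
    b U (x \<otimes>\<^bsub>R U\<^esub> y) z \<oplus>\<^bsub>M U\<^esub> z \<odot>\<^bsub>M U\<^esub> b U x y"
  using f by (simp add: symmetric_cocycles_iff cocycle_family_def)

lemma b_zero [simp]:
  assumes U: "openin T U" and x: "x \<in> Sec OY U"
  shows "b U \<zero>\<^bsub>R U\<^esub> x = \<zero>\<^bsub>M U\<^esub>" "b U x \<zero>\<^bsub>R U\<^esub> = \<zero>\<^bsub>M U\<^esub>"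
proof -
  interpret U: module "R U" "M U" by (rule Y.module_sect[OF U])
  have "b U \<zero>\<^bsub>R U\<^esub> x = b U \<zero>\<^bsub>R U\<^esub> x \<oplus>\<^bsub>M U\<^esub> b U \<zero>\<^bsub>R U\<^esub> x"
    using b_add(1)[OF U U.R.zero_closed x U.R.zero_closed] by simp
  then show z: "b U \<zero>\<^bsub>R U\<^esub> x = \<zero>\<^bsub>M U\<^esub>"
    using U.M.add.l_cancel_one'[of "b U \<zero>\<^bsub>R U\<^esub> x" "b U \<zero>\<^bsub>R U\<^esub> x"] U x by simp
  then show "b U x \<zero>\<^bsub>R U\<^esub> = \<zero>\<^bsub>M U\<^esub>" using b_sym[OF U x U.R.zero_closed] by simp
qed

lemma e_closed [simp, intro]: "openin T U \<Longrightarrow> e U \<in> Sec F U"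
  by (simp add: e_def)

lemma e_res [simp]: "\<lbrakk>openin T U; openin T V; V \<subseteq> U\<rbrakk> \<Longrightarrow> res F U V (e U) = e V"
  using b_res[of U V "\<one>\<^bsub>R U\<^esub>" "\<one>\<^bsub>R U\<^esub>"] by (simp add: e_def)

text \<open>The cocycle identity at \<open>1, 1, x\<close> gives \<open>b(1, x) = x b(1, 1)\<close>
  after cancelling one copy of \<open>b(1, x)\<close>. It explains the shape of the unit and of the
  structure map.\<close>

lemma smult_e:
  assumes U: "openin T U" and x: "x \<in> Sec OY U"
  shows "x \<odot>\<^bsub>M U\<^esub> e U \<oplus>\<^bsub>M U\<^esub> b U \<one>\<^bsub>R U\<^esub> x = \<zero>\<^bsub>M U\<^esub>"
proof -
  interpret U: module "R U" "M U" by (rule Y.module_sect[OF U])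
  have "b U \<one>\<^bsub>R U\<^esub> x \<oplus>\<^bsub>M U\<^esub> b U \<one>\<^bsub>R U\<^esub> x =
      b U \<one>\<^bsub>R U\<^esub> x \<oplus>\<^bsub>M U\<^esub> x \<odot>\<^bsub>M U\<^esub> b U \<one>\<^bsub>R U\<^esub> \<one>\<^bsub>R U\<^esub>"
    using b_cocycle[OF U U.R.one_closed U.R.one_closed x] U x by simp
  then have "b U \<one>\<^bsub>R U\<^esub> x = x \<odot>\<^bsub>M U\<^esub> b U \<one>\<^bsub>R U\<^esub> \<one>\<^bsub>R U\<^esub>"
    using U x by (simp add: U.M.add.l_cancel)
  then show ?thesis using U x by (simp add: e_def U.smult_r_minus U.M.l_neg)
qed

lemma mult_one:
  assumes U: "openin T U" and x: "x \<in> Sec OY U" and m: "m \<in> Sec F U"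
  shows "\<one>\<^bsub>R U\<^esub> \<odot>\<^bsub>M U\<^esub> m \<oplus>\<^bsub>M U\<^esub> x \<odot>\<^bsub>M U\<^esub> e U \<oplus>\<^bsub>M U\<^esub> b U \<one>\<^bsub>R U\<^esub> x = m"
proof -
  interpret U: module "R U" "M U" by (rule Y.module_sect[OF U])
  show ?thesis using smult_e[OF U x] U x m by (simp add: U.M.a_assoc)
qed

text \<open>Associativity is the cocycle identity, commutativity is the symmetry of
  \<open>b\<close>, and distributivity is its bilinearity.\<close>

lemma cring_Tot:
  assumes U: "openin T U"
  shows "cring (sect Tot U)"
proof -
  interpret U: module "R U" "M U" by (rule Y.module_sect[OF U])
  have assoc: "(x \<otimes>\<^bsub>R U\<^esub> y) \<odot>\<^bsub>M U\<^esub> k \<oplus>\<^bsub>M U\<^esub>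
      z \<odot>\<^bsub>M U\<^esub> (x \<odot>\<^bsub>M U\<^esub> n \<oplus>\<^bsub>M U\<^esub> y \<odot>\<^bsub>M U\<^esub> m \<oplus>\<^bsub>M U\<^esub> b U x y) \<oplus>\<^bsub>M U\<^esub> b U (x \<otimes>\<^bsub>R U\<^esub> y) z
    = x \<odot>\<^bsub>M U\<^esub> (y \<odot>\<^bsub>M U\<^esub> k \<oplus>\<^bsub>M U\<^esub> z \<odot>\<^bsub>M U\<^esub> n \<oplus>\<^bsub>M U\<^esub> b U y z) \<oplus>\<^bsub>M U\<^esub>
      (y \<otimes>\<^bsub>R U\<^esub> z) \<odot>\<^bsub>M U\<^esub> m \<oplus>\<^bsub>M U\<^esub> b U x (y \<otimes>\<^bsub>R U\<^esub> z)"
    if "x \<in> Sec OY U" "y \<in> Sec OY U" "z \<in> Sec OY U"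
      "m \<in> Sec F U" "n \<in> Sec F U" "k \<in> Sec F U" for x y z m n k
  proof -
    \<comment> \<open>\<open>s\<close> collects the terms without \<open>b\<close>, which are the
      same on both sides; what remains is the cocycle identity.\<close>
    define s where "s = (x \<otimes>\<^bsub>R U\<^esub> y) \<odot>\<^bsub>M U\<^esub> k \<oplus>\<^bsub>M U\<^esub> (x \<otimes>\<^bsub>R U\<^esub> z) \<odot>\<^bsub>M U\<^esub> n
      \<oplus>\<^bsub>M U\<^esub> (y \<otimes>\<^bsub>R U\<^esub> z) \<odot>\<^bsub>M U\<^esub> m"
    have s: "s \<in> Sec F U" using that by (simp add: s_def)
    have "(x \<otimes>\<^bsub>R U\<^esub> y) \<odot>\<^bsub>M U\<^esub> k \<oplus>\<^bsub>M U\<^esub>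
        z \<odot>\<^bsub>M U\<^esub> (x \<odot>\<^bsub>M U\<^esub> n \<oplus>\<^bsub>M U\<^esub> y \<odot>\<^bsub>M U\<^esub> m \<oplus>\<^bsub>M U\<^esub> b U x y) \<oplus>\<^bsub>M U\<^esub> b U (x \<otimes>\<^bsub>R U\<^esub> y) z
      = s \<oplus>\<^bsub>M U\<^esub> (b U (x \<otimes>\<^bsub>R U\<^esub> y) z \<oplus>\<^bsub>M U\<^esub> z \<odot>\<^bsub>M U\<^esub> b U x y)"
      unfolding s_def using U that
      by (simp add: U.smult_r_distr U.smult_assoc1[symmetric] U.R.m_comm U.M.a_ac)
    also have "\<dots> = s \<oplus>\<^bsub>M U\<^esub> (x \<odot>\<^bsub>M U\<^esub> b U y z \<oplus>\<^bsub>M U\<^esub> b U x (y \<otimes>\<^bsub>R U\<^esub> z))"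
      using b_cocycle[OF U that(1-3)] by simp
    also have "\<dots> = x \<odot>\<^bsub>M U\<^esub> (y \<odot>\<^bsub>M U\<^esub> k \<oplus>\<^bsub>M U\<^esub> z \<odot>\<^bsub>M U\<^esub> n \<oplus>\<^bsub>M U\<^esub> b U y z) \<oplus>\<^bsub>M U\<^esub>
      (y \<otimes>\<^bsub>R U\<^esub> z) \<odot>\<^bsub>M U\<^esub> m \<oplus>\<^bsub>M U\<^esub> b U x (y \<otimes>\<^bsub>R U\<^esub> z)"
      unfolding s_def using U that
      by (simp add: U.smult_r_distr U.smult_assoc1[symmetric] U.M.a_ac)
    finally show ?thesis .
  qed
  show ?thesis
  proof (rule cringI)
    show "abelian_group (sect Tot U)"
    proof (rule abelian_groupI)
      fix x assume "x \<in> Sec Tot U"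
      then obtain a m where "x = (a, m)" "a \<in> Sec OY U" "m \<in> Sec F U" by auto
      then show "\<exists>y\<in>Sec Tot U. y \<oplus>\<^bsub>sect Tot U\<^esub> x = \<zero>\<^bsub>sect Tot U\<^esub>"
        by (intro bexI[of _ "(\<ominus>\<^bsub>R U\<^esub> a, \<ominus>\<^bsub>M U\<^esub> m)"]) (simp_all add: U.R.l_neg U.M.l_neg)
    qed (auto simp: U.R.a_ac U.M.a_ac)
    show "comm_monoid (sect Tot U)"
    proof (rule comm_monoidI)
      fix x y z assume xyz: "x \<in> Sec Tot U" "y \<in> Sec Tot U" "z \<in> Sec Tot U"
      show "x \<otimes>\<^bsub>sect Tot U\<^esub> y \<in> Sec Tot U" using xyz U by auto
      show "x \<otimes>\<^bsub>sect Tot U\<^esub> y \<otimes>\<^bsub>sect Tot U\<^esub> z = x \<otimes>\<^bsub>sect Tot U\<^esub> (y \<otimes>\<^bsub>sect Tot U\<^esub> z)"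
        using xyz assoc by (cases x; cases y; cases z) (simp add: U.R.m_assoc)
      show "x \<otimes>\<^bsub>sect Tot U\<^esub> y = y \<otimes>\<^bsub>sect Tot U\<^esub> x"
        using xyz U b_sym[OF U] by (cases x; cases y) (simp add: U.R.m_comm U.M.a_comm)
    next
      fix x assume "x \<in> Sec Tot U"
      then show "\<one>\<^bsub>sect Tot U\<^esub> \<otimes>\<^bsub>sect Tot U\<^esub> x = x" using mult_one[OF U] by (cases x) simp
    qed (use U in simp)
    fix x y z assume xyz: "x \<in> Sec Tot U" "y \<in> Sec Tot U" "z \<in> Sec Tot U"
    show "(x \<oplus>\<^bsub>sect Tot U\<^esub> y) \<otimes>\<^bsub>sect Tot U\<^esub> z = x \<otimes>\<^bsub>sect Tot U\<^esub> z \<oplus>\<^bsub>sect Tot U\<^esub> y \<otimes>\<^bsub>sect Tot U\<^esub> z"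
      using xyz U by (cases x; cases y; cases z)
        (simp add: U.R.l_distr U.smult_l_distr U.smult_r_distr b_add U.M.a_ac)
  qed
qed

text \<open>Restriction acts componentwise, so the sheaf condition is that of \<open>OY\<close> and
  \<open>F\<close> separately; the twist affects only the ring structure.\<close>

lemma sheaf_Tot: "is_sheaf T Tot"
proof -
  have res: "res Tot U V s = (res OY U V (fst s), res F U V (snd s))" for U V s
    by (cases s) simp
  have "is_presheaf T Tot"
    unfolding is_presheaf_def res by (auto simp: subset_iff)
  moreover have glue: "\<exists>!x. x \<in> Sec Tot (\<Union>\<U>) \<and> (\<forall>U\<in>\<U>. res Tot (\<Union>\<U>) U x = s U)"
    if o: "\<forall>U\<in>\<U>. openin T U" and s: "\<forall>U\<in>\<U>. s U \<in> Sec Tot U"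
      and c: "\<forall>U\<in>\<U>. \<forall>V\<in>\<U>. res Tot U (U \<inter> V) (s U) = res Tot V (U \<inter> V) (s V)" for \<U> s
  proof -
    have s1: "fst (s U) \<in> Sec OY U" "snd (s U) \<in> Sec F U" if "U \<in> \<U>" for U
      using bspec[OF s that] by (auto simp: mem_Times_iff)
    have c1: "res OY U (U \<inter> V) (fst (s U)) = res OY V (U \<inter> V) (fst (s V))"
      "res F U (U \<inter> V) (snd (s U)) = res F V (U \<inter> V) (snd (s V))" if "U \<in> \<U>" "V \<in> \<U>" for U V
      using bspec[OF bspec[OF c that(1)] that(2)] unfolding res by simp_all
    have o1: "openin T U" if "U \<in> \<U>" for U using o that by blast
    have "\<exists>!x. x \<in> Sec OY (\<Union>\<U>) \<and> (\<forall>U\<in>\<U>. res OY (\<Union>\<U>) U x = fst (s U))"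
      by (rule Y.ex1_glue[OF o1 s1(1) c1(1)])
    then obtain x where x: "x \<in> Sec OY (\<Union>\<U>) \<and> (\<forall>U\<in>\<U>. res OY (\<Union>\<U>) U x = fst (s U))"
      and xu: "\<forall>y. y \<in> Sec OY (\<Union>\<U>) \<and> (\<forall>U\<in>\<U>. res OY (\<Union>\<U>) U y = fst (s U)) \<longrightarrow> y = x"
      by (rule ex1E)
    have "\<exists>!x. x \<in> Sec F (\<Union>\<U>) \<and> (\<forall>U\<in>\<U>. res F (\<Union>\<U>) U x = snd (s U))"
      by (rule Y.F.ex1_glue[OF o1 s1(2) c1(2)])
    then obtain m where m: "m \<in> Sec F (\<Union>\<U>) \<and> (\<forall>U\<in>\<U>. res F (\<Union>\<U>) U m = snd (s U))"
      and mu: "\<forall>y. y \<in> Sec F (\<Union>\<U>) \<and> (\<forall>U\<in>\<U>. res F (\<Union>\<U>) U y = snd (s U)) \<longrightarrow> y = m"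
      by (rule ex1E)
    show ?thesis
    proof (rule ex1I[of _ "(x, m)"])
      show "(x, m) \<in> Sec Tot (\<Union>\<U>) \<and> (\<forall>U\<in>\<U>. res Tot (\<Union>\<U>) U (x, m) = s U)"
        using x m by simp
      fix z assume z: "z \<in> Sec Tot (\<Union>\<U>) \<and> (\<forall>U\<in>\<U>. res Tot (\<Union>\<U>) U z = s U)"
      obtain y n where yn: "z = (y, n)" by (cases z)
      have "\<forall>U\<in>\<U>. res OY (\<Union>\<U>) U y = fst (s U) \<and> res F (\<Union>\<U>) U n = snd (s U)"
      proof
        fix U assume "U \<in> \<U>"
        then have "(res OY (\<Union>\<U>) U y, res F (\<Union>\<U>) U n) = s U" using z yn by simp
        from arg_cong[OF this, of fst] arg_cong[OF this, of snd]
        show "res OY (\<Union>\<U>) U y = fst (s U) \<and> res F (\<Union>\<U>) U n = snd (s U)" by simp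
      qed
      moreover have "y \<in> Sec OY (\<Union>\<U>)" "n \<in> Sec F (\<Union>\<U>)" using z yn by simp_all
      ultimately have "y = x" "n = m" using xu mu by simp_all
      then show "z = (x, m)" using yn by simp
    qed
  qed
  ultimately show ?thesis unfolding is_sheaf_def
    by (intro conjI allI impI; (elim conjE)?) (assumption, rule glue)
qed

lemma ring_sheaf_Tot: "ring_sheaf T Tot"
proof -
  have "res Tot U V \<in> ring_hom (sect Tot U) (sect Tot V)"
    if U: "openin T U" and V: "openin T V" "V \<subseteq> U" for U V
  proof (rule ring_hom_memI)
    show "res Tot U V x \<in> Sec Tot V" if "x \<in> Sec Tot U" for x
      using that U V by auto
    show "res Tot U V \<one>\<^bsub>sect Tot U\<^esub> = \<one>\<^bsub>sect Tot V\<^esub>" using U V by simp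
    fix x y assume xy: "x \<in> Sec Tot U" "y \<in> Sec Tot U"
    then show "res Tot U V (x \<otimes>\<^bsub>sect Tot U\<^esub> y) = res Tot U V x \<otimes>\<^bsub>sect Tot V\<^esub> res Tot U V y"
      "res Tot U V (x \<oplus>\<^bsub>sect Tot U\<^esub> y) = res Tot U V x \<oplus>\<^bsub>sect Tot V\<^esub> res Tot U V y"
      using U V by (auto)
  qed
  then show ?thesis unfolding ring_sheaf_def using sheaf_Tot cring_Tot by simp
qed

end

section \<open>The twisted sum as a scheme\<close>

context cocycle_setting
begin

sublocale X: ring_sheaf_on T Tot
  by (rule ring_sheaf_onI[OF ring_sheaf_Tot])

lemma fst_hom: "openin T U \<Longrightarrow> fst \<in> ring_hom (sect Tot U) (R U)"
  by (rule ring_hom_memI) auto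

text \<open>An inverse of the first component is completed to an inverse of the pair by solving for
  the second component, which is possible because the unknown is multiplied by a unit.\<close>

lemma unit_at_Tot:
  assumes U: "openin T U" and x: "x \<in> Sec OY U" and m: "m \<in> Sec F U"
  shows "unit_at T Tot U (x, m) p \<longleftrightarrow> unit_at T OY U x p"
proof
  assume "unit_at T Tot U (x, m) p"
  then obtain W c where W: "openin T W" "p \<in> W" "W \<subseteq> U" and c: "c \<in> Sec Tot W"
    "c \<otimes>\<^bsub>sect Tot W\<^esub> res Tot U W (x, m) = \<one>\<^bsub>sect Tot W\<^esub>" unfolding unit_at_def by (elim exE conjE bexE)
  have "fst c \<otimes>\<^bsub>R W\<^esub> res OY U W x = \<one>\<^bsub>R W\<^esub>" "fst c \<in> Sec OY W"
    using c by (cases c; simp)+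
  then show "unit_at T OY U x p" unfolding unit_at_def using W by (intro exI conjI bexI)
next
  assume "unit_at T OY U x p"
  then obtain W c where W: "openin T W" "p \<in> W" "W \<subseteq> U" and c: "c \<in> Sec OY W"
    "c \<otimes>\<^bsub>R W\<^esub> res OY U W x = \<one>\<^bsub>R W\<^esub>" unfolding unit_at_def by (elim exE conjE bexE)
  interpret W: module "R W" "M W" by (rule Y.module_sect[OF W(1)])
  define y k where "y = res OY U W x" and "k = res F U W m"
  have y: "y \<in> Sec OY W" "k \<in> Sec F W" using U W x m by (auto simp: y_def k_def)
  define r where "r = c \<odot>\<^bsub>M W\<^esub> k \<oplus>\<^bsub>M W\<^esub> b W c y"
  have r: "r \<in> Sec F W" using W y c by (simp add: r_def)
  \<comment> \<open>\<open>r\<close> is the second component of \<open>(c, 0)\<close> times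
    \<open>(y, k)\<close>. Since \<open>c\<close> is inverse to \<open>y\<close>, multiplying
    \<open>n\<close> by \<open>y\<close> gives the difference of \<open>e W\<close> and
    \<open>r\<close>, the correction that leads to the unit.\<close>
  define n where "n = c \<odot>\<^bsub>M W\<^esub> (e W \<ominus>\<^bsub>M W\<^esub> r)"
  have n: "n \<in> Sec F W" using W c r by (simp add: n_def)
  have "y \<odot>\<^bsub>M W\<^esub> n = (c \<otimes>\<^bsub>R W\<^esub> y) \<odot>\<^bsub>M W\<^esub> (e W \<ominus>\<^bsub>M W\<^esub> r)"
    unfolding n_def using W c y r by (simp add: W.smult_assoc1[symmetric] W.R.m_comm)
  then have "y \<odot>\<^bsub>M W\<^esub> n = e W \<ominus>\<^bsub>M W\<^esub> r" using c(2) W r by (simp add: y_def)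
  then have "c \<odot>\<^bsub>M W\<^esub> k \<oplus>\<^bsub>M W\<^esub> y \<odot>\<^bsub>M W\<^esub> n \<oplus>\<^bsub>M W\<^esub> b W c y = (\<ominus>\<^bsub>M W\<^esub> r \<oplus>\<^bsub>M W\<^esub> r) \<oplus>\<^bsub>M W\<^esub> e W"
    using W c y r e_closed[OF W(1)] unfolding r_def by (simp add: W.M.minus_eq W.M.a_ac)
  then have "(c, n) \<otimes>\<^bsub>sect Tot W\<^esub> res Tot U W (x, m) = \<one>\<^bsub>sect Tot W\<^esub>"
    using c(2) r W by (simp add: W.M.l_neg flip: y_def k_def)
  moreover have "(c, n) \<in> Sec Tot W" using c n by simp
  ultimately show "unit_at T Tot U (x, m) p" unfolding unit_at_def using W by (intro exI conjI bexI)
qed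

lemma nonunits_Tot:
  assumes "openin T U"
  shows "nonunits T Tot U p = {x \<in> Sec Tot U. fst x \<in> nonunits T OY U p}"
  using unit_at_Tot[OF assms] by (auto simp: nonunits_def)

text \<open>
  The kernel of \<open>fst\<close> is square-zero, so it lies in every prime ideal, and an element is invertible
  when its first component is. Hence the points and the basic open sets are those of \<open>OY\<close>.
\<close>

lemma ring_presentation_Tot:
  assumes ring: "ring_presentation T OY U (R U) (nonunits T OY U) id"
    and mod: "module_presentation T OY U (R U) (nonunits T OY U) id F (M U) id"
  shows "ring_presentation T Tot U (sect Tot U) (nonunits T Tot U) id"
proof -
  have U: "openin T U"
  proof -
    interpret R: ring_presentation T OY U "R U" "nonunits T OY U" id by (rule ring)
    show ?thesis by (rule R.open_U)
  qed
  interpret U: module "R U" "M U" by (rule Y.module_sect[OF U])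
  interpret R: ring_presentation T OY U "R U" "nonunits T OY U" id by (rule ring)
  interpret M: module_presentation T OY U "R U" "nonunits T OY U" id F "M U" id by (rule mod)
  have cr: "cring (sect Tot U)" by (rule cring_Tot[OF U])
  interpret fst: ring_hom_ring "sect Tot U" "R U" fst
    by (intro ring_hom_ring.intro cring.axioms(1)[OF cr] U.R.ring_axioms ring_hom_ring_axioms.intro fst_hom U)
  note nonunits = nonunits_Tot[OF U]
  have surj: "\<exists>p\<in>U. Q = nonunits T Tot U p" if Q: "primeideal Q (sect Tot U)" for Q
  proof -
    interpret Q: primeideal Q "sect Tot U" by (rule Q)
    have nil: "(\<zero>\<^bsub>R U\<^esub>, m) \<in> Q" if m: "m \<in> Sec F U" for m
    proof -
      have "(\<zero>\<^bsub>R U\<^esub>, m) \<otimes>\<^bsub>sect Tot U\<^esub> (\<zero>\<^bsub>R U\<^esub>, m) = \<zero>\<^bsub>sect Tot U\<^esub>" using m U by simp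
      then show ?thesis using Q.I_prime[of "(\<zero>\<^bsub>R U\<^esub>, m)" "(\<zero>\<^bsub>R U\<^esub>, m)"] m Q.zero_closed by simp
    qed
    have mem: "(x, m) \<in> Q \<longleftrightarrow> (x, n) \<in> Q"
      if x: "x \<in> Sec OY U" and m: "m \<in> Sec F U" and n: "n \<in> Sec F U" for x m n
    proof -
      have *: "(x, k) \<in> Q" if "(x, l) \<in> Q" "k \<in> Sec F U" "l \<in> Sec F U" for k l
      proof -
        have "(x, l) \<oplus>\<^bsub>sect Tot U\<^esub> (\<zero>\<^bsub>R U\<^esub>, k \<ominus>\<^bsub>M U\<^esub> l) = (x, k)"
          using x that by (simp add: U.M.minus_eq U.M.a_lcomm[of l] U.M.r_neg)
        then show ?thesis using Q.a_closed[OF that(1) nil[of "k \<ominus>\<^bsub>M U\<^esub> l"]] that by simp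
      qed
      show ?thesis using *[OF _ m n] *[OF _ n m] by blast
    qed
    \<comment> \<open>\<open>Q\<close> contains the kernel of the projection, so membership depends
      on the first component alone and \<open>Q\<close> is the preimage of this prime of
      \<open>R U\<close>.\<close>
    define Q' where "Q' = {x \<in> Sec OY U. (x, \<zero>\<^bsub>M U\<^esub>) \<in> Q}"
    have Q'I: "x \<in> Q'" if "(x, m) \<in> Q" "x \<in> Sec OY U" "m \<in> Sec F U" for x m
      using that mem[of x m "\<zero>\<^bsub>M U\<^esub>"] by (simp add: Q'_def)
    have "primeideal Q' (R U)"
    proof (rule primeidealI[OF cring.cring_idealI[OF U.R.is_cring] U.R.is_cring])
      show "Q' \<subseteq> Sec OY U" by (auto simp: Q'_def)
      show "\<zero>\<^bsub>R U\<^esub> \<in> Q'" using nil[of "\<zero>\<^bsub>M U\<^esub>"] by (simp add: Q'_def)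
      fix x y assume "x \<in> Q'" "y \<in> Q'"
      then show "x \<oplus>\<^bsub>R U\<^esub> y \<in> Q'"
        using Q.a_closed[of "(x, \<zero>\<^bsub>M U\<^esub>)" "(y, \<zero>\<^bsub>M U\<^esub>)"] by (simp add: Q'_def)
    next
      fix r x assume r: "r \<in> Sec OY U" and x: "x \<in> Q'"
      then have "(r, \<zero>\<^bsub>M U\<^esub>) \<otimes>\<^bsub>sect Tot U\<^esub> (x, \<zero>\<^bsub>M U\<^esub>) \<in> Q"
        by (intro Q.I_l_closed) (simp_all add: Q'_def)
      then show "r \<otimes>\<^bsub>R U\<^esub> x \<in> Q'" using r x U by (intro Q'I) (auto simp: Q'_def)
    next
      have "\<one>\<^bsub>R U\<^esub> \<notin> Q'"
      proof
        assume "\<one>\<^bsub>R U\<^esub> \<in> Q'"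
        then have "\<one>\<^bsub>sect Tot U\<^esub> \<in> Q"
          using mem[OF U.R.one_closed _ e_closed[OF U], of "\<zero>\<^bsub>M U\<^esub>"] by (simp add: Q'_def)
        then show False using Q.one_imp_carrier Q.I_notcarr by simp
      qed
      then show "Sec OY U \<noteq> Q'" using U.R.one_closed by blast
      fix x y assume x: "x \<in> Sec OY U" and y: "y \<in> Sec OY U" and xy: "x \<otimes>\<^bsub>R U\<^esub> y \<in> Q'"
      have "(x, \<zero>\<^bsub>M U\<^esub>) \<otimes>\<^bsub>sect Tot U\<^esub> (y, \<zero>\<^bsub>M U\<^esub>) \<in> Q"
        using xy mem[of "x \<otimes>\<^bsub>R U\<^esub> y" "\<zero>\<^bsub>M U\<^esub>"] x y U by (simp add: Q'_def)
      then show "x \<in> Q' \<or> y \<in> Q'"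
        using Q.I_prime[of "(x, \<zero>\<^bsub>M U\<^esub>)" "(y, \<zero>\<^bsub>M U\<^esub>)"] x y by (simp add: Q'_def)
    qed
    then have "Q' \<in> Spec (R U)" by (simp add: Spec_def)
    then have "Q' \<in> nonunits T OY U ` U" using bij_betw_imp_surj_on[OF R.bij] by simp
    then obtain p where p: "p \<in> U" "Q' = nonunits T OY U p" by (elim imageE)
    have "z \<in> Q \<longleftrightarrow> z \<in> nonunits T Tot U p" for z
    proof (cases "z \<in> Sec Tot U")
      case True
      then obtain x m where z: "z = (x, m)" "x \<in> Sec OY U" "m \<in> Sec F U" by auto
      have "z \<in> Q \<longleftrightarrow> x \<in> Q'" using mem[of x m "\<zero>\<^bsub>M U\<^esub>"] z by (simp add: Q'_def)
      then show ?thesis unfolding p(2) nonunits using True z(1) by simp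
    next
      case False
      then show ?thesis using Q.Icarr unfolding nonunits by blast
    qed
    then show ?thesis using p(1) by blast
  qed
  have affine: "affine_presentation T Tot U (sect Tot U) (nonunits T Tot U) id"
  proof (intro affine_presentation.intro affine_presentation_axioms.intro X.ring_sheaf_on_axioms cr U)
    show "bij_betw (nonunits T Tot U) U (Spec (sect Tot U))"
    proof (rule bij_betwI')
      fix p q assume p: "p \<in> U" and q: "q \<in> U"
      show "nonunits T Tot U p = nonunits T Tot U q \<longleftrightarrow> p = q"
      proof
        assume eq: "nonunits T Tot U p = nonunits T Tot U q"
        have "x \<in> nonunits T OY U p \<longleftrightarrow> x \<in> nonunits T OY U q" if "x \<in> Sec OY U" for x
        proof -
          have "(x, \<zero>\<^bsub>M U\<^esub>) \<in> nonunits T Tot U p \<longleftrightarrow> (x, \<zero>\<^bsub>M U\<^esub>) \<in> nonunits T Tot U q"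
            unfolding eq ..
          then show ?thesis unfolding nonunits using that by simp
        qed
        then have "nonunits T OY U p = nonunits T OY U q" by (auto simp: nonunits_def)
        then show "p = q" using bij_betw_imp_inj_on[OF R.bij] p q by (simp add: inj_on_def)
      qed simp
    next
      fix p assume "p \<in> U"
      then show "nonunits T Tot U p \<in> Spec (sect Tot U)"
        unfolding nonunits Spec_def using fst.primeideal_vimage[OF cr R.prime] by simp
    next
      fix Q assume "Q \<in> Spec (sect Tot U)"
      then show "\<exists>p\<in>U. Q = nonunits T Tot U p" using surj by (simp add: Spec_def)
    qed
    show "openin T {q \<in> U. x \<notin> nonunits T Tot U q}" if x: "x \<in> Sec Tot U" for x
    proof -
      have "{q \<in> U. x \<notin> nonunits T Tot U q} = {q \<in> U. fst x \<notin> nonunits T OY U q}"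
        unfolding nonunits using x by simp
      then show ?thesis using R.open_D[of "fst x"] x by auto
    qed
    show "\<exists>x\<in>Sec Tot U. x \<notin> nonunits T Tot U p \<and> {q \<in> U. x \<notin> nonunits T Tot U q} \<subseteq> V"
      if V: "openin T V" "V \<subseteq> U" "p \<in> V" for V p
    proof -
      obtain g where g: "g \<in> Sec OY U" "g \<notin> nonunits T OY U p" "{q \<in> U. g \<notin> nonunits T OY U q} \<subseteq> V"
        using R.basis[OF V] by (elim bexE conjE)
      then show ?thesis unfolding nonunits by (intro bexI[of _ "(g, \<zero>\<^bsub>M U\<^esub>)"]) simp_all
    qed
    show "id \<in> ring_hom (sect Tot U) (sect Tot U)" by (rule ring_hom_memI) simp_all
    show "unit_at T Tot U (id x) p \<longleftrightarrow> x \<notin> nonunits T Tot U p" if "x \<in> Sec Tot U" for x p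
      using that by (simp add: nonunits_def)
  qed
  \<comment> \<open>Denominators are cleared in two stages. Multiplying by \<open>s\<close> makes
    the first component a section over \<open>U\<close> and leaves a section \<open>m'\<close> of
    \<open>F\<close> near \<open>p\<close>; multiplying by \<open>t\<close> then makes the second
    component global. The twist contributes the terms with \<open>b\<close>.\<close>
  have frac: "\<exists>W k g. openin T W \<and> p \<in> W \<and> W \<subseteq> V \<and> k \<in> Sec Tot U \<and> g \<in> Sec Tot U \<and>
      g \<notin> nonunits T Tot U p \<and> res Tot U W g \<otimes>\<^bsub>sect Tot W\<^esub> res Tot V W y = res Tot U W k"
    if V: "openin T V" "V \<subseteq> U" and y: "y \<in> Sec Tot V" and p: "p \<in> V" for V y p
  proof -
    obtain a m where am: "y = (a, m)" "a \<in> Sec OY V" "m \<in> Sec F V" using y by auto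
    have pU: "p \<in> U" using p V by blast
    have "a \<in> Sec (regular_sheaf OY) V" using am by simp
    from R.fractions[OF V this p] obtain W1 r s where W1: "openin T W1" "p \<in> W1" "W1 \<subseteq> V"
      and r: "r \<in> Sec OY U" and s: "s \<in> Sec OY U" "s \<notin> nonunits T OY U p"
      and eq1: "res OY U W1 s \<otimes>\<^bsub>R W1\<^esub> res OY V W1 a = res OY U W1 r"
      unfolding id_apply regular_sheaf_simps regular_module_simps by (elim exE conjE)
    have W1U: "W1 \<subseteq> U" using W1(3) V(2) by blast
    define m' where "m' = res OY U W1 s \<odot>\<^bsub>M W1\<^esub> res F V W1 m \<oplus>\<^bsub>M W1\<^esub> b W1 (res OY U W1 s) (res OY V W1 a)"
    have m': "m' \<in> Sec F W1" using W1 W1U U V s am by (simp add: m'_def)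
    from M.fractions[OF W1(1) W1U m' W1(2)] obtain W n t where W: "openin T W" "p \<in> W" "W \<subseteq> W1"
      and n: "n \<in> Sec F U" and t: "t \<in> Sec OY U" "t \<notin> nonunits T OY U p"
      and eq2: "res OY U W t \<odot>\<^bsub>M W\<^esub> res F W1 W m' = res F U W n"
      unfolding id_apply by (elim exE conjE)
    have WU: "W \<subseteq> U" and WV: "W \<subseteq> V" using W W1 W1U by auto
    interpret W: module "R W" "M W" by (rule Y.module_sect[OF W(1)])
    interpret WX: cring "sect Tot W" by (rule cring_Tot[OF W(1)])
    define s' a' m1 t' where "s' = res OY U W s" and "a' = res OY V W a" and "m1 = res F V W m"
      and "t' = res OY U W t"
    have c: "s' \<in> Sec OY W" "a' \<in> Sec OY W" "m1 \<in> Sec F W"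
      "t' \<in> Sec OY W"
      unfolding s'_def a'_def m1_def t'_def using W(1) U V WU WV s t am by auto
    have sa: "s' \<otimes>\<^bsub>R W\<^esub> a' = res OY U W r"
      using arg_cong[OF eq1, of "res OY W1 W"] W W1 W1U U V s r am by (simp add: s'_def a'_def)
    have "res F W1 W m' = s' \<odot>\<^bsub>M W\<^esub> m1 \<oplus>\<^bsub>M W\<^esub> b W s' a'"
      using W W1 W1U U V s am WU WV by (simp add: m'_def s'_def a'_def m1_def flip: b_res[OF W1(1) W(1,3)])
    then have tm: "t' \<odot>\<^bsub>M W\<^esub> (s' \<odot>\<^bsub>M W\<^esub> m1 \<oplus>\<^bsub>M W\<^esub> b W s' a') = res F U W n"
      using eq2 by (simp add: t'_def)
    \<comment> \<open>The denominator is a product in the twisted ring, so that associativity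
      reduces the computation to the two stages.\<close>
    define g where "g = (t, \<zero>\<^bsub>M U\<^esub>) \<otimes>\<^bsub>sect Tot U\<^esub> (s, \<zero>\<^bsub>M U\<^esub>)"
    define k where "k = (t \<otimes>\<^bsub>R U\<^esub> r, n \<oplus>\<^bsub>M U\<^esub> b U t r)"
    have g: "g \<in> Sec Tot U" "g \<notin> nonunits T Tot U p"
      using t s U R.not_mem_mult[OF pU t(1) s(1)] by (simp_all add: g_def nonunits)
    have k: "k \<in> Sec Tot U" using t r n U by (simp add: k_def)
    have "res Tot U W g \<otimes>\<^bsub>sect Tot W\<^esub> res Tot V W y
        = ((t', \<zero>\<^bsub>M W\<^esub>) \<otimes>\<^bsub>sect Tot W\<^esub> (s', \<zero>\<^bsub>M W\<^esub>)) \<otimes>\<^bsub>sect Tot W\<^esub> (a', m1)"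
      unfolding g_def am(1) using X.res_mult[OF U W(1) WU, of "(t, \<zero>\<^bsub>M U\<^esub>)" "(s, \<zero>\<^bsub>M U\<^esub>)"] t s U W WU
      by (simp add: a'_def m1_def t'_def s'_def del: E_simps(2))
    also have "\<dots> = (t', \<zero>\<^bsub>M W\<^esub>) \<otimes>\<^bsub>sect Tot W\<^esub> ((s', \<zero>\<^bsub>M W\<^esub>) \<otimes>\<^bsub>sect Tot W\<^esub> (a', m1))"
      using c by (intro WX.m_assoc) simp_all
    also have "(s', \<zero>\<^bsub>M W\<^esub>) \<otimes>\<^bsub>sect Tot W\<^esub> (a', m1) = (res OY U W r, s' \<odot>\<^bsub>M W\<^esub> m1 \<oplus>\<^bsub>M W\<^esub> b W s' a')"
      using c sa W by simp
    also have "(t', \<zero>\<^bsub>M W\<^esub>) \<otimes>\<^bsub>sect Tot W\<^esub> \<dots> = (t' \<otimes>\<^bsub>R W\<^esub> res OY U W r, res F U W n \<oplus>\<^bsub>M W\<^esub> b W t' (res OY U W r))"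
      using c tm W WU U r n by simp
    also have "\<dots> = res Tot U W k"
      using W WU U r n t by (simp add: k_def t'_def)
    finally show ?thesis using W WV g k by (intro exI conjI)
  qed
  \<comment> \<open>Again two stages: \<open>u\<close> kills the first component, so
    \<open>(u, 0)\<close> times \<open>y\<close> lies in the kernel \<open>F\<close>, and
    \<open>v\<close> kills what is left.\<close>
  have tors: "\<exists>u\<in>Sec Tot U. u \<notin> nonunits T Tot U p \<and> u \<otimes>\<^bsub>sect Tot U\<^esub> y = \<zero>\<^bsub>sect Tot U\<^esub>"
    if y: "y \<in> Sec Tot U" and W: "openin T W" "p \<in> W" "W \<subseteq> U"
      and z: "res Tot U W y = \<zero>\<^bsub>sect Tot W\<^esub>" for y W p
  proof -
    obtain a m where am: "y = (a, m)" "a \<in> Sec OY U" "m \<in> Sec F U" using y by auto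
    have pU: "p \<in> U" using W by blast
    have za: "res OY U W a = \<zero>\<^bsub>R W\<^esub>" and zm: "res F U W m = \<zero>\<^bsub>M W\<^esub>" using z am by simp_all
    interpret W: module "R W" "M W" by (rule Y.module_sect[OF W(1)])
    have "a \<in> carrier (regular_module (R U))" using am by simp
    from R.torsion[OF this W] za obtain u where u: "u \<in> Sec OY U" "u \<notin> nonunits T OY U p"
      "u \<otimes>\<^bsub>R U\<^esub> a = \<zero>\<^bsub>R U\<^esub>"
      by auto
    define k where "k = u \<odot>\<^bsub>M U\<^esub> m \<oplus>\<^bsub>M U\<^esub> b U u a"
    have k: "k \<in> Sec F U" using u am U by (simp add: k_def)
    have "res F U W k = \<zero>\<^bsub>M W\<^esub>"
      unfolding k_def using u am U W za zm by (simp flip: b_res)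
    then obtain v where v: "v \<in> Sec OY U" "v \<notin> nonunits T OY U p" "v \<odot>\<^bsub>M U\<^esub> k = \<zero>\<^bsub>M U\<^esub>"
      using M.torsion[OF k W] by auto
    define w where "w = (v, \<zero>\<^bsub>M U\<^esub>) \<otimes>\<^bsub>sect Tot U\<^esub> (u, \<zero>\<^bsub>M U\<^esub>)"
    have w: "w \<in> Sec Tot U" "w \<notin> nonunits T Tot U p"
      using u v U R.not_mem_mult[OF pU v(1) u(1)] by (simp_all add: w_def nonunits)
    have "w \<otimes>\<^bsub>sect Tot U\<^esub> y = (v, \<zero>\<^bsub>M U\<^esub>) \<otimes>\<^bsub>sect Tot U\<^esub> ((u, \<zero>\<^bsub>M U\<^esub>) \<otimes>\<^bsub>sect Tot U\<^esub> y)"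
      unfolding w_def using u v y by (intro fst.R.m_assoc) simp_all
    also have "(u, \<zero>\<^bsub>M U\<^esub>) \<otimes>\<^bsub>sect Tot U\<^esub> y = (\<zero>\<^bsub>R U\<^esub>, k)"
      using u am U by (simp add: k_def)
    also have "(v, \<zero>\<^bsub>M U\<^esub>) \<otimes>\<^bsub>sect Tot U\<^esub> (\<zero>\<^bsub>R U\<^esub>, k) = \<zero>\<^bsub>sect Tot U\<^esub>"
      using v k U by simp
    finally show ?thesis using w by (intro bexI conjI)
  qed
  have "module_presentation T Tot U (sect Tot U) (nonunits T Tot U) id (regular_sheaf Tot)
      (regular_module (sect Tot U)) id"
  proof (intro module_presentation.intro module_presentation_axioms.intro affine
      X.regular_module_sheaf_on regular_module_module cr)
    show "\<exists>W k g. openin T W \<and> p \<in> W \<and> W \<subseteq> V \<and> k \<in> carrier (regular_module (sect Tot U)) \<and>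
        g \<in> Sec Tot U \<and> g \<notin> nonunits T Tot U p \<and>
        res Tot U W (id g) \<odot>\<^bsub>sect (regular_sheaf Tot) W\<^esub> res (regular_sheaf Tot) V W y =
          res (regular_sheaf Tot) U W (id k)"
      if "openin T V" "V \<subseteq> U" "y \<in> Sec (regular_sheaf Tot) V" "p \<in> V" for V y p
      unfolding id_apply regular_sheaf_simps regular_module_simps
      by (rule frac[OF that(1,2) _ that(4)]) (use that(3) in simp)
    show "\<exists>u\<in>Sec Tot U. u \<notin> nonunits T Tot U p \<and>
        u \<odot>\<^bsub>regular_module (sect Tot U)\<^esub> y = \<zero>\<^bsub>regular_module (sect Tot U)\<^esub>"
      if "y \<in> carrier (regular_module (sect Tot U))" "openin T W" "p \<in> W" "W \<subseteq> U"
        "res (regular_sheaf Tot) U W (id y) = \<zero>\<^bsub>sect (regular_sheaf Tot) W\<^esub>" for y W p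
      unfolding regular_module_simps
      by (rule tors[OF _ that(2-4)])
        (use that(1,5) in \<open>simp_all only: id_apply regular_sheaf_simps regular_module_simps\<close>)
  qed (simp_all del: E_simps)
  then show ?thesis by (simp add: ring_presentation_def)
qed

end

section \<open>The twisted sum as a split extension of algebras\<close>

context cocycle_setting
begin

lemma b_scal:
  assumes "openin T U" "c \<in> Sec OZ U" "x \<in> Sec OY U" "y \<in> Sec OY U"
  shows "b U (h U c \<otimes>\<^bsub>R U\<^esub> x) y = h U c \<odot>\<^bsub>M U\<^esub> b U x y"
    and "b U x (h U c \<otimes>\<^bsub>R U\<^esub> y) = h U c \<odot>\<^bsub>M U\<^esub> b U x y"
  using b_fam(4,5)[OF assms(1,3,4,2)] by simp_all

text \<open>The terms with \<open>e\<close> and with \<open>b\<close> cancel by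
  \<open>smult_e\<close> and the linearity of \<open>b\<close> over \<open>OZ\<close>. Hence the
  twisted sum is \<open>OY \<oplus> F\<close> as an \<open>OZ\<close>-module, even when its unit
  differs from \<open>(1, 0)\<close>.\<close>

lemma scal_mult:
  assumes U: "openin T U" and z: "z \<in> Sec OZ U" and x: "x \<in> Sec OY U"
    and m: "m \<in> Sec F U"
  shows "scal E U z \<otimes>\<^bsub>sect Tot U\<^esub> (x, m) = (h U z \<otimes>\<^bsub>R U\<^esub> x, h U z \<odot>\<^bsub>M U\<^esub> m)"
proof -
  interpret U: module "R U" "M U" by (rule Y.module_sect[OF U])
  have hz: "h U z \<in> Sec OY U" using U z by simp
  have "b U (h U z) x = h U z \<odot>\<^bsub>M U\<^esub> b U \<one>\<^bsub>R U\<^esub> x"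
    using b_scal(1)[OF U z U.R.one_closed x] hz by simp
  then have "x \<odot>\<^bsub>M U\<^esub> (h U z \<odot>\<^bsub>M U\<^esub> e U) \<oplus>\<^bsub>M U\<^esub> b U (h U z) x
      = h U z \<odot>\<^bsub>M U\<^esub> (x \<odot>\<^bsub>M U\<^esub> e U \<oplus>\<^bsub>M U\<^esub> b U \<one>\<^bsub>R U\<^esub> x)"
    using U x hz by (simp add: U.smult_r_distr U.smult_assoc1[symmetric] U.R.m_comm)
  then have "x \<odot>\<^bsub>M U\<^esub> (h U z \<odot>\<^bsub>M U\<^esub> e U) \<oplus>\<^bsub>M U\<^esub> b U (h U z) x = \<zero>\<^bsub>M U\<^esub>"
    using smult_e[OF U x] hz by simp
  then show ?thesis using U x hz m by (simp add: U.M.a_assoc)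
qed

lemma kernel_proj:
  "a_kernel (sect Tot U) (R U) (proj E U) = {\<zero>\<^bsub>R U\<^esub>} \<times> Sec F U"
  if "openin T U"
  unfolding a_kernel_def' using that by auto

text \<open>The scheme structure is local and comes from the charts of the coherent sheaf. On the
  kernel, whose first component is zero, \<open>b\<close> vanishes; so the kernel squares to zero
  and carries the given action of \<open>OY\<close>.\<close>

lemma infinitesimal_E:
  assumes coh: "coherent T OY F"
  shows "infinitesimal_extension T OY F E"
  unfolding infinitesimal_extension_def
proof (intro conjI allI impI)
  show "scheme T Tot"
  proof (rule scheme_of_presentations[OF ring_sheaf_Tot])
    fix p assume "p \<in> topspace T"
    then obtain U where U: "p \<in> U" "ring_presentation T OY U (R U) (nonunits T OY U) id"
      "module_presentation T OY U (R U) (nonunits T OY U) id F (M U) id"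
      by (rule coherent_presentations[OF OY coh])
    then show "\<exists>U. p \<in> U \<and> ring_presentation T Tot U (sect Tot U) (nonunits T Tot U) id"
      using ring_presentation_Tot by (intro exI[of _ U] conjI)
  qed
  show "ring_sheaf_hom T Tot OY (proj E)"
    unfolding ring_sheaf_hom_def commutes_with_res_def using fst_hom by auto
  show "locally_surjective T Tot OY (proj E)"
    unfolding locally_surjective_def
  proof (intro allI impI ballI)
    fix U y p assume U: "openin T U" and y: "y \<in> Sec OY U" and p: "p \<in> U"
    have "(y, \<zero>\<^bsub>M U\<^esub>) \<in> Sec Tot U" using U y by simp
    moreover have "proj E U (y, \<zero>\<^bsub>M U\<^esub>) = res OY U U y" using U y by simp
    ultimately show "\<exists>V. openin T V \<and> p \<in> V \<and> V \<subseteq> U \<and> (\<exists>x\<in>Sec Tot V. proj E V x = res OY U V y)"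
      using U p by (intro exI[of _ U] conjI bexI[of _ "(y, \<zero>\<^bsub>M U\<^esub>)"] subset_refl)
  qed
  show "commutes_with_res T F Tot (incl E)" unfolding commutes_with_res_def by simp
  fix U assume U: "openin T U"
  interpret U: module "R U" "M U" by (rule Y.module_sect[OF U])
  show "\<forall>x\<in>a_kernel (sect Tot U) (R U) (proj E U).
      \<forall>y\<in>a_kernel (sect Tot U) (R U) (proj E U). x \<otimes>\<^bsub>sect Tot U\<^esub> y = \<zero>\<^bsub>sect Tot U\<^esub>"
    unfolding kernel_proj[OF U] using U by auto
  show "bij_betw (incl E U) (Sec F U) (a_kernel (sect Tot U) (R U) (proj E U))"
    unfolding kernel_proj[OF U] by (auto simp: bij_betw_def inj_on_def)
  show "\<forall>m\<in>Sec F U. \<forall>n\<in>Sec F U.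
      incl E U (m \<oplus>\<^bsub>M U\<^esub> n) = incl E U m \<oplus>\<^bsub>sect Tot U\<^esub> incl E U n" by simp
  show "\<forall>x\<in>Sec Tot U. \<forall>m\<in>Sec F U.
      incl E U (proj E U x \<odot>\<^bsub>M U\<^esub> m) = x \<otimes>\<^bsub>sect Tot U\<^esub> incl E U m"
    using U by auto
qed

lemma algebra_E: "algebra_extension T OZ h E"
  unfolding algebra_extension_def ring_sheaf_hom_def
proof (intro conjI allI impI ballI)
  fix U assume U: "openin T U"
  interpret U: module "R U" "M U" by (rule Y.module_sect[OF U])
  note hU = ring_hom_closed[OF h_hom[OF U]] ring_hom_add[OF h_hom[OF U]] ring_hom_mult[OF h_hom[OF U]]
    ring_hom_one[OF h_hom[OF U]]
  show "scal E U \<in> ring_hom (sect OZ U) (sect Tot U)"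
  proof (rule ring_hom_memI)
    show "scal E U z \<in> Sec Tot U" if "z \<in> Sec OZ U" for z
      using that U by simp
    show "scal E U \<one>\<^bsub>sect OZ U\<^esub> = \<one>\<^bsub>sect Tot U\<^esub>" using U by (simp add: hU)
    fix z w assume z: "z \<in> Sec OZ U" and w: "w \<in> Sec OZ U"
    have "scal E U z \<otimes>\<^bsub>sect Tot U\<^esub> scal E U w = (h U z \<otimes>\<^bsub>R U\<^esub> h U w, h U z \<odot>\<^bsub>M U\<^esub> (h U w \<odot>\<^bsub>M U\<^esub> e U))"
      using scal_mult[OF U z, of "h U w" "h U w \<odot>\<^bsub>M U\<^esub> e U"] w U by simp
    then show "scal E U (z \<otimes>\<^bsub>sect OZ U\<^esub> w) = scal E U z \<otimes>\<^bsub>sect Tot U\<^esub> scal E U w"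
      using z w U by (simp add: hU U.smult_assoc1)
    show "scal E U (z \<oplus>\<^bsub>sect OZ U\<^esub> w) = scal E U z \<oplus>\<^bsub>sect Tot U\<^esub> scal E U w"
      using z w U by (simp add: hU U.smult_l_distr)
  qed
  show "proj E U (scal E U z) = h U z" for z by simp
next
  show "commutes_with_res T OZ Tot (scal E)" unfolding commutes_with_res_def by simp
qed

text \<open>The splitting is the inclusion of the first summand, which is linear over
  \<open>OZ\<close> by \<open>scal_mult\<close>.\<close>

lemma split_E: "module_split T OZ OY h E"
  unfolding module_split_def
proof (intro exI[of _ "\<lambda>U y. (y, \<zero>\<^bsub>M U\<^esub>)"] conjI allI impI ballI)
  show "mod_sheaf_hom T OZ YM (algebra_as_module (scal E) Tot) (\<lambda>U y. (y, \<zero>\<^bsub>M U\<^esub>))"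
    unfolding mod_sheaf_hom_def commutes_with_res_def
  proof (intro conjI allI impI ballI; (elim conjE)?)
    fix U assume U: "openin T U"
    interpret U: module "R U" "M U" by (rule Y.module_sect[OF U])
    show "(\<lambda>y. (y, \<zero>\<^bsub>M U\<^esub>)) \<in> Sec YM U \<rightarrow> Sec (algebra_as_module (scal E) Tot) U"
      by simp
    fix x assume x: "x \<in> Sec YM U"
    show "(x \<oplus>\<^bsub>sect YM U\<^esub> y, \<zero>\<^bsub>M U\<^esub>) = (x, \<zero>\<^bsub>M U\<^esub>) \<oplus>\<^bsub>sect (algebra_as_module (scal E) Tot) U\<^esub> (y, \<zero>\<^bsub>M U\<^esub>)"
      for y by simp
    show "(c \<odot>\<^bsub>sect YM U\<^esub> x, \<zero>\<^bsub>M U\<^esub>) = c \<odot>\<^bsub>sect (algebra_as_module (scal E) Tot) U\<^esub> (x, \<zero>\<^bsub>M U\<^esub>)"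
      if c: "c \<in> Sec OZ U" for c
      using scal_mult[OF U c, of x "\<zero>\<^bsub>M U\<^esub>"] x c U by (simp del: E_simps)
    show "(res YM U V x, \<zero>\<^bsub>M V\<^esub>) = res (algebra_as_module (scal E) Tot) U V (x, \<zero>\<^bsub>M U\<^esub>)"
      if "openin T V" "V \<subseteq> U" for V
      using that U by simp
  qed
qed simp

lemma split_extension_E: "coherent T OY F \<Longrightarrow> split_extension T OZ OY h F E"
  by (simp add: split_extension_def infinitesimal_E algebra_E split_E)

end

section \<open>Isomorphism classes of extensions\<close>

context extension_setting
begin

lemma isomorphic_refl: "isomorphic_extensions T OZ F E E"
  unfolding isomorphic_extensions_def
proof (intro exI[of _ "\<lambda>U x. x"] conjI allI impI ballI refl)
  show "ring_sheaf_iso T (total E) (total E) (\<lambda>U x. x)"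
    unfolding ring_sheaf_iso_def ring_sheaf_hom_def commutes_with_res_def
    by (auto simp: ring_hom_def bij_betw_def)
qed

lemma isomorphic_sym:
  assumes E: "split_extension T OZ OY h F E" and E': "split_extension T OZ OY h F E'"
    and iso: "isomorphic_extensions T OZ F E E'"
  shows "isomorphic_extensions T OZ F E' E"
proof -
  obtain \<phi> where \<phi>: "ring_sheaf_iso T (total E) (total E') \<phi>"
    and c: "\<And>U. openin T U \<Longrightarrow> (\<forall>z\<in>Sec OZ U. \<phi> U (scal E U z) = scal E' U z) \<and>
        (\<forall>m\<in>Sec F U. \<phi> U (incl E U m) = incl E' U m) \<and>
        (\<forall>x\<in>Sec (total E) U. proj E' U (\<phi> U x) = proj E U x)"
    using iso unfolding isomorphic_extensions_def by (elim exE conjE) simp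
  let ?\<psi> = "\<lambda>U. inv_into (Sec (total E) U) (\<phi> U)"
  have inf: "infinitesimal_extension T OY F E" and alg: "algebra_extension T OZ h E"
    using E by (simp_all add: split_extension_def)
  interpret X: ring_sheaf_on T "total E"
    by (rule ring_sheaf_onI) (use inf in \<open>simp add: infinitesimal_extension_def scheme_def\<close>)
  have bij: "bij_betw (\<phi> U) (Sec (total E) U) (Sec (total E') U)" if "openin T U" for U
    using \<phi> that by (simp add: ring_sheaf_iso_def)
  have "ring_sheaf_iso T (total E') (total E) ?\<psi>"
    by (rule ring_sheaf_iso_inverse[OF \<phi> X.presheaf cring.axioms(1)[OF X.cring_sect]])
  moreover have "?\<psi> U (scal E' U z) = scal E U z" if U: "openin T U" and z: "z \<in> Sec OZ U" for U z
  proof -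
    have "scal E U z \<in> Sec (total E) U"
      using alg U z by (auto simp: algebra_extension_def ring_sheaf_hom_def intro: ring_hom_closed)
    then show ?thesis using inv_into_f_f[OF bij_betw_imp_inj_on[OF bij[OF U]]] c[OF U] z by metis
  qed
  moreover have "?\<psi> U (incl E' U m) = incl E U m" if U: "openin T U" and m: "m \<in> Sec F U" for U m
  proof -
    have "bij_betw (incl E U) (Sec F U) (a_kernel (sect (total E) U) (R U) (proj E U))"
      using inf U by (simp add: infinitesimal_extension_def)
    then have "incl E U m \<in> Sec (total E) U"
      using m bij_betwE unfolding a_kernel_def' by blast
    then show ?thesis using inv_into_f_f[OF bij_betw_imp_inj_on[OF bij[OF U]]] c[OF U] m by metis
  qed
  moreover have "proj E U (?\<psi> U x) = proj E' U x" if U: "openin T U" and x: "x \<in> Sec (total E') U" for U x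
  proof -
    have "?\<psi> U x \<in> Sec (total E) U" "\<phi> U (?\<psi> U x) = x"
      using bij_betwE[OF bij_betw_inv_into[OF bij[OF U]]] x bij_betw_inv_into_right[OF bij[OF U] x] by auto
    then show ?thesis using c[OF U] by metis
  qed
  ultimately show ?thesis unfolding isomorphic_extensions_def by (intro exI[of _ ?\<psi>] conjI allI impI ballI)
qed

lemma isomorphic_trans:
  assumes E: "split_extension T OZ OY h F E"
    and 1: "isomorphic_extensions T OZ F E E'" and 2: "isomorphic_extensions T OZ F E' E''"
  shows "isomorphic_extensions T OZ F E E''"
proof -
  obtain \<phi> where \<phi>: "ring_sheaf_iso T (total E) (total E') \<phi>"
    and c: "\<And>U. openin T U \<Longrightarrow> (\<forall>z\<in>Sec OZ U. \<phi> U (scal E U z) = scal E' U z) \<and>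
        (\<forall>m\<in>Sec F U. \<phi> U (incl E U m) = incl E' U m) \<and>
        (\<forall>x\<in>Sec (total E) U. proj E' U (\<phi> U x) = proj E U x)"
    using 1 unfolding isomorphic_extensions_def by (elim exE conjE) simp
  obtain \<psi> where \<psi>: "ring_sheaf_iso T (total E') (total E'') \<psi>"
    and d: "\<And>U. openin T U \<Longrightarrow> (\<forall>z\<in>Sec OZ U. \<psi> U (scal E' U z) = scal E'' U z) \<and>
        (\<forall>m\<in>Sec F U. \<psi> U (incl E' U m) = incl E'' U m) \<and>
        (\<forall>x\<in>Sec (total E') U. proj E'' U (\<psi> U x) = proj E' U x)"
    using 2 unfolding isomorphic_extensions_def by (elim exE conjE) simp
  have \<phi>c: "\<phi> U x \<in> Sec (total E') U" if "openin T U" "x \<in> Sec (total E) U" for U x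
    using \<phi> that bij_betwE unfolding ring_sheaf_iso_def by blast
  have "ring_sheaf_iso T (total E) (total E'') (\<lambda>U. \<psi> U \<circ> \<phi> U)"
    unfolding ring_sheaf_iso_def ring_sheaf_hom_def commutes_with_res_def
  proof (intro conjI allI impI ballI; (elim conjE)?)
    fix U assume U: "openin T U"
    show "\<psi> U \<circ> \<phi> U \<in> ring_hom (sect (total E) U) (sect (total E'') U)"
      by (rule ring_hom_trans[where S = "sect (total E') U"]) (use \<phi> \<psi> U in \<open>simp_all add: ring_sheaf_iso_def ring_sheaf_hom_def\<close>)
    show "bij_betw (\<psi> U \<circ> \<phi> U) (Sec (total E) U) (Sec (total E'') U)"
      by (rule bij_betw_trans[where B = "Sec (total E') U"]) (use \<phi> \<psi> U in \<open>simp_all add: ring_sheaf_iso_def\<close>)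
    fix V x assume V: "openin T V" "V \<subseteq> U" and x: "x \<in> Sec (total E) U"
    then show "(\<psi> V \<circ> \<phi> V) (res (total E) U V x) = res (total E'') U V ((\<psi> U \<circ> \<phi> U) x)"
      using \<phi> \<psi> U \<phi>c[OF U x] by (simp add: ring_sheaf_iso_def ring_sheaf_hom_def commutes_with_res_def)
  qed
  then show ?thesis unfolding isomorphic_extensions_def
    by (intro exI[of _ "\<lambda>U. \<psi> U \<circ> \<phi> U"] conjI allI impI ballI) (use c d \<phi>c in simp_all)
qed

lemma equiv_iso_relation:
  "equiv {E. split_extension T OZ OY h F E} (iso_relation T OZ OY h F)"
proof (rule equivI)
  show "iso_relation T OZ OY h F \<subseteq> {E. split_extension T OZ OY h F E} \<times> {E. split_extension T OZ OY h F E}"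
    by (auto simp: iso_relation_def)
  show "refl_on {E. split_extension T OZ OY h F E} (iso_relation T OZ OY h F)"
    by (rule refl_onI) (simp add: iso_relation_def isomorphic_refl)
  show "sym (iso_relation T OZ OY h F)"
    by (rule symI) (simp add: iso_relation_def isomorphic_sym)
  show "trans (iso_relation T OZ OY h F)"
    by (rule transI) (simp add: iso_relation_def, blast intro: isomorphic_trans)
qed

end

section \<open>Isomorphisms of extensions and coboundaries\<close>

context extension_setting
begin

lemma cocycle_setting: "f \<in> SC \<Longrightarrow> cocycle_setting T OZ OY h F f"
  by (intro cocycle_setting.intro extension_setting_axioms cocycle_setting_axioms.intro)

lemma isomorphic_of_coboundary:
  assumes f: "f \<in> SC" and g: "g \<in> SC" and fg: "f \<ominus>\<^bsub>C2\<^esub> g \<in> BC"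
  shows "isomorphic_extensions T OZ F (cocycle_extension T OZ OY h F f) (cocycle_extension T OZ OY h F g)"
proof -
  interpret f: cocycle_setting T OZ OY h F f by (rule cocycle_setting[OF f])
  interpret g: cocycle_setting T OZ OY h F g by (rule cocycle_setting[OF g])
  interpret G: abelian_group C2 by (rule C2_group)
  obtain k where k: "linear_family k"
    and eq: "\<forall>U. openin T U \<longrightarrow> (\<forall>x\<in>Sec OY U. \<forall>y\<in>Sec OY U. ev (f \<ominus>\<^bsub>C2\<^esub> g) U x y = cob k U x y)"
    using fg by (rule coboundariesE)
  note kD = linear_familyD[OF k]
  \<comment> \<open>The relation \<open>f \<ominus> g = \<delta>\<^sub>0 k\<close> freed of
    subtraction, as multiplicativity of the isomorphism requires it.\<close>
  have ev: "ev f U x y \<oplus>\<^bsub>M U\<^esub> k U (x \<otimes>\<^bsub>R U\<^esub> y) =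
      x \<odot>\<^bsub>M U\<^esub> k U y \<oplus>\<^bsub>M U\<^esub> y \<odot>\<^bsub>M U\<^esub> k U x \<oplus>\<^bsub>M U\<^esub> ev g U x y"
    if U: "openin T U" and x: "x \<in> Sec OY U" and y: "y \<in> Sec OY U" for U x y
  proof -
    interpret U: module "R U" "M U" by (rule Y.module_sect[OF U])
    define p q r a c where "p = x \<odot>\<^bsub>M U\<^esub> k U y" and "q = k U (x \<otimes>\<^bsub>R U\<^esub> y)"
      and "r = y \<odot>\<^bsub>M U\<^esub> k U x" and "a = ev f U x y" and "c = ev g U x y"
    have cl: "p \<in> Sec F U" "q \<in> Sec F U" "r \<in> Sec F U"
      "a \<in> Sec F U" "c \<in> Sec F U"
      unfolding p_def q_def r_def a_def c_def using U x y kD(1)[OF U] by simp_all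
    have "a \<ominus>\<^bsub>M U\<^esub> c = p \<ominus>\<^bsub>M U\<^esub> q \<oplus>\<^bsub>M U\<^esub> r"
      using eq U x y f.f_C2 g.f_C2
      by (simp add: p_def q_def r_def a_def c_def G.minus_eq U.M.minus_eq)
    then have "(a \<ominus>\<^bsub>M U\<^esub> c) \<oplus>\<^bsub>M U\<^esub> (c \<oplus>\<^bsub>M U\<^esub> q) = (p \<ominus>\<^bsub>M U\<^esub> q \<oplus>\<^bsub>M U\<^esub> r) \<oplus>\<^bsub>M U\<^esub> (c \<oplus>\<^bsub>M U\<^esub> q)"
      by simp
    moreover have "(a \<ominus>\<^bsub>M U\<^esub> c) \<oplus>\<^bsub>M U\<^esub> (c \<oplus>\<^bsub>M U\<^esub> q) = (\<ominus>\<^bsub>M U\<^esub> c \<oplus>\<^bsub>M U\<^esub> c) \<oplus>\<^bsub>M U\<^esub> (a \<oplus>\<^bsub>M U\<^esub> q)"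
      using cl by (simp only: U.M.minus_eq U.M.a_ac U.M.a_closed U.M.a_inv_closed)
    moreover have "(p \<ominus>\<^bsub>M U\<^esub> q \<oplus>\<^bsub>M U\<^esub> r) \<oplus>\<^bsub>M U\<^esub> (c \<oplus>\<^bsub>M U\<^esub> q) = (\<ominus>\<^bsub>M U\<^esub> q \<oplus>\<^bsub>M U\<^esub> q) \<oplus>\<^bsub>M U\<^esub> (p \<oplus>\<^bsub>M U\<^esub> r \<oplus>\<^bsub>M U\<^esub> c)"
      using cl by (simp only: U.M.minus_eq U.M.a_ac U.M.a_closed U.M.a_inv_closed)
    ultimately have "a \<oplus>\<^bsub>M U\<^esub> q = p \<oplus>\<^bsub>M U\<^esub> r \<oplus>\<^bsub>M U\<^esub> c"
      using cl by (simp add: U.M.l_neg)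
    then show ?thesis by (simp add: p_def q_def r_def a_def c_def)
  qed
  \<comment> \<open>The relation at \<open>(1, 1)\<close> accounts for the difference of the two
    units, since \<open>k\<close> may be nonzero at \<open>1\<close>.\<close>
  have e: "f.e U \<oplus>\<^bsub>M U\<^esub> k U \<one>\<^bsub>R U\<^esub> = g.e U" if U: "openin T U" for U
  proof -
    interpret U: module "R U" "M U" by (rule Y.module_sect[OF U])
    define q a c where "q = k U \<one>\<^bsub>R U\<^esub>" and "a = ev f U \<one>\<^bsub>R U\<^esub> \<one>\<^bsub>R U\<^esub>"
      and "c = ev g U \<one>\<^bsub>R U\<^esub> \<one>\<^bsub>R U\<^esub>"
    have cl: "q \<in> Sec F U" "a \<in> Sec F U" "c \<in> Sec F U"
      unfolding q_def a_def c_def using U kD(1)[OF U] by simp_all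
    have "a \<oplus>\<^bsub>M U\<^esub> q = q \<oplus>\<^bsub>M U\<^esub> q \<oplus>\<^bsub>M U\<^esub> c"
      using ev[OF U U.R.one_closed U.R.one_closed] cl by (simp add: q_def a_def c_def)
    then have "q \<oplus>\<^bsub>M U\<^esub> a = q \<oplus>\<^bsub>M U\<^esub> (q \<oplus>\<^bsub>M U\<^esub> c)" using cl by (simp add: U.M.a_ac)
    then have "a = q \<oplus>\<^bsub>M U\<^esub> c" by (rule U.M.add.l_cancel) (use cl in simp_all)
    then have "\<ominus>\<^bsub>M U\<^esub> a \<oplus>\<^bsub>M U\<^esub> q = \<ominus>\<^bsub>M U\<^esub> c \<oplus>\<^bsub>M U\<^esub> (\<ominus>\<^bsub>M U\<^esub> q \<oplus>\<^bsub>M U\<^esub> q)"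
      using cl by (simp only: U.M.minus_add U.M.a_ac U.M.a_closed U.M.a_inv_closed)
    then show ?thesis using cl by (simp add: f.e_def g.e_def q_def a_def c_def U.M.l_neg)
  qed
  define \<phi> where "\<phi> U = (\<lambda>(x, m). (x, m \<oplus>\<^bsub>M U\<^esub> k U x))" for U
  have \<phi>: "\<phi> U (x, m) = (x, m \<oplus>\<^bsub>M U\<^esub> k U x)" for U x m by (simp add: \<phi>_def)
  have "ring_sheaf_iso T f.Tot g.Tot \<phi>"
    unfolding ring_sheaf_iso_def ring_sheaf_hom_def commutes_with_res_def
  proof (intro conjI allI impI ballI; (elim conjE)?)
    fix U assume U: "openin T U"
    interpret U: module "R U" "M U" by (rule Y.module_sect[OF U])
    note kU = kD[OF U]
    show "\<phi> U \<in> ring_hom (sect f.Tot U) (sect g.Tot U)"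
    proof (rule ring_hom_memI)
      show "\<phi> U x \<in> Sec g.Tot U" if "x \<in> Sec f.Tot U" for x
        using that kU(1) by (cases x) (simp add: \<phi>)
      show "\<phi> U \<one>\<^bsub>sect f.Tot U\<^esub> = \<one>\<^bsub>sect g.Tot U\<^esub>" using e[OF U] by (simp add: \<phi>)
      fix v w assume vw: "v \<in> Sec f.Tot U" "w \<in> Sec f.Tot U"
      obtain x m y n where xy: "v = (x, m)" "w = (y, n)" "x \<in> Sec OY U" "y \<in> Sec OY U"
        "m \<in> Sec F U" "n \<in> Sec F U" using vw by auto
      show "\<phi> U (v \<oplus>\<^bsub>sect f.Tot U\<^esub> w) = \<phi> U v \<oplus>\<^bsub>sect g.Tot U\<^esub> \<phi> U w"
        using xy kU(1) by (simp add: \<phi> kU(2) U.M.a_ac)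
      have "x \<odot>\<^bsub>M U\<^esub> n \<oplus>\<^bsub>M U\<^esub> y \<odot>\<^bsub>M U\<^esub> m \<oplus>\<^bsub>M U\<^esub> ev f U x y \<oplus>\<^bsub>M U\<^esub> k U (x \<otimes>\<^bsub>R U\<^esub> y)
          = (x \<odot>\<^bsub>M U\<^esub> n \<oplus>\<^bsub>M U\<^esub> y \<odot>\<^bsub>M U\<^esub> m) \<oplus>\<^bsub>M U\<^esub> (ev f U x y \<oplus>\<^bsub>M U\<^esub> k U (x \<otimes>\<^bsub>R U\<^esub> y))"
        using xy U kU(1) by (simp add: U.M.a_assoc)
      also have "\<dots> = x \<odot>\<^bsub>M U\<^esub> (n \<oplus>\<^bsub>M U\<^esub> k U y) \<oplus>\<^bsub>M U\<^esub> y \<odot>\<^bsub>M U\<^esub> (m \<oplus>\<^bsub>M U\<^esub> k U x) \<oplus>\<^bsub>M U\<^esub> ev g U x y"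
        unfolding ev[OF U xy(3,4)] using xy U kU(1) by (simp add: U.smult_r_distr U.M.a_ac)
      finally show "\<phi> U (v \<otimes>\<^bsub>sect f.Tot U\<^esub> w) = \<phi> U v \<otimes>\<^bsub>sect g.Tot U\<^esub> \<phi> U w"
        using xy by (simp add: \<phi>)
    qed
    show "bij_betw (\<phi> U) (Sec f.Tot U) (Sec g.Tot U)"
    proof (rule bij_betwI')
      fix v w assume vw: "v \<in> Sec f.Tot U" "w \<in> Sec f.Tot U"
      then show "\<phi> U v = \<phi> U w \<longleftrightarrow> v = w"
        using kU(1) by (cases v; cases w) (auto simp: \<phi>)
    next
      fix v assume "v \<in> Sec f.Tot U"
      then show "\<phi> U v \<in> Sec g.Tot U" using kU(1) by (cases v) (simp add: \<phi>)
    next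
      fix w assume "w \<in> Sec g.Tot U"
      then obtain y n where w: "w = (y, n)" "y \<in> Sec OY U" "n \<in> Sec F U" by auto
      then show "\<exists>v\<in>Sec f.Tot U. w = \<phi> U v"
        using kU(1)[of y] by (intro bexI[of _ "(y, n \<ominus>\<^bsub>M U\<^esub> k U y)"])
          (simp_all add: \<phi> U.M.minus_eq U.M.a_assoc U.M.l_neg)
    qed
    fix V v assume V: "openin T V" "V \<subseteq> U" and v: "v \<in> Sec f.Tot U"
    then show "\<phi> V (res f.Tot U V v) = res g.Tot U V (\<phi> U v)"
      using kU(1) kU(4)[OF _ V] U by (cases v) (simp add: \<phi>)
  qed
  \<comment> \<open>The structure maps are multiples of the units, so their compatibility follows
    from that of the units and the linearity of \<open>k\<close> over \<open>OZ\<close>.\<close>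
  moreover have "\<phi> U (scal f.E U z) = scal g.E U z" if U: "openin T U" and z: "z \<in> Sec OZ U" for U z
  proof -
    interpret U: module "R U" "M U" by (rule Y.module_sect[OF U])
    have hz: "h U z \<in> Sec OY U" using U z by simp
    have "k U (h U z) = h U z \<odot>\<^bsub>M U\<^esub> k U \<one>\<^bsub>R U\<^esub>"
      using kD(3)[OF U U.R.one_closed z] hz by simp
    then have "h U z \<odot>\<^bsub>M U\<^esub> f.e U \<oplus>\<^bsub>M U\<^esub> k U (h U z) = h U z \<odot>\<^bsub>M U\<^esub> g.e U"
      using U hz kD(1)[OF U U.R.one_closed] by (simp add: U.smult_r_distr[symmetric] e)
    then show ?thesis by (simp add: \<phi>)
  qed
  moreover have "\<phi> U (incl f.E U m) = incl g.E U m" if U: "openin T U" and m: "m \<in> Sec F U" for U m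
  proof -
    interpret U: module "R U" "M U" by (rule Y.module_sect[OF U])
    have c: "k U \<zero>\<^bsub>R U\<^esub> \<in> Sec F U" by (rule kD(1)[OF U U.R.zero_closed])
    have "k U \<zero>\<^bsub>R U\<^esub> = k U \<zero>\<^bsub>R U\<^esub> \<oplus>\<^bsub>M U\<^esub> k U \<zero>\<^bsub>R U\<^esub>"
      using kD(2)[OF U U.R.zero_closed U.R.zero_closed] by simp
    then have "k U \<zero>\<^bsub>R U\<^esub> = \<zero>\<^bsub>M U\<^esub>" using U.M.add.l_cancel_one'[OF c c] by simp
    then show ?thesis using m by (simp add: \<phi>)
  qed
  ultimately show ?thesis unfolding isomorphic_extensions_def
    by (intro exI[of _ \<phi>] conjI allI impI ballI) (auto simp: \<phi>)
qed

lemma coboundary_of_isomorphic: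
  assumes f: "f \<in> SC" and g: "g \<in> SC"
    and iso: "isomorphic_extensions T OZ F (cocycle_extension T OZ OY h F f) (cocycle_extension T OZ OY h F g)"
  shows "f \<ominus>\<^bsub>C2\<^esub> g \<in> BC"
proof -
  interpret f: cocycle_setting T OZ OY h F f by (rule cocycle_setting[OF f])
  interpret g: cocycle_setting T OZ OY h F g by (rule cocycle_setting[OF g])
  interpret G: abelian_group C2 by (rule C2_group)
  obtain \<phi> where \<phi>: "ring_sheaf_iso T f.Tot g.Tot \<phi>"
    and c: "\<And>U. openin T U \<Longrightarrow> (\<forall>z\<in>Sec OZ U. \<phi> U (scal f.E U z) = scal g.E U z) \<and>
        (\<forall>m\<in>Sec F U. \<phi> U (incl f.E U m) = incl g.E U m) \<and>
        (\<forall>x\<in>Sec f.Tot U. proj g.E U (\<phi> U x) = proj f.E U x)"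
    using iso unfolding isomorphic_extensions_def by (elim exE conjE) simp
  have hom: "\<phi> U \<in> ring_hom (sect f.Tot U) (sect g.Tot U)" if "openin T U" for U
    using \<phi> that by (simp add: ring_sheaf_iso_def ring_sheaf_hom_def)
  have nat: "\<phi> V (res f.Tot U V x) = res g.Tot U V (\<phi> U x)"
    if "openin T U" "openin T V" "V \<subseteq> U" "x \<in> Sec f.Tot U" for U V x
    using \<phi> that by (simp add: ring_sheaf_iso_def ring_sheaf_hom_def commutes_with_res_def del: f.E_simps g.E_simps)
  \<comment> \<open>Inducing the identity on \<open>OY\<close>, the isomorphism fixes first
    components; being the identity on \<open>F\<close>, it translates the second component by an
    amount \<open>k x\<close> that depends on the first component only.\<close>
  define k where "k U x = snd (\<phi> U (x, \<zero>\<^bsub>M U\<^esub>))" for U x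
  have \<phi>0: "\<phi> U (x, \<zero>\<^bsub>M U\<^esub>) = (x, k U x)" and kc: "k U x \<in> Sec F U"
    if U: "openin T U" and x: "x \<in> Sec OY U" for U x
  proof -
    have m: "(x, \<zero>\<^bsub>M U\<^esub>) \<in> Sec f.Tot U" using U x by simp
    have "fst (\<phi> U (x, \<zero>\<^bsub>M U\<^esub>)) = x" using c[OF U] m by simp
    then show "\<phi> U (x, \<zero>\<^bsub>M U\<^esub>) = (x, k U x)" by (simp add: k_def prod_eq_iff)
    show "k U x \<in> Sec F U"
      using ring_hom_closed[OF hom[OF U] m] by (auto simp: k_def mem_Times_iff)
  qed
  have \<phi>1: "\<phi> U (x, m) = (x, k U x \<oplus>\<^bsub>M U\<^esub> m)"
    if U: "openin T U" and x: "x \<in> Sec OY U" and m: "m \<in> Sec F U" for U x m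
  proof -
    interpret U: module "R U" "M U" by (rule Y.module_sect[OF U])
    have "(x, \<zero>\<^bsub>M U\<^esub>) \<oplus>\<^bsub>sect f.Tot U\<^esub> (\<zero>\<^bsub>R U\<^esub>, m) = (x, m)" using x m by simp
    moreover have "\<phi> U (\<zero>\<^bsub>R U\<^esub>, m) = (\<zero>\<^bsub>R U\<^esub>, m)" using c[OF U] m by simp
    ultimately show ?thesis
      using ring_hom_add[OF hom[OF U], of "(x, \<zero>\<^bsub>M U\<^esub>)" "(\<zero>\<^bsub>R U\<^esub>, m)"] x m U kc[OF U x] by (simp add: \<phi>0)
  qed
  have k: "linear_family k" unfolding linear_family_def
  proof (intro allI impI ballI conjI; (elim conjE)?)
    fix U x assume U: "openin T U" and x: "x \<in> Sec OY U"
    interpret U: module "R U" "M U" by (rule Y.module_sect[OF U])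
    have m: "(x, \<zero>\<^bsub>M U\<^esub>) \<in> Sec f.Tot U" using U x by simp
    show "k U x \<in> Sec F U" by (rule kc[OF U x])
    show "k U (x \<oplus>\<^bsub>R U\<^esub> y) = k U x \<oplus>\<^bsub>M U\<^esub> k U y" if y: "y \<in> Sec OY U" for y
      using ring_hom_add[OF hom[OF U] m, of "(y, \<zero>\<^bsub>M U\<^esub>)"] U x y \<phi>0[OF U, of "x \<oplus>\<^bsub>R U\<^esub> y"]
      by (simp add: \<phi>0)
    \<comment> \<open>Linearity of \<open>k\<close> over \<open>OZ\<close> rests on compatibility
      with the structure maps, since both extensions carry the componentwise action of
      \<open>OZ\<close>.\<close>
    show "k U (h U z \<otimes>\<^bsub>R U\<^esub> x) = h U z \<odot>\<^bsub>M U\<^esub> k U x" if z: "z \<in> Sec OZ U" for z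
    proof -
      have hz: "h U z \<in> Sec OY U" using U z by simp
      have s: "scal f.E U z \<in> Sec f.Tot U" using U z by simp
      have "\<phi> U (h U z \<otimes>\<^bsub>R U\<^esub> x, \<zero>\<^bsub>M U\<^esub>) = \<phi> U (scal f.E U z \<otimes>\<^bsub>sect f.Tot U\<^esub> (x, \<zero>\<^bsub>M U\<^esub>))"
        unfolding f.scal_mult[OF U z x U.M.zero_closed] using hz by simp
      also have "\<dots> = scal g.E U z \<otimes>\<^bsub>sect g.Tot U\<^esub> (x, k U x)"
        unfolding ring_hom_mult[OF hom[OF U] s m] using c[OF U] z \<phi>0[OF U x] by simp
      also have "\<dots> = (h U z \<otimes>\<^bsub>R U\<^esub> x, h U z \<odot>\<^bsub>M U\<^esub> k U x)"
        by (rule g.scal_mult[OF U z x kc[OF U x]])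
      finally show ?thesis using hz x \<phi>0[OF U, of "h U z \<otimes>\<^bsub>R U\<^esub> x"] by simp
    qed
    show "k V (res OY U V x) = res F U V (k U x)" if V: "openin T V" "V \<subseteq> U" for V
      using nat[OF U V m] U V x by (simp add: \<phi>0)
  qed
  show ?thesis
  proof (rule coboundariesI[OF _ k])
    show "f \<ominus>\<^bsub>C2\<^esub> g \<in> carrier C2" using f.f_C2 g.f_C2 by (rule G.minus_closed)
    fix U x y assume U: "openin T U" and x: "x \<in> Sec OY U" and y: "y \<in> Sec OY U"
    interpret U: module "R U" "M U" by (rule Y.module_sect[OF U])
    have m: "(x, \<zero>\<^bsub>M U\<^esub>) \<in> Sec f.Tot U" "(y, \<zero>\<^bsub>M U\<^esub>) \<in> Sec f.Tot U"
      using U x y by simp_all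
    define p q r a d where "p = x \<odot>\<^bsub>M U\<^esub> k U y" and "q = k U (x \<otimes>\<^bsub>R U\<^esub> y)"
      and "r = y \<odot>\<^bsub>M U\<^esub> k U x" and "a = ev f U x y" and "d = ev g U x y"
    have cl: "p \<in> Sec F U" "q \<in> Sec F U" "r \<in> Sec F U"
      "a \<in> Sec F U" "d \<in> Sec F U"
      unfolding p_def q_def r_def a_def d_def using U x y kc[OF U] by simp_all
    have "q \<oplus>\<^bsub>M U\<^esub> a = p \<oplus>\<^bsub>M U\<^esub> r \<oplus>\<^bsub>M U\<^esub> d"
      using ring_hom_mult[OF hom[OF U] m] U x y \<phi>1[OF U, of "x \<otimes>\<^bsub>R U\<^esub> y" a] cl(4)
      by (simp add: \<phi>0 p_def q_def r_def a_def d_def)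
    then have "(q \<oplus>\<^bsub>M U\<^esub> a) \<oplus>\<^bsub>M U\<^esub> (\<ominus>\<^bsub>M U\<^esub> d \<oplus>\<^bsub>M U\<^esub> \<ominus>\<^bsub>M U\<^esub> q) =
        (p \<oplus>\<^bsub>M U\<^esub> r \<oplus>\<^bsub>M U\<^esub> d) \<oplus>\<^bsub>M U\<^esub> (\<ominus>\<^bsub>M U\<^esub> d \<oplus>\<^bsub>M U\<^esub> \<ominus>\<^bsub>M U\<^esub> q)" by simp
    moreover have "(q \<oplus>\<^bsub>M U\<^esub> a) \<oplus>\<^bsub>M U\<^esub> (\<ominus>\<^bsub>M U\<^esub> d \<oplus>\<^bsub>M U\<^esub> \<ominus>\<^bsub>M U\<^esub> q) =
        (\<ominus>\<^bsub>M U\<^esub> q \<oplus>\<^bsub>M U\<^esub> q) \<oplus>\<^bsub>M U\<^esub> (a \<oplus>\<^bsub>M U\<^esub> \<ominus>\<^bsub>M U\<^esub> d)"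
      using cl by (simp only: U.M.a_ac U.M.a_closed U.M.a_inv_closed)
    moreover have "(p \<oplus>\<^bsub>M U\<^esub> r \<oplus>\<^bsub>M U\<^esub> d) \<oplus>\<^bsub>M U\<^esub> (\<ominus>\<^bsub>M U\<^esub> d \<oplus>\<^bsub>M U\<^esub> \<ominus>\<^bsub>M U\<^esub> q) =
        (\<ominus>\<^bsub>M U\<^esub> d \<oplus>\<^bsub>M U\<^esub> d) \<oplus>\<^bsub>M U\<^esub> (p \<oplus>\<^bsub>M U\<^esub> \<ominus>\<^bsub>M U\<^esub> q \<oplus>\<^bsub>M U\<^esub> r)"
      using cl by (simp only: U.M.a_ac U.M.a_closed U.M.a_inv_closed)
    ultimately have "a \<oplus>\<^bsub>M U\<^esub> \<ominus>\<^bsub>M U\<^esub> d = p \<oplus>\<^bsub>M U\<^esub> \<ominus>\<^bsub>M U\<^esub> q \<oplus>\<^bsub>M U\<^esub> r"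
      using cl by (simp add: U.M.l_neg)
    then show "ev (f \<ominus>\<^bsub>C2\<^esub> g) U x y = cob k U x y"
      using U x y f.f_C2 g.f_C2 by (simp add: p_def q_def r_def a_def d_def G.minus_eq U.M.minus_eq)
  qed
qed

text \<open>The type \<open>'x\<close> of sections of \<open>E\<close> is arbitrary, and the lemma
  replaces \<open>E\<close> by an extension on pairs. It provides surjectivity of the
  correspondence.\<close>

lemma split_extension_cocycle:
  fixes E :: "('p, 'c, 'a, 'm, 'x) extension"
  assumes E: "split_extension T OZ OY h F E" and coh: "coherent T OY F"
  shows "\<exists>f\<in>SC. isomorphic_extensions T OZ F E (cocycle_extension T OZ OY h F f)"
proof -
  have inf: "infinitesimal_extension T OY F E" and alg: "algebra_extension T OZ h E"
    and spl: "module_split T OZ OY h E" using E by (simp_all add: split_extension_def)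
  let ?A = "total E" and ?i = "incl E" and ?p = "proj E"
  interpret X: ring_sheaf_on T ?A
    by (rule ring_sheaf_onI) (use inf in \<open>simp add: infinitesimal_extension_def scheme_def\<close>)
  have p_hom: "?p U \<in> ring_hom (sect ?A U) (R U)" if "openin T U" for U
    using inf that by (simp add: infinitesimal_extension_def ring_sheaf_hom_def)
  have i_res: "?i V (res F U V m) = res ?A U V (?i U m)"
    if "openin T U" "openin T V" "V \<subseteq> U" "m \<in> Sec F U" for U V m
    using inf that by (simp add: infinitesimal_extension_def commutes_with_res_def)
  have i_bij: "bij_betw (?i U) (Sec F U) {x \<in> Sec ?A U. ?p U x = \<zero>\<^bsub>R U\<^esub>}"
    if "openin T U" for U
    using inf that by (simp add: infinitesimal_extension_def a_kernel_def')
  have i_c: "?i U m \<in> Sec ?A U" "?p U (?i U m) = \<zero>\<^bsub>R U\<^esub>"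
    if "openin T U" "m \<in> Sec F U" for U m
    using bij_betwE[OF i_bij[OF that(1)]] that(2) by blast+
  have i_inj: "m = n" if "openin T U" "m \<in> Sec F U" "n \<in> Sec F U" "?i U m = ?i U n" for U m n
    by (rule inj_onD[OF bij_betw_imp_inj_on[OF i_bij[OF that(1)]] that(4,2,3)])
  have i_surj: "\<exists>m\<in>Sec F U. ?i U m = x"
    if "openin T U" "x \<in> Sec ?A U" "?p U x = \<zero>\<^bsub>R U\<^esub>" for U x
  proof -
    have "x \<in> ?i U ` Sec F U" unfolding bij_betw_imp_surj_on[OF i_bij[OF that(1)]] using that by simp
    then show ?thesis by (elim imageE) (intro bexI[rotated], simp_all)
  qed
  have i_add: "?i U (m \<oplus>\<^bsub>M U\<^esub> n) = ?i U m \<oplus>\<^bsub>sect ?A U\<^esub> ?i U n"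
    if "openin T U" "m \<in> Sec F U" "n \<in> Sec F U" for U m n
    using inf that by (simp add: infinitesimal_extension_def)
  have i_smult: "?i U (?p U x \<odot>\<^bsub>M U\<^esub> m) = x \<otimes>\<^bsub>sect ?A U\<^esub> ?i U m"
    if "openin T U" "x \<in> Sec ?A U" "m \<in> Sec F U" for U x m
    using inf that by (simp add: infinitesimal_extension_def)
  have s_hom: "scal E U \<in> ring_hom (sect OZ U) (sect ?A U)" if "openin T U" for U
    using alg that by (simp add: algebra_extension_def ring_sheaf_hom_def)
  have p_s: "?p U (scal E U z) = h U z" if "openin T U" "z \<in> Sec OZ U" for U z
    using alg that by (simp add: algebra_extension_def)
  obtain \<sigma> where \<sigma>: "mod_sheaf_hom T OZ YM (algebra_as_module (scal E) ?A) \<sigma>"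
    and p\<sigma>: "\<And>U y. openin T U \<Longrightarrow> y \<in> Sec OY U \<Longrightarrow> ?p U (\<sigma> U y) = y"
    using spl unfolding module_split_def by (elim exE conjE) simp
  have \<sigma>c: "\<sigma> U x \<in> Sec ?A U" if "openin T U" "x \<in> Sec OY U" for U x
    using \<sigma> that by (auto simp: mod_sheaf_hom_def)
  have \<sigma>add: "\<sigma> U (x \<oplus>\<^bsub>R U\<^esub> y) = \<sigma> U x \<oplus>\<^bsub>sect ?A U\<^esub> \<sigma> U y"
    if "openin T U" "x \<in> Sec OY U" "y \<in> Sec OY U" for U x y
    using \<sigma> that by (simp add: mod_sheaf_hom_def)
  have \<sigma>scal: "\<sigma> U (h U z \<otimes>\<^bsub>R U\<^esub> x) = scal E U z \<otimes>\<^bsub>sect ?A U\<^esub> \<sigma> U x"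
    if "openin T U" "x \<in> Sec OY U" "z \<in> Sec OZ U" for U x z
    using \<sigma> that by (simp add: mod_sheaf_hom_def)
  have \<sigma>res: "\<sigma> V (res OY U V x) = res ?A U V (\<sigma> U x)"
    if "openin T U" "openin T V" "V \<subseteq> U" "x \<in> Sec OY U" for U V x
    using \<sigma> that by (simp add: mod_sheaf_hom_def commutes_with_res_def)
  \<comment> \<open>The failure of \<open>\<sigma>\<close> to be multiplicative is killed by the
    projection, hence comes from a section of \<open>F\<close>.\<close>
  have ex: "\<exists>m\<in>Sec F U. \<sigma> U x \<otimes>\<^bsub>sect ?A U\<^esub> \<sigma> U y = \<sigma> U (x \<otimes>\<^bsub>R U\<^esub> y) \<oplus>\<^bsub>sect ?A U\<^esub> ?i U m"
    if U: "openin T U" and x: "x \<in> Sec OY U" and y: "y \<in> Sec OY U" for U x y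
  proof -
    interpret A: cring "sect ?A U" by (rule X.cring_sect[OF U])
    interpret U: cring "R U" by (rule Y.cring_sect[OF U])
    interpret p: ring_hom_cring "sect ?A U" "R U" "?p U"
      by (intro ring_hom_cring.intro A.is_cring U.is_cring ring_hom_cring_axioms.intro p_hom U)
    let ?d = "\<sigma> U x \<otimes>\<^bsub>sect ?A U\<^esub> \<sigma> U y \<oplus>\<^bsub>sect ?A U\<^esub> \<ominus>\<^bsub>sect ?A U\<^esub> \<sigma> U (x \<otimes>\<^bsub>R U\<^esub> y)"
    have c: "\<sigma> U x \<in> Sec ?A U" "\<sigma> U y \<in> Sec ?A U" "\<sigma> U (x \<otimes>\<^bsub>R U\<^esub> y) \<in> Sec ?A U"
      using \<sigma>c[OF U] x y by simp_all
    have "?p U ?d = \<zero>\<^bsub>R U\<^esub>" using c x y p\<sigma>[OF U] by (simp add: U.r_neg)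
    then obtain m where m: "m \<in> Sec F U" "?i U m = ?d" using i_surj[OF U, of ?d] c by auto
    have "\<sigma> U (x \<otimes>\<^bsub>R U\<^esub> y) \<oplus>\<^bsub>sect ?A U\<^esub> ?d
        = (\<ominus>\<^bsub>sect ?A U\<^esub> \<sigma> U (x \<otimes>\<^bsub>R U\<^esub> y) \<oplus>\<^bsub>sect ?A U\<^esub> \<sigma> U (x \<otimes>\<^bsub>R U\<^esub> y)) \<oplus>\<^bsub>sect ?A U\<^esub> \<sigma> U x \<otimes>\<^bsub>sect ?A U\<^esub> \<sigma> U y"
      using c by (simp only: A.a_ac A.a_closed A.a_inv_closed A.m_closed)
    then have "\<sigma> U (x \<otimes>\<^bsub>R U\<^esub> y) \<oplus>\<^bsub>sect ?A U\<^esub> ?d = \<sigma> U x \<otimes>\<^bsub>sect ?A U\<^esub> \<sigma> U y"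
      using c by (simp add: A.l_neg)
    then show ?thesis using m by (intro bexI[of _ m]) simp_all
  qed
  define b where "b U x y = (SOME m. m \<in> Sec F U \<and>
    \<sigma> U x \<otimes>\<^bsub>sect ?A U\<^esub> \<sigma> U y = \<sigma> U (x \<otimes>\<^bsub>R U\<^esub> y) \<oplus>\<^bsub>sect ?A U\<^esub> ?i U m)" for U x y
  have b: "b U x y \<in> Sec F U"
    "\<sigma> U x \<otimes>\<^bsub>sect ?A U\<^esub> \<sigma> U y = \<sigma> U (x \<otimes>\<^bsub>R U\<^esub> y) \<oplus>\<^bsub>sect ?A U\<^esub> ?i U (b U x y)"
    if "openin T U" "x \<in> Sec OY U" "y \<in> Sec OY U" for U x y
    using someI_ex[OF ex[OF that, unfolded Bex_def]] unfolding b_def by simp_all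
  have i_cancel: "m = n" if "openin T U" "a \<in> Sec ?A U" "m \<in> Sec F U" "n \<in> Sec F U"
    "a \<oplus>\<^bsub>sect ?A U\<^esub> ?i U m = a \<oplus>\<^bsub>sect ?A U\<^esub> ?i U n" for U a m n
  proof -
    interpret A: cring "sect ?A U" by (rule X.cring_sect[OF that(1)])
    show ?thesis using that i_c(1)[OF that(1)] i_inj[OF that(1,3,4)] by (simp add: A.add.l_cancel)
  qed
  \<comment> \<open>Injectivity of the inclusion makes the defect unique. Symmetry, bilinearity and
    naturality of \<open>b\<close> are obtained by exhibiting the claimed value as a defect.\<close>
  have b_unique: "b U x y = m"
    if "openin T U" "x \<in> Sec OY U" "y \<in> Sec OY U" "m \<in> Sec F U"
      "\<sigma> U x \<otimes>\<^bsub>sect ?A U\<^esub> \<sigma> U y = \<sigma> U (x \<otimes>\<^bsub>R U\<^esub> y) \<oplus>\<^bsub>sect ?A U\<^esub> ?i U m" for U x y m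
    by (rule i_cancel[OF that(1) \<sigma>c[OF that(1) Y.sect_simps(3)[OF that(1-3)]] b(1)[OF that(1-3)] that(4)])
      (use b(2)[OF that(1-3)] that(5) in simp)
  have b_sym: "b U x y = b U y x"
    if U: "openin T U" and x: "x \<in> Sec OY U" and y: "y \<in> Sec OY U" for U x y
  proof -
    interpret A: cring "sect ?A U" by (rule X.cring_sect[OF U])
    interpret U: cring "R U" by (rule Y.cring_sect[OF U])
    show ?thesis
      by (rule b_unique[OF U x y b(1)[OF U y x]])
        (use b(2)[OF U y x] A.m_comm[OF \<sigma>c[OF U x] \<sigma>c[OF U y]] U.m_comm[OF x y] in simp)
  qed
  have b_left: "b U (x \<oplus>\<^bsub>R U\<^esub> z) y = b U x y \<oplus>\<^bsub>M U\<^esub> b U z y"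
    if U: "openin T U" and x: "x \<in> Sec OY U" and y: "y \<in> Sec OY U"
      and z: "z \<in> Sec OY U" for U x y z
  proof -
    interpret A: cring "sect ?A U" by (rule X.cring_sect[OF U])
    interpret U: module "R U" "M U" by (rule Y.module_sect[OF U])
    have c: "\<sigma> U x \<in> Sec ?A U" "\<sigma> U y \<in> Sec ?A U" "\<sigma> U z \<in> Sec ?A U"
      "\<sigma> U (x \<otimes>\<^bsub>R U\<^esub> y) \<in> Sec ?A U" "\<sigma> U (z \<otimes>\<^bsub>R U\<^esub> y) \<in> Sec ?A U"
      "?i U (b U x y) \<in> Sec ?A U" "?i U (b U z y) \<in> Sec ?A U"
      using \<sigma>c[OF U] i_c(1)[OF U] b(1)[OF U] x y z by simp_all
    show ?thesis
    proof (rule b_unique[OF U _ y])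
      have "\<sigma> U (x \<oplus>\<^bsub>R U\<^esub> z) \<otimes>\<^bsub>sect ?A U\<^esub> \<sigma> U y
          = \<sigma> U x \<otimes>\<^bsub>sect ?A U\<^esub> \<sigma> U y \<oplus>\<^bsub>sect ?A U\<^esub> \<sigma> U z \<otimes>\<^bsub>sect ?A U\<^esub> \<sigma> U y"
        using c by (simp add: \<sigma>add[OF U x z] A.l_distr)
      also have "\<dots> = \<sigma> U ((x \<oplus>\<^bsub>R U\<^esub> z) \<otimes>\<^bsub>R U\<^esub> y) \<oplus>\<^bsub>sect ?A U\<^esub> ?i U (b U x y \<oplus>\<^bsub>M U\<^esub> b U z y)"
        using c x y z by (simp add: b(2)[OF U x y] b(2)[OF U z y] U.R.l_distr \<sigma>add[OF U] i_add[OF U] b(1)[OF U] A.a_ac)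
      finally show "\<sigma> U (x \<oplus>\<^bsub>R U\<^esub> z) \<otimes>\<^bsub>sect ?A U\<^esub> \<sigma> U y
          = \<sigma> U ((x \<oplus>\<^bsub>R U\<^esub> z) \<otimes>\<^bsub>R U\<^esub> y) \<oplus>\<^bsub>sect ?A U\<^esub> ?i U (b U x y \<oplus>\<^bsub>M U\<^esub> b U z y)" .
    qed (use x y z b(1)[OF U] in simp_all)
  qed
  have b_scal: "b U (h U w \<otimes>\<^bsub>R U\<^esub> x) y = h U w \<odot>\<^bsub>M U\<^esub> b U x y"
    if U: "openin T U" and x: "x \<in> Sec OY U" and y: "y \<in> Sec OY U"
      and w: "w \<in> Sec OZ U" for U x y w
  proof -
    interpret A: cring "sect ?A U" by (rule X.cring_sect[OF U])
    interpret U: module "R U" "M U" by (rule Y.module_sect[OF U])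
    have hw: "h U w \<in> Sec OY U" using U w by simp
    have c: "\<sigma> U x \<in> Sec ?A U" "\<sigma> U y \<in> Sec ?A U" "scal E U w \<in> Sec ?A U"
      "\<sigma> U (x \<otimes>\<^bsub>R U\<^esub> y) \<in> Sec ?A U" "?i U (b U x y) \<in> Sec ?A U"
      using \<sigma>c[OF U] i_c(1)[OF U] b(1)[OF U] ring_hom_closed[OF s_hom[OF U]] x y w by simp_all
    show ?thesis
    proof (rule b_unique[OF U _ y])
      have "\<sigma> U (h U w \<otimes>\<^bsub>R U\<^esub> x) \<otimes>\<^bsub>sect ?A U\<^esub> \<sigma> U y
          = scal E U w \<otimes>\<^bsub>sect ?A U\<^esub> (\<sigma> U x \<otimes>\<^bsub>sect ?A U\<^esub> \<sigma> U y)"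
        using c by (simp add: \<sigma>scal[OF U x w] A.m_assoc)
      also have "\<dots> = scal E U w \<otimes>\<^bsub>sect ?A U\<^esub> \<sigma> U (x \<otimes>\<^bsub>R U\<^esub> y) \<oplus>\<^bsub>sect ?A U\<^esub> scal E U w \<otimes>\<^bsub>sect ?A U\<^esub> ?i U (b U x y)"
        using c by (simp add: b(2)[OF U x y] A.r_distr)
      \<comment> \<open>A section of the total ring acts on the kernel through its projection, and
        the structure map projects to \<open>h\<close>.\<close>
      also have "scal E U w \<otimes>\<^bsub>sect ?A U\<^esub> ?i U (b U x y) = ?i U (h U w \<odot>\<^bsub>M U\<^esub> b U x y)"
        using i_smult[OF U c(3) b(1)[OF U x y]] p_s[OF U w] by simp
      also have "scal E U w \<otimes>\<^bsub>sect ?A U\<^esub> \<sigma> U (x \<otimes>\<^bsub>R U\<^esub> y) = \<sigma> U ((h U w \<otimes>\<^bsub>R U\<^esub> x) \<otimes>\<^bsub>R U\<^esub> y)"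
        using \<sigma>scal[OF U _ w, of "x \<otimes>\<^bsub>R U\<^esub> y"] x y hw by (simp add: U.R.m_assoc)
      finally show "\<sigma> U (h U w \<otimes>\<^bsub>R U\<^esub> x) \<otimes>\<^bsub>sect ?A U\<^esub> \<sigma> U y =
          \<sigma> U ((h U w \<otimes>\<^bsub>R U\<^esub> x) \<otimes>\<^bsub>R U\<^esub> y) \<oplus>\<^bsub>sect ?A U\<^esub> ?i U (h U w \<odot>\<^bsub>M U\<^esub> b U x y)" .
    qed (use x y hw b(1)[OF U] in simp_all)
  qed
  have b_res: "b V (res OY U V x) (res OY U V y) = res F U V (b U x y)"
    if U: "openin T U" and V: "openin T V" "V \<subseteq> U" and x: "x \<in> Sec OY U" and y: "y \<in> Sec OY U" for U V x y
  proof (rule b_unique[OF V(1)])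
    have xy: "x \<otimes>\<^bsub>R U\<^esub> y \<in> Sec OY U" using U x y by simp
    have c: "\<sigma> U x \<in> Sec ?A U" "\<sigma> U y \<in> Sec ?A U" "\<sigma> U (x \<otimes>\<^bsub>R U\<^esub> y) \<in> Sec ?A U"
      "?i U (b U x y) \<in> Sec ?A U"
      using \<sigma>c[OF U] i_c(1)[OF U] b(1)[OF U] x y xy by simp_all
    have "res ?A U V (\<sigma> U x \<otimes>\<^bsub>sect ?A U\<^esub> \<sigma> U y) = res ?A U V (\<sigma> U (x \<otimes>\<^bsub>R U\<^esub> y) \<oplus>\<^bsub>sect ?A U\<^esub> ?i U (b U x y))"
      by (rule arg_cong[OF b(2)[OF U x y]])
    then show "\<sigma> V (res OY U V x) \<otimes>\<^bsub>sect ?A V\<^esub> \<sigma> V (res OY U V y) =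
        \<sigma> V (res OY U V x \<otimes>\<^bsub>R V\<^esub> res OY U V y) \<oplus>\<^bsub>sect ?A V\<^esub> ?i V (res F U V (b U x y))"
      using U V c x y \<sigma>res[OF U V xy]
      by (simp add: \<sigma>res[OF U V x] \<sigma>res[OF U V y] i_res[OF U V b(1)[OF U x y]])
  qed (use U V x y b(1)[OF U x y] in auto)
  have bil: "bilinear_family b" unfolding bilinear_family_def
  proof (intro allI impI ballI conjI; (elim conjE)?)
    fix U x y assume U: "openin T U" and x: "x \<in> Sec OY U" and y: "y \<in> Sec OY U"
    show "b U x y \<in> Sec F U" by (rule b(1)[OF U x y])
    show "b U (x \<oplus>\<^bsub>R U\<^esub> z) y = b U x y \<oplus>\<^bsub>M U\<^esub> b U z y" if "z \<in> Sec OY U" for z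
      by (rule b_left[OF U x y that])
    show "b U x (y \<oplus>\<^bsub>R U\<^esub> z) = b U x y \<oplus>\<^bsub>M U\<^esub> b U x z" if z: "z \<in> Sec OY U" for z
      using b_left[OF U y x z] b_sym[OF U x] U y z by simp
    show "b U (h U c \<otimes>\<^bsub>R U\<^esub> x) y = h U c \<odot>\<^bsub>M U\<^esub> b U x y" if "c \<in> Sec OZ U" for c
      by (rule b_scal[OF U x y that])
    show "b U x (h U c \<otimes>\<^bsub>R U\<^esub> y) = h U c \<odot>\<^bsub>M U\<^esub> b U x y" if c: "c \<in> Sec OZ U" for c
      using b_scal[OF U y x c] b_sym[OF U x] U y c by simp
    show "b V (res OY U V x) (res OY U V y) = res F U V (b U x y)" if "openin T V" "V \<subseteq> U" for V
      by (rule b_res[OF U that x y])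
  qed
  \<comment> \<open>Both bracketings of a product of three lifts are expanded into \<open>?t\<close>
    plus an element of the kernel; associativity and injectivity of the inclusion give the
    identity.\<close>
  have coc: "x \<odot>\<^bsub>M U\<^esub> b U y z \<oplus>\<^bsub>M U\<^esub> b U x (y \<otimes>\<^bsub>R U\<^esub> z) =
      b U (x \<otimes>\<^bsub>R U\<^esub> y) z \<oplus>\<^bsub>M U\<^esub> z \<odot>\<^bsub>M U\<^esub> b U x y"
    if U: "openin T U" and x: "x \<in> Sec OY U" and y: "y \<in> Sec OY U"
      and z: "z \<in> Sec OY U" for U x y z
  proof -
    interpret A: cring "sect ?A U" by (rule X.cring_sect[OF U])
    interpret U: module "R U" "M U" by (rule Y.module_sect[OF U])
    have xy: "x \<otimes>\<^bsub>R U\<^esub> y \<in> Sec OY U" "y \<otimes>\<^bsub>R U\<^esub> z \<in> Sec OY U"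
      "x \<otimes>\<^bsub>R U\<^esub> (y \<otimes>\<^bsub>R U\<^esub> z) \<in> Sec OY U"
      using x y z by simp_all
    note bc = b(1)[OF U]
    have c: "\<sigma> U v \<in> Sec ?A U" if "v \<in> Sec OY U" for v using \<sigma>c[OF U that] .
    have ib: "?i U (b U v w) \<in> Sec ?A U" if "v \<in> Sec OY U" "w \<in> Sec OY U" for v w
      by (rule i_c(1)[OF U bc[OF that]])
    have sm: "\<sigma> U v \<otimes>\<^bsub>sect ?A U\<^esub> ?i U m = ?i U (v \<odot>\<^bsub>M U\<^esub> m)"
      if "v \<in> Sec OY U" "m \<in> Sec F U" for v m
      using i_smult[OF U c[OF that(1)] that(2)] p\<sigma>[OF U that(1)] by simp
    let ?t = "\<sigma> U (x \<otimes>\<^bsub>R U\<^esub> (y \<otimes>\<^bsub>R U\<^esub> z))"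
    have "\<sigma> U x \<otimes>\<^bsub>sect ?A U\<^esub> (\<sigma> U y \<otimes>\<^bsub>sect ?A U\<^esub> \<sigma> U z) =
        \<sigma> U x \<otimes>\<^bsub>sect ?A U\<^esub> \<sigma> U (y \<otimes>\<^bsub>R U\<^esub> z) \<oplus>\<^bsub>sect ?A U\<^esub> ?i U (x \<odot>\<^bsub>M U\<^esub> b U y z)"
      using c x y z xy ib by (simp add: b(2)[OF U y z] A.r_distr sm bc)
    also have "\<dots> = ?t \<oplus>\<^bsub>sect ?A U\<^esub> ?i U (x \<odot>\<^bsub>M U\<^esub> b U y z \<oplus>\<^bsub>M U\<^esub> b U x (y \<otimes>\<^bsub>R U\<^esub> z))"
      using c x y z xy ib i_c(1)[OF U, of "x \<odot>\<^bsub>M U\<^esub> b U y z"]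
      by (simp add: b(2)[OF U x xy(2)] i_add[OF U] bc A.a_ac)
    finally have l: "\<sigma> U x \<otimes>\<^bsub>sect ?A U\<^esub> (\<sigma> U y \<otimes>\<^bsub>sect ?A U\<^esub> \<sigma> U z) =
        ?t \<oplus>\<^bsub>sect ?A U\<^esub> ?i U (x \<odot>\<^bsub>M U\<^esub> b U y z \<oplus>\<^bsub>M U\<^esub> b U x (y \<otimes>\<^bsub>R U\<^esub> z))" .
    have "(\<sigma> U x \<otimes>\<^bsub>sect ?A U\<^esub> \<sigma> U y) \<otimes>\<^bsub>sect ?A U\<^esub> \<sigma> U z =
        \<sigma> U (x \<otimes>\<^bsub>R U\<^esub> y) \<otimes>\<^bsub>sect ?A U\<^esub> \<sigma> U z \<oplus>\<^bsub>sect ?A U\<^esub> ?i U (z \<odot>\<^bsub>M U\<^esub> b U x y)"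
      using c x y z xy ib A.m_comm[OF ib[OF x y] c[OF z]] by (simp add: b(2)[OF U x y] A.l_distr sm bc)
    also have "\<dots> = ?t \<oplus>\<^bsub>sect ?A U\<^esub> ?i U (b U (x \<otimes>\<^bsub>R U\<^esub> y) z \<oplus>\<^bsub>M U\<^esub> z \<odot>\<^bsub>M U\<^esub> b U x y)"
      using c x y z xy ib i_c(1)[OF U, of "z \<odot>\<^bsub>M U\<^esub> b U x y"]
      by (simp add: b(2)[OF U xy(1) z] i_add[OF U] bc A.a_assoc U.R.m_assoc)
    finally have r: "(\<sigma> U x \<otimes>\<^bsub>sect ?A U\<^esub> \<sigma> U y) \<otimes>\<^bsub>sect ?A U\<^esub> \<sigma> U z =
        ?t \<oplus>\<^bsub>sect ?A U\<^esub> ?i U (b U (x \<otimes>\<^bsub>R U\<^esub> y) z \<oplus>\<^bsub>M U\<^esub> z \<odot>\<^bsub>M U\<^esub> b U x y)" .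
    show ?thesis
      by (rule i_cancel[OF U c[OF xy(3)]])
        (use l r A.m_assoc[OF c[OF x] c[OF y] c[OF z]] x y z xy bc in simp_all)
  qed
  obtain f where f: "f \<in> carrier C2"
    and evf: "\<forall>U. openin T U \<longrightarrow> (\<forall>x\<in>Sec OY U. \<forall>y\<in>Sec OY U. ev f U x y = b U x y)"
    by (rule C2_exists[OF bil])
  have fS: "f \<in> SC"
    using f evf coc b_sym by (simp add: symmetric_cocycles_iff cocycle_family_def symmetric_family_def)
  interpret f: cocycle_setting T OZ OY h F f by (rule cocycle_setting[OF fS])
  \<comment> \<open>The map runs from the cocycle extension to \<open>E\<close>, where it has an
    explicit formula; the direction in the claim follows by symmetry.\<close>
  define \<phi> where "\<phi> U = (\<lambda>(x, m). \<sigma> U x \<oplus>\<^bsub>sect ?A U\<^esub> ?i U m)" for U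
  have \<phi>: "\<phi> U (x, m) = \<sigma> U x \<oplus>\<^bsub>sect ?A U\<^esub> ?i U m" for U x m by (simp add: \<phi>_def)
  have \<phi>c: "\<phi> U (x, m) \<in> Sec ?A U"
    if "openin T U" "x \<in> Sec OY U" "m \<in> Sec F U" for U x m
    unfolding \<phi> using \<sigma>c i_c(1) that by simp
  have p\<phi>: "?p U (\<phi> U (x, m)) = x"
    if U: "openin T U" and x: "x \<in> Sec OY U" and m: "m \<in> Sec F U" for U x m
  proof -
    interpret U: cring "R U" by (rule Y.cring_sect[OF U])
    show ?thesis unfolding \<phi> ring_hom_add[OF p_hom[OF U] \<sigma>c[OF U x] i_c(1)[OF U m]]
      using p\<sigma>[OF U x] i_c(2)[OF U m] x by simp
  qed
  have bij: "bij_betw (\<phi> U) (Sec f.Tot U) (Sec ?A U)" if U: "openin T U" for U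
  proof -
    interpret A: cring "sect ?A U" by (rule X.cring_sect[OF U])
    interpret U: cring "R U" by (rule Y.cring_sect[OF U])
    interpret p: ring_hom_cring "sect ?A U" "R U" "?p U"
      by (intro ring_hom_cring.intro A.is_cring U.is_cring ring_hom_cring_axioms.intro p_hom U)
    show ?thesis
    proof (rule bij_betwI')
      fix v w assume vw: "v \<in> Sec f.Tot U" "w \<in> Sec f.Tot U"
      obtain x m y n where xy: "v = (x, m)" "w = (y, n)" "x \<in> Sec OY U" "y \<in> Sec OY U"
        "m \<in> Sec F U" "n \<in> Sec F U" using vw by auto
      show "\<phi> U v = \<phi> U w \<longleftrightarrow> v = w"
      proof
        assume eq: "\<phi> U v = \<phi> U w"
        have "x = y" using p\<phi>[OF U xy(3,5)] p\<phi>[OF U xy(4,6)] eq xy(1,2) by simp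
        moreover from this have "m = n"
          using i_cancel[OF U \<sigma>c[OF U xy(3)] xy(5,6)] eq unfolding xy(1,2) \<phi> by simp
        ultimately show "v = w" by (simp add: xy)
      qed simp
    next
      fix v assume "v \<in> Sec f.Tot U"
      then show "\<phi> U v \<in> Sec ?A U" using \<phi>c[OF U] by (cases v) simp
    next
      fix a assume a: "a \<in> Sec ?A U"
      define x where "x = ?p U a"
      have x: "x \<in> Sec OY U" using a by (simp add: x_def)
      let ?d = "\<ominus>\<^bsub>sect ?A U\<^esub> \<sigma> U x \<oplus>\<^bsub>sect ?A U\<^esub> a"
      have "?p U ?d = \<zero>\<^bsub>R U\<^esub>" using a \<sigma>c[OF U x] p\<sigma>[OF U x] x by (simp add: x_def U.l_neg)
      then obtain m where m: "m \<in> Sec F U" "?i U m = ?d"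
        using i_surj[OF U, of ?d] a \<sigma>c[OF U x] by auto
      have "\<phi> U (x, m) = a" unfolding \<phi> m(2) using a \<sigma>c[OF U x] by (simp add: A.a_assoc[symmetric] A.r_neg)
      then show "\<exists>v\<in>Sec f.Tot U. a = \<phi> U v" using x m by (intro bexI[of _ "(x, m)"]) simp_all
    qed
  qed
  have mult: "\<phi> U (v \<otimes>\<^bsub>sect f.Tot U\<^esub> w) = \<phi> U v \<otimes>\<^bsub>sect ?A U\<^esub> \<phi> U w"
    if U: "openin T U" and vw: "v \<in> Sec f.Tot U" "w \<in> Sec f.Tot U" for U v w
  proof -
    interpret A: cring "sect ?A U" by (rule X.cring_sect[OF U])
    interpret U: module "R U" "M U" by (rule Y.module_sect[OF U])
    obtain x m y n where xy: "v = (x, m)" "w = (y, n)" "x \<in> Sec OY U" "y \<in> Sec OY U"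
      "m \<in> Sec F U" "n \<in> Sec F U" using vw by auto
    have c: "\<sigma> U x \<in> Sec ?A U" "\<sigma> U y \<in> Sec ?A U" "\<sigma> U (x \<otimes>\<^bsub>R U\<^esub> y) \<in> Sec ?A U"
      "?i U m \<in> Sec ?A U" "?i U n \<in> Sec ?A U" "?i U (b U x y) \<in> Sec ?A U"
      using \<sigma>c[OF U] i_c(1)[OF U] b(1)[OF U] xy by simp_all
    \<comment> \<open>In the product of two sums, the mixed terms are given by the module action and
      the product of the two kernel elements is zero.\<close>
    have sm: "\<sigma> U x \<otimes>\<^bsub>sect ?A U\<^esub> ?i U n = ?i U (x \<odot>\<^bsub>M U\<^esub> n)" "?i U m \<otimes>\<^bsub>sect ?A U\<^esub> \<sigma> U y = ?i U (y \<odot>\<^bsub>M U\<^esub> m)"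
      "?i U m \<otimes>\<^bsub>sect ?A U\<^esub> ?i U n = \<zero>\<^bsub>sect ?A U\<^esub>"
    proof -
      show "\<sigma> U x \<otimes>\<^bsub>sect ?A U\<^esub> ?i U n = ?i U (x \<odot>\<^bsub>M U\<^esub> n)"
        using i_smult[OF U c(1) xy(6)] p\<sigma>[OF U xy(3)] by simp
      show "?i U m \<otimes>\<^bsub>sect ?A U\<^esub> \<sigma> U y = ?i U (y \<odot>\<^bsub>M U\<^esub> m)"
        using i_smult[OF U c(2) xy(5)] p\<sigma>[OF U xy(4)] A.m_comm[OF c(4,2)] by simp
      have "\<forall>a\<in>a_kernel (sect ?A U) (R U) (?p U). \<forall>d\<in>a_kernel (sect ?A U) (R U) (?p U).
          a \<otimes>\<^bsub>sect ?A U\<^esub> d = \<zero>\<^bsub>sect ?A U\<^esub>"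
        using inf U by (simp add: infinitesimal_extension_def)
      then show "?i U m \<otimes>\<^bsub>sect ?A U\<^esub> ?i U n = \<zero>\<^bsub>sect ?A U\<^esub>"
        using i_c[OF U xy(5)] i_c[OF U xy(6)] unfolding a_kernel_def' by simp
    qed
    have ic: "?i U (x \<odot>\<^bsub>M U\<^esub> n) \<in> Sec ?A U" "?i U (y \<odot>\<^bsub>M U\<^esub> m) \<in> Sec ?A U"
      using i_c(1)[OF U] xy by simp_all
    have "\<phi> U v \<otimes>\<^bsub>sect ?A U\<^esub> \<phi> U w =
        \<sigma> U x \<otimes>\<^bsub>sect ?A U\<^esub> \<sigma> U y \<oplus>\<^bsub>sect ?A U\<^esub> ?i U (y \<odot>\<^bsub>M U\<^esub> m) \<oplus>\<^bsub>sect ?A U\<^esub> ?i U (x \<odot>\<^bsub>M U\<^esub> n)"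
      unfolding xy(1,2) \<phi> using c ic by (simp add: A.l_distr A.r_distr sm A.a_ac)
    also have "\<dots> = \<sigma> U (x \<otimes>\<^bsub>R U\<^esub> y) \<oplus>\<^bsub>sect ?A U\<^esub> ?i U (x \<odot>\<^bsub>M U\<^esub> n \<oplus>\<^bsub>M U\<^esub> y \<odot>\<^bsub>M U\<^esub> m \<oplus>\<^bsub>M U\<^esub> b U x y)"
      using c ic xy b(1)[OF U xy(3,4)] by (simp add: b(2)[OF U xy(3,4)] i_add[OF U] A.a_ac)
    finally show ?thesis using evf U xy by (simp add: \<phi>)
  qed
  \<comment> \<open>The unit comes for free: \<open>\<phi>\<close> is a multiplicative bijection.\<close>
  have one: "\<phi> U \<one>\<^bsub>sect f.Tot U\<^esub> = \<one>\<^bsub>sect ?A U\<^esub>" if U: "openin T U" for U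
  proof -
    interpret A: cring "sect ?A U" by (rule X.cring_sect[OF U])
    interpret S: cring "sect f.Tot U" by (rule f.cring_Tot[OF U])
    have "\<one>\<^bsub>sect ?A U\<^esub> \<in> \<phi> U ` Sec f.Tot U"
      unfolding bij_betw_imp_surj_on[OF bij[OF U]] by simp
    then obtain v where v: "v \<in> Sec f.Tot U" "\<phi> U v = \<one>\<^bsub>sect ?A U\<^esub>" by (elim imageE) simp
    have "\<phi> U \<one>\<^bsub>sect f.Tot U\<^esub> \<in> Sec ?A U"
      using bij_betwE[OF bij[OF U]] S.one_closed by blast
    then have "\<phi> U \<one>\<^bsub>sect f.Tot U\<^esub> = \<phi> U \<one>\<^bsub>sect f.Tot U\<^esub> \<otimes>\<^bsub>sect ?A U\<^esub> \<phi> U v" using v(2) by simp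
    also have "\<dots> = \<phi> U (\<one>\<^bsub>sect f.Tot U\<^esub> \<otimes>\<^bsub>sect f.Tot U\<^esub> v)" using mult[OF U S.one_closed v(1)] by simp
    finally show ?thesis using S.l_one[OF v(1)] v(2) by simp
  qed
  have "ring_sheaf_iso T f.Tot ?A \<phi>"
    unfolding ring_sheaf_iso_def ring_sheaf_hom_def commutes_with_res_def
  proof (intro conjI allI impI ballI bij; (elim conjE)?)
    fix U assume U: "openin T U"
    interpret A: cring "sect ?A U" by (rule X.cring_sect[OF U])
    show "\<phi> U \<in> ring_hom (sect f.Tot U) (sect ?A U)"
    proof (rule ring_hom_memI)
      show "\<phi> U v \<in> Sec ?A U" if "v \<in> Sec f.Tot U" for v
        using bij_betwE[OF bij[OF U]] that by blast
      fix v w assume vw: "v \<in> Sec f.Tot U" "w \<in> Sec f.Tot U"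
      show "\<phi> U (v \<otimes>\<^bsub>sect f.Tot U\<^esub> w) = \<phi> U v \<otimes>\<^bsub>sect ?A U\<^esub> \<phi> U w" by (rule mult[OF U vw])
      show "\<phi> U (v \<oplus>\<^bsub>sect f.Tot U\<^esub> w) = \<phi> U v \<oplus>\<^bsub>sect ?A U\<^esub> \<phi> U w"
        using vw \<sigma>c[OF U] i_c(1)[OF U]
        by (cases v; cases w) (simp add: \<phi> \<sigma>add[OF U] i_add[OF U] A.a_ac)
    qed (rule one[OF U])
    fix V v assume V: "openin T V" "V \<subseteq> U" and v: "v \<in> Sec f.Tot U"
    then show "\<phi> V (res f.Tot U V v) = res ?A U V (\<phi> U v)"
      using U \<sigma>c[OF U] i_c(1)[OF U] by (cases v) (simp add: \<phi> \<sigma>res[OF U V] i_res[OF U V])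
  qed
  \<comment> \<open>A scalar is the structure map's value times the unit, so preservation of the
    unit yields preservation of scalars.\<close>
  moreover have "\<phi> U (scal f.E U z) = scal E U z" if U: "openin T U" and z: "z \<in> Sec OZ U" for U z
  proof -
    interpret A: cring "sect ?A U" by (rule X.cring_sect[OF U])
    interpret U: cring "R U" by (rule Y.cring_sect[OF U])
    have hz: "h U z \<in> Sec OY U" and s: "scal E U z \<in> Sec ?A U"
      using U z ring_hom_closed[OF s_hom[OF U]] by simp_all
    have "\<sigma> U (h U z) = scal E U z \<otimes>\<^bsub>sect ?A U\<^esub> \<sigma> U \<one>\<^bsub>R U\<^esub>"
      using \<sigma>scal[OF U U.one_closed z] hz by simp
    moreover have "?i U (h U z \<odot>\<^bsub>M U\<^esub> f.e U) = scal E U z \<otimes>\<^bsub>sect ?A U\<^esub> ?i U (f.e U)"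
      using i_smult[OF U s f.e_closed[OF U]] p_s[OF U z] by simp
    ultimately have "\<phi> U (scal f.E U z) = scal E U z \<otimes>\<^bsub>sect ?A U\<^esub> \<phi> U \<one>\<^bsub>sect f.Tot U\<^esub>"
      using s \<sigma>c[OF U U.one_closed] i_c(1)[OF U f.e_closed[OF U]] by (simp add: \<phi> A.r_distr)
    then show ?thesis using one[OF U] s by simp
  qed
  moreover have "\<phi> U (incl f.E U m) = ?i U m" if U: "openin T U" and m: "m \<in> Sec F U" for U m
  proof -
    interpret A: cring "sect ?A U" by (rule X.cring_sect[OF U])
    interpret U: cring "R U" by (rule Y.cring_sect[OF U])
    have c: "\<sigma> U \<zero>\<^bsub>R U\<^esub> \<in> Sec ?A U" by (rule \<sigma>c[OF U U.zero_closed])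
    have "\<sigma> U \<zero>\<^bsub>R U\<^esub> = \<sigma> U \<zero>\<^bsub>R U\<^esub> \<oplus>\<^bsub>sect ?A U\<^esub> \<sigma> U \<zero>\<^bsub>R U\<^esub>"
      using \<sigma>add[OF U U.zero_closed U.zero_closed] by simp
    then have "\<sigma> U \<zero>\<^bsub>R U\<^esub> = \<zero>\<^bsub>sect ?A U\<^esub>" using A.add.l_cancel_one'[OF c c] by simp
    then show ?thesis using i_c(1)[OF U m] by (simp add: \<phi>)
  qed
  moreover have "?p U (\<phi> U v) = proj f.E U v" if "openin T U" "v \<in> Sec f.Tot U" for U v
    using that p\<phi>[OF that(1)] by (cases v) simp
  ultimately have "isomorphic_extensions T OZ F f.E E" unfolding isomorphic_extensions_def
    by (intro exI[of _ \<phi>] conjI allI impI ballI)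
  then show ?thesis using isomorphic_sym[OF f.split_extension_E[OF coh] E] fS by (intro bexI[of _ f])
qed

end

text \<open>A bijection needs one type of sections for the extensions it classifies; pairs are
  chosen because the cocycle extensions live there. The final clause, for an arbitrary type of
  sections, says that this choice loses no isomorphism class.\<close>

theorem lemma1p2:
  fixes T :: "'p topology"
    and OY :: "('p, 'a) ring_presheaf"
    and OZ :: "('p, 'c) ring_presheaf"
    and h :: "'p set \<Rightarrow> 'c \<Rightarrow> 'a"
    and F :: "('p, 'a, 'm) mod_presheaf"
  assumes "scheme T OY"
    and "scheme T OZ"
    and "scheme_morphism_over_id T OZ OY h"
    and "coherent T OY F"
  shows "submodule (H2_S T OZ OY h F) (sect OZ (topspace T)) (H2 T OZ OY h F) \<and>
    (\<forall>f\<in>symmetric_cocycles T OZ OY h F.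
      split_extension T OZ OY h F (cocycle_extension T OZ OY h F f)) \<and>
    (\<exists>\<Phi>. bij_betw \<Phi> (H2_S T OZ OY h F)
        (extension_classes T OZ OY h F :: ('p, 'c, 'a, 'm, 'a \<times> 'm) extension set set) \<and>
      (\<forall>f\<in>symmetric_cocycles T OZ OY h F.
        \<Phi> (H2_class T OZ OY h F f) =
          iso_relation T OZ OY h F `` {cocycle_extension T OZ OY h F f})) \<and>
    (\<forall>E :: ('p, 'c, 'a, 'm, 'x) extension. split_extension T OZ OY h F E \<longrightarrow>
      (\<exists>f\<in>symmetric_cocycles T OZ OY h F.
        isomorphic_extensions T OZ F E (cocycle_extension T OZ OY h F f)))"
proof -
  interpret extension_setting T OZ OY h F
    by (rule extension_setting.intro)
      (use assms in \<open>simp_all add: scheme_def scheme_morphism_over_id_def coherent_def\<close>)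
  note coh = assms(4)
  let ?R = "iso_relation T OZ OY h F :: ('p, 'c, 'a, 'm, 'a \<times> 'm) extension rel"
  let ?S = "{E :: ('p, 'c, 'a, 'm, 'a \<times> 'm) extension. split_extension T OZ OY h F E}"
  let ?E = "cocycle_extension T OZ OY h F"
  have split: "split_extension T OZ OY h F (?E f)" if "f \<in> SC" for f
  proof -
    interpret f: cocycle_setting T OZ OY h F f by (rule cocycle_setting[OF that])
    show ?thesis by (rule f.split_extension_E[OF coh])
  qed
  \<comment> \<open>One direction makes the correspondence well defined, the other makes it
    injective.\<close>
  have class_eq: "?R `` {?E f} = ?R `` {?E g} \<longleftrightarrow> HC f = HC g" if f: "f \<in> SC" and g: "g \<in> SC" for f g
  proof -
    have "f \<in> carrier C2" "g \<in> carrier C2" using f g by (simp_all add: symmetric_cocycles_iff)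
    then have "HC f = HC g \<longleftrightarrow> f \<ominus>\<^bsub>C2\<^esub> g \<in> BC" by (rule HC_eq_iff)
    also have "\<dots> \<longleftrightarrow> isomorphic_extensions T OZ F (?E f) (?E g)"
      using isomorphic_of_coboundary[OF f g] coboundary_of_isomorphic[OF f g] by blast
    also have "\<dots> \<longleftrightarrow> (?E f, ?E g) \<in> ?R" using split f g by (simp add: iso_relation_def)
    also have "\<dots> \<longleftrightarrow> ?R `` {?E f} = ?R `` {?E g}"
      by (rule eq_equiv_class_iff[OF equiv_iso_relation, symmetric]) (use split[OF f] split[OF g] in simp_all)
    finally show ?thesis by simp
  qed
  \<comment> \<open>A class goes to the extension of a chosen symmetric representative;
    \<open>class_eq\<close> makes the outcome independent of the choice.\<close>
  define \<Phi> where "\<Phi> C = ?R `` {?E (SOME f. f \<in> SC \<and> HC f = C)}" for C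
  have \<Phi>: "\<Phi> (HC f) = ?R `` {?E f}" if f: "f \<in> SC" for f
  proof -
    have "\<exists>g. g \<in> SC \<and> HC g = HC f" using f by blast
    then have "(SOME g. g \<in> SC \<and> HC g = HC f) \<in> SC \<and> HC (SOME g. g \<in> SC \<and> HC g = HC f) = HC f"
      by (rule someI_ex)
    then show ?thesis unfolding \<Phi>_def using class_eq[OF _ f] by simp
  qed
  have "bij_betw \<Phi> (H2_S T OZ OY h F) (extension_classes T OZ OY h F)"
    unfolding bij_betw_def
  proof
    show "inj_on \<Phi> (H2_S T OZ OY h F)"
    proof (rule inj_onI)
      fix C D assume "C \<in> H2_S T OZ OY h F" "D \<in> H2_S T OZ OY h F" and eq: "\<Phi> C = \<Phi> D"
      then obtain f g where f: "f \<in> SC" "C = HC f" and g: "g \<in> SC" "D = HC g"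
        unfolding H2_S_def by (elim imageE) simp
      show "C = D" using eq class_eq[OF f(1) g(1)] \<Phi>[OF f(1)] \<Phi>[OF g(1)] by (simp add: f(2) g(2))
    qed
    show "\<Phi> ` H2_S T OZ OY h F = extension_classes T OZ OY h F"
    proof (intro equalityI subsetI)
      fix K assume "K \<in> \<Phi> ` H2_S T OZ OY h F"
      then obtain f where f: "f \<in> SC" "K = ?R `` {?E f}" unfolding H2_S_def using \<Phi> by auto
      then show "K \<in> extension_classes T OZ OY h F"
        unfolding extension_classes_def f(2) using split[OF f(1)] by (intro quotientI) simp
    next
      fix K :: "('p, 'c, 'a, 'm, 'a \<times> 'm) extension set" assume "K \<in> extension_classes T OZ OY h F"
      then obtain E' where E': "split_extension T OZ OY h F E'" "K = ?R `` {E'}"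
        unfolding extension_classes_def by (elim quotientE) simp
      obtain f where f: "f \<in> SC" "isomorphic_extensions T OZ F E' (?E f)"
        using split_extension_cocycle[OF E'(1) coh] by (elim bexE)
      have "(E', ?E f) \<in> ?R" using E'(1) f split[OF f(1)] by (simp add: iso_relation_def)
      then have "K = ?R `` {?E f}" unfolding E'(2) by (rule equiv_class_eq[OF equiv_iso_relation])
      then have "K = \<Phi> (HC f)" using \<Phi>[OF f(1)] by simp
      then show "K \<in> \<Phi> ` H2_S T OZ OY h F" unfolding H2_S_def using f(1) by blast
    qed
  qed
  moreover have "\<exists>f\<in>SC. isomorphic_extensions T OZ F E (?E f)"
    if "split_extension T OZ OY h F E" for E :: "('p, 'c, 'a, 'm, 'x) extension"
    by (rule split_extension_cocycle[OF that coh])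
  ultimately show ?thesis
    using H2_S_submodule split \<Phi> by (intro conjI exI[of _ \<Phi>]) simp_all
qed

end
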